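(* Let $\Gamma$ be a tropical curve with a fixed model, and $D$ a divisor on $\Gamma$. Let $\mathcal V$ be the set of vertices ($0$-dimensional cells) of the cell complex $|D|$ and let $\mathcal S(\mathcal V)=\{f\in R(D): D+(f)\in\mathcal V\}$. Then: (a) $\mathcal S(\mathcal V)$ contains the set $\mathcal S$ of all $f\in R(D)$ such that $\mathrm{supp}(D+(f))$ does not contain a smooth cut set of $\Gamma$; (b) $\mathcal S(\mathcal V)$ is finite modulo tropical scaling (adding real constants); (c) $\mathcal S(\mathcal V)$ generates $R(D)$ as a tropical semi-module.
   Context: A metric graph is a compact connected metric space locally isometric to star-shaped sets; the number of branches at $x$ is the valence of $x$. A tropical curve $\Gamma$ is a metric graph whose leaf edges may have infinite length (with a point at infinity added at the end). A model of $\Gamma$ is a finite nonempty set $V\subset\Gamma$ of "vertices" containing all points of valence $\neq 2$; the edges are the connected components of $\Gamma\setminus V$ (open intervals). A divisor is a finite formal $\mathbb Z$-combination of points of $\Gamma$; effective means all coefficients are $\ge0$. A rational function $f$ is a continuous, piecewise linear function with finitely many pieces and integer slopes (possibly $\pm\infty$ at points at infinity); $(f)=\sum_x \mathrm{ord}_x(f)\cdot x$ with $\mathrm{ord}_x(f)$ the sum of outgoing slopes at $x$. $R(D)=\{f: D+(f)\ge 0\}$, $|D|=\{D+(f): f\in R(D)\}$. Tropical operations: $f\oplus g=\max(f,g)$, $a\odot f=a+f$ for $a\in\mathbb R$; "generates" means every element is a finite tropical linear combination of elements of the set. A cut set is a set $A\subset\Gamma$ with $\Gamma\setminus A$ disconnected;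 it is smooth if it consists of points of valence 2. Cell structure on $|D|$ (depending on the model): orient each open edge $e$ and identify it with $(0,\ell(e))$. A cell is indexed by: an integer $d_v$ for each vertex $v$; an ordered composition $d_e=d_e^{(1)}+\cdots+d_e^{(r_e)}$ (positive parts) for each edge $e$; and an integer $m_e$ for each edge $e$. A divisor $D'=D+(f)\in|D|$ belongs to that cell iff $D'(v)=d_v$ for all $v$; $D'$ restricted to $e$ is $\sum_i d_e^{(i)}x_i$ for some $0<x_1<\cdots<x_{r_e}<\ell(e)$; and the slope of $f$ at the start of $e$ is $m_e$. *)

theory Defs
  imports "HOL-Analysis.Analysis" "HOL-Library.Function_Algebras"
begin

text \<open>Star-shaped set of valence \<open>n\<close> and radius \<open>r\<close>, with centre \<open>0\<close>, carrying the path metric.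
  For \<open>n = 0\<close> it is a single point.\<close>

definition star_shaped :: "nat \<Rightarrow> real \<Rightarrow> complex set" where
  "star_shaped n r =
     {z. z = 0 \<or> (\<exists>k<n. \<exists>t. 0 \<le> t \<and> t < r \<and> z = rcis t (2 * pi * real k / real n))}"

definition star_dist :: "complex \<Rightarrow> complex \<Rightarrow> real" where
  "star_dist z w = (if sgn z = sgn w then cmod (z - w) else cmod z + cmod w)"

text \<open>The underlying compact space of a curve is a whole type \<open>'a\<close> with its class topology. The
  record adds the finite set of points at infinity and the metric, which is only meaningful on the
  complement of that set. The metric need not be the global path metric: only its restriction to
  small neighbourhoods matters.\<close>

record 'a curve =
  inf_pts :: "'a set"
  gdist :: "'a \<Rightarrow> 'a \<Rightarrow> real"

definition star_chart ::
    "'a::topological_space curve \<Rightarrow> 'a \<Rightarrow> nat \<Rightarrow> real \<Rightarrow> 'a set \<Rightarrow> ('a \<Rightarrow> complex) \<Rightarrow> bool" where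
  "star_chart \<Gamma> x n r U h \<longleftrightarrow>
     open U \<and> x \<in> U \<and> U \<subseteq> - inf_pts \<Gamma> \<and> 0 < r \<and>
     bij_betw h U (star_shaped n r) \<and> h x = 0 \<and>
     (\<forall>y\<in>U. \<forall>z\<in>U. gdist \<Gamma> y z = star_dist (h y) (h z))"

text \<open>Neighbourhood of a point at infinity: the end \<open>(0, \<infinity>]\<close> of an infinite leaf edge.\<close>

definition inf_chart ::
    "'a::topological_space curve \<Rightarrow> 'a \<Rightarrow> 'a set \<Rightarrow> ('a \<Rightarrow> ereal) \<Rightarrow> bool" where
  "inf_chart \<Gamma> x U h \<longleftrightarrow>
     open U \<and> U \<inter> inf_pts \<Gamma> = {x} \<and>
     (\<exists>g. homeomorphism U {0<..} h g) \<and> h x = \<infinity> \<and>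
     (\<forall>y\<in>U - {x}. \<forall>z\<in>U - {x}.
        gdist \<Gamma> y z = \<bar>real_of_ereal (h y) - real_of_ereal (h z)\<bar>)"

definition tropical_curve :: "'a::t2_space curve \<Rightarrow> bool" where
  "tropical_curve \<Gamma> \<longleftrightarrow>
     compact (UNIV :: 'a set) \<and> connected (UNIV :: 'a set) \<and>
     finite (inf_pts \<Gamma>) \<and>
     Metric_space (- inf_pts \<Gamma>) (gdist \<Gamma>) \<and>
     Metric_space.mtopology (- inf_pts \<Gamma>) (gdist \<Gamma>) = top_of_set (- inf_pts \<Gamma>) \<and>
     (\<forall>x. x \<notin> inf_pts \<Gamma> \<longrightarrow> (\<exists>n r U h. star_chart \<Gamma> x n r U h)) \<and>
     (\<forall>x\<in>inf_pts \<Gamma>. \<exists>U h. inf_chart \<Gamma> x U h)"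

definition has_valence :: "'a::topological_space curve \<Rightarrow> 'a \<Rightarrow> nat \<Rightarrow> bool" where
  "has_valence \<Gamma> x n \<longleftrightarrow>
     (if x \<in> inf_pts \<Gamma> then n = 1 else (\<exists>r U h. star_chart \<Gamma> x n r U h))"

definition cut_set :: "'a::topological_space set \<Rightarrow> bool" where
  "cut_set A \<longleftrightarrow> \<not> connected (- A)"

definition smooth_set :: "'a::topological_space curve \<Rightarrow> 'a set \<Rightarrow> bool" where
  "smooth_set \<Gamma> A \<longleftrightarrow> (\<forall>x\<in>A. has_valence \<Gamma> x 2)"

text \<open>A model together with the orientation of its open edges and their identification with open
  intervals. The edge \<open>e\<close> is identified with \<open>(lo e, hi e)\<close>; the usual normalisation is \<open>lo e = 0\<close>,
  \<open>hi e\<close> being the length. Other values of \<open>lo\<close> are admitted because an edge with points at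
  infinity at both of its ends can only be identified with the whole real line.\<close>

record 'a model =
  verts :: "'a set"
  lo :: "'a set \<Rightarrow> ereal"
  hi :: "'a set \<Rightarrow> ereal"
  edge_map :: "'a set \<Rightarrow> real \<Rightarrow> 'a"

definition edges :: "'a::topological_space model \<Rightarrow> 'a set set" where
  "edges M = components (- verts M)"

definition edge_interval :: "'a model \<Rightarrow> 'a set \<Rightarrow> real set" where
  "edge_interval M e = {t. lo M e < ereal t \<and> ereal t < hi M e}"

definition model :: "'a::topological_space curve \<Rightarrow> 'a model \<Rightarrow> bool" where
  "model \<Gamma> M \<longleftrightarrow>
     finite (verts M) \<and> verts M \<noteq> {} \<and> {x. \<not> has_valence \<Gamma> x 2} \<subseteq> verts M \<and>
     (\<forall>e\<in>edges M.
        (\<exists>g. homeomorphism (edge_interval M e) e (edge_map M e) g) \<and>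
        (\<forall>t\<in>edge_interval M e. \<exists>\<epsilon>>0.
           \<forall>s\<in>edge_interval M e \<inter> ball t \<epsilon>. \<forall>u\<in>edge_interval M e \<inter> ball t \<epsilon>.
             gdist \<Gamma> (edge_map M e s) (edge_map M e u) = \<bar>s - u\<bar>))"

definition supp :: "('a \<Rightarrow> int) \<Rightarrow> 'a set" where
  "supp D = {x. D x \<noteq> 0}"

definition divisor :: "('a \<Rightarrow> int) \<Rightarrow> bool" where
  "divisor D \<longleftrightarrow> finite (supp D)"

text \<open>A star of valence 2 is an open real interval around \<open>0\<close>, so \<open>Re\<close> is its coordinate.\<close>

definition linear_near :: "'a::topological_space curve \<Rightarrow> ('a \<Rightarrow> ereal) \<Rightarrow> 'a \<Rightarrow> bool" where
  "linear_near \<Gamma> f x \<longleftrightarrow>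
     (\<exists>r U h (m::int). star_chart \<Gamma> x 2 r U h \<and>
        (\<forall>y\<in>U. f y = f x + ereal (of_int m * Re (h y))))"

definition rational_function :: "'a::topological_space curve \<Rightarrow> ('a \<Rightarrow> ereal) \<Rightarrow> bool" where
  "rational_function \<Gamma> f \<longleftrightarrow>
     continuous_on UNIV f \<and> (\<forall>x. x \<notin> inf_pts \<Gamma> \<longrightarrow> \<bar>f x\<bar> \<noteq> \<infinity>) \<and>
     finite {x. \<not> linear_near \<Gamma> f x}"

text \<open>Sum of the outgoing slopes. At a point at infinity the only outgoing direction is the one
  in which the coordinate of the chart decreases.\<close>

definition has_ord :: "'a::topological_space curve \<Rightarrow> ('a \<Rightarrow> ereal) \<Rightarrow> 'a \<Rightarrow> int \<Rightarrow> bool" where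
  "has_ord \<Gamma> f x k \<longleftrightarrow>
     (if x \<in> inf_pts \<Gamma>
      then \<exists>U h c. inf_chart \<Gamma> x U h \<and>
             (\<forall>y\<in>U - {x}. f y = ereal (c + of_int (- k) * real_of_ereal (h y)))
      else \<exists>n r U h (s :: nat \<Rightarrow> int). star_chart \<Gamma> x n r U h \<and>
             (\<forall>i<n. \<forall>y\<in>U. h y = rcis (cmod (h y)) (2 * pi * real i / real n) \<longrightarrow>
                f y = f x + ereal (of_int (s i) * cmod (h y))) \<and>
             k = (\<Sum>i<n. s i))"

definition principal :: "'a::topological_space curve \<Rightarrow> ('a \<Rightarrow> ereal) \<Rightarrow> 'a \<Rightarrow> int" where
  "principal \<Gamma> f = (\<lambda>x. THE k. has_ord \<Gamma> f x k)"

definition RR :: "'a::topological_space curve \<Rightarrow> ('a \<Rightarrow> int) \<Rightarrow> ('a \<Rightarrow> ereal) set" where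
  "RR \<Gamma> D = {f. rational_function \<Gamma> f \<and> (\<forall>x. 0 \<le> D x + principal \<Gamma> f x)}"

definition linear_system :: "'a::topological_space curve \<Rightarrow> ('a \<Rightarrow> int) \<Rightarrow> ('a \<Rightarrow> int) set" where
  "linear_system \<Gamma> D = {D + principal \<Gamma> f | f. f \<in> RR \<Gamma> D}"

definition trop_scale :: "real \<Rightarrow> ('a \<Rightarrow> ereal) \<Rightarrow> 'a \<Rightarrow> ereal" where
  "trop_scale a f = (\<lambda>x. ereal a + f x)"

definition trop_span :: "('a \<Rightarrow> ereal) set \<Rightarrow> ('a \<Rightarrow> ereal) set" where
  "trop_span A =
     {\<lambda>x. Max ((\<lambda>g. trop_scale (a g) g x) ` G) | G a. finite G \<and> G \<noteq> {} \<and> G \<subseteq> A}"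

definition trop_scaling_rel :: "(('a \<Rightarrow> ereal) \<times> ('a \<Rightarrow> ereal)) set" where
  "trop_scaling_rel = {(f, g). \<exists>a. g = trop_scale a f}"

record 'a cell_index =
  vert_mult :: "'a \<Rightarrow> int"
  edge_comp :: "'a set \<Rightarrow> nat list"
  edge_slope :: "'a set \<Rightarrow> int"

definition start_slope :: "'a model \<Rightarrow> ('a \<Rightarrow> ereal) \<Rightarrow> 'a set \<Rightarrow> int \<Rightarrow> bool" where
  "start_slope M f e m \<longleftrightarrow>
     (\<exists>c. \<exists>b\<in>edge_interval M e. \<forall>t\<in>edge_interval M e. t < b \<longrightarrow>
        f (edge_map M e t) = ereal (c + of_int m * t))"

text \<open>\<open>x (e, i)\<close> is the position on the edge \<open>e\<close> of the \<open>i\<close>-th point (counted from \<open>0\<close>) of the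
  restriction of \<open>E\<close> to \<open>e\<close>. Entries of \<open>x\<close> not corresponding to such a point are \<open>0\<close>, so \<open>x\<close> is
  the coordinate vector of \<open>E\<close> in the cell.\<close>

definition in_cell ::
    "'a::topological_space curve \<Rightarrow> 'a model \<Rightarrow> ('a \<Rightarrow> int) \<Rightarrow> 'a cell_index \<Rightarrow>
     ('a \<Rightarrow> int) \<Rightarrow> ('a set \<times> nat \<Rightarrow> real) \<Rightarrow> bool" where
  "in_cell \<Gamma> M D c E x \<longleftrightarrow>
     (\<exists>f\<in>RR \<Gamma> D. E = D + principal \<Gamma> f \<and>
        (\<forall>e\<in>edges M. start_slope M f e (edge_slope c e))) \<and>
     (\<forall>v\<in>verts M. E v = vert_mult c v) \<and>
     (\<forall>e\<in>edges M.
        let r = length (edge_comp c e) in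
        (\<forall>i<r. x (e, i) \<in> edge_interval M e) \<and>
        (\<forall>j<r. \<forall>i<j. x (e, i) < x (e, j)) \<and>
        (\<forall>t\<in>edge_interval M e.
           E (edge_map M e t) = (\<Sum>i | i < r \<and> x (e, i) = t. int (edge_comp c e ! i)))) \<and>
     (\<forall>e i. \<not> (e \<in> edges M \<and> i < length (edge_comp c e)) \<longrightarrow> x (e, i) = 0)"

definition cell ::
    "'a::topological_space curve \<Rightarrow> 'a model \<Rightarrow> ('a \<Rightarrow> int) \<Rightarrow> 'a cell_index \<Rightarrow> ('a \<Rightarrow> int) set" where
  "cell \<Gamma> M D c = {E. \<exists>x. in_cell \<Gamma> M D c E x}"

lemma cell_subset_linear_system: "cell \<Gamma> M D c \<subseteq> linear_system \<Gamma> D"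
  unfolding cell_def linear_system_def in_cell_def by blast

definition cell_coords ::
    "'a::topological_space curve \<Rightarrow> 'a model \<Rightarrow> ('a \<Rightarrow> int) \<Rightarrow> 'a cell_index \<Rightarrow>
     ('a set \<times> nat \<Rightarrow> real) set" where
  "cell_coords \<Gamma> M D c = {x. \<exists>E. in_cell \<Gamma> M D c E x}"

text \<open>In coordinates a cell is a relatively open convex polyhedron; its dimension is that of its
  affine hull, i.e. of the space spanned by the differences of its points. The library's \<open>aff_dim\<close>
  does not apply because the number of coordinates varies with the cell.\<close>

definition cell_dim ::
    "'a::topological_space curve \<Rightarrow> 'a model \<Rightarrow> ('a \<Rightarrow> int) \<Rightarrow> 'a cell_index \<Rightarrow> nat" where
  "cell_dim \<Gamma> M D c =
     vector_space.dim (\<lambda>(a::real) x p. a * x p)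
       {x - y | x y. x \<in> cell_coords \<Gamma> M D c \<and> y \<in> cell_coords \<Gamma> M D c}"

definition cell_vertices ::
    "'a::topological_space curve \<Rightarrow> 'a model \<Rightarrow> ('a \<Rightarrow> int) \<Rightarrow> ('a \<Rightarrow> int) set" where
  "cell_vertices \<Gamma> M D =
     {E. \<exists>c. (\<forall>e\<in>edges M. \<forall>k\<in>set (edge_comp c e). 0 < k) \<and>
         E \<in> cell \<Gamma> M D c \<and> cell_dim \<Gamma> M D c = 0}"

definition vertex_functions ::
    "'a::topological_space curve \<Rightarrow> 'a model \<Rightarrow> ('a \<Rightarrow> int) \<Rightarrow> ('a \<Rightarrow> ereal) set" where
  "vertex_functions \<Gamma> M D = {f \<in> RR \<Gamma> D. D + principal \<Gamma> f \<in> cell_vertices \<Gamma> M D}"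

definition no_smooth_cut_functions ::
    "'a::topological_space curve \<Rightarrow> ('a \<Rightarrow> int) \<Rightarrow> ('a \<Rightarrow> ereal) set" where
  "no_smooth_cut_functions \<Gamma> D =
     {f \<in> RR \<Gamma> D. \<not> (\<exists>A \<subseteq> supp (D + principal \<Gamma> f). smooth_set \<Gamma> A \<and> cut_set A)}"

end

theory Submission
  imports Defs
begin

text \<open>
  Call a chip of \<open>D + (f)\<close> a point of its support that is not a vertex of the model, and let \<open>T\<close> be
  the set of all \<open>f\<close> in \<open>R(D)\<close> whose chips do not disconnect the curve. Chips form smooth sets, so
  \<open>T\<close> contains the functions of (a). If \<open>f\<close> is in \<open>T\<close> and \<open>f'\<close> in the same cell, then \<open>f' - f\<close> is
  constant near every vertex; since the complement of the chips is connected, every edge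
  carries at most one chip and these constants agree, so the chips cannot have moved and the cell is
  a point.

  For (b), a vertex of the complex is determined by the index of its cell, and \<open>D + (f)\<close>
  determines \<open>f\<close> up to a constant. The multiplicities in an index are bounded because principal
  divisors have degree 0, the slopes because the same holds for the principal divisor of \<open>max f c\<close>.

  For (c), if \<open>f\<close> is not in \<open>T\<close> and \<open>x\<close> is a point, one can lower \<open>f\<close> away from \<open>x\<close> such that chips
  move until two of them merge or one reaches a vertex. As the number of chips drops, every
  \<open>f\<close> dominates, for each \<open>x\<close>, some \<open>g\<close> in \<open>T\<close> with \<open>g x = f x\<close>. These \<open>g\<close> have \<open>f\<close> as their maximum and
  are finite in number, because two of them that differ by a constant are equal.
\<close>

section \<open>One-sided neighbourhoods on the line\<close>

text \<open>Chips are counted off the vertices of the model, since a cell leaves no freedom at the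
  vertices, and these may include points of valence 2. The definitions speak of charts, the cells of
  edge coordinates. The two are reconciled once: each branch of a chart becomes a one-sided filter
  on an edge, and from then on slopes, divisors and continuity are read along such directions, alike
  at interior points, vertices and points at infinity. Functions are made real-valued, because their
  values at infinity are limits. The obstacle in (c) is that lowering one side of a cut requires
  every moving chip to reach a vertex after a finite distance. A chip next to an infinite end not
  shielded by \<open>x\<close> is therefore sent there at once, by an unbounded lowering function,
  and two chips of an edge with \<open>x\<close> not between them are merged. What remains is either
  \<open>x\<close> between two chips of an edge, where everything outside is lowered, or at most one
  chip on each edge, where a cut works. The slope used at a chip is its full multiplicity, so that
  the point is vacated and the count of occupied points drops.\<close>

definition sgb :: "bool \<Rightarrow> real" where
  "sgb s = (if s then 1 else - 1)"

lemma sgb_simps [simp]: "sgb True = 1" "sgb False = - 1"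
  by (auto simp: sgb_def)

lemma sgb_square [simp]: "sgb s * sgb s = 1" "sgb s * (sgb s * x) = x"
  by (auto simp: sgb_def)

lemma abs_sgb [simp]: "\<bar>sgb s\<bar> = 1" "sgb s \<noteq> 0"
  by (auto simp: sgb_def)

text \<open>\<open>dfil a s\<close> describes real numbers approaching the extended real \<open>a\<close> from the right if \<open>s\<close>
  holds, and from the left otherwise.\<close>

definition dfil :: "ereal \<Rightarrow> bool \<Rightarrow> real filter" where
  "dfil a s = filtercomap ereal (if s then at_right a else at_left a)"

text \<open>Basic set of \<open>dfil a s\<close>: the end \<open>a\<close> may be infinite, the
  other end is real.\<close>

definition seg :: "ereal \<Rightarrow> bool \<Rightarrow> real \<Rightarrow> real set" where
  "seg a s b = {t. if s then a < ereal t \<and> t < b else b < t \<and> ereal t < a}"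

text \<open>As a hypothesis with some \<open>c\<close>, it says that there is room on the side
  \<open>s\<close> of \<open>a\<close>, so that \<open>dfil a s\<close> is not the trivial
  filter.\<close>

definition beyond :: "ereal \<Rightarrow> bool \<Rightarrow> ereal \<Rightarrow> bool" where
  "beyond a s b \<longleftrightarrow> (if s then a < b else b < a)"

text \<open>A real number lies between any two distinct extended reals, so the bound of a one-sided
  neighbourhood can be taken real.\<close>

lemma eventually_dfil:
  assumes "beyond a s c"
  shows "eventually P (dfil a s) \<longleftrightarrow> (\<exists>b. beyond a s (ereal b) \<and> (\<forall>t\<in>seg a s b. P t))"
proof (cases s)
  case True
  then have ac: "a < c" using assms by (auto simp: beyond_def)
  have "eventually P (dfil a s) \<longleftrightarrow> (\<exists>Q. (\<exists>b>a. \<forall>y>a. y < b \<longrightarrow> Q y) \<and> (\<forall>x. Q (ereal x) \<longrightarrow> P x))"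
    using True by (simp add: dfil_def eventually_filtercomap eventually_at_right[OF ac])
  also have "\<dots> \<longleftrightarrow> (\<exists>b. a < ereal b \<and> (\<forall>t. a < ereal t \<and> t < b \<longrightarrow> P t))"
  proof safe
    fix Q b assume *: "\<forall>x. Q (ereal x) \<longrightarrow> P x" "a < b" "\<forall>y>a. y < b \<longrightarrow> Q y"
    obtain b' where b': "a < ereal b'" "ereal b' < b" using ereal_dense2[OF *(2)] by auto
    show "\<exists>b. a < ereal b \<and> (\<forall>t. a < ereal t \<and> t < b \<longrightarrow> P t)"
    proof (intro exI[of _ b'] conjI allI impI)
      fix t assume "a < ereal t \<and> t < b'"
      then have "a < ereal t" "t < b'" by auto
      then have "ereal t < b" using b'(2) by (metis less_ereal.simps(1) less_trans)
      then show "P t" using * \<open>a < ereal t\<close> by auto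
    qed (use b' in auto)
  next
    fix b assume *: "a < ereal b" "\<forall>t. a < ereal t \<and> t < b \<longrightarrow> P t"
    show "\<exists>Q. (\<exists>b>a. \<forall>y>a. y < b \<longrightarrow> Q y) \<and> (\<forall>x. Q (ereal x) \<longrightarrow> P x)"
      using * by (intro exI[of _ "\<lambda>y. a < y \<and> y < ereal b"]) auto
  qed
  finally show ?thesis using True by (simp add: seg_def beyond_def)
next
  case False
  then have ac: "c < a" using assms by (auto simp: beyond_def)
  have "eventually P (dfil a s) \<longleftrightarrow> (\<exists>Q. (\<exists>b<a. \<forall>y>b. y < a \<longrightarrow> Q y) \<and> (\<forall>x. Q (ereal x) \<longrightarrow> P x))"
    using False by (simp add: dfil_def eventually_filtercomap eventually_at_left[OF ac])
  also have "\<dots> \<longleftrightarrow> (\<exists>b. ereal b < a \<and> (\<forall>t. b < t \<and> ereal t < a \<longrightarrow> P t))"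
  proof safe
    fix Q b assume *: "\<forall>x. Q (ereal x) \<longrightarrow> P x" "b < a" "\<forall>y>b. y < a \<longrightarrow> Q y"
    obtain b' where b': "ereal b' < a" "b < ereal b'" using ereal_dense2[OF *(2)] by auto
    show "\<exists>b. ereal b < a \<and> (\<forall>t. b < t \<and> ereal t < a \<longrightarrow> P t)"
    proof (intro exI[of _ b'] conjI allI impI)
      fix t assume "b' < t \<and> ereal t < a"
      then have "ereal t < a" "b' < t" by auto
      then have "b < ereal t" using b'(2) by (metis less_ereal.simps(1) less_trans)
      then show "P t" using * \<open>ereal t < a\<close> by auto
    qed (use b' in auto)
  next
    fix b assume *: "ereal b < a" "\<forall>t. b < t \<and> ereal t < a \<longrightarrow> P t"
    show "\<exists>Q. (\<exists>b<a. \<forall>y>b. y < a \<longrightarrow> Q y) \<and> (\<forall>x. Q (ereal x) \<longrightarrow> P x)"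
      using * by (intro exI[of _ "\<lambda>y. y < a \<and> ereal b < y"]) auto
  qed
  finally show ?thesis using False by (simp add: seg_def beyond_def)
qed

lemma seg_open: "open (seg a s b)"
proof -
  have "seg a s b = (if s then ereal -` {a<..} \<inter> {..<b} else {b<..} \<inter> ereal -` {..<a})"
    by (auto simp: seg_def)
  moreover have "open (ereal -` {a<..})" "open (ereal -` {..<a})"
    by (auto intro!: open_vimage continuous_intros)
  ultimately show ?thesis by auto
qed

lemma seg_connected: "connected (seg a s b)"
proof -
  have "is_interval (seg a s b)"
    unfolding is_interval_1
  proof (intro ballI allI impI, elim conjE)
    fix x z y assume *: "x \<in> seg a s b" "z \<in> seg a s b" "x \<le> y" "y \<le> z"
    then have "ereal x \<le> ereal y" "ereal y \<le> ereal z" by auto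
    then show "y \<in> seg a s b" using * less_le_trans[of a "ereal x" "ereal y"] le_less_trans[of "ereal y" "ereal z" a]
      by (cases s) (auto simp: seg_def)
  qed
  then show ?thesis by (simp add: is_interval_connected_1)
qed

lemma seg_nonempty:
  assumes "beyond a s (ereal b)"
  shows "seg a s b \<noteq> {}"
proof (cases s)
  case True
  then obtain c where "a < ereal c" "ereal c < b" using assms ereal_dense2[of a b] by (auto simp: beyond_def)
  then show ?thesis using True by (auto simp: seg_def)
next
  case False
  then obtain c where "ereal c < a" "b < ereal c" using assms ereal_dense2[of b a] by (auto simp: beyond_def)
  then show ?thesis using False by (auto simp: seg_def)
qed

lemma dfil_neq_bot:
  assumes "beyond a s c"
  shows "dfil a s \<noteq> bot"
  using seg_nonempty by (auto simp: trivial_limit_def eventually_dfil[OF assms])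

lemma eventually_dfil_seg: "beyond a s (ereal b) \<Longrightarrow> eventually (\<lambda>t. t \<in> seg a s b) (dfil a s)"
  by (subst eventually_dfil, assumption) auto

lemma eventually_dfil_beyond:
  assumes "beyond a s c"
  shows "eventually (\<lambda>t. beyond a s (ereal t)) (dfil a s)"
proof -
  have "\<exists>b. beyond a s (ereal b)"
    using assms ereal_dense2[of a c] ereal_dense2[of c a] by (auto simp: beyond_def split: if_splits)
  then show ?thesis unfolding eventually_dfil[OF assms] by (auto simp: seg_def beyond_def)
qed

lemma eventually_dfil_less:
  assumes "beyond a s c'" "a < c"
  shows "eventually (\<lambda>t. ereal t < c) (dfil a s)"
proof (cases s)
  case True
  obtain b where b: "a < ereal b" "ereal b < c" using ereal_dense2[OF assms(2)] by auto
  have "beyond a s (ereal b)" using True b by (simp add: beyond_def)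
  from eventually_dfil_seg[OF this] show ?thesis
  proof eventually_elim
    case (elim t)
    then have "ereal t < ereal b" using True by (simp add: seg_def)
    then show ?case using b(2) by (rule less_trans)
  qed
next
  case False
  show ?thesis using eventually_dfil_beyond[OF assms(1)]
  proof eventually_elim
    case (elim t)
    then show ?case using False assms(2) by (auto simp: beyond_def intro: less_trans)
  qed
qed

lemma eventually_dfil_greater:
  assumes "beyond a s c'" "c < a"
  shows "eventually (\<lambda>t. c < ereal t) (dfil a s)"
proof (cases s)
  case False
  obtain b where b: "c < ereal b" "ereal b < a" using ereal_dense2[OF assms(2)] by auto
  have "beyond a s (ereal b)" using False b by (simp add: beyond_def)
  from eventually_dfil_seg[OF this] show ?thesis
  proof eventually_elim
    case (elim t)
    then have "ereal b < ereal t" using False by (simp add: seg_def)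
    with b(1) show ?case by (rule less_trans)
  qed
next
  case True
  show ?thesis using eventually_dfil_beyond[OF assms(1)]
  proof eventually_elim
    case (elim t)
    then show ?case using True assms(2) by (auto simp: beyond_def intro: less_trans)
  qed
qed

lemma filterlim_ereal_dfil: "beyond a s c' \<Longrightarrow> (ereal \<longlongrightarrow> a) (dfil a s)"
  by (rule order_tendstoI) (auto intro: eventually_dfil_less eventually_dfil_greater)

lemma filterlim_dfil: "(id \<longlongrightarrow> a) (dfil (ereal a) s)"
proof -
  have "beyond (ereal a) s (if s then a + 1 else a - 1)" by (auto simp: beyond_def)
  from filterlim_ereal_dfil[OF this] show ?thesis by (simp add: id_def)
qed

text \<open>Different one-sided approaches have disjoint tails. This lets a point be surrounded by
  tails of its own directions that a foreign direction avoids.\<close>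

lemma dfil_separated:
  assumes "beyond a s c" "beyond a' s' c'" "(a, s) \<noteq> (a', s')"
  shows "\<exists>S. eventually (\<lambda>t. t \<in> S) (dfil a s) \<and> eventually (\<lambda>t. t \<notin> S) (dfil a' s')"
proof -
  consider "a < a'" | "a' < a" | "a = a'" "s' \<noteq> s" using assms(3) by fastforce
  then show ?thesis
  proof cases
    case 1
    then obtain b where b: "a < ereal b" "ereal b < a'" using ereal_dense2 by blast
    have "eventually (\<lambda>t. t \<notin> {t. t < b}) (dfil a' s')"
      using eventually_dfil_greater[OF assms(2) b(2)] by eventually_elim auto
    then show ?thesis using eventually_dfil_less[OF assms(1) b(1)] by (intro exI[of _ "{t. t < b}"]) auto
  next
    case 2
    then obtain b where b: "a' < ereal b" "ereal b < a" using ereal_dense2 by blast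
    have "eventually (\<lambda>t. t \<notin> {t. t > b}) (dfil a' s')"
      using eventually_dfil_less[OF assms(2) b(1)] by eventually_elim auto
    then show ?thesis using eventually_dfil_greater[OF assms(1) b(2)] by (intro exI[of _ "{t. t > b}"]) auto
  next
    case 3
    let ?S = "{t. beyond a s (ereal t)}"
    have "eventually (\<lambda>t. t \<notin> ?S) (dfil a' s')"
      using eventually_dfil_beyond[OF assms(2)] by eventually_elim (use 3 in \<open>auto simp: beyond_def split: if_splits\<close>)
    then show ?thesis using eventually_dfil_beyond[OF assms(1)] by (intro exI[of _ ?S]) auto
  qed
qed

lemma eventually_dfil_neq:
  assumes "beyond a s c"
  shows "eventually (\<lambda>t. t \<noteq> t0) (dfil a s)"
proof -
  consider "a < ereal t0" | "ereal t0 < a" | "a = ereal t0" by fastforce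
  then show ?thesis
  proof cases
    case 1 show ?thesis using eventually_dfil_less[OF assms 1] by eventually_elim auto
  next
    case 2 show ?thesis using eventually_dfil_greater[OF assms 2] by eventually_elim auto
  next
    case 3 show ?thesis using eventually_dfil_beyond[OF assms]
      by eventually_elim (use 3 in \<open>auto simp: beyond_def split: if_splits\<close>)
  qed
qed

lemma eventually_dfil_not_in_finite:
  assumes "beyond a s c" "finite S"
  shows "eventually (\<lambda>t. t \<notin> S) (dfil a s)"
proof -
  have "eventually (\<lambda>t. \<forall>x\<in>S. t \<noteq> x) (dfil a s)"
    using assms by (intro eventually_ball_finite ballI eventually_dfil_neq)
  then show ?thesis by eventually_elim auto
qed

lemma beyond_real: "beyond (ereal a) s (ereal (a + sgb s))"
  by (auto simp: beyond_def)

lemma eventually_dfil_real: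
  "eventually P (dfil (ereal a) s) \<longleftrightarrow> (\<exists>\<delta>>0. \<forall>\<tau>. 0 < \<tau> \<and> \<tau> < \<delta> \<longrightarrow> P (a + sgb s * \<tau>))"
proof (cases s)
  case True
  show ?thesis unfolding eventually_dfil[OF beyond_real]
  proof safe
    fix b assume b: "beyond (ereal a) s (ereal b)" "\<forall>t\<in>seg (ereal a) s b. P t"
    then show "\<exists>\<delta>>0. \<forall>\<tau>. 0 < \<tau> \<and> \<tau> < \<delta> \<longrightarrow> P (a + sgb s * \<tau>)"
      using True by (intro exI[of _ "b - a"]) (auto simp: beyond_def seg_def)
  next
    fix \<delta> :: real assume \<delta>: "\<delta> > 0" "\<forall>\<tau>. 0 < \<tau> \<and> \<tau> < \<delta> \<longrightarrow> P (a + sgb s * \<tau>)"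
    have "P t" if "t \<in> seg (ereal a) s (a + \<delta>)" for t
      using \<delta>(2)[rule_format, of "t - a"] that True by (auto simp: seg_def)
    then show "\<exists>b. beyond (ereal a) s (ereal b) \<and> (\<forall>t\<in>seg (ereal a) s b. P t)"
      using True \<delta> by (intro exI[of _ "a + \<delta>"]) (auto simp: beyond_def)
  qed
next
  case False
  show ?thesis unfolding eventually_dfil[OF beyond_real]
  proof safe
    fix b assume b: "beyond (ereal a) s (ereal b)" "\<forall>t\<in>seg (ereal a) s b. P t"
    then show "\<exists>\<delta>>0. \<forall>\<tau>. 0 < \<tau> \<and> \<tau> < \<delta> \<longrightarrow> P (a + sgb s * \<tau>)"
      using False by (intro exI[of _ "a - b"]) (auto simp: beyond_def seg_def)
  next
    fix \<delta> :: real assume \<delta>: "\<delta> > 0" "\<forall>\<tau>. 0 < \<tau> \<and> \<tau> < \<delta> \<longrightarrow> P (a + sgb s * \<tau>)"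
    have "P t" if "t \<in> seg (ereal a) s (a - \<delta>)" for t
      using \<delta>(2)[rule_format, of "a - t"] that False by (auto simp: seg_def)
    then show "\<exists>b. beyond (ereal a) s (ereal b) \<and> (\<forall>t\<in>seg (ereal a) s b. P t)"
      using False \<delta> by (intro exI[of _ "a - \<delta>"]) (auto simp: beyond_def)
  qed
qed

text \<open>The free offset \<open>\<alpha>\<close> matches a chart at infinity, whose coordinate
  \<open>\<tau>\<close> differs from the edge coordinate by a shift and possibly a
  reflection.\<close>

lemma eventually_dfil_inf:
  "eventually P (dfil (if s then -\<infinity> else \<infinity>) s) \<longleftrightarrow> (\<exists>R. \<forall>\<tau>>R. P (\<alpha> - sgb s * \<tau>))"
proof -
  have b: "beyond (if s then -\<infinity> else \<infinity>) s (ereal b)" for b by (auto simp: beyond_def)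
  show ?thesis unfolding eventually_dfil[OF b[of 0]]
  proof safe
    fix c assume c: "\<forall>t\<in>seg (if s then - \<infinity> else \<infinity>) s c. P t"
    then show "\<exists>R. \<forall>\<tau>>R. P (\<alpha> - sgb s * \<tau>)"
      by (intro exI[of _ "sgb s * (\<alpha> - c)"]) (cases s; auto simp: seg_def)
  next
    fix R assume R: "\<forall>\<tau>>R. P (\<alpha> - sgb s * \<tau>)"
    have "P t" if "t \<in> seg (if s then - \<infinity> else \<infinity>) s (\<alpha> - sgb s * R)" for t
      using R[rule_format, of "sgb s * (\<alpha> - t)"] that by (cases s) (auto simp: seg_def)
    then show "\<exists>c. beyond (if s then - \<infinity> else \<infinity>) s (ereal c) \<and> (\<forall>t\<in>seg (if s then - \<infinity> else \<infinity>) s c. P t)"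
      using b by blast
  qed
qed

lemma nhds_real_dfil:
  "eventually P (nhds (t::real)) \<longleftrightarrow> P t \<and> eventually P (dfil (ereal t) True) \<and> eventually P (dfil (ereal t) False)"
proof safe
  assume "eventually P (nhds t)"
  then obtain \<delta> where \<delta>: "\<delta> > 0" "\<And>s. dist s t < \<delta> \<Longrightarrow> P s" unfolding eventually_nhds_metric by auto
  show "P t" using \<delta> by auto
  show "eventually P (dfil (ereal t) True)" "eventually P (dfil (ereal t) False)"
    unfolding eventually_dfil_real using \<delta> by (auto intro!: exI[of _ \<delta>] simp: dist_real_def)
next
  assume "P t" "eventually P (dfil (ereal t) True)" "eventually P (dfil (ereal t) False)"
  then obtain d d' where d: "d > 0" "\<And>\<tau>. 0 < \<tau> \<and> \<tau> < d \<Longrightarrow> P (t + \<tau>)" 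
     "d' > 0" "\<And>\<tau>. 0 < \<tau> \<and> \<tau> < d' \<Longrightarrow> P (t - \<tau>)"
    unfolding eventually_dfil_real by auto
  have "P s" if "dist s t < min d d'" for s
  proof -
    consider "s = t" | "s > t" | "s < t" by linarith
    then show ?thesis using that d(2)[of "s - t"] d(4)[of "t - s"] \<open>P t\<close> by cases (auto simp: dist_real_def)
  qed
  then show "eventually P (nhds t)" unfolding eventually_nhds_metric using d by (intro exI[of _ "min d d'"]) auto
qed

text \<open>A one-sided segment contains two distinct points, and these determine an affine
  function. Uniqueness of slopes rests on this.\<close>

lemma inj_dir:
  fixes m m' :: int
  assumes "beyond a s c'" "eventually (\<lambda>t. c + sgb s * of_int m * t = d + sgb s * of_int m' * t) (dfil a s)"
  shows "m = m' \<and> c = d"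
proof -
  obtain b where b: "beyond a s (ereal b)" "\<And>t. t \<in> seg a s b \<Longrightarrow> c + sgb s * of_int m * t = d + sgb s * of_int m' * t"
    using assms(2) unfolding eventually_dfil[OF assms(1)] by auto
  obtain t where t: "t \<in> seg a s b" using seg_nonempty[OF b(1)] by auto
  obtain e where e: "e > 0" "ball t e \<subseteq> seg a s b" using t seg_open by (meson open_contains_ball)
  have t2: "t + e / 2 \<in> seg a s b" using e by (auto simp: subset_iff dist_real_def)
  have *: "c + sgb s * of_int m * t = d + sgb s * of_int m' * t"
    "c + sgb s * of_int m * (t + e/2) = d + sgb s * of_int m' * (t + e/2)" using b(2) t t2 by auto
  then have "sgb s * of_int m * (e / 2) = sgb s * of_int m' * (e / 2)" by (simp only: distrib_left)
  then have "m = m'" using e(1) by simp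
  then show ?thesis using * by auto
qed

text \<open>The pair of constant term and slope is determined by the germ at \<open>t\<close>. An
  equation near \<open>t\<close> is also an equation near all points close to \<open>t\<close>, so
  this pair is locally constant, hence constant on a connected set.\<close>

lemma local_affine_const:
  fixes u :: "real \<Rightarrow> real"
  assumes J: "open J" "connected J" "J \<noteq> {}"
    and loc: "\<And>t. t \<in> J \<Longrightarrow> \<exists>c. \<exists>m::int. eventually (\<lambda>s. u s = c + of_int m * s) (nhds t)"
  obtains c and m :: int where "\<And>t. t \<in> J \<Longrightarrow> u t = c + of_int m * t"
proof -
  let ?A = "\<lambda>t p. eventually (\<lambda>s. u s = fst p + of_int (snd p) * s) (nhds t)"
  have uniq: "p = q" if "?A t p" "?A t q" for t p q
  proof -
    have "eventually (\<lambda>s. fst p + of_int (snd p) * s = fst q + of_int (snd q) * s) (nhds t)"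
      using that by eventually_elim auto
    then have "eventually (\<lambda>s. fst p + sgb True * of_int (snd p) * s = fst q + sgb True * of_int (snd q) * s) (dfil (ereal t) True)"
      unfolding nhds_real_dfil by simp
    from inj_dir[OF beyond_real this] show ?thesis by (simp add: prod_eq_iff)
  qed
  define P where "P t = (SOME p. ?A t p)" for t
  have P: "?A t (P t)" if t: "t \<in> J" for t
  proof -
    obtain c m where "eventually (\<lambda>s. u s = c + of_int m * s) (nhds t)" using loc[OF t] by blast
    then have "?A t (c, m)" by simp
    then show ?thesis unfolding P_def by (rule someI)
  qed
  have "\<forall>a\<in>J. eventually (\<lambda>b. P a = P b) (at a within J)"
  proof
    fix a assume "a \<in> J"
    have "eventually (\<lambda>b. ?A b (P a)) (nhds a)" using P[OF \<open>a \<in> J\<close>] by (subst eventually_eventually)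
    then have "eventually (\<lambda>b. b \<in> J \<longrightarrow> P a = P b) (nhds a)"
      by eventually_elim (use P uniq in blast)
    then show "eventually (\<lambda>b. P a = P b) (at a within J)" 
      unfolding eventually_at_filter by eventually_elim auto
  qed
  then have c: "P a = P b" if "a \<in> J" "b \<in> J" for a b using connected_local_const[OF J(2) that] by blast
  obtain t0 where t0: "t0 \<in> J" using J(3) by auto
  have "u t = fst (P t0) + of_int (snd (P t0)) * t" if "t \<in> J" for t
    using eventually_nhds_x_imp_x[OF P[OF that]] c[OF that t0] by simp
  then show ?thesis by (rule that)
qed

text \<open>Near \<open>t\<close>, a second point \<open>w\<close> fixes the sign, and the distances
  to \<open>t\<close> and \<open>w\<close> fix all other values; so the map is locally affine with
  slope 1 or -1. The local formulas are then glued.\<close>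

lemma locally_isometric_affine:
  fixes \<gamma> :: "real \<Rightarrow> real"
  assumes J: "open J" "connected J" "J \<noteq> {}"
    and iso: "\<And>t. t \<in> J \<Longrightarrow> \<exists>\<delta>>0. \<forall>u\<in>J \<inter> ball t \<delta>. \<forall>v\<in>J \<inter> ball t \<delta>. \<bar>\<gamma> u - \<gamma> v\<bar> = \<bar>u - v\<bar>"
  shows "\<exists>a s. \<forall>t\<in>J. \<gamma> t = a + sgb s * t"
proof -
  have iso': "\<exists>\<epsilon>>0. ball t \<epsilon> \<subseteq> J \<and> (\<forall>u\<in>ball t \<epsilon>. \<forall>v\<in>ball t \<epsilon>. \<bar>\<gamma> u - \<gamma> v\<bar> = \<bar>u - v\<bar>)" if tJ: "t \<in> J" for t
  proof -
    obtain \<delta> where \<delta>: "\<delta> > 0" "\<And>u v. u \<in> J \<inter> ball t \<delta> \<Longrightarrow> v \<in> J \<inter> ball t \<delta> \<Longrightarrow> \<bar>\<gamma> u - \<gamma> v\<bar> = \<bar>u - v\<bar>"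
      using iso[OF tJ] by meson
    obtain \<delta>' where \<delta>': "\<delta>' > 0" "ball t \<delta>' \<subseteq> J" using J(1) tJ by (meson open_contains_ball)
    show ?thesis using \<delta>(1) \<delta>' by (intro exI[of _ "min \<delta> \<delta>'"]) (auto intro!: \<delta>(2))
  qed
  have loc: "\<exists>c. \<exists>m::int. eventually (\<lambda>u. \<gamma> u = c + of_int m * u) (nhds t)" if tJ: "t \<in> J" for t
  proof -
    obtain \<epsilon> where \<epsilon>: "\<epsilon> > 0" "\<And>u v. u \<in> ball t \<epsilon> \<Longrightarrow> v \<in> ball t \<epsilon> \<Longrightarrow> \<bar>\<gamma> u - \<gamma> v\<bar> = \<bar>u - v\<bar>"
      using iso'[OF tJ] by meson
    define w where "w = t + \<epsilon> / 2"
    have w: "w \<in> ball t \<epsilon>" "w > t" using \<epsilon>(1) by (auto simp: w_def dist_real_def)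
    have tt: "t \<in> ball t \<epsilon>" using \<epsilon> by auto
    define m :: int where "m = (if \<gamma> w - \<gamma> t = w - t then 1 else - 1)"
    have u: "\<gamma> u = (\<gamma> t - of_int m * t) + of_int m * u" if u: "u \<in> ball t \<epsilon>" for u
    proof -
      have *: "\<bar>\<gamma> u - \<gamma> t\<bar> = \<bar>u - t\<bar>" "\<bar>\<gamma> u - \<gamma> w\<bar> = \<bar>u - w\<bar>" "\<bar>\<gamma> w - \<gamma> t\<bar> = \<bar>w - t\<bar>"
        using \<epsilon>(2) u tt w(1) by blast+
      show ?thesis
      proof (cases "\<gamma> w - \<gamma> t = w - t")
        case True
        then have "\<gamma> u - \<gamma> t = u - t" using * w(2) by linarith
        then show ?thesis using True by (simp add: m_def)
      next
        case False
        then have "\<gamma> w - \<gamma> t = t - w" using *(3) w(2) by linarith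
        then have "\<gamma> u - \<gamma> t = t - u" using * w(2) by linarith
        then show ?thesis using False by (simp add: m_def)
      qed
    qed
    have "eventually (\<lambda>u. u \<in> ball t \<epsilon>) (nhds t)" using \<epsilon>(1) by (intro eventually_nhds_in_open) auto
    then have "eventually (\<lambda>u. \<gamma> u = (\<gamma> t - of_int m * t) + of_int m * u) (nhds t)"
      by (rule eventually_mono) (rule u)
    then show ?thesis by blast
  qed
  obtain c and m :: int where cm: "\<And>t. t \<in> J \<Longrightarrow> \<gamma> t = c + of_int m * t"
    by (rule local_affine_const[OF J, where u=\<gamma>, OF loc]) (assumption, rule that)
  obtain t where t: "t \<in> J" using J(3) by blast
  obtain \<epsilon> where \<epsilon>: "\<epsilon> > 0" "ball t \<epsilon> \<subseteq> J" "\<And>u v. u \<in> ball t \<epsilon> \<Longrightarrow> v \<in> ball t \<epsilon> \<Longrightarrow> \<bar>\<gamma> u - \<gamma> v\<bar> = \<bar>u - v\<bar>"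
    using iso'[OF t] by meson
  have b: "t + \<epsilon> / 2 \<in> ball t \<epsilon>" "t \<in> ball t \<epsilon>" using \<epsilon>(1) by (auto simp: dist_real_def)
  have "\<bar>\<gamma> (t + \<epsilon> / 2) - \<gamma> t\<bar> = \<epsilon> / 2" using \<epsilon>(3)[OF b] \<epsilon>(1) by simp
  moreover have "\<gamma> (t + \<epsilon> / 2) - \<gamma> t = of_int m * (\<epsilon> / 2)"
    using cm[of t] cm[of "t + \<epsilon> / 2"] t b(1) \<epsilon>(2) by (simp add: algebra_simps subset_iff)
  ultimately have "\<bar>real_of_int m\<bar> = 1" using \<epsilon>(1) by (simp add: abs_mult)
  then have "m = 1 \<or> m = - 1" by linarith
  then have "real_of_int m = sgb (m = 1)" by auto
  then show ?thesis using cm by metis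
qed

section \<open>Charts and edges\<close>

lemma sgn_rcis: "\<tau> > 0 \<Longrightarrow> sgn (rcis \<tau> \<theta>) = cis \<theta>"
  by (simp add: rcis_def sgn_mult sgn_of_real)

lemma of_real_star_2:
  "\<bar>\<tau>\<bar> < r \<Longrightarrow> complex_of_real \<tau> \<in> star_shaped 2 r"
  "z \<in> star_shaped 2 r \<Longrightarrow> z = of_real (Re z) \<and> \<bar>Re z\<bar> = cmod z"
proof -
  show "complex_of_real \<tau> \<in> star_shaped 2 r" if "\<bar>\<tau>\<bar> < r"
  proof (cases "\<tau> \<ge> 0")
    case True
    then show ?thesis using that unfolding star_shaped_def
      by (intro CollectI disjI2 exI[of _ 0] conjI exI[of _ \<tau>]) (auto simp: rcis_def)
  next
    case False
    then show ?thesis using that unfolding star_shaped_def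
      by (intro CollectI disjI2 exI[of _ 1] conjI exI[of _ "-\<tau>"]) (auto simp: rcis_def)
  qed
  assume "z \<in> star_shaped 2 r"
  then consider "z = 0" | k t where "k < 2" "z = rcis t (pi * real k)"
    unfolding star_shaped_def by auto
  then have "Im z = 0"
  proof cases
    case (2 k t)
    then have "k = 0 \<or> k = 1" by auto
    then show ?thesis using 2 by (auto simp: rcis_def)
  qed auto
  then show "z = of_real (Re z) \<and> \<bar>Re z\<bar> = cmod z" by (simp add: complex_eq_iff cmod_eq_Re)
qed

text \<open>The direction \<open>(e, a, s)\<close> leaves the point with coordinate \<open>a\<close> on the edge \<open>e\<close>, in the sense of
  increasing coordinates if \<open>s\<close> holds. If \<open>a\<close> is an end of the coordinate interval, the point
  is a vertex. In this way the tangent directions at all points of the curve are treated alike.\<close>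

type_synonym 'a direction = "'a set \<times> ereal \<times> bool"

locale curve_model =
  fixes \<Gamma> :: "'a::t2_space curve" and M :: "'a model"
  assumes curve: "tropical_curve \<Gamma>" and is_model: "model \<Gamma> M"
begin

abbreviation "V \<equiv> verts M"
abbreviation "E \<equiv> edges M"
abbreviation "I \<equiv> edge_interval M"
abbreviation "em \<equiv> edge_map M"
abbreviation "dist\<^sub>\<Gamma> \<equiv> gdist \<Gamma>"
abbreviation "inf\<^sub>\<Gamma> \<equiv> inf_pts \<Gamma>"

lemma finite_V: "finite V" and V_nonempty: "V \<noteq> {}" and finite_inf: "finite inf\<^sub>\<Gamma>"
  using is_model curve by (auto simp: model_def tropical_curve_def)

lemma inf_subset_V: "inf\<^sub>\<Gamma> \<subseteq> V"
proof
  fix x assume "x \<in> inf\<^sub>\<Gamma>"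
  then have "\<not> has_valence \<Gamma> x 2" by (simp add: has_valence_def)
  then show "x \<in> V" using is_model unfolding model_def by blast
qed

lemma compact_UNIV: "compact (UNIV :: 'a set)" and connected_UNIV: "connected (UNIV :: 'a set)"
  using curve by (auto simp: tropical_curve_def)

sublocale metric: Metric_space "- inf\<^sub>\<Gamma>" "gdist \<Gamma>"
  using curve by (simp add: tropical_curve_def)

lemma mtop: "metric.mtopology = top_of_set (- inf\<^sub>\<Gamma>)"
  using curve by (simp add: tropical_curve_def)

lemma open_not_inf: "open (- inf\<^sub>\<Gamma>)"
  using finite_inf by (simp add: open_Compl finite_imp_closed)

text \<open>On the finite points the metric topology is the class topology, and these points form an
  open set, so small balls are open in the whole curve.\<close>

lemma open_gball:
  assumes "x \<notin> inf\<^sub>\<Gamma>"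
  shows "open {y. y \<notin> inf\<^sub>\<Gamma> \<and> dist\<^sub>\<Gamma> x y < r}"
proof -
  have "openin (top_of_set (- inf\<^sub>\<Gamma>)) (metric.mball x r)"
    using metric.openin_mball mtop by metis
  then have "open (metric.mball x r)" using open_not_inf by (simp add: openin_open_eq)
  moreover have "metric.mball x r = {y. y \<notin> inf\<^sub>\<Gamma> \<and> dist\<^sub>\<Gamma> x y < r}"
    using assms by auto
  ultimately show ?thesis by simp
qed

lemma gball_subset:
  assumes "open W" "x \<in> W" "x \<notin> inf\<^sub>\<Gamma>"
  obtains r where "r > 0" "\<And>y. y \<notin> inf\<^sub>\<Gamma> \<Longrightarrow> dist\<^sub>\<Gamma> x y < r \<Longrightarrow> y \<in> W"
proof -
  have "openin metric.mtopology (W \<inter> - inf\<^sub>\<Gamma>)"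
    unfolding mtop using assms by (metis Int_commute openin_open_Int)
  then obtain r where r: "r > 0" "metric.mball x r \<subseteq> W \<inter> - inf\<^sub>\<Gamma>"
    using assms unfolding metric.openin_mtopology by blast
  show ?thesis using r assms(3) by (intro that[of r]) auto
qed

lemma isometric_continuous:
  fixes \<rho> :: "real \<Rightarrow> 'a"
  assumes "\<And>t. t \<in> J \<Longrightarrow> \<rho> t \<notin> inf\<^sub>\<Gamma>" "\<And>s t. s \<in> J \<Longrightarrow> t \<in> J \<Longrightarrow> dist\<^sub>\<Gamma> (\<rho> s) (\<rho> t) = \<bar>s - t\<bar>"
  shows "continuous_on J \<rho>"
  unfolding continuous_on_topological
proof (intro ballI allI impI)
  fix t B assume t: "t \<in> J" and B: "open B" "\<rho> t \<in> B"
  obtain r where r: "r > 0" "\<And>y. y \<notin> inf\<^sub>\<Gamma> \<Longrightarrow> dist\<^sub>\<Gamma> (\<rho> t) y < r \<Longrightarrow> y \<in> B"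
    using gball_subset[OF B] assms(1) t by blast
  show "\<exists>A. open A \<and> t \<in> A \<and> (\<forall>y\<in>J. y \<in> A \<longrightarrow> \<rho> y \<in> B)"
  proof (intro exI[of _ "ball t r"] conjI ballI impI)
    fix y assume "y \<in> J" "y \<in> ball t r"
    then show "\<rho> y \<in> B" using r(2)[of "\<rho> y"] assms t by (auto simp: dist_real_def)
  qed (use r in auto)
qed

lemma edge_subset: "e \<in> E \<Longrightarrow> e \<subseteq> - V"
  by (auto simp: edges_def dest: in_components_subset)

lemma edge_disjoint: "e \<in> E \<Longrightarrow> e' \<in> E \<Longrightarrow> x \<in> e \<Longrightarrow> x \<in> e' \<Longrightarrow> e = e'"
  unfolding edges_def using components_eq by blast

lemma edge_exists: "x \<notin> V \<Longrightarrow> \<exists>e\<in>E. x \<in> e"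
  unfolding edges_def using Union_components[of "- V"] by blast

lemma edge_nonempty: "e \<in> E \<Longrightarrow> e \<noteq> {}"
  unfolding edges_def by (rule in_components_nonempty)

definition coord :: "'a set \<Rightarrow> 'a \<Rightarrow> real" where
  "coord e = (SOME g. homeomorphism (I e) e (em e) g)"

lemma edge_homeo: "e \<in> E \<Longrightarrow> homeomorphism (I e) e (em e) (coord e)"
proof -
  assume "e \<in> E"
  then have "\<exists>g. homeomorphism (I e) e (em e) g" using is_model unfolding model_def by blast
  then show ?thesis unfolding coord_def by (rule someI_ex)
qed

lemma em_in: "e \<in> E \<Longrightarrow> t \<in> I e \<Longrightarrow> em e t \<in> e"
  using homeomorphism_image1[OF edge_homeo] by blast

lemma coord_em [simp]: "e \<in> E \<Longrightarrow> t \<in> I e \<Longrightarrow> coord e (em e t) = t"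
  using homeomorphism_apply1[OF edge_homeo] by blast

lemma em_coord [simp]: "e \<in> E \<Longrightarrow> x \<in> e \<Longrightarrow> em e (coord e x) = x"
  using homeomorphism_apply2[OF edge_homeo] by blast

lemma coord_in: "e \<in> E \<Longrightarrow> x \<in> e \<Longrightarrow> coord e x \<in> I e"
  using homeomorphism_image2[OF edge_homeo] by blast

lemma em_inj: "e \<in> E \<Longrightarrow> t \<in> I e \<Longrightarrow> t' \<in> I e \<Longrightarrow> em e t = em e t' \<longleftrightarrow> t = t'"
  by (metis coord_em)

lemma em_inj2: "e \<in> E \<Longrightarrow> t \<in> I e \<Longrightarrow> e' \<in> E \<Longrightarrow> t' \<in> I e' \<Longrightarrow> em e t = em e' t' \<longleftrightarrow> e = e' \<and> t = t'"
  by (metis coord_em edge_disjoint em_in)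

lemma em_not_V: "e \<in> E \<Longrightarrow> t \<in> I e \<Longrightarrow> em e t \<notin> V"
  using em_in edge_subset by blast

lemma em_not_inf: "e \<in> E \<Longrightarrow> t \<in> I e \<Longrightarrow> em e t \<notin> inf\<^sub>\<Gamma>"
  using em_not_V inf_subset_V by blast

lemma I_open: "open (I e)"
proof -
  have "I e = ereal -` {lo M e<..} \<inter> ereal -` {..<hi M e}" by (auto simp: edge_interval_def)
  moreover have "open (ereal -` {lo M e<..})" "open (ereal -` {..<hi M e})"
    by (auto intro!: open_vimage continuous_intros)
  ultimately show ?thesis by auto
qed

lemma I_nonempty: "e \<in> E \<Longrightarrow> I e \<noteq> {}"
  using edge_nonempty[of e] coord_in[of e] by blast

lemma I_less: "e \<in> E \<Longrightarrow> lo M e < hi M e"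
  using I_nonempty by (fastforce simp: edge_interval_def)

lemma I_connected: "connected (I e)"
proof -
  have "is_interval (I e)"
    unfolding is_interval_1
  proof (intro ballI allI impI)
    fix x y z assume *: "x \<in> I e" "z \<in> I e" "x \<le> y \<and> y \<le> z"
    then have "ereal x \<le> ereal y" "ereal y \<le> ereal z" by auto
    then show "y \<in> I e" using * less_le_trans[of "lo M e" "ereal x" "ereal y"] le_less_trans[of "ereal y" "ereal z" "hi M e"]
      by (auto simp: edge_interval_def)
  qed
  then show ?thesis by (simp add: is_interval_connected_1)
qed

lemma em_local_isometry:
  assumes "e \<in> E" "t \<in> I e"
  obtains \<epsilon> where "\<epsilon> > 0" "ball t \<epsilon> \<subseteq> I e"
    "\<And>s u. s \<in> ball t \<epsilon> \<Longrightarrow> u \<in> ball t \<epsilon> \<Longrightarrow> dist\<^sub>\<Gamma> (em e s) (em e u) = \<bar>s - u\<bar>"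
proof -
  obtain \<epsilon> where \<epsilon>: "\<epsilon> > 0" "\<forall>s\<in>I e \<inter> ball t \<epsilon>. \<forall>u\<in>I e \<inter> ball t \<epsilon>. dist\<^sub>\<Gamma> (em e s) (em e u) = \<bar>s - u\<bar>"
    using is_model assms unfolding model_def by meson
  obtain \<delta> where \<delta>: "\<delta> > 0" "ball t \<delta> \<subseteq> I e" using I_open assms(2) by (meson open_contains_ball)
  have "ball t (min \<delta> \<epsilon>) \<subseteq> I e" "ball t (min \<delta> \<epsilon>) \<subseteq> ball t \<epsilon>" using \<delta>(2) by auto
  moreover have "min \<delta> \<epsilon> > 0" using \<epsilon>(1) \<delta>(1) by simp
  ultimately show ?thesis using \<epsilon>(2) by (intro that[of "min \<delta> \<epsilon>"]) blast+
qed

lemma em_continuous: "e \<in> E \<Longrightarrow> continuous_on (I e) (em e)"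
  using homeomorphism_cont1[OF edge_homeo] .

lemma coord_continuous: "e \<in> E \<Longrightarrow> continuous_on e (coord e)"
  using homeomorphism_cont2[OF edge_homeo] .

text \<open>The link between charts and edges. An isometric arc that avoids the vertices stays in
  one component by connectedness; its edge coordinate is a local isometry of the line, hence a shift
  or a reflection followed by a shift.\<close>

lemma isometric_arc_in_edge:
  assumes J: "open J" "connected J" "J \<noteq> {}"
    and V: "\<And>t. t \<in> J \<Longrightarrow> \<rho> t \<notin> V" 
    and iso: "\<And>s t. s \<in> J \<Longrightarrow> t \<in> J \<Longrightarrow> dist\<^sub>\<Gamma> (\<rho> s) (\<rho> t) = \<bar>s - t\<bar>"
  obtains e a s where "e \<in> E" "\<And>t. t \<in> J \<Longrightarrow> a + sgb s * t \<in> I e" "\<And>t. t \<in> J \<Longrightarrow> \<rho> t = em e (a + sgb s * t)"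
proof -
  have inf: "\<rho> t \<notin> inf\<^sub>\<Gamma>" if "t \<in> J" for t using V[OF that] inf_subset_V by auto
  have cont: "continuous_on J \<rho>" using inf iso by (rule isometric_continuous)
  have "\<rho> ` J \<subseteq> - V" "- V \<noteq> {}" using V J(3) by auto
  then obtain e where e: "e \<in> E" "\<rho> ` J \<subseteq> e"
    using exists_component_superset connected_continuous_image[OF cont J(2)] unfolding edges_def by blast
  define \<gamma> where "\<gamma> = coord e \<circ> \<rho>"
  have cont\<gamma>: "continuous_on J \<gamma>" unfolding \<gamma>_def
    using cont coord_continuous[OF e(1)] e(2) by (intro continuous_on_compose) (auto elim: continuous_on_subset)
  have \<gamma>I: "\<gamma> t \<in> I e" "em e (\<gamma> t) = \<rho> t" if "t \<in> J" for t
    using e that by (auto simp: \<gamma>_def intro!: coord_in em_coord)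
  have "\<exists>\<delta>>0. \<forall>u\<in>J \<inter> ball t \<delta>. \<forall>v\<in>J \<inter> ball t \<delta>. \<bar>\<gamma> u - \<gamma> v\<bar> = \<bar>u - v\<bar>" if t: "t \<in> J" for t
  proof -
    obtain \<epsilon> where \<epsilon>: "\<epsilon> > 0" "\<And>s u. s \<in> ball (\<gamma> t) \<epsilon> \<Longrightarrow> u \<in> ball (\<gamma> t) \<epsilon> \<Longrightarrow> dist\<^sub>\<Gamma> (em e s) (em e u) = \<bar>s - u\<bar>"
      using em_local_isometry[OF e(1) \<gamma>I(1)[OF t]] by metis
    obtain \<delta> where \<delta>: "\<delta> > 0" "\<And>u. u \<in> J \<Longrightarrow> dist u t < \<delta> \<Longrightarrow> dist (\<gamma> u) (\<gamma> t) < \<epsilon>"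
      using cont\<gamma> t \<epsilon>(1) unfolding continuous_on_iff by meson
    have "\<bar>\<gamma> u - \<gamma> v\<bar> = \<bar>u - v\<bar>" if "u \<in> J \<inter> ball t \<delta>" "v \<in> J \<inter> ball t \<delta>" for u v
    proof -
      have "\<gamma> u \<in> ball (\<gamma> t) \<epsilon>" "\<gamma> v \<in> ball (\<gamma> t) \<epsilon>" using \<delta>(2)[of u] \<delta>(2)[of v] that by (auto simp: dist_commute)
      then show ?thesis using \<epsilon>(2)[of "\<gamma> u" "\<gamma> v"] that by (auto simp: \<gamma>I(2) iso)
    qed
    then show ?thesis using \<delta>(1) by blast
  qed
  from locally_isometric_affine[OF J this] obtain a s where as: "\<And>t. t \<in> J \<Longrightarrow> \<gamma> t = a + sgb s * t" by blast
  show ?thesis using e(1) \<gamma>I as by (intro that[of e a s]) auto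
qed

definition dirs :: "'a direction set" where
  "dirs = {(e, a, s). e \<in> E \<and> (if s then lo M e \<le> a \<and> a < hi M e else lo M e < a \<and> a \<le> hi M e)}"

text \<open>An edge carries no record of its end vertices. Incidence is expressed by convergence of
  the parametrization, which makes sense at vertices, interior points and points at
  infinity.\<close>

definition dirs_at :: "'a \<Rightarrow> 'a direction set" where
  "dirs_at x = {(e, a, s). (e, a, s) \<in> dirs \<and> filterlim (em e) (nhds x) (dfil a s)}"

definition dir_ev :: "('a \<Rightarrow> bool) \<Rightarrow> 'a direction \<Rightarrow> bool" where
  "dir_ev P d = (case d of (e, a, s) \<Rightarrow> eventually (\<lambda>t. P (em e t)) (dfil a s))"

lemma dirs_edge: "(e, a, s) \<in> dirs \<Longrightarrow> e \<in> E"
  by (auto simp: dirs_def)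

lemma dirs_beyond: "(e, a, s) \<in> dirs \<Longrightarrow> beyond a s (if s then hi M e else lo M e)"
  by (auto simp: dirs_def beyond_def split: if_splits)

lemma dirs_neq_bot: "(e, a, s) \<in> dirs \<Longrightarrow> dfil a s \<noteq> bot"
  using dfil_neq_bot dirs_beyond by blast

lemma dirs_at_dirs: "d \<in> dirs_at x \<Longrightarrow> d \<in> dirs"
  by (auto simp: dirs_at_def)

lemma dirs_ev_I: 
  assumes "(e, a, s) \<in> dirs"
  shows "eventually (\<lambda>t. t \<in> I e) (dfil a s)"
proof -
  note b = dirs_beyond[OF assms]
  have "lo M e \<le> a" "a \<le> hi M e" using assms by (auto simp: dirs_def split: if_splits)
  have "eventually (\<lambda>t. lo M e < ereal t) (dfil a s)"
  proof (cases s)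
    case True
    from eventually_dfil_beyond[OF b] show ?thesis
      by eventually_elim (use True \<open>lo M e \<le> a\<close> in \<open>auto simp: beyond_def\<close>)
  next
    case False
    then show ?thesis using eventually_dfil_greater[OF b] assms by (auto simp: dirs_def)
  qed
  moreover have "eventually (\<lambda>t. ereal t < hi M e) (dfil a s)"
  proof (cases s)
    case False
    from eventually_dfil_beyond[OF b] show ?thesis
      by eventually_elim (use False \<open>a \<le> hi M e\<close> in \<open>auto simp: beyond_def\<close>)
  next
    case True
    then show ?thesis using eventually_dfil_less[OF b] assms by (auto simp: dirs_def)
  qed
  ultimately show ?thesis by eventually_elim (auto simp: edge_interval_def)
qed

lemma dirs_at_unique:
  assumes "d \<in> dirs_at x" "d \<in> dirs_at y"
  shows "x = y"
proof -
  obtain e a s where d: "d = (e, a, s)" by (cases d) auto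
  show ?thesis using assms dirs_neq_bot[of e a s] unfolding d dirs_at_def
    by (auto intro: tendsto_unique)
qed

definition ray :: "'a set \<Rightarrow> ('a \<Rightarrow> complex) \<Rightarrow> nat \<Rightarrow> nat \<Rightarrow> real \<Rightarrow> 'a" where
  "ray U h n k \<tau> = inv_into U h (rcis \<tau> (2 * pi * real k / real n))"

lemma star_chart_D:
  assumes "star_chart \<Gamma> x n r U h"
  shows "open U" "x \<in> U" "U \<subseteq> - inf\<^sub>\<Gamma>" "0 < r" "inj_on h U" "h ` U = star_shaped n r" "h x = 0"
    "\<And>y z. y \<in> U \<Longrightarrow> z \<in> U \<Longrightarrow> dist\<^sub>\<Gamma> y z = star_dist (h y) (h z)"
  using assms by (auto simp: star_chart_def bij_betw_def)

lemma ray_in: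
  assumes C: "star_chart \<Gamma> x n r U h" and "k < n" "0 \<le> \<tau>" "\<tau> < r"
  shows "ray U h n k \<tau> \<in> U" "h (ray U h n k \<tau>) = rcis \<tau> (2 * pi * real k / real n)"
proof -
  have "rcis \<tau> (2 * pi * real k / real n) \<in> h ` U"
    unfolding star_chart_D(6)[OF C] star_shaped_def using assms by blast
  then show "ray U h n k \<tau> \<in> U" "h (ray U h n k \<tau>) = rcis \<tau> (2 * pi * real k / real n)"
    unfolding ray_def by (auto intro: inv_into_into f_inv_into_f)
qed

lemma star_chart_centre_dist:
  assumes C: "star_chart \<Gamma> x n r U h" and "y \<in> U"
  shows "dist\<^sub>\<Gamma> x y = cmod (h y)"
  using star_chart_D[OF C] assms(2) by (simp add: star_dist_def sgn_zero_iff)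

lemma ray_dist:
  assumes C: "star_chart \<Gamma> x n r U h" and "k < n" "0 < \<tau>" "\<tau> < r" "0 < \<tau>'" "\<tau>' < r"
  shows "dist\<^sub>\<Gamma> (ray U h n k \<tau>) (ray U h n k \<tau>') = \<bar>\<tau> - \<tau>'\<bar>"
proof -
  have "rcis \<tau> \<theta> - rcis \<tau>' \<theta> = rcis (\<tau> - \<tau>') \<theta>" for \<theta> by (simp add: rcis_def algebra_simps)
  then show ?thesis using assms ray_in[OF C] star_chart_D(8)[OF C]
    by (simp add: star_dist_def sgn_rcis)
qed

lemma ray_distinct:
  assumes C: "star_chart \<Gamma> x n r U h" and "k < n" "0 < \<tau>" "\<tau> < r" "k' < n" "0 < \<tau>'" "\<tau>' < r"
    and eq: "ray U h n k \<tau> = ray U h n k' \<tau>'"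
  shows "k = k'"
proof -
  have "rcis \<tau> (2 * pi * real k / real n) = rcis \<tau>' (2 * pi * real k' / real n)"
    using ray_in(2)[OF C, of k \<tau>] ray_in(2)[OF C, of k' \<tau>'] eq assms by simp
  then have "cis (2 * pi * real k / real n) = cis (2 * pi * real k' / real n)"
    using sgn_rcis assms by metis
  then show ?thesis
    using inj_onD[OF bij_betw_imp_inj_on[OF Complex.bij_betw_roots_unity[of n]]] assms(2,5) by auto
qed

lemma ray_cover:
  assumes C: "star_chart \<Gamma> x n r U h" and "y \<in> U" "y \<noteq> x"
  obtains k where "k < n" "0 < cmod (h y)" "cmod (h y) < r" "y = ray U h n k (cmod (h y))"
    "h y = rcis (cmod (h y)) (2 * pi * real k / real n)"
proof -
  have "h y \<noteq> 0" using star_chart_D[OF C] assms by (metis inj_onD)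
  moreover have "h y \<in> star_shaped n r" using star_chart_D[OF C] assms by blast
  ultimately obtain k t where k: "k < n" "0 \<le> t" "t < r" "h y = rcis t (2 * pi * real k / real n)"
    unfolding star_shaped_def by blast
  then have t: "cmod (h y) = t" by simp
  have "y = inv_into U h (h y)" using star_chart_D(5)[OF C] assms(2) by simp
  then have "y = ray U h n k t" unfolding ray_def using k(4) by simp
  then show ?thesis using k t \<open>h y \<noteq> 0\<close> by (intro that[of k]) auto
qed

lemma ray_centre_dist:
  assumes C: "star_chart \<Gamma> x n r U h" and "k < n" "0 < \<tau>" "\<tau> < r"
  shows "dist\<^sub>\<Gamma> x (ray U h n k \<tau>) = \<tau>" "cmod (h (ray U h n k \<tau>)) = \<tau>" "ray U h n k \<tau> \<noteq> x"
proof -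
  show "cmod (h (ray U h n k \<tau>)) = \<tau>" using ray_in[OF C] assms by simp
  then show "dist\<^sub>\<Gamma> x (ray U h n k \<tau>) = \<tau>"
    using star_chart_centre_dist[OF C] ray_in[OF C] assms by simp
  show "ray U h n k \<tau> \<noteq> x" using \<open>cmod (h (ray U h n k \<tau>)) = \<tau>\<close> star_chart_D(7)[OF C] assms by auto
qed

lemma star_chart_centre_not_inf: "star_chart \<Gamma> x n r U h \<Longrightarrow> x \<notin> inf\<^sub>\<Gamma>"
  by (auto simp: star_chart_def)

lemma star_chart_small_radius:
  assumes C: "star_chart \<Gamma> x n r U h"
  obtains r' where "0 < r'" "r' \<le> r" "\<And>y. y \<notin> inf\<^sub>\<Gamma> \<Longrightarrow> dist\<^sub>\<Gamma> x y < r' \<Longrightarrow> y \<in> U \<and> (y = x \<or> y \<notin> V)"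
proof -
  have "open (U - (V - {x}))" using star_chart_D(1)[OF C] finite_V by (simp add: open_Diff finite_imp_closed)
  moreover have "x \<in> U - (V - {x})" using star_chart_D(2)[OF C] by auto
  ultimately obtain r1 where "r1 > 0" "\<And>y. y \<notin> inf\<^sub>\<Gamma> \<Longrightarrow> dist\<^sub>\<Gamma> x y < r1 \<Longrightarrow> y \<in> U - (V - {x})"
    using gball_subset star_chart_centre_not_inf[OF C] by blast
  then show ?thesis using star_chart_D(4)[OF C] by (intro that[of "min r r1"]) auto
qed

text \<open>The inverse of a chart of valence 2 is an isometric arc through the centre, so the chart
  is the edge coordinate up to shift and sign. Metric balls are then images of coordinate
  balls.\<close>

lemma chart2_edge:
  assumes e: "e \<in> E" "t \<in> I e" and C: "star_chart \<Gamma> (em e t) 2 r U h"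
  obtains r' s where "r' > 0" "r' \<le> r" "ball t r' \<subseteq> I e"
    "\<And>\<delta>. \<delta> \<le> r' \<Longrightarrow> em e ` ball t \<delta> = {y. y \<notin> inf\<^sub>\<Gamma> \<and> dist\<^sub>\<Gamma> (em e t) y < \<delta>}"
    "\<And>u. u \<in> ball t r' \<Longrightarrow> em e u \<in> U \<and> Re (h (em e u)) = sgb s * (u - t)"
proof -
  define x where "x = em e t"
  note C = C[folded x_def]
  have xV: "x \<notin> V" using em_not_V e by (simp add: x_def)
  obtain r' where r': "0 < r'" "r' \<le> r" "\<And>y. y \<notin> inf\<^sub>\<Gamma> \<Longrightarrow> dist\<^sub>\<Gamma> x y < r' \<Longrightarrow> y \<in> U \<and> (y = x \<or> y \<notin> V)"
    using star_chart_small_radius[OF C] by blast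
  define \<rho> where "\<rho> \<tau> = inv_into U h (complex_of_real \<tau>)" for \<tau>
  have \<rho>: "\<rho> \<tau> \<in> U" "h (\<rho> \<tau>) = of_real \<tau>" if "\<bar>\<tau>\<bar> < r" for \<tau>
    using of_real_star_2(1)[OF that] star_chart_D(6)[OF C] unfolding \<rho>_def
    by (auto intro: inv_into_into f_inv_into_f)
  have \<rho>inf: "\<rho> \<tau> \<notin> inf\<^sub>\<Gamma>" if "\<bar>\<tau>\<bar> < r" for \<tau> using \<rho>(1)[OF that] star_chart_D(3)[OF C] by auto
  have d0: "dist\<^sub>\<Gamma> x (\<rho> \<tau>) = \<bar>\<tau>\<bar>" if "\<bar>\<tau>\<bar> < r" for \<tau>
    using star_chart_centre_dist[OF C \<rho>(1)[OF that]] \<rho>(2)[OF that] by simp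
  have iso: "dist\<^sub>\<Gamma> (\<rho> u) (\<rho> v) = \<bar>u - v\<bar>" if "\<bar>u\<bar> < r" "\<bar>v\<bar> < r" for u v
  proof -
    have "sgn (complex_of_real u) = complex_of_real (sgn u)" "sgn (complex_of_real v) = complex_of_real (sgn v)"
      by (simp_all add: sgn_of_real)
    moreover have "cmod (complex_of_real u - complex_of_real v) = \<bar>u - v\<bar>"
      by (metis norm_of_real of_real_diff)
    ultimately have "star_dist (of_real u) (of_real v) = \<bar>u - v\<bar>"
      unfolding star_dist_def by (auto simp: sgn_if)
    then show ?thesis using star_chart_D(8)[OF C \<rho>(1)[OF that(1)] \<rho>(1)[OF that(2)]] \<rho>(2) that by simp
  qed
  have \<rho>0: "\<rho> 0 = x" 
    using star_chart_D[OF C] unfolding \<rho>_def by (metis inv_into_f_f of_real_0)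
  let ?J = "{-r'<..<r'}"
  have "\<rho> \<tau> \<notin> V" if "\<tau> \<in> ?J" for \<tau>
    using r'(3)[of "\<rho> \<tau>"] d0[of \<tau>] \<rho>inf[of \<tau>] that r'(2) xV by auto
  moreover have "dist\<^sub>\<Gamma> (\<rho> u) (\<rho> v) = \<bar>u - v\<bar>" if "u \<in> ?J" "v \<in> ?J" for u v
    using that r'(2) by (intro iso) auto
  moreover have "open ?J" "connected ?J" "?J \<noteq> {}" using r'(1) by auto
  ultimately obtain e' a s where es: "e' \<in> E" "\<And>\<tau>. \<tau> \<in> ?J \<Longrightarrow> a + sgb s * \<tau> \<in> I e'"
    "\<And>\<tau>. \<tau> \<in> ?J \<Longrightarrow> \<rho> \<tau> = em e' (a + sgb s * \<tau>)"
    using isometric_arc_in_edge[of ?J \<rho>] by metis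
  \<comment> \<open>At \<tau> = 0 the arc passes through the centre, which identifies the edge and
    the shift.\<close>
  have "a \<in> I e'" "em e' a = em e t" using es(2,3)[of 0] \<rho>0 r'(1) by (auto simp: x_def)
  then have ea: "e' = e" "a = t" using em_inj2 es(1) e by metis+
  have sub: "ball t r' \<subseteq> I e"
  proof
    fix u assume "u \<in> ball t r'"
    then show "u \<in> I e" using es(2)[of "sgb s * (u - t)"] by (cases s) (auto simp: ea dist_real_def abs_less_iff)
  qed
  have em\<rho>: "em e u = \<rho> (sgb s * (u - t))" if "u \<in> ball t r'" for u
    using es(3)[of "sgb s * (u - t)"] that by (cases s) (auto simp: ea dist_real_def abs_less_iff)
  have small: "\<bar>sgb s * (u - t)\<bar> < r" "\<bar>sgb s * (u - t)\<bar> = dist t u" if "u \<in> ball t r'" for u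
    using that r'(2) by (auto simp: abs_mult dist_real_def)
  show ?thesis
  proof (rule that[of r' s])
    show "0 < r'" "r' \<le> r" "ball t r' \<subseteq> I e" using r' sub by auto
    show "em e u \<in> U \<and> Re (h (em e u)) = sgb s * (u - t)" if "u \<in> ball t r'" for u
      unfolding em\<rho>[OF that] using \<rho>[OF small(1)[OF that]] by simp
    show "em e ` ball t \<delta> = {y. y \<notin> inf\<^sub>\<Gamma> \<and> dist\<^sub>\<Gamma> (em e t) y < \<delta>}" if \<delta>: "\<delta> \<le> r'" for \<delta>
    proof (intro subset_antisym subsetI)
      fix y assume "y \<in> em e ` ball t \<delta>"
      then obtain u where u: "u \<in> ball t \<delta>" "y = em e u" by auto
      then have ur: "u \<in> ball t r'" using \<delta> by auto
      show "y \<in> {y. y \<notin> inf\<^sub>\<Gamma> \<and> dist\<^sub>\<Gamma> (em e t) y < \<delta>}"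
        unfolding u(2) em\<rho>[OF ur] using d0[OF small(1)[OF ur]] \<rho>inf[OF small(1)[OF ur]] small(2)[OF ur] u(1)
        by (simp add: x_def)
    next
      fix y assume "y \<in> {y. y \<notin> inf\<^sub>\<Gamma> \<and> dist\<^sub>\<Gamma> (em e t) y < \<delta>}"
      then have y: "y \<notin> inf\<^sub>\<Gamma>" "dist\<^sub>\<Gamma> x y < \<delta>" by (auto simp: x_def)
      then have yU: "y \<in> U" using r'(3)[of y] \<delta> by auto
      have hy: "h y \<in> star_shaped 2 r" using star_chart_D(6)[OF C] yU by auto
      define \<tau> where "\<tau> = Re (h y)"
      have h\<tau>: "h y = of_real \<tau>" "\<bar>\<tau>\<bar> < \<delta>" using of_real_star_2(2)[OF hy] star_chart_centre_dist[OF C yU] y by (auto simp: \<tau>_def)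
      have "y = \<rho> \<tau>" using star_chart_D(5)[OF C] yU unfolding \<rho>_def by (metis h\<tau>(1) inv_into_f_f)
      also have "\<dots> = em e (t + sgb s * \<tau>)" using es(3)[of \<tau>] h\<tau>(2) \<delta> by (auto simp: ea abs_less_iff)
      finally show "y \<in> em e ` ball t \<delta>" using h\<tau>(2) by (auto simp: dist_real_def abs_mult)
    qed
  qed
qed

text \<open>The edge homeomorphism yields only relative openness in \<open>e\<close>. Openness in
  the curve comes from the chart of valence 2 that every point off the vertices has.\<close>

lemma em_ball:
  assumes e: "e \<in> E" "t \<in> I e"
  obtains r where "r > 0" "ball t r \<subseteq> I e" "\<And>\<delta>. \<delta> \<le> r \<Longrightarrow> open (em e ` ball t \<delta>)"
    "\<And>s u. s \<in> ball t r \<Longrightarrow> u \<in> ball t r \<Longrightarrow> dist\<^sub>\<Gamma> (em e s) (em e u) = \<bar>s - u\<bar>"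
proof -
  have "has_valence \<Gamma> (em e t) 2" using is_model em_not_V[OF e] unfolding model_def by blast
  then obtain r U h where C: "star_chart \<Gamma> (em e t) 2 r U h"
    using em_not_inf[OF e] by (auto simp: has_valence_def)
  obtain r' s where r': "r' > 0" "r' \<le> r" "ball t r' \<subseteq> I e"
    "\<And>\<delta>. \<delta> \<le> r' \<Longrightarrow> em e ` ball t \<delta> = {y. y \<notin> inf\<^sub>\<Gamma> \<and> dist\<^sub>\<Gamma> (em e t) y < \<delta>}"
    "\<And>u. u \<in> ball t r' \<Longrightarrow> em e u \<in> U \<and> Re (h (em e u)) = sgb s * (u - t)"
    by (rule chart2_edge[OF e C]) (rule that)
  obtain \<epsilon> where \<epsilon>: "\<epsilon> > 0" "ball t \<epsilon> \<subseteq> I e"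
    "\<And>s u. s \<in> ball t \<epsilon> \<Longrightarrow> u \<in> ball t \<epsilon> \<Longrightarrow> dist\<^sub>\<Gamma> (em e s) (em e u) = \<bar>s - u\<bar>"
    by (rule em_local_isometry[OF e]) (rule that)
  have "open (em e ` ball t \<delta>)" if "\<delta> \<le> r'" for \<delta>
    using r'(4)[OF that] open_gball[OF em_not_inf[OF e]] by simp
  moreover have "ball t (min r' \<epsilon>) \<subseteq> ball t r'" "ball t (min r' \<epsilon>) \<subseteq> ball t \<epsilon>" by auto
  ultimately show ?thesis using r'(1,3) \<epsilon>(1,3) by (intro that[of "min r' \<epsilon>"]) (blast | simp)+
qed

text \<open>A direction converging to an interior point eventually runs in an open arc of
  \<open>e\<close> around it. So it is a direction of \<open>e\<close>, and its coordinate tends to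
  \<open>t\<close>.\<close>

lemma dirs_at_I:
  assumes "e \<in> E" "t \<in> I e"
  shows "dirs_at (em e t) = {(e, ereal t, True), (e, ereal t, False)}"
proof (intro subset_antisym subsetI)
  fix d assume "d \<in> {(e, ereal t, True), (e, ereal t, False)}"
  then obtain s where d: "d = (e, ereal t, s)" by auto
  have dd: "d \<in> dirs" using assms by (auto simp: d dirs_def edge_interval_def less_imp_le)
  have "isCont (em e) t" using em_continuous[OF assms(1)] I_open assms(2) by (simp add: continuous_on_eq_continuous_at)
  then have "filterlim (em e) (nhds (em e t)) (nhds t)" by (simp add: isCont_def tendsto_at_iff_tendsto_nhds)
  then have "filterlim (\<lambda>t. em e (id t)) (nhds (em e t)) (dfil (ereal t) s)"
    by (rule filterlim_compose) (rule filterlim_dfil)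
  then show "d \<in> dirs_at (em e t)" using dd by (simp add: dirs_at_def d)
next
  fix d assume d0: "d \<in> dirs_at (em e t)"
  obtain e' a s where d: "d = (e', a, s)" by (cases d) auto
  have dd: "(e', a, s) \<in> dirs" and lim: "filterlim (em e') (nhds (em e t)) (dfil a s)"
    using d0 by (auto simp: d dirs_at_def)
  note b = dirs_beyond[OF dd]
  have e': "e' \<in> E" using dd by (auto simp: dirs_def)
  obtain r where r: "r > 0" "ball t r \<subseteq> I e" "\<And>\<delta>. \<delta> \<le> r \<Longrightarrow> open (em e ` ball t \<delta>)"
    and "\<And>s u. s \<in> ball t r \<Longrightarrow> u \<in> ball t r \<Longrightarrow> dist\<^sub>\<Gamma> (em e s) (em e u) = \<bar>s - u\<bar>"
    by (rule em_ball[OF assms]) (rule that)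
  have ev: "eventually (\<lambda>u. e' = e \<and> u \<in> ball t \<delta>) (dfil a s)" if "0 < \<delta>" "\<delta> \<le> r" for \<delta>
  proof -
    have "eventually (\<lambda>u. em e' u \<in> em e ` ball t \<delta>) (dfil a s)"
      using lim r(3)[OF that(2)] that(1) by (intro topological_tendstoD) auto
    then show ?thesis using dirs_ev_I[OF dd]
    proof eventually_elim
      case (elim u)
      then obtain v where v: "v \<in> ball t \<delta>" "em e' u = em e v" by auto
      then have "v \<in> I e" using r(2) that(2) by auto
      then have "e' = e \<and> u = v" using em_inj2[OF e' elim(2) assms(1), of v] v by blast
      then show ?case using v by simp
    qed
  qed
  have ee: "e' = e"
    using eventually_happens'[OF dirs_neq_bot[OF dd] ev[OF r(1) order_refl]] by auto
  have lt: "(ereal \<longlongrightarrow> ereal t) (dfil a s)"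
  proof -
    have "((\<lambda>u. u) \<longlongrightarrow> t) (dfil a s)"
    proof (rule tendstoI)
      fix \<epsilon> :: real assume "\<epsilon> > 0"
      then have "eventually (\<lambda>u. e' = e \<and> u \<in> ball t (min \<epsilon> r)) (dfil a s)" using r(1) by (intro ev) auto
      then show "eventually (\<lambda>u. dist u t < \<epsilon>) (dfil a s)" by eventually_elim (auto simp: dist_commute)
    qed
    then show ?thesis by (rule tendsto_ereal)
  qed
  have "a = ereal t" using tendsto_unique[OF dirs_neq_bot[OF dd] filterlim_ereal_dfil[OF b] lt] .
  then show "d \<in> {(e, ereal t, True), (e, ereal t, False)}" using ee d by auto
qed

section \<open>Directions at a point\<close>

lemma dirs_at_ev: "d \<in> dirs_at x \<Longrightarrow> eventually P (nhds x) \<Longrightarrow> dir_ev P d"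
  by (auto simp: dirs_at_def dir_ev_def filterlim_iff)

lemma dirs_ev_neq:
  assumes d: "(e, a, s) \<in> dirs"
  shows "eventually (\<lambda>t. em e t \<noteq> x) (dfil a s)"
proof (cases "\<exists>t0\<in>I e. x = em e t0")
  case True
  then obtain t0 where t0: "t0 \<in> I e" "x = em e t0" by auto
  from eventually_dfil_neq[OF dirs_beyond[OF d], of t0] dirs_ev_I[OF d] show ?thesis
    by eventually_elim (use t0 em_inj[OF dirs_edge[OF d]] in auto)
next
  case False
  from dirs_ev_I[OF d] show ?thesis by eventually_elim (use False in auto)
qed

text \<open>If the directions in \<open>A\<close> already fill a neighbourhood of \<open>x\<close>,
  a further direction at \<open>x\<close> would eventually have to run inside their tails, but its
  own tail can be separated from these.\<close>

lemma dirs_at_eqI: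
  assumes "finite A" "A \<subseteq> dirs_at x"
    and nb: "\<And>Q. Q x \<Longrightarrow> (\<And>d. d \<in> A \<Longrightarrow> dir_ev Q d) \<Longrightarrow> eventually Q (nhds x)"
  shows "dirs_at x = A"
proof (intro subset_antisym subsetI)
  fix d assume dx: "d \<in> dirs_at x"
  obtain e a s where d: "d = (e, a, s)" by (cases d) auto
  have dd: "(e, a, s) \<in> dirs" using dirs_at_dirs[OF dx] d by simp
  show "d \<in> A"
  proof (rule ccontr)
    assume "d \<notin> A"
    have "\<exists>S. eventually (\<lambda>t. t \<in> S) (dfil (fst (snd d')) (snd (snd d'))) \<and> eventually (\<lambda>t. t \<notin> S) (dfil a s)"
      if "d' \<in> A" and fd: "fst d' = e" for d'
    proof -
      obtain a' s' where d': "d' = (e, a', s')" using fd by (metis prod.collapse)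
      have "(e, a', s') \<in> dirs" using dirs_at_dirs[of d' x] assms(2) \<open>d' \<in> A\<close> d' by auto
      moreover have "(a', s') \<noteq> (a, s)" using \<open>d \<notin> A\<close> \<open>d' \<in> A\<close> d d' by metis
      ultimately show ?thesis using dfil_separated[OF dirs_beyond dirs_beyond[OF dd]] by (simp add: d')
    qed
    then obtain S where S: "\<And>d'. d' \<in> A \<Longrightarrow> fst d' = e \<Longrightarrow> 
       eventually (\<lambda>t. t \<in> S d') (dfil (fst (snd d')) (snd (snd d'))) \<and> eventually (\<lambda>t. t \<notin> S d') (dfil a s)"
      by metis
    \<comment> \<open>On the edge of the foreign direction \<open>d\<close>, the set
      \<open>Q\<close> keeps only \<open>x\<close> and points in the sets \<open>S\<close>, which
      the tail of \<open>d\<close> avoids; other edges are unrestricted.\<close>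
    define Q where "Q y \<longleftrightarrow> y = x \<or> (\<forall>t\<in>I e. y = em e t \<longrightarrow> (\<exists>d'\<in>A. fst d' = e \<and> t \<in> S d'))" for y
    have "dir_ev Q d'" if d'A: "d' \<in> A" for d'
    proof -
      obtain e' a' s' where d': "d' = (e', a', s')" by (cases d') auto
      have dd': "(e', a', s') \<in> dirs" using dirs_at_dirs[of d' x] assms(2) d'A d' by auto
      have "eventually (\<lambda>t. Q (em e' t)) (dfil a' s')"
      proof (cases "e' = e")
        case True
        have "eventually (\<lambda>t. t \<in> S d') (dfil a' s')" using S[OF d'A] True by (simp add: d')
        then show ?thesis using dirs_ev_I[OF dd']
          by eventually_elim (use True em_inj[OF dirs_edge[OF dd']] d'A d' in \<open>auto simp: Q_def\<close>)
      next
        case False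
        from dirs_ev_I[OF dd'] show ?thesis
          by eventually_elim (use False em_inj2[OF dirs_edge[OF dd'] _ dirs_edge[OF dd]] in \<open>auto simp: Q_def\<close>)
      qed
      then show ?thesis by (simp add: dir_ev_def d')
    qed
    then have "eventually Q (nhds x)" by (intro nb) (auto simp: Q_def)
    from dirs_at_ev[OF dx this] have "eventually (\<lambda>t. Q (em e t)) (dfil a s)" by (simp add: d dir_ev_def)
    moreover have "eventually (\<lambda>t. \<forall>d'\<in>{d'\<in>A. fst d' = e}. t \<notin> S d') (dfil a s)"
      using assms(1) S by (intro eventually_ball_finite) auto
    ultimately have "eventually (\<lambda>t. False) (dfil a s)"
      using dirs_ev_I[OF dd] dirs_ev_neq[OF dd, of x] by eventually_elim (auto simp: Q_def)
    then show False using dirs_neq_bot[OF dd] by (simp add: trivial_limit_def)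
  qed
qed (use assms in auto)

text \<open>Each ray of the chart is an isometric arc, hence a piece of an edge, and its starting
  coordinate gives a direction. Rays are disjoint and fill the chart, so branches correspond to
  directions, and neighbourhoods of \<open>x\<close> can be tested along them.\<close>

lemma star_chart_dirs:
  assumes C: "star_chart \<Gamma> x n r U h"
  obtains r0 de da ds where "0 < r0" "r0 \<le> r"
    "bij_betw (\<lambda>k. (de k, ereal (da k), ds k)) {..<n} (dirs_at x)"
    "\<And>k \<tau>. k < n \<Longrightarrow> 0 < \<tau> \<Longrightarrow> \<tau> < r0 \<Longrightarrow> 
        da k + sgb (ds k) * \<tau> \<in> I (de k) \<and> ray U h n k \<tau> = em (de k) (da k + sgb (ds k) * \<tau>)"
    "\<And>Q. Q x \<Longrightarrow> (\<And>d. d \<in> dirs_at x \<Longrightarrow> dir_ev Q d) \<Longrightarrow> eventually Q (nhds x)"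
proof -
  have xinf: "x \<notin> inf\<^sub>\<Gamma>" by (rule star_chart_centre_not_inf[OF C])
  obtain r0 where r0: "0 < r0" "r0 \<le> r" "\<And>y. y \<notin> inf\<^sub>\<Gamma> \<Longrightarrow> dist\<^sub>\<Gamma> x y < r0 \<Longrightarrow> y \<in> U \<and> (y = x \<or> y \<notin> V)"
    by (rule star_chart_small_radius[OF C]) (rule that)
  have "\<exists>p. fst p \<in> E \<and> (\<forall>\<tau>. 0 < \<tau> \<and> \<tau> < r0 \<longrightarrow> fst (snd p) + sgb (snd (snd p)) * \<tau> \<in> I (fst p) \<and> 
     ray U h n k \<tau> = em (fst p) (fst (snd p) + sgb (snd (snd p)) * \<tau>))" if k: "k < n" for k
  proof -
    let ?J = "{0<..<r0}"
    have inU: "ray U h n k \<tau> \<in> U" if "\<tau> \<in> ?J" for \<tau> using ray_in[OF C k] that r0(2) by auto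
    have "ray U h n k \<tau> \<notin> V" if "\<tau> \<in> ?J" for \<tau>
      using r0(3)[of "ray U h n k \<tau>"] inU[OF that] star_chart_D(3)[OF C] ray_centre_dist[OF C k, of \<tau>] that r0(2) by auto
    moreover have "dist\<^sub>\<Gamma> (ray U h n k u) (ray U h n k v) = \<bar>u - v\<bar>" if "u \<in> ?J" "v \<in> ?J" for u v
      using ray_dist[OF C k, of u v] that r0(2) by auto
    moreover have "open ?J" "connected ?J" "?J \<noteq> {}" using r0(1) by auto
    ultimately obtain e' a s where es: "e' \<in> E" "\<And>\<tau>. \<tau> \<in> ?J \<Longrightarrow> a + sgb s * \<tau> \<in> I e'"
      "\<And>\<tau>. \<tau> \<in> ?J \<Longrightarrow> ray U h n k \<tau> = em e' (a + sgb s * \<tau>)"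
      using isometric_arc_in_edge[of ?J "ray U h n k"] by metis
    then show ?thesis by (intro exI[of _ "(e', a, s)"]) auto
  qed
  then obtain p where p: "\<And>k. k < n \<Longrightarrow> fst (p k) \<in> E \<and> (\<forall>\<tau>. 0 < \<tau> \<and> \<tau> < r0 \<longrightarrow> fst (snd (p k)) + sgb (snd (snd (p k))) * \<tau> \<in> I (fst (p k)) \<and> 
     ray U h n k \<tau> = em (fst (p k)) (fst (snd (p k)) + sgb (snd (snd (p k))) * \<tau>))" by metis
  define de where "de k = fst (p k)" for k
  define da where "da k = fst (snd (p k))" for k
  define ds where "ds k = snd (snd (p k))" for k
  define dr where "dr k = (de k, ereal (da k), ds k)" for k
  have de: "de k \<in> E" if "k < n" for k using p[OF that] by (simp add: de_def)
  have ry: "da k + sgb (ds k) * \<tau> \<in> I (de k)" "ray U h n k \<tau> = em (de k) (da k + sgb (ds k) * \<tau>)"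
    if "k < n" "0 < \<tau>" "\<tau> < r0" for k \<tau> using p[OF that(1)] that(2,3) by (auto simp: de_def da_def ds_def)
  \<comment> \<open>The coordinate \<open>da k\<close> is the limit of coordinates in the open
    interval. It may be an end of the interval, but only the end that the direction leaves.\<close>
  have dr_dirs: "dr k \<in> dirs" if k: "k < n" for k
  proof -
    have mid: "lo M (de k) < ereal (da k + sgb (ds k) * \<tau>)" "ereal (da k + sgb (ds k) * \<tau>) < hi M (de k)"
      if "0 < \<tau>" "\<tau> < r0" for \<tau> using ry(1)[OF k that] by (auto simp: edge_interval_def)
    show ?thesis
    proof (cases "ds k")
      case True
      have "lo M (de k) \<le> ereal (da k)"
      proof (rule ccontr)
        assume "\<not> ?thesis"
        then have "ereal (da k) < min (lo M (de k)) (ereal (da k + r0))" using r0(1) by auto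
        then obtain c where c: "ereal (da k) < ereal c" "ereal c < min (lo M (de k)) (ereal (da k + r0))"
          using ereal_dense2 by blast
        then show False using mid(1)[of "c - da k"] True by auto
      qed
      moreover have "ereal (da k) < hi M (de k)"
      proof -
        have "ereal (da k) < ereal (da k + r0 / 2)" using r0 by simp
        also have "\<dots> < hi M (de k)" using mid(2)[of "r0/2"] True r0 by simp
        finally show ?thesis .
      qed
      ultimately show ?thesis using de[OF k] True by (simp add: dirs_def dr_def)
    next
      case False
      have "ereal (da k) \<le> hi M (de k)"
      proof (rule ccontr)
        assume "\<not> ?thesis"
        then have "max (hi M (de k)) (ereal (da k - r0)) < ereal (da k)" using r0(1) by auto
        then obtain c where c: "ereal c < ereal (da k)" "max (hi M (de k)) (ereal (da k - r0)) < ereal c"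
          using ereal_dense2 by blast
        then show False using mid(2)[of "da k - c"] False by auto
      qed
      moreover have "lo M (de k) < ereal (da k)"
      proof -
        have "lo M (de k) < ereal (da k - r0 / 2)" using mid(1)[of "r0/2"] False r0 by simp
        also have "\<dots> < ereal (da k)" using r0 by simp
        finally show ?thesis .
      qed
      ultimately show ?thesis using de[OF k] False by (simp add: dirs_def dr_def)
    qed
  qed
  have lim: "filterlim (em (de k)) (nhds x) (dfil (ereal (da k)) (ds k))" if k: "k < n" for k
  proof (rule topological_tendstoI)
    fix W assume "open W" "x \<in> W"
    then obtain \<delta> where \<delta>: "\<delta> > 0" "\<And>y. y \<notin> inf\<^sub>\<Gamma> \<Longrightarrow> dist\<^sub>\<Gamma> x y < \<delta> \<Longrightarrow> y \<in> W"
      using gball_subset xinf by blast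
    show "eventually (\<lambda>t. em (de k) t \<in> W) (dfil (ereal (da k)) (ds k))"
      unfolding eventually_dfil_real
    proof (intro exI[of _ "min r0 \<delta>"] conjI allI impI)
      fix \<tau> assume "0 < \<tau> \<and> \<tau> < min r0 \<delta>"
      then have \<tau>: "0 < \<tau>" "\<tau> < r0" "\<tau> < \<delta>" by auto
      then have "ray U h n k \<tau> \<in> U" "dist\<^sub>\<Gamma> x (ray U h n k \<tau>) = \<tau>"
        using ray_in[OF C k, of \<tau>] ray_centre_dist[OF C k, of \<tau>] r0(2) by auto
      then have "ray U h n k \<tau> \<in> W" using \<delta>(2)[of "ray U h n k \<tau>"] \<tau>(3) star_chart_D(3)[OF C] by auto
      then show "em (de k) (da k + sgb (ds k) * \<tau>) \<in> W" using ry(2)[OF k \<tau>(1,2)] by simp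
    qed (use r0 \<delta> in auto)
  qed
  have dr_at: "dr ` {..<n} \<subseteq> dirs_at x" using dr_dirs lim by (auto simp: dirs_at_def dr_def)
  have inj: "inj_on dr {..<n}"
  proof (rule inj_onI)
    fix k k' assume k: "k \<in> {..<n}" "k' \<in> {..<n}" "dr k = dr k'"
    then have "ray U h n k (r0/2) = ray U h n k' (r0/2)" using ry(2)[of k "r0/2"] ry(2)[of k' "r0/2"] r0(1)
      by (auto simp: dr_def)
    then show "k = k'" using ray_distinct[OF C, of k "r0/2" k' "r0/2"] k r0 by auto
  qed
  have nb: "eventually Q (nhds x)" if Qx: "Q x" and Qd: "\<And>d. d \<in> dr ` {..<n} \<Longrightarrow> dir_ev Q d" for Q
  proof -
    have "\<exists>\<delta>>0. \<forall>\<tau>. 0 < \<tau> \<and> \<tau> < \<delta> \<longrightarrow> Q (em (de k) (da k + sgb (ds k) * \<tau>))" if "k < n" for k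
      using Qd[of "dr k"] that by (auto simp: dir_ev_def dr_def eventually_dfil_real)
    then obtain \<delta> where \<delta>: "\<And>k. k < n \<Longrightarrow> \<delta> k > 0" 
      "\<And>k \<tau>. k < n \<Longrightarrow> 0 < \<tau> \<Longrightarrow> \<tau> < \<delta> k \<Longrightarrow> Q (em (de k) (da k + sgb (ds k) * \<tau>))" by metis
    define m where "m = Min (insert r0 (\<delta> ` {..<n}))"
    have m: "m > 0" "m \<le> r0" "\<And>k. k < n \<Longrightarrow> m \<le> \<delta> k" using r0(1) \<delta>(1) by (auto simp: m_def)
    have "Q y" if y: "y \<notin> inf\<^sub>\<Gamma> \<and> dist\<^sub>\<Gamma> x y < m" for y
    proof (cases "y = x")
      case False
      have yU: "y \<in> U" using r0(3)[of y] y m(2) by auto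
      obtain k where k: "k < n" "0 < cmod (h y)" "cmod (h y) < r" "y = ray U h n k (cmod (h y))"
        "h y = rcis (cmod (h y)) (2 * pi * real k / real n)"
        by (rule ray_cover[OF C yU False]) (rule that)
      have "cmod (h y) < m" using star_chart_centre_dist[OF C yU] y by simp
      then have "Q (em (de k) (da k + sgb (ds k) * cmod (h y)))" "ray U h n k (cmod (h y)) = em (de k) (da k + sgb (ds k) * cmod (h y))"
        using \<delta>(2)[OF k(1,2)] ry(2)[OF k(1,2)] m(2) m(3)[OF k(1)] by auto
      then show ?thesis using k(4) by simp
    qed (use Qx in simp)
    moreover have "eventually (\<lambda>y. y \<in> {y. y \<notin> inf\<^sub>\<Gamma> \<and> dist\<^sub>\<Gamma> x y < m}) (nhds x)"
      using open_gball[OF xinf] m(1) xinf by (intro eventually_nhds_in_open) auto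
    ultimately show ?thesis by (auto elim: eventually_mono)
  qed
  have D: "dirs_at x = dr ` {..<n}" by (rule dirs_at_eqI[OF _ dr_at nb]) auto
  show ?thesis
  proof (rule that[of r0 de da ds])
    show "bij_betw (\<lambda>k. (de k, ereal (da k), ds k)) {..<n} (dirs_at x)"
      using inj D by (simp add: bij_betw_def dr_def[abs_def])
    show "eventually Q (nhds x)" if "Q x" "\<And>d. d \<in> dirs_at x \<Longrightarrow> dir_ev Q d" for Q
      using nb that D by blast
  qed (use r0 ry in auto)
qed

text \<open>The analogue at infinity: beyond the last vertex in the chart, the end is an isometric
  arc on a single edge, and it provides the only direction.\<close>

lemma inf_chart_dirs:
  assumes C: "inf_chart \<Gamma> x U h"
  obtains g R e s \<alpha> where "R \<ge> 0" "homeomorphism U {0<..} h g"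
    "dirs_at x = {(e, if s then - \<infinity> else \<infinity>, s)}"
    "\<And>\<tau>. \<tau> > R \<Longrightarrow> \<alpha> - sgb s * \<tau> \<in> I e \<and> g (ereal \<tau>) = em e (\<alpha> - sgb s * \<tau>)"
    "\<And>Q. Q x \<Longrightarrow> (\<And>d. d \<in> dirs_at x \<Longrightarrow> dir_ev Q d) \<Longrightarrow> eventually Q (nhds x)"
proof -
  obtain g where U: "open U" "U \<inter> inf\<^sub>\<Gamma> = {x}" "homeomorphism U {0<..} h g" "h x = \<infinity>"
    and dist: "\<And>y z. y \<in> U - {x} \<Longrightarrow> z \<in> U - {x} \<Longrightarrow> dist\<^sub>\<Gamma> y z = \<bar>real_of_ereal (h y) - real_of_ereal (h z)\<bar>"
    using C by (auto simp: inf_chart_def)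
  have xU: "x \<in> U" using U(2) by auto
  have gh: "g (h y) = y" if "y \<in> U" for y using homeomorphism_apply1[OF U(3) that] .
  have hg: "h (g u) = u" "g u \<in> U" if "u > 0" for u 
    using homeomorphism_apply2[OF U(3)] homeomorphism_image2[OF U(3)] that by auto
  have hfin: "h y < \<infinity>" if "y \<in> U" "y \<noteq> x" for y
    using gh[OF that(1)] gh[OF xU] U(4) that(2) by (metis ereal_infty_less(1))
  have hpos: "h y > 0" if "y \<in> U" for y using homeomorphism_image1[OF U(3)] that by blast
  \<comment> \<open>From \<open>R\<close> on, the end contains no vertex other than
    \<open>x\<close>.\<close>
  define R where "R = Max (insert 0 ((\<lambda>y. real_of_ereal (h y)) ` (V \<inter> U)))"
  have R0: "R \<ge> 0" using finite_V by (auto simp: R_def)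
  have RV: "y \<notin> V" if "y \<in> U" "y \<noteq> x" "h y > ereal R" for y
  proof
    assume "y \<in> V"
    then have "real_of_ereal (h y) \<le> R" using finite_V that unfolding R_def by (intro Max_ge) auto
    then show False using that hfin[of y] hpos[of y] by (cases "h y") auto
  qed
  define \<rho> where "\<rho> \<tau> = g (ereal \<tau>)" for \<tau>
  let ?J = "{R<..}"
  have \<rho>: "\<rho> \<tau> \<in> U" "h (\<rho> \<tau>) = ereal \<tau>" "\<rho> \<tau> \<noteq> x" if "\<tau> \<in> ?J" for \<tau>
    using hg[of "ereal \<tau>"] that R0 U(4) by (auto simp: \<rho>_def)
  have "\<rho> \<tau> \<notin> V" if "\<tau> \<in> ?J" for \<tau>
    using RV[OF \<rho>(1,3)[OF that]] \<rho>(2)[OF that] that by auto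
  moreover have "dist\<^sub>\<Gamma> (\<rho> u) (\<rho> v) = \<bar>u - v\<bar>" if "u \<in> ?J" "v \<in> ?J" for u v
    using dist[of "\<rho> u" "\<rho> v"] \<rho>[OF that(1)] \<rho>[OF that(2)] by auto
  moreover have "open ?J" "connected ?J" "?J \<noteq> {}" by auto
  ultimately obtain e \<alpha> s' where es: "e \<in> E" "\<And>\<tau>. \<tau> \<in> ?J \<Longrightarrow> \<alpha> + sgb s' * \<tau> \<in> I e"
    "\<And>\<tau>. \<tau> \<in> ?J \<Longrightarrow> \<rho> \<tau> = em e (\<alpha> + sgb s' * \<tau>)"
    using isometric_arc_in_edge[of ?J \<rho>] by metis
  \<comment> \<open>A direction leaves its target, whereas \<tau> increases towards
    \<open>x\<close>; hence the opposite orientation.\<close>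
  define s where "s = (\<not> s')"
  have ss: "sgb s' = - sgb s" by (auto simp: s_def sgb_def)
  let ?a = "if s then - \<infinity> else \<infinity> :: ereal"
  have ry: "\<alpha> - sgb s * \<tau> \<in> I e" "g (ereal \<tau>) = em e (\<alpha> - sgb s * \<tau>)" if "\<tau> > R" for \<tau>
    using es(2,3)[of \<tau>] that by (auto simp: ss \<rho>_def)
  have dd: "(e, ?a, s) \<in> dirs"
  proof (cases s)
    case True
    have "lo M e = - \<infinity>"
    proof (rule ccontr)
      assume "lo M e \<noteq> - \<infinity>"
      moreover have "lo M e < \<infinity>" using I_less[OF es(1)] by auto
      ultimately obtain l where l: "lo M e = ereal l" by (cases "lo M e") auto
      define \<tau> where "\<tau> = max (R + 1) (\<alpha> - l)"
      have "\<alpha> - \<tau> \<in> I e" using ry(1)[of \<tau>] True by (simp add: \<tau>_def)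
      then show False using l by (auto simp: edge_interval_def \<tau>_def)
    qed
    then show ?thesis using True es(1) I_less[OF es(1)] by (auto simp: dirs_def)
  next
    case False
    have "hi M e = \<infinity>"
    proof (rule ccontr)
      assume "hi M e \<noteq> \<infinity>"
      moreover have "hi M e > - \<infinity>" using I_less[OF es(1)] by auto
      ultimately obtain l where l: "hi M e = ereal l" by (cases "hi M e") auto
      define \<tau> where "\<tau> = max (R + 1) (l - \<alpha>)"
      have "\<alpha> + \<tau> \<in> I e" using ry(1)[of \<tau>] False by (simp add: \<tau>_def)
      then show False using l by (auto simp: edge_interval_def \<tau>_def)
    qed
    then show ?thesis using False es(1) I_less[OF es(1)] by (auto simp: dirs_def)
  qed
  have lim: "filterlim (em e) (nhds x) (dfil ?a s)"
  proof (rule topological_tendstoI)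
    fix W assume W: "open W" "x \<in> W"
    have cont: "continuous_on {0<..} g" using homeomorphism_cont2[OF U(3)] .
    have "g \<infinity> = x" using gh[OF xU] U(4) by simp
    then obtain A where A: "open A" "\<infinity> \<in> A" "\<And>y. y > 0 \<Longrightarrow> y \<in> A \<Longrightarrow> g y \<in> W"
      using cont[unfolded continuous_on_topological, rule_format, of \<infinity> W] W by auto
    obtain R' where R': "{ereal R'<..} \<subseteq> A" using open_PInfty[OF A(1,2)] by auto
    show "eventually (\<lambda>t. em e t \<in> W) (dfil ?a s)"
      unfolding eventually_dfil_inf[where \<alpha>=\<alpha>]
    proof (intro exI[of _ "max R R'"] allI impI)
      fix \<tau> assume \<tau>: "\<tau> > max R R'"
      then have "ereal \<tau> \<in> {ereal R'<..}" "ereal \<tau> > 0" using R0 by auto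
      then have "g (ereal \<tau>) \<in> W" using A(3)[of "ereal \<tau>"] R' by blast
      then show "em e (\<alpha> - sgb s * \<tau>) \<in> W" using ry(2)[of \<tau>] \<tau> by simp
    qed
  qed
  have nb: "eventually Q (nhds x)" if Qx: "Q x" and Qd: "\<And>d. d \<in> {(e, ?a, s)} \<Longrightarrow> dir_ev Q d" for Q
  proof -
    obtain R' where R': "\<And>\<tau>. \<tau> > R' \<Longrightarrow> Q (em e (\<alpha> - sgb s * \<tau>))"
      using Qd[of "(e, ?a, s)"] unfolding dir_ev_def by (auto simp only: prod.case eventually_dfil_inf[where \<alpha>=\<alpha>] singletonI)
    let ?W = "U \<inter> h -` {ereal (max R R')<..}"
    have "open ?W" using homeomorphism_cont1[OF U(3)] U(1) unfolding continuous_on_open_vimage[OF U(1)]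
      by (metis Int_commute open_greaterThan)
    moreover have "x \<in> ?W" using xU U(4) by (simp add: max_def)
    ultimately have "eventually (\<lambda>y. y \<in> ?W) (nhds x)" by (rule eventually_nhds_in_open)
    then show ?thesis
    proof eventually_elim
      case (elim y)
      show ?case
      proof (cases "y = x")
        case False
        then obtain \<tau> where \<tau>: "h y = ereal \<tau>" "\<tau> > R" "\<tau> > R'" 
          using elim hfin[of y] hpos[of y] by (cases "h y") auto
        then have "y = em e (\<alpha> - sgb s * \<tau>)" using gh[of y] ry(2)[of \<tau>] elim by simp
        then show ?thesis using R'[OF \<tau>(3)] by simp
      qed (use Qx in simp)
    qed
  qed
  have D: "dirs_at x = {(e, ?a, s)}" by (rule dirs_at_eqI[OF _ _ nb]) (use dd lim in \<open>auto simp: dirs_at_def\<close>)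
  show ?thesis
  proof (rule that[of R g e s \<alpha>])
    show "eventually Q (nhds x)" if "Q x" "\<And>d. d \<in> dirs_at x \<Longrightarrow> dir_ev Q d" for Q
      using nb that D by blast
  qed (use R0 U(3) D ry in auto)
qed

lemma star_chart_exists: "x \<notin> inf\<^sub>\<Gamma> \<Longrightarrow> \<exists>n r U h. star_chart \<Gamma> x n r U h"
  using curve by (auto simp: tropical_curve_def)

lemma inf_chart_exists: "x \<in> inf\<^sub>\<Gamma> \<Longrightarrow> \<exists>U h. inf_chart \<Gamma> x U h"
  using curve by (auto simp: tropical_curve_def)

text \<open>Reduces every local statement on the curve to one-sided statements on the line; after
  this, charts are rarely seen.\<close>

lemma eventually_nhdsI:
  assumes "Q x" "\<And>d. d \<in> dirs_at x \<Longrightarrow> dir_ev Q d"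
  shows "eventually Q (nhds x)"
proof (cases "x \<in> inf\<^sub>\<Gamma>")
  case True
  then obtain U h where C: "inf_chart \<Gamma> x U h" using inf_chart_exists by blast
  show ?thesis
  proof (rule inf_chart_dirs[OF C])
    assume nb: "\<And>Q. Q x \<Longrightarrow> (\<And>d. d \<in> dirs_at x \<Longrightarrow> dir_ev Q d) \<Longrightarrow> eventually Q (nhds x)"
    show ?thesis by (rule nb[OF assms])
  qed
next
  case False
  then obtain n r U h where C: "star_chart \<Gamma> x n r U h" using star_chart_exists by blast
  show ?thesis
  proof (rule star_chart_dirs[OF C])
    assume nb: "\<And>Q. Q x \<Longrightarrow> (\<And>d. d \<in> dirs_at x \<Longrightarrow> dir_ev Q d) \<Longrightarrow> eventually Q (nhds x)"
    show ?thesis by (rule nb[OF assms])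
  qed
qed

lemma finite_dirs_at: "finite (dirs_at x)"
proof (cases "x \<in> inf\<^sub>\<Gamma>")
  case True
  then obtain U h where C: "inf_chart \<Gamma> x U h" using inf_chart_exists by blast
  show ?thesis
  proof (rule inf_chart_dirs[OF C])
    fix e s assume "dirs_at x = {(e, if s then - \<infinity> else \<infinity>, s)}"
    then show ?thesis by simp
  qed
next
  case False
  then obtain n r U h where C: "star_chart \<Gamma> x n r U h" using star_chart_exists by blast
  show ?thesis
  proof (rule star_chart_dirs[OF C])
    fix de da ds assume "bij_betw (\<lambda>k. (de k, ereal (da k), ds k)) {..<n} (dirs_at x)"
    then show ?thesis using bij_betw_finite by blast
  qed
qed

lemma dirs_at_inf: 
  assumes "x \<in> inf\<^sub>\<Gamma>"
  obtains e a s where "dirs_at x = {(e, a, s)}"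
proof -
  obtain U h where C: "inf_chart \<Gamma> x U h" using inf_chart_exists assms by blast
  show ?thesis
  proof (rule inf_chart_dirs[OF C])
    fix e s assume "dirs_at x = {(e, if s then - \<infinity> else \<infinity>, s)}"
    then show ?thesis by (rule that)
  qed
qed

text \<open>Compactness enters only through this principle.\<close>

lemma compact_principle:
  assumes "\<And>x::'a. eventually (P x) (nhds x)"
  shows "\<exists>X. finite X \<and> (\<forall>y. \<exists>x\<in>X. P x y)"
proof -
  have "\<exists>S. open S \<and> x \<in> S \<and> (\<forall>y\<in>S. P x y)" for x using assms[of x] by (auto simp: eventually_nhds)
  then obtain S where S: "\<And>x. open (S x)" "\<And>x. x \<in> S x" "\<And>x y. y \<in> S x \<Longrightarrow> P x y" by metis
  have "UNIV \<subseteq> (\<Union>x\<in>UNIV. S x)" using S(2) by auto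
  then obtain X where X: "X \<subseteq> UNIV" "finite X" "UNIV \<subseteq> (\<Union>x\<in>X. S x)"
    using compactE_image[OF compact_UNIV, of UNIV S] S(1) by metis
  show ?thesis
  proof (intro exI[of _ X] conjI X(2) allI)
    fix y :: 'a
    have "y \<in> (\<Union>x\<in>X. S x)" using X(3) by auto
    then show "\<exists>x\<in>X. P x y" using S(3) by blast
  qed
qed

text \<open>Near a point only the edges of its finitely many directions occur, so finitely many such
  neighbourhoods account for all edges.\<close>

lemma finite_edges: "finite E"
proof -
  define P where "P x y \<longleftrightarrow> y = x \<or> (\<exists>d\<in>dirs_at x. y \<in> fst d)" for x y
  have "eventually (P x) (nhds x)" for x
  proof (rule eventually_nhdsI)
    fix d assume dx: "d \<in> dirs_at x"
    obtain e a s where d: "d = (e, a, s)" by (cases d) auto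
    have dd: "(e, a, s) \<in> dirs" using dx dirs_at_dirs d by simp
    have "eventually (\<lambda>t. P x (em e t)) (dfil a s)"
      using dirs_ev_I[OF dd]
    proof eventually_elim
      case (elim t)
      then show ?case unfolding P_def using dx d em_in[OF dirs_edge[OF dd]] by (intro disjI2 bexI[of _ d]) auto
    qed
    then show "dir_ev (P x) d" by (simp add: d dir_ev_def)
  qed (simp add: P_def)
  then have "\<exists>X. finite X \<and> (\<forall>y. \<exists>x\<in>X. P x y)" by (rule compact_principle)
  then obtain X where X: "finite X" "\<And>y. \<exists>x\<in>X. P x y" by blast
  have sub: "E \<subseteq> (\<Union>x\<in>X. fst ` dirs_at x \<union> {e\<in>E. x \<in> e})"
  proof
    fix e assume e: "e \<in> E"
    then obtain y where y: "y \<in> e" using edge_nonempty by blast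
    obtain x where x: "x \<in> X" "P x y" using X(2) by blast
    have "e \<in> fst ` dirs_at x \<or> x \<in> e"
    proof (cases "y = x")
      case False
      then obtain d where d: "d \<in> dirs_at x" "y \<in> fst d" using x(2) by (auto simp: P_def)
      then have "fst d \<in> E" using dirs_at_dirs[OF d(1)] dirs_edge by (cases d) auto
      then have "fst d = e" using edge_disjoint[OF _ e d(2) y] by simp
      then show ?thesis using d(1) by blast
    qed (use y in simp)
    then show "e \<in> (\<Union>x\<in>X. fst ` dirs_at x \<union> {e\<in>E. x \<in> e})" using x(1) e by blast
  qed
  have "finite {e\<in>E. x \<in> e}" for x
  proof (cases "\<exists>e\<in>E. x \<in> e")
    case True
    then obtain e0 where e0: "e0 \<in> E" "x \<in> e0" by blast
    have "{e\<in>E. x \<in> e} \<subseteq> {e0}"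
    proof
      fix e assume "e \<in> {e\<in>E. x \<in> e}"
      then have "e = e0" by (intro edge_disjoint[OF _ e0(1) _ e0(2)]) simp_all
      then show "e \<in> {e0}" by simp
    qed
    then show ?thesis by (rule finite_subset) simp
  next
    case False
    then have "{e\<in>E. x \<in> e} = {}" by auto
    then show ?thesis by (metis finite.emptyI)
  qed
  then have "finite (\<Union>x\<in>X. fst ` dirs_at x \<union> {e\<in>E. x \<in> e})"
    using X(1) finite_dirs_at by blast
  with sub show ?thesis by (rule finite_subset)
qed

text \<open>By compactness, every end of an edge has a limit: otherwise each point has a
  neighbourhood that the direction eventually leaves, and finitely many of these cover the
  curve.\<close>

lemma dirs_converge:
  assumes d: "d \<in> dirs"
  shows "\<exists>x. d \<in> dirs_at x"
proof (rule ccontr)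
  assume no: "\<not> ?thesis"
  obtain e a s where ds: "d = (e, a, s)" by (cases d) auto
  note dd = d[unfolded ds]
  have "\<exists>P. eventually P (nhds x) \<and> eventually (\<lambda>t. \<not> P (em e t)) (dfil a s)" for x
  proof (rule ccontr)
    assume *: "\<not> (\<exists>P. eventually P (nhds x) \<and> eventually (\<lambda>t. \<not> P (em e t)) (dfil a s))"
    have "\<exists>S. eventually (\<lambda>t. t \<in> S) (dfil (fst (snd d')) (snd (snd d'))) \<and> eventually (\<lambda>t. t \<notin> S) (dfil a s)"
      if "d' \<in> dirs_at x" and fd: "fst d' = e" for d'
    proof -
      obtain a' s' where d': "d' = (e, a', s')" using fd by (metis prod.collapse)
      have "(e, a', s') \<in> dirs" using dirs_at_dirs[of d' x] \<open>d' \<in> dirs_at x\<close> d' by auto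
      moreover have "(a', s') \<noteq> (a, s)" using no \<open>d' \<in> dirs_at x\<close> ds d' by metis
      ultimately show ?thesis using dfil_separated[OF dirs_beyond dirs_beyond[OF dd]] by (simp add: d')
    qed
    then obtain S where S: "\<And>d'. d' \<in> dirs_at x \<Longrightarrow> fst d' = e \<Longrightarrow> 
       eventually (\<lambda>t. t \<in> S d') (dfil (fst (snd d')) (snd (snd d'))) \<and> eventually (\<lambda>t. t \<notin> S d') (dfil a s)"
      by metis
    \<comment> \<open>A neighbourhood of \<open>x\<close> made of tails of the directions at
      \<open>x\<close>, each chosen disjoint from a tail of \<open>d\<close>.\<close>
    define P where "P y \<longleftrightarrow> y = x \<or> (\<exists>d'\<in>dirs_at x. \<exists>t\<in>I (fst d'). y = em (fst d') t \<and> (fst d' = e \<longrightarrow> t \<in> S d'))" for y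
    have "eventually P (nhds x)"
    proof (rule eventually_nhdsI)
      fix d' assume d'x: "d' \<in> dirs_at x"
      obtain e' a' s' where d': "d' = (e', a', s')" by (cases d') auto
      have dd': "(e', a', s') \<in> dirs" using dirs_at_dirs[OF d'x] d' by simp
      have "eventually (\<lambda>t. e' = e \<longrightarrow> t \<in> S d') (dfil a' s')" 
        using S[OF d'x] by (cases "e' = e") (auto simp: d')
      then have "eventually (\<lambda>t. P (em e' t)) (dfil a' s')" using dirs_ev_I[OF dd']
      proof eventually_elim
        case (elim t)
        then show ?case unfolding P_def using d'x d' by (intro disjI2 bexI[of _ d'] bexI[of _ t]) auto
      qed
      then show "dir_ev P d'" by (simp add: dir_ev_def d')
    qed (simp add: P_def)
    moreover have "eventually (\<lambda>t. \<forall>d'\<in>{d'\<in>dirs_at x. fst d' = e}. t \<notin> S d') (dfil a s)"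
      using finite_dirs_at S by (intro eventually_ball_finite) auto
    then have "eventually (\<lambda>t. \<not> P (em e t)) (dfil a s)"
      using dirs_ev_I[OF dd] dirs_ev_neq[OF dd, of x]
    proof eventually_elim
      case (elim t)
      have "False" if "d' \<in> dirs_at x" "u \<in> I (fst d')" "em e t = em (fst d') u" "fst d' = e \<longrightarrow> u \<in> S d'" for d' u
      proof -
        have "fst d' \<in> E" using that(1) dirs_at_dirs dirs_edge by (metis prod.collapse)
        then have "fst d' = e" "u = t" using em_inj2[OF dirs_edge[OF dd] elim(2)] that(2,3) by auto
        then show False using that elim(1) by auto
      qed
      then show ?case using elim(3) unfolding P_def by blast
    qed
    ultimately show False using * by blast
  qed
  then obtain P where P: "\<And>x. eventually (P x) (nhds x)" "\<And>x. eventually (\<lambda>t. \<not> P x (em e t)) (dfil a s)" by metis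
  have "\<exists>X. finite X \<and> (\<forall>y. \<exists>x\<in>X. P x y)" by (rule compact_principle) (rule P(1))
  then obtain X where X: "finite X" "\<And>y. \<exists>x\<in>X. P x y" by blast
  have "eventually (\<lambda>t. \<forall>x\<in>X. \<not> P x (em e t)) (dfil a s)" using X(1) P(2) by (intro eventually_ball_finite) auto
  then have "eventually (\<lambda>t. False) (dfil a s)" by eventually_elim (use X(2) in blast)
  then show False using dirs_neq_bot[OF dd] by (simp add: trivial_limit_def)
qed

definition target :: "'a direction \<Rightarrow> 'a" where
  "target d = (THE x. d \<in> dirs_at x)"

lemma dirs_at_target: "d \<in> dirs \<Longrightarrow> d \<in> dirs_at (target d)"
  unfolding target_def using dirs_converge dirs_at_unique by (metis (mono_tags, lifting) the_equality)

lemma target_eq: "d \<in> dirs_at x \<Longrightarrow> target d = x"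
  using dirs_at_target dirs_at_dirs dirs_at_unique by blast

lemma dirs_at_iff: "d \<in> dirs_at x \<longleftrightarrow> d \<in> dirs \<and> target d = x"
  using dirs_at_target target_eq dirs_at_dirs by blast

definition ends :: "'a direction set" where
  "ends = (\<lambda>e. (e, lo M e, True)) ` E \<union> (\<lambda>e. (e, hi M e, False)) ` E"

lemma ends_dirs: "ends \<subseteq> dirs"
  using I_less by (auto simp: ends_def dirs_def)

lemma dirs_cases:
  assumes "(e, a, s) \<in> dirs"
  obtains "(e, a, s) \<in> ends" | t where "a = ereal t" "t \<in> I e"
proof -
  note b = dirs_beyond[OF assms]
  show ?thesis
  proof (cases "lo M e < a \<and> a < hi M e")
    case True
    then obtain t where "a = ereal t" by (cases a) auto
    then show ?thesis using True by (intro that(2)[of t]) (auto simp: edge_interval_def)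
  next
    case False
    then show ?thesis using assms by (intro that(1)) (auto simp: dirs_def ends_def split: if_splits)
  qed
qed

lemma target_I: "e \<in> E \<Longrightarrow> t \<in> I e \<Longrightarrow> target (e, ereal t, s) = em e t"
  by (rule target_eq) (cases s; simp add: dirs_at_I)

text \<open>A limit off the vertices would be interior to an edge, and the only directions there
  start at an interior coordinate.\<close>

lemma ends_target: "d \<in> ends \<Longrightarrow> target d \<in> V"
proof (rule ccontr)
  assume d: "d \<in> ends" "target d \<notin> V"
  then obtain e where e: "e \<in> E" "target d \<in> e" using edge_exists by blast
  define t where "t = coord e (target d)"
  have t: "t \<in> I e" "target d = em e t" using e coord_in by (auto simp: t_def)
  have "d \<in> dirs_at (em e t)" using d ends_dirs dirs_at_target t by (metis subsetD)
  then have "d = (e, ereal t, True) \<or> d = (e, ereal t, False)" using dirs_at_I[OF e(1) t(1)] by auto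
  then show False using d(1) t(1) by (auto simp: ends_def edge_interval_def)
qed

lemma dirs_at_V:
  assumes "v \<in> V"
  shows "dirs_at v = {d\<in>ends. target d = v}"
proof (intro subset_antisym subsetI)
  fix d assume d: "d \<in> dirs_at v"
  obtain e a s where ds: "d = (e, a, s)" by (cases d) auto
  have "(e, a, s) \<in> dirs" using d ds dirs_at_dirs by blast
  then show "d \<in> {d\<in>ends. target d = v}"
  proof (cases rule: dirs_cases)
    case 1 then show ?thesis using d ds target_eq by auto
  next
    case (2 t)
    then have "target d = em e t" using target_I ds \<open>(e, a, s) \<in> dirs\<close> dirs_edge by blast
    then have "v = em e t" "e \<in> E" using target_eq[OF d] \<open>(e, a, s) \<in> dirs\<close> dirs_edge by auto
    then show ?thesis using assms em_not_V 2 by blast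
  qed
qed (use ends_dirs dirs_at_target in auto)

end

section \<open>Piecewise linear functions\<close>

lemma tendsto_ereal_add_const:
  assumes "(f \<longlongrightarrow> l) F"
  shows "((\<lambda>x. ereal c + f x) \<longlongrightarrow> ereal c + l) F"
proof (cases "l = - \<infinity>")
  case True
  have "((\<lambda>x. - f x) \<longlongrightarrow> - l) F" using assms by (rule tendsto_uminus_ereal)
  then have "((\<lambda>x. ereal (- c) + - f x) \<longlongrightarrow> ereal (- c) + - l) F"
    using True by (intro tendsto_add_ereal_nonneg tendsto_const) auto
  then have "((\<lambda>x. - (ereal (- c) + - f x)) \<longlongrightarrow> - (ereal (- c) + - l)) F" by (rule tendsto_uminus_ereal)
  moreover have "- (ereal (- c) + - y) = ereal c + y" for y by (cases y) auto
  ultimately show ?thesis by simp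
next
  case False
  then show ?thesis using assms by (intro tendsto_add_ereal_nonneg tendsto_const) auto
qed

lemma star_dist_of_real: "star_dist (complex_of_real u) (complex_of_real v) = \<bar>u - v\<bar>"
proof -
  have "sgn (complex_of_real u) = complex_of_real (sgn u)" "sgn (complex_of_real v) = complex_of_real (sgn v)"
    by (simp_all add: sgn_of_real)
  moreover have "cmod (complex_of_real u - complex_of_real v) = \<bar>u - v\<bar>"
    by (metis norm_of_real of_real_diff)
  ultimately show ?thesis unfolding star_dist_def by (auto simp: sgn_if)
qed

context curve_model
begin

text \<open>\<open>m\<close> is the slope of \<open>k\<close> in the direction \<open>d\<close>, counted as outgoing.\<close>

definition slp :: "('a \<Rightarrow> real) \<Rightarrow> 'a direction \<Rightarrow> int \<Rightarrow> bool" where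
  "slp k d m = (case d of (e, a, s) \<Rightarrow> \<exists>c. eventually (\<lambda>t. k (em e t) = c + sgb s * of_int m * t) (dfil a s))"

definition dlim :: "('a \<Rightarrow> real) \<Rightarrow> 'a direction \<Rightarrow> bool" where
  "dlim k d = (case d of (e, a, s) \<Rightarrow> ((\<lambda>t. k (em e t)) \<longlongrightarrow> k (target d)) (dfil a s))"

text \<open>The values at the points at infinity are irrelevant: rational functions, which may be infinite
  there, are replaced by their real values elsewhere.\<close>

definition PL :: "('a \<Rightarrow> real) \<Rightarrow> bool" where
  "PL k \<longleftrightarrow> (\<forall>d\<in>dirs. (\<exists>m. slp k d m) \<and> (target d \<notin> inf\<^sub>\<Gamma> \<longrightarrow> dlim k d))"

definition sl :: "('a \<Rightarrow> real) \<Rightarrow> 'a direction \<Rightarrow> int" where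
  "sl k d = (THE m. slp k d m)"

definition dv :: "('a \<Rightarrow> real) \<Rightarrow> 'a \<Rightarrow> int" where
  "dv k x = (\<Sum>d\<in>dirs_at x. sl k d)"

lemma slp_unique:
  assumes "d \<in> dirs" "slp k d m" "slp k d m'"
  shows "m = m'"
proof -
  obtain e a s where d: "d = (e, a, s)" by (cases d) auto
  obtain c c' where "eventually (\<lambda>t. k (em e t) = c + sgb s * of_int m * t) (dfil a s)"
    "eventually (\<lambda>t. k (em e t) = c' + sgb s * of_int m' * t) (dfil a s)"
    using assms by (auto simp: slp_def d)
  then have "eventually (\<lambda>t. c + sgb s * of_int m * t = c' + sgb s * of_int m' * t) (dfil a s)"
    by eventually_elim simp
  then show ?thesis using inj_dir[OF dirs_beyond] assms(1) d by blast
qed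

lemma sl_eq: "d \<in> dirs \<Longrightarrow> slp k d m \<Longrightarrow> sl k d = m"
  unfolding sl_def by (rule the_equality) (auto intro: slp_unique)

lemma PL_slp: "PL k \<Longrightarrow> d \<in> dirs \<Longrightarrow> slp k d (sl k d)"
  using sl_eq unfolding PL_def by metis

lemma PL_dlim: "PL k \<Longrightarrow> d \<in> dirs \<Longrightarrow> target d \<notin> inf\<^sub>\<Gamma> \<Longrightarrow> dlim k d"
  unfolding PL_def by blast

lemma slp_add:
  assumes "slp k d m" "slp k' d m'"
  shows "slp (\<lambda>x. k x + k' x) d (m + m')"
proof -
  obtain e a s where d: "d = (e, a, s)" by (cases d) auto
  obtain c c' where "eventually (\<lambda>t. k (em e t) = c + sgb s * of_int m * t) (dfil a s)"
    "eventually (\<lambda>t. k' (em e t) = c' + sgb s * of_int m' * t) (dfil a s)"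
    using assms by (auto simp: slp_def d)
  then have "eventually (\<lambda>t. k (em e t) + k' (em e t) = (c + c') + sgb s * of_int (m + m') * t) (dfil a s)"
    by eventually_elim (simp add: algebra_simps)
  then show ?thesis by (auto simp: slp_def d)
qed

lemma slp_scale:
  assumes "slp k d m"
  shows "slp (\<lambda>x. of_int n * k x) d (n * m)"
proof -
  obtain e a s where d: "d = (e, a, s)" by (cases d) auto
  obtain c where "eventually (\<lambda>t. k (em e t) = c + sgb s * of_int m * t) (dfil a s)"
    using assms by (auto simp: slp_def d)
  then have "eventually (\<lambda>t. of_int n * k (em e t) = (of_int n * c) + sgb s * of_int (n * m) * t) (dfil a s)"
    by eventually_elim (simp add: algebra_simps)
  then show ?thesis by (auto simp: slp_def d)
qed

lemma slp_diff: "slp k d m \<Longrightarrow> slp k' d m' \<Longrightarrow> slp (\<lambda>x. k x - k' x) d (m - m')"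
  using slp_add[of k d m "\<lambda>x. of_int (- 1) * k' x" "- 1 * m'"] slp_scale[of k' d m' "-1"] by simp

lemma dlim_diff: "dlim k d \<Longrightarrow> dlim k' d \<Longrightarrow> dlim (\<lambda>x. k x - k' x) d"
  by (cases d) (auto simp: dlim_def intro: tendsto_diff)

lemma dlim_max: "dlim k d \<Longrightarrow> dlim (\<lambda>x. max (k x) c) d"
  by (cases d) (auto simp: dlim_def intro: tendsto_max)

lemma PL_diff: "PL k \<Longrightarrow> PL k' \<Longrightarrow> PL (\<lambda>x. k x - k' x)"
  unfolding PL_def using slp_diff dlim_diff by blast

lemma sl_diff: "PL k \<Longrightarrow> PL k' \<Longrightarrow> d \<in> dirs \<Longrightarrow> sl (\<lambda>x. k x - k' x) d = sl k d - sl k' d"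
  by (intro sl_eq slp_diff PL_slp)

lemma dv_diff: "PL k \<Longrightarrow> PL k' \<Longrightarrow> dv (\<lambda>x. k x - k' x) x = dv k x - dv k' x"
  unfolding dv_def sum_subtractf[symmetric] by (intro sum.cong refl sl_diff) (auto dest: dirs_at_dirs)

text \<open>At a finite point the star chart exhibits all directions, with real starting
  coordinates; infinite ones occur only at points at infinity.\<close>

lemma dirs_real:
  assumes "(e, a, s) \<in> dirs" "target (e, a, s) \<notin> inf\<^sub>\<Gamma>"
  obtains \<alpha> where "a = ereal \<alpha>"
proof -
  obtain n r U h where C: "star_chart \<Gamma> (target (e, a, s)) n r U h" using star_chart_exists assms(2) by blast
  show ?thesis
  proof (rule star_chart_dirs[OF C])
    fix de da ds assume "bij_betw (\<lambda>k. (de k, ereal (da k), ds k)) {..<n} (dirs_at (target (e, a, s)))"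
    then have "dirs_at (target (e, a, s)) = (\<lambda>k. (de k, ereal (da k), ds k)) ` {..<n}" by (auto simp: bij_betw_def)
    then have "(e, a, s) \<in> (\<lambda>k. (de k, ereal (da k), ds k)) ` {..<n}" using dirs_at_target[OF assms(1)] by simp
    then show ?thesis using that by auto
  qed
qed

text \<open>Slope and continuity together become one formula in the distance \<tau> from the target,
  the shape in which \<open>has_ord\<close> describes a branch.\<close>

lemma slp_dlim_real:
  assumes d: "(e, ereal \<alpha>, s) \<in> dirs"
  shows "slp k (e, ereal \<alpha>, s) m \<and> dlim k (e, ereal \<alpha>, s) \<longleftrightarrow>
    (\<exists>\<delta>>0. \<forall>\<tau>. 0 < \<tau> \<and> \<tau> < \<delta> \<longrightarrow> k (em e (\<alpha> + sgb s * \<tau>)) = k (target (e, ereal \<alpha>, s)) + of_int m * \<tau>)"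
    (is "?L = ?R")
proof
  assume ?L
  then obtain c where c: "eventually (\<lambda>t. k (em e t) = c + sgb s * of_int m * t) (dfil (ereal \<alpha>) s)"
    by (auto simp: slp_def)
  have "((\<lambda>t. k (em e t)) \<longlongrightarrow> k (target (e, ereal \<alpha>, s))) (dfil (ereal \<alpha>) s)" using \<open>?L\<close> by (simp add: dlim_def)
  then have l1: "((\<lambda>t. c + sgb s * of_int m * t) \<longlongrightarrow> k (target (e, ereal \<alpha>, s))) (dfil (ereal \<alpha>) s)"
    by (rule Lim_transform_eventually) (use c in simp)
  have "((\<lambda>t. t) \<longlongrightarrow> \<alpha>) (dfil (ereal \<alpha>) s)" using filterlim_dfil by (simp add: id_def)
  then have "((\<lambda>t. c + sgb s * of_int m * t) \<longlongrightarrow> c + sgb s * of_int m * \<alpha>) (dfil (ereal \<alpha>) s)"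
    by (intro tendsto_intros)
  then have eq: "k (target (e, ereal \<alpha>, s)) = c + sgb s * of_int m * \<alpha>"
    using tendsto_unique[OF dirs_neq_bot[OF d] l1] by blast
  have "c + sgb s * of_int m * (\<alpha> + sgb s * \<tau>) = c + sgb s * of_int m * \<alpha> + of_int m * \<tau>" for \<tau>
    by (simp add: algebra_simps)
  then show ?R using c unfolding eventually_dfil_real eq by (simp only:)
next
  assume ?R
  then obtain \<delta> where \<delta>: "\<delta> > 0" "\<And>\<tau>. 0 < \<tau> \<and> \<tau> < \<delta> \<Longrightarrow> k (em e (\<alpha> + sgb s * \<tau>)) = k (target (e, ereal \<alpha>, s)) + of_int m * \<tau>"
    by blast
  let ?c = "k (target (e, ereal \<alpha>, s)) - sgb s * of_int m * \<alpha>"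
  have c: "eventually (\<lambda>t. k (em e t) = ?c + sgb s * of_int m * t) (dfil (ereal \<alpha>) s)"
    unfolding eventually_dfil_real using \<delta> by (intro exI[of _ \<delta>]) (auto simp: algebra_simps)
  have "((\<lambda>t. t) \<longlongrightarrow> \<alpha>) (dfil (ereal \<alpha>) s)" using filterlim_dfil by (simp add: id_def)
  then have "((\<lambda>t. ?c + sgb s * of_int m * t) \<longlongrightarrow> ?c + sgb s * of_int m * \<alpha>) (dfil (ereal \<alpha>) s)"
    by (intro tendsto_intros)
  then have "((\<lambda>t. k (em e t)) \<longlongrightarrow> ?c + sgb s * of_int m * \<alpha>) (dfil (ereal \<alpha>) s)"
    by (rule Lim_transform_eventually) (use c in eventually_elim, simp)
  then show ?L using c by (auto simp: slp_def dlim_def)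
qed

section \<open>Rational functions as real piecewise linear functions\<close>

abbreviation fin_off_inf :: "('a \<Rightarrow> ereal) \<Rightarrow> bool" where
  "fin_off_inf f \<equiv> (\<forall>x. x \<notin> inf\<^sub>\<Gamma> \<longrightarrow> \<bar>f x\<bar> \<noteq> \<infinity>)"

definition rl :: "('a \<Rightarrow> ereal) \<Rightarrow> 'a \<Rightarrow> real" where
  "rl f = (\<lambda>x. real_of_ereal (f x))"

lemma ereal_rl: "fin_off_inf f \<Longrightarrow> x \<notin> inf\<^sub>\<Gamma> \<Longrightarrow> f x = ereal (rl f x)"
  by (auto simp: rl_def ereal_real)

text \<open>\<open>has_ord\<close> asks for the slope formula on an entire chart, whereas slopes
  along directions are germs. Charts must therefore be shrunk.\<close>

lemma star_chart_restrict:
  assumes C: "star_chart \<Gamma> x n r U h" and r': "0 < r'" "r' \<le> r"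
  shows "star_chart \<Gamma> x n r' {y\<in>U. dist\<^sub>\<Gamma> x y < r'} h"
proof -
  have xinf: "x \<notin> inf\<^sub>\<Gamma>" by (rule star_chart_centre_not_inf[OF C])
  let ?U = "{y\<in>U. dist\<^sub>\<Gamma> x y < r'}"
  have "?U = U \<inter> {y. y \<notin> inf\<^sub>\<Gamma> \<and> dist\<^sub>\<Gamma> x y < r'}" using star_chart_D(3)[OF C] by auto
  then have "open ?U" using star_chart_D(1)[OF C] open_gball[OF xinf] by (simp add: open_Int)
  moreover have "bij_betw h ?U (star_shaped n r')"
    unfolding bij_betw_def
  proof
    show "inj_on h ?U" using star_chart_D(5)[OF C] by (auto simp: inj_on_def)
    show "h ` ?U = star_shaped n r'"
    proof (intro subset_antisym subsetI)
      fix z assume "z \<in> h ` ?U"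
      then obtain y where y: "y \<in> U" "dist\<^sub>\<Gamma> x y < r'" "z = h y" by auto
      show "z \<in> star_shaped n r'"
      proof (cases "y = x")
        case True then show ?thesis using star_chart_D(7)[OF C] y by (simp add: star_shaped_def)
      next
        case False
        obtain k where "k < n" "h y = rcis (cmod (h y)) (2 * pi * real k / real n)"
          by (rule ray_cover[OF C y(1) False]) (rule that)
        moreover have "cmod (h y) < r'" using y star_chart_centre_dist[OF C] by simp
        ultimately show ?thesis unfolding star_shaped_def y(3) using norm_ge_zero by blast
      qed
    next
      fix z assume "z \<in> star_shaped n r'"
      then consider "z = 0" | k t where "k < n" "0 \<le> t" "t < r'" "z = rcis t (2 * pi * real k / real n)"
        unfolding star_shaped_def by blast
      then show "z \<in> h ` ?U"
      proof cases
        case 1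
        have "dist\<^sub>\<Gamma> x x = 0" using xinf by simp
        then show ?thesis using star_chart_D(2,7)[OF C] r' 1 by (intro image_eqI[of _ _ x]) auto
      next
        case (2 k t)
        have "ray U h n k t \<in> U" "h (ray U h n k t) = z" using ray_in[OF C 2(1,2)] 2 r' by auto
        moreover have "dist\<^sub>\<Gamma> x (ray U h n k t) < r'"
          using star_chart_centre_dist[OF C] calculation 2 by simp
        ultimately show ?thesis by (intro image_eqI[of _ _ "ray U h n k t"]) auto
      qed
    qed
  qed
  moreover have "x \<in> ?U" using star_chart_D(2)[OF C] r' xinf by simp
  ultimately show ?thesis using star_chart_D[OF C] r' by (auto simp: star_chart_def)
qed

text \<open>Shrinking at infinity means cutting off an initial piece of the end and shifting the
  coordinate so that it starts at 0 again.\<close>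

lemma inf_chart_shift:
  assumes C: "inf_chart \<Gamma> x U h" and R: "R \<ge> (0::real)"
  shows "inf_chart \<Gamma> x {y\<in>U. h y > ereal R} (\<lambda>y. ereal (- R) + h y)"
proof -
  obtain g where U: "open U" "U \<inter> inf\<^sub>\<Gamma> = {x}" "homeomorphism U {0<..} h g" "h x = \<infinity>"
    and dist: "\<And>y z. y \<in> U - {x} \<Longrightarrow> z \<in> U - {x} \<Longrightarrow> dist\<^sub>\<Gamma> y z = \<bar>real_of_ereal (h y) - real_of_ereal (h z)\<bar>"
    using C by (auto simp: inf_chart_def)
  let ?U = "{y\<in>U. h y > ereal R}"
  have xU: "x \<in> U" using U(2) by auto
  have "?U = U \<inter> h -` {ereal R<..}" by auto
  moreover have "open (U \<inter> h -` {ereal R<..})" 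
    using homeomorphism_cont1[OF U(3)] unfolding continuous_on_open_vimage[OF U(1)]
    by (metis Int_commute open_greaterThan)
  ultimately have op: "open ?U" by simp
  have g: "g u \<in> U" "h (g u) = u" if "u > 0" for u 
    using homeomorphism_apply2[OF U(3)] homeomorphism_image2[OF U(3)] that by auto
  have gh: "g (h y) = y" if "y \<in> U" for y using homeomorphism_apply1[OF U(3) that] .
  have hfin: "h y \<noteq> \<infinity>" if "y \<in> U" "y \<noteq> x" for y using gh[OF that(1)] gh[OF xU] U(4) that(2) by metis
  have add: "ereal R + (ereal (- R) + v) = v" "ereal (- R) + (ereal R + v) = v" for v by (cases v; simp)+
  have pos: "ereal (- R) + v > 0" if "v > ereal R" for v using that by (cases v) auto
  have posR: "ereal R + v > ereal R" "ereal R + v > 0" if "v > 0" for v using that R by (cases v; simp)+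
  have cR: "continuous_on T (\<lambda>u. ereal c + u)" for T c
    unfolding continuous_on_def using tendsto_ereal_add_const[OF tendsto_ident_at] by blast
  have hom: "homeomorphism ?U {0<..} (\<lambda>y. ereal (- R) + h y) (\<lambda>u. g (ereal R + u))"
  proof (rule homeomorphismI)
    have "continuous_on ?U h" using homeomorphism_cont1[OF U(3)] by (rule continuous_on_subset) auto
    then show "continuous_on ?U (\<lambda>y. ereal (- R) + h y)"
      by (rule continuous_on_compose2[OF cR[of UNIV]]) auto
    show "continuous_on {0<..} (\<lambda>u. g (ereal R + u))"
      by (rule continuous_on_compose2[OF homeomorphism_cont2[OF U(3)] cR]) (use posR in auto)
    show "(\<lambda>y. ereal (- R) + h y) ` ?U \<subseteq> {0<..}" using pos by auto
    show "(\<lambda>u. g (ereal R + u)) ` {0<..} \<subseteq> ?U" using posR g by auto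
    show "g (ereal R + (ereal (- R) + h y)) = y" if "y \<in> ?U" for y using that gh add by simp
    show "ereal (- R) + h (g (ereal R + u)) = u" if "u \<in> {0<..}" for u using that g(2) posR add by simp
  qed
  have U': "?U \<inter> inf\<^sub>\<Gamma> = {x}" using U(2,4) xU by auto
  have d': "dist\<^sub>\<Gamma> y z = \<bar>real_of_ereal (ereal (- R) + h y) - real_of_ereal (ereal (- R) + h z)\<bar>" 
    if y: "y \<in> ?U - {x}" and z: "z \<in> ?U - {x}" for y z
  proof -
    obtain u v where "h y = ereal u" "h z = ereal v"
      using hfin[of y] hfin[of z] y z by (cases "h y"; cases "h z") auto
    then show ?thesis using dist[of y z] y z by simp
  qed
  have hx: "ereal (- R) + h x = \<infinity>" using U(4) by simp
  show ?thesis unfolding inf_chart_def using op U' hom hx d' by blast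
qed

text \<open>The bijection between branches and directions turns the sum over a chart into a sum over
  \<open>dirs_at x\<close>, which does not depend on the chart. At infinity the coordinate decreases
  along the outgoing direction, which accounts for the sign in \<open>has_ord\<close>.\<close>

lemma has_ord_slp:
  assumes fin: "fin_off_inf f" and ord: "has_ord \<Gamma> f x m"
  shows "\<exists>sp. (\<forall>d\<in>dirs_at x. slp (rl f) d (sp d) \<and> (x \<notin> inf\<^sub>\<Gamma> \<longrightarrow> dlim (rl f) d)) \<and> m = (\<Sum>d\<in>dirs_at x. sp d)"
proof (cases "x \<in> inf\<^sub>\<Gamma>")
  case True
  then obtain U h c where C: "inf_chart \<Gamma> x U h" and f: "\<And>y. y \<in> U - {x} \<Longrightarrow> f y = ereal (c + of_int (- m) * real_of_ereal (h y))"
    using ord by (auto simp: has_ord_def)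
  show ?thesis
  proof (rule inf_chart_dirs[OF C])
    fix g R e s \<alpha>
    assume R: "R \<ge> (0::real)" and hom: "homeomorphism U {0<..} h g"
      and D: "dirs_at x = {(e, if s then - \<infinity> else \<infinity>, s)}"
      and ry: "\<And>\<tau>. \<tau> > R \<Longrightarrow> \<alpha> - sgb s * \<tau> \<in> I e \<and> g (ereal \<tau>) = em e (\<alpha> - sgb s * \<tau>)"
    have hx: "h x = \<infinity>" using C by (simp add: inf_chart_def)
    have *: "rl f (em e (\<alpha> - sgb s * \<tau>)) = c - of_int m * \<tau>" if "\<tau> > R" for \<tau>
    proof -
      have g: "g (ereal \<tau>) \<in> U" "h (g (ereal \<tau>)) = ereal \<tau>"
        using homeomorphism_apply2[OF hom] homeomorphism_image2[OF hom] that R by auto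
      then have "g (ereal \<tau>) \<noteq> x" using hx by auto
      then have "f (g (ereal \<tau>)) = ereal (c - of_int m * \<tau>)" using f[of "g (ereal \<tau>)"] g by simp
      then show ?thesis using ry[OF that] by (simp add: rl_def)
    qed
    have "eventually (\<lambda>t. rl f (em e t) = (c - of_int m * sgb s * \<alpha>) + sgb s * of_int m * t) (dfil (if s then - \<infinity> else \<infinity>) s)"
      unfolding eventually_dfil_inf[where \<alpha>=\<alpha>] using * by (intro exI[of _ R]) (auto simp: algebra_simps)
    then have "slp (rl f) (e, if s then - \<infinity> else \<infinity>, s) m" by (auto simp: slp_def)
    then show ?thesis using True D by (intro exI[of _ "\<lambda>_. m"]) auto
  qed
next
  case False
  then obtain n r U h and s :: "nat \<Rightarrow> int" where C: "star_chart \<Gamma> x n r U h"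
    and f: "\<And>i y. i < n \<Longrightarrow> y \<in> U \<Longrightarrow> h y = rcis (cmod (h y)) (2 * pi * real i / real n) \<Longrightarrow>
                f y = f x + ereal (of_int (s i) * cmod (h y))" and m: "m = (\<Sum>i<n. s i)"
    using ord unfolding has_ord_def by auto
  show ?thesis
  proof (rule star_chart_dirs[OF C])
    fix r0 de da ds
    assume r0: "0 < r0" "r0 \<le> r" and bij: "bij_betw (\<lambda>k. (de k, ereal (da k), ds k)) {..<n} (dirs_at x)"
      and ry: "\<And>k \<tau>. k < n \<Longrightarrow> 0 < \<tau> \<Longrightarrow> \<tau> < r0 \<Longrightarrow> 
        da k + sgb (ds k) * \<tau> \<in> I (de k) \<and> ray U h n k \<tau> = em (de k) (da k + sgb (ds k) * \<tau>)"
    define dr where "dr = (\<lambda>k. (de k, ereal (da k), ds k))"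
    note bij = bij[folded dr_def]
    have *: "slp (rl f) (dr k) (s k) \<and> dlim (rl f) (dr k)" if k: "k < n" for k
    proof -
      have dk: "dr k \<in> dirs_at x" using bij k by (auto simp: bij_betw_def)
      have "rl f (em (de k) (da k + sgb (ds k) * \<tau>)) = rl f (target (dr k)) + of_int (s k) * \<tau>" if \<tau>: "0 < \<tau>" "\<tau> < r0" for \<tau>
      proof -
        have r: "ray U h n k \<tau> \<in> U" "h (ray U h n k \<tau>) = rcis \<tau> (2 * pi * real k / real n)" "cmod (h (ray U h n k \<tau>)) = \<tau>"
          using ray_in[OF C k, of \<tau>] ray_centre_dist[OF C k, of \<tau>] \<tau> r0 by auto
        have "f (ray U h n k \<tau>) = f x + ereal (of_int (s k) * \<tau>)" using f[OF k r(1)] r by simp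
        then have "f (ray U h n k \<tau>) = ereal (rl f x + of_int (s k) * \<tau>)" using ereal_rl[OF fin False] by simp
        then show ?thesis using ry[OF k \<tau>] target_eq[OF dk] by (simp add: rl_def)
      qed
      then show ?thesis using slp_dlim_real[of "de k" "da k" "ds k" "rl f" "s k"] dirs_at_dirs[OF dk] r0(1)
        unfolding dr_def by blast
    qed
    define sp where "sp d = s (inv_into {..<n} dr d)" for d
    have sp: "sp (dr k) = s k" if "k < n" for k using bij that by (simp add: sp_def bij_betw_def)
    have "(\<Sum>i<n. s i) = (\<Sum>i<n. sp (dr i))" by (intro sum.cong) (auto simp: sp)
    also have "\<dots> = (\<Sum>d\<in>dirs_at x. sp d)" by (rule sum.reindex_bij_betw[OF bij])
    finally have "m = (\<Sum>d\<in>dirs_at x. sp d)" using m by simp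
    moreover have "slp (rl f) d (sp d) \<and> dlim (rl f) d" if dx: "d \<in> dirs_at x" for d
    proof -
      obtain k where "k < n" "d = dr k" using bij dx by (auto simp: bij_betw_def)
      then show ?thesis using * sp by auto
    qed
    ultimately show ?thesis by blast
  qed
qed

text \<open>The converse of \<open>has_ord_slp\<close>; together they evaluate the definite
  description in \<open>principal\<close>.\<close>

lemma has_ordI:
  assumes fin: "fin_off_inf f" and sp: "\<And>d. d \<in> dirs_at x \<Longrightarrow> slp (rl f) d (sp d) \<and> (x \<notin> inf\<^sub>\<Gamma> \<longrightarrow> dlim (rl f) d)"
  shows "has_ord \<Gamma> f x (\<Sum>d\<in>dirs_at x. sp d)"
proof (cases "x \<in> inf\<^sub>\<Gamma>")
  case True
  then obtain U h where C: "inf_chart \<Gamma> x U h" using inf_chart_exists by blast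
  show ?thesis
  proof (rule inf_chart_dirs[OF C])
    fix g R e s \<alpha>
    assume R: "R \<ge> (0::real)" and hom: "homeomorphism U {0<..} h g"
      and D: "dirs_at x = {(e, if s then - \<infinity> else \<infinity>, s)}"
      and ry: "\<And>\<tau>. \<tau> > R \<Longrightarrow> \<alpha> - sgb s * \<tau> \<in> I e \<and> g (ereal \<tau>) = em e (\<alpha> - sgb s * \<tau>)"
    define m where "m = sp (e, if s then - \<infinity> else \<infinity>, s)"
    have "slp (rl f) (e, if s then - \<infinity> else \<infinity>, s) m" using sp D by (simp add: m_def)
    then obtain c where "eventually (\<lambda>t. rl f (em e t) = c + sgb s * of_int m * t) (dfil (if s then - \<infinity> else \<infinity>) s)"
      by (auto simp: slp_def)
    then obtain R1 where R1: "\<And>\<tau>. \<tau> > R1 \<Longrightarrow> rl f (em e (\<alpha> - sgb s * \<tau>)) = c + sgb s * of_int m * (\<alpha> - sgb s * \<tau>)"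
      unfolding eventually_dfil_inf[where \<alpha>=\<alpha>] by blast
    define R' where "R' = max R R1"
    have R': "R' \<ge> 0" using R by (simp add: R'_def)
    have C': "inf_chart \<Gamma> x {y\<in>U. h y > ereal R'} (\<lambda>y. ereal (- R') + h y)" by (rule inf_chart_shift[OF C R'])
    have hx: "h x = \<infinity>" and xU: "x \<in> U" using C by (auto simp: inf_chart_def)
    have fy: "f y = ereal ((c + sgb s * of_int m * \<alpha> - of_int m * R') + of_int (- m) * real_of_ereal (ereal (- R') + h y))"
      if y: "y \<in> {y\<in>U. h y > ereal R'} - {x}" for y
    proof -
      have gh: "g (h y) = y" if "y \<in> U" for y using homeomorphism_apply1[OF hom that] .
      have "h y \<noteq> \<infinity>" using y gh[of y] gh[OF xU] hx by (metis DiffE mem_Collect_eq singletonI)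
      then obtain \<tau> where \<tau>: "h y = ereal \<tau>" using y by (cases "h y") auto
      have "\<tau> > R" "\<tau> > R1" using y \<tau> by (auto simp: R'_def)
      have ye: "y = em e (\<alpha> - sgb s * \<tau>)" using gh[of y] ry[OF \<open>\<tau> > R\<close>] y \<tau> by simp
      have "y \<notin> inf\<^sub>\<Gamma>" using C y by (auto simp: inf_chart_def)
      then have "f y = ereal (rl f y)" by (rule ereal_rl[OF fin])
      also have "rl f y = c + sgb s * of_int m * (\<alpha> - sgb s * \<tau>)" using R1[OF \<open>\<tau> > R1\<close>] ye by simp
      finally show ?thesis using \<tau> by (simp add: algebra_simps)
    qed
    have "has_ord \<Gamma> f x m" unfolding has_ord_def using True C' fy by auto
    then show ?thesis using D by (simp add: m_def)
  qed
next
  case False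
  then obtain n r U h where C: "star_chart \<Gamma> x n r U h" using star_chart_exists by blast
  show ?thesis
  proof (rule star_chart_dirs[OF C])
    fix r0 de da ds
    assume r0: "0 < r0" "r0 \<le> r" and bij: "bij_betw (\<lambda>k. (de k, ereal (da k), ds k)) {..<n} (dirs_at x)"
      and ry: "\<And>k \<tau>. k < n \<Longrightarrow> 0 < \<tau> \<Longrightarrow> \<tau> < r0 \<Longrightarrow> 
        da k + sgb (ds k) * \<tau> \<in> I (de k) \<and> ray U h n k \<tau> = em (de k) (da k + sgb (ds k) * \<tau>)"
    define dr where "dr = (\<lambda>k. (de k, ereal (da k), ds k))"
    note bij = bij[folded dr_def]
    have "\<exists>\<delta>>0. \<forall>\<tau>. 0 < \<tau> \<and> \<tau> < \<delta> \<longrightarrow> rl f (em (de k) (da k + sgb (ds k) * \<tau>)) = rl f x + of_int (sp (dr k)) * \<tau>"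
      if k: "k < n" for k
    proof -
      have dk: "dr k \<in> dirs_at x" using bij k by (auto simp: bij_betw_def)
      then show ?thesis using slp_dlim_real[of "de k" "da k" "ds k" "rl f" "sp (dr k)"] dirs_at_dirs[OF dk] sp[OF dk] False
         target_eq[OF dk] unfolding dr_def by simp
    qed
    then obtain \<delta> where \<delta>: "\<And>k. k < n \<Longrightarrow> \<delta> k > 0" 
      "\<And>k \<tau>. k < n \<Longrightarrow> 0 < \<tau> \<Longrightarrow> \<tau> < \<delta> k \<Longrightarrow> rl f (em (de k) (da k + sgb (ds k) * \<tau>)) = rl f x + of_int (sp (dr k)) * \<tau>"
      by metis
    define r' where "r' = Min (insert r0 (\<delta> ` {..<n}))"
    have r': "r' > 0" "r' \<le> r0" "\<And>k. k < n \<Longrightarrow> r' \<le> \<delta> k" using r0(1) \<delta>(1) by (auto simp: r'_def)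
    let ?U = "{y\<in>U. dist\<^sub>\<Gamma> x y < r'}"
    have C': "star_chart \<Gamma> x n r' ?U h" using star_chart_restrict[OF C r'(1)] r'(2) r0(2) by simp
    have fy: "f y = f x + ereal (of_int (sp (dr i)) * cmod (h y))"
      if i: "i < n" and y: "y \<in> ?U" and hy: "h y = rcis (cmod (h y)) (2 * pi * real i / real n)" for i y
    proof (cases "cmod (h y) = 0")
      case True
      then have "y = x" using star_chart_D[OF C] y by (metis (mono_tags, lifting) inj_onD mem_Collect_eq norm_eq_zero)
      then show ?thesis using True by (metis add.right_neutral mult_zero_right zero_ereal_def)
    next
      case nz: False
      define \<tau> where "\<tau> = cmod (h y)"
      have \<tau>: "0 < \<tau>" "\<tau> < r'" using nz y star_chart_centre_dist[OF C] by (auto simp: \<tau>_def)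
      have "inv_into U h (h y) = y" using star_chart_D(5)[OF C] y by simp
      then have yr: "y = ray U h n i \<tau>" unfolding ray_def \<tau>_def using hy by simp
      then have "y = em (de i) (da i + sgb (ds i) * \<tau>)" using ry[OF i \<tau>(1)] \<tau>(2) r'(2) by simp
      then have "rl f y = rl f x + of_int (sp (dr i)) * \<tau>" using \<delta>(2)[OF i \<tau>(1)] \<tau>(2) r'(3)[OF i] by simp
      moreover have "y \<notin> inf\<^sub>\<Gamma>" using y star_chart_D(3)[OF C] by auto
      ultimately show ?thesis using ereal_rl[OF fin False] ereal_rl[OF fin, of y] by (simp add: \<tau>_def)
    qed
    have "\<exists>n' r U h (s :: nat \<Rightarrow> int). star_chart \<Gamma> x n' r U h \<and>
             (\<forall>i<n'. \<forall>y\<in>U. h y = rcis (cmod (h y)) (2 * pi * real i / real n') \<longrightarrow>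
                f y = f x + ereal (of_int (s i) * cmod (h y))) \<and> (\<Sum>i<n. sp (dr i)) = (\<Sum>i<n'. s i)"
      by (rule exI[of _ n], rule exI[of _ r'], rule exI[of _ ?U], rule exI[of _ h], rule exI[of _ "\<lambda>i. sp (dr i)"])
         (use C' fy in auto)
    then have "has_ord \<Gamma> f x (\<Sum>i<n. sp (dr i))"
      unfolding has_ord_def using False by simp
    then show ?thesis using sum.reindex_bij_betw[OF bij] by metis
  qed
qed

text \<open>The edge coordinate, centred at \<open>t\<close>, is itself a star chart of valence
  2.\<close>

lemma linear_nearI:
  assumes fin: "fin_off_inf f" and e: "e \<in> E" "t \<in> I e"
    and lin: "eventually (\<lambda>u. rl f (em e u) = c + of_int m * u) (nhds t)"
  shows "linear_near \<Gamma> f (em e t)"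
proof -
  obtain r where r: "r > 0" "ball t r \<subseteq> I e" "\<And>\<delta>. \<delta> \<le> r \<Longrightarrow> open (em e ` ball t \<delta>)"
    and iso: "\<And>s u. s \<in> ball t r \<Longrightarrow> u \<in> ball t r \<Longrightarrow> dist\<^sub>\<Gamma> (em e s) (em e u) = \<bar>s - u\<bar>"
    by (rule em_ball[OF e]) (rule that)
  obtain \<delta>' where \<delta>': "\<delta>' > 0" "\<And>u. dist u t < \<delta>' \<Longrightarrow> rl f (em e u) = c + of_int m * u"
    using lin unfolding eventually_nhds_metric by auto
  define \<delta> where "\<delta> = min r \<delta>'"
  have \<delta>: "\<delta> > 0" "\<delta> \<le> r" "\<delta> \<le> \<delta>'" using r(1) \<delta>'(1) by (auto simp: \<delta>_def)
  have sub: "ball t \<delta> \<subseteq> I e" "ball t \<delta> \<subseteq> ball t r" using r(2) \<delta>(2) by auto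
  let ?U = "em e ` ball t \<delta>" and ?h = "\<lambda>y. complex_of_real (coord e y - t)"
  have h: "?h (em e u) = of_real (u - t)" if "u \<in> ball t \<delta>" for u using that sub(1) e by (simp add: subset_iff)
  have "bij_betw ?h ?U (star_shaped 2 \<delta>)"
    unfolding bij_betw_def
  proof
    show "inj_on ?h ?U" 
    proof (rule inj_onI)
      fix y z assume "y \<in> ?U" "z \<in> ?U" and eq: "?h y = ?h z"
      then obtain u v where "u \<in> ball t \<delta>" "v \<in> ball t \<delta>" "y = em e u" "z = em e v" by blast
      then show "y = z" using eq h by (metis add_diff_cancel_right' diff_add_cancel of_real_eq_iff)
    qed
    show "?h ` ?U = star_shaped 2 \<delta>"
    proof (intro subset_antisym subsetI)
      fix z assume "z \<in> ?h ` ?U"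
      then obtain u where u: "u \<in> ball t \<delta>" "z = ?h (em e u)" by blast
      then have "z = of_real (u - t)" using h by simp
      then show "z \<in> star_shaped 2 \<delta>" using of_real_star_2(1)[of "u - t" \<delta>] u(1) by (simp add: dist_real_def abs_minus_commute)
    next
      fix z assume "z \<in> star_shaped 2 \<delta>"
      moreover from this have "cmod z < \<delta>" using \<delta>(1) by (auto simp: star_shaped_def)
      ultimately have z: "z = of_real (Re z)" "\<bar>Re z\<bar> < \<delta>" using of_real_star_2(2) by auto
      then have u: "t + Re z \<in> ball t \<delta>" by (simp add: dist_real_def)
      then have "z = ?h (em e (t + Re z))" using h[OF u] z(1) by simp
      then show "z \<in> ?h ` ?U" using u by blast
    qed
  qed
  moreover have "open ?U" using r(3) \<delta>(2) by blast
  moreover have "em e t \<in> ?U" using \<delta>(1) by auto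
  moreover have "?U \<subseteq> - inf\<^sub>\<Gamma>" using em_not_inf e(1) sub(1) by auto
  moreover have "?h (em e t) = 0" using e by simp
  moreover have "dist\<^sub>\<Gamma> y z = star_dist (?h y) (?h z)" if yz: "y \<in> ?U" "z \<in> ?U" for y z
  proof -
    obtain u v where uv: "u \<in> ball t \<delta>" "v \<in> ball t \<delta>" "y = em e u" "z = em e v" using yz by blast
    then have "dist\<^sub>\<Gamma> y z = \<bar>u - v\<bar>" using iso[of u v] sub(2) by blast
    moreover have "coord e y = u" "coord e z = v" using uv sub(1) e(1) by auto
    ultimately show ?thesis unfolding star_dist_of_real by simp
  qed
  ultimately have "star_chart \<Gamma> (em e t) 2 \<delta> ?U ?h" unfolding star_chart_def using \<delta>(1) by blast
  moreover have "f y = f (em e t) + ereal (of_int m * Re (?h y))" if yU: "y \<in> ?U" for y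
  proof -
    obtain u where u: "u \<in> ball t \<delta>" "y = em e u" using yU by blast
    have fi: "f (em e v) = ereal (c + of_int m * v)" if v: "v \<in> ball t \<delta>" for v
    proof -
      have "em e v \<notin> inf\<^sub>\<Gamma>" using em_not_inf e(1) v sub(1) by blast
      then show ?thesis using ereal_rl[OF fin] \<delta>'(2)[of v] v \<delta>(3) by (simp add: dist_commute)
    qed
    have "t \<in> ball t \<delta>" using \<delta>(1) by simp
    then show ?thesis using fi[OF u(1)] fi[of t] h[OF u(1)] u(2) by (simp add: algebra_simps)
  qed
  ultimately show ?thesis unfolding linear_near_def by blast
qed

lemma linear_nearD:
  assumes fin: "fin_off_inf f" and e: "e \<in> E" "t \<in> I e" and lin: "linear_near \<Gamma> f (em e t)"
  shows "\<exists>c. \<exists>m::int. eventually (\<lambda>u. rl f (em e u) = c + of_int m * u) (nhds t)"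
proof -
  obtain r U h and m :: int where C: "star_chart \<Gamma> (em e t) 2 r U h"
    and f: "\<And>y. y \<in> U \<Longrightarrow> f y = f (em e t) + ereal (of_int m * Re (h y))"
    using lin unfolding linear_near_def by blast
  obtain r' s where r': "r' > 0" "r' \<le> r" "ball t r' \<subseteq> I e"
    "\<And>\<delta>. \<delta> \<le> r' \<Longrightarrow> em e ` ball t \<delta> = {y. y \<notin> inf\<^sub>\<Gamma> \<and> dist\<^sub>\<Gamma> (em e t) y < \<delta>}"
    "\<And>u. u \<in> ball t r' \<Longrightarrow> em e u \<in> U \<and> Re (h (em e u)) = sgb s * (u - t)"
    by (rule chart2_edge[OF e C]) (rule that)
  let ?m = "if s then m else - m" and ?t = "rl f (em e t)"
  have "rl f (em e u) = (?t - of_int ?m * t) + of_int ?m * u" if u: "u \<in> ball t r'" for u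
  proof -
    have "f (em e u) = ereal ?t + ereal (of_int m * (sgb s * (u - t)))"
      using f[of "em e u"] r'(5)[OF u] ereal_rl[OF fin em_not_inf[OF e]] by simp
    then have "rl f (em e u) = ?t + of_int m * (sgb s * (u - t))" by (simp add: rl_def)
    then show ?thesis by (cases s) (auto simp: algebra_simps)
  qed
  moreover have "eventually (\<lambda>u. u \<in> ball t r') (nhds t)" using r'(1) by (intro eventually_nhds_in_open) auto
  ultimately have "eventually (\<lambda>u. rl f (em e u) = (?t - of_int ?m * t) + of_int ?m * u) (nhds t)"
    by (auto elim: eventually_mono)
  then show ?thesis by blast
qed

lemma rational_fin: "rational_function \<Gamma> f \<Longrightarrow> fin_off_inf f"
  by (simp add: rational_function_def)

lemma rational_lim:
  assumes f: "rational_function \<Gamma> f" and d: "(e, a, s) \<in> dirs"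
  shows "((\<lambda>t. f (em e t)) \<longlongrightarrow> f (target (e, a, s))) (dfil a s)"
proof -
  have "isCont f (target (e, a, s))" using f by (simp add: rational_function_def continuous_on_eq_continuous_at)
  moreover have "filterlim (em e) (nhds (target (e, a, s))) (dfil a s)"
    using dirs_at_target[OF d] by (simp add: dirs_at_def)
  ultimately show ?thesis by (rule isCont_tendsto_compose)
qed

text \<open>Only finitely many points fail to be linear, so a one-sided segment avoids them all; the
  local affine formulas on it agree because it is connected.\<close>

lemma rational_PL:
  assumes f: "rational_function \<Gamma> f"
  shows "PL (rl f)"
  unfolding PL_def
proof (intro ballI conjI impI)
  fix d assume d0: "d \<in> dirs"
  obtain e a s where ds: "d = (e, a, s)" by (cases d) auto
  note d = d0[unfolded ds]
  note fin = rational_fin[OF f]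
  show "dlim (rl f) d" if "target d \<notin> inf\<^sub>\<Gamma>"
  proof -
    have "f (target d) = ereal (rl f (target d))" using ereal_rl[OF fin that] .
    then show ?thesis using rational_lim[OF f d] lim_real_of_ereal unfolding dlim_def ds rl_def by simp
  qed
  let ?Z = "{x. \<not> linear_near \<Gamma> f x}"
  have e: "e \<in> E" by (rule dirs_edge[OF d])
  \<comment> \<open>Applying \<open>coord e\<close> to points off \<open>e\<close> gives arbitrary
    values, but still finitely many, and all of them can be avoided.\<close>
  have "finite (coord e ` ?Z)" using f by (simp add: rational_function_def)
  then have "eventually (\<lambda>t. t \<notin> coord e ` ?Z) (dfil a s)"
    by (rule eventually_dfil_not_in_finite[OF dirs_beyond[OF d]])
  then have "eventually (\<lambda>t. t \<in> I e \<and> linear_near \<Gamma> f (em e t)) (dfil a s)"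
    using dirs_ev_I[OF d]
  proof eventually_elim
    case (elim t)
    then show ?case using coord_em[OF e, of t] by (metis (mono_tags, lifting) image_eqI mem_Collect_eq)
  qed
  then obtain b where b: "beyond a s (ereal b)" "\<forall>t\<in>seg a s b. t \<in> I e \<and> linear_near \<Gamma> f (em e t)"
    unfolding eventually_dfil[OF dirs_beyond[OF d]] by blast
  have loc: "\<exists>c. \<exists>m::int. eventually (\<lambda>u. rl f (em e u) = c + of_int m * u) (nhds t)" if "t \<in> seg a s b" for t
    using linear_nearD[OF fin e, of t] b(2) that by blast
  obtain c and m :: int where cm: "\<And>t. t \<in> seg a s b \<Longrightarrow> rl f (em e t) = c + of_int m * t"
    by (rule local_affine_const[OF seg_open seg_connected seg_nonempty[OF b(1)], where u="\<lambda>t. rl f (em e t)", OF loc]) (assumption, rule that)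
  have "eventually (\<lambda>t. rl f (em e t) = c + sgb s * of_int (if s then m else - m) * t) (dfil a s)"
    using eventually_dfil_seg[OF b(1)] by eventually_elim (cases s; simp add: cm)
  then show "\<exists>m. slp (rl f) d m" unfolding slp_def ds by auto
qed

lemma principal_eq:
  assumes f: "fin_off_inf f" and PL: "PL (rl f)"
  shows "principal \<Gamma> f x = dv (rl f) x"
  unfolding principal_def
proof (rule the_equality)
  have *: "slp (rl f) d (sl (rl f) d) \<and> (x \<notin> inf\<^sub>\<Gamma> \<longrightarrow> dlim (rl f) d)" if "d \<in> dirs_at x" for d
    using PL_slp[OF PL] PL_dlim[OF PL] dirs_at_dirs[OF that] target_eq[OF that] by auto
  show "has_ord \<Gamma> f x (dv (rl f) x)" unfolding dv_def by (rule has_ordI[OF f *])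
  fix m assume "has_ord \<Gamma> f x m"
  then obtain sp where sp: "\<forall>d\<in>dirs_at x. slp (rl f) d (sp d)" "m = (\<Sum>d\<in>dirs_at x. sp d)"
    using has_ord_slp[OF f] by blast
  have "sp d = sl (rl f) d" if "d \<in> dirs_at x" for d
    using sl_eq[OF dirs_at_dirs[OF that], of "rl f" "sp d"] sp(1) that by simp
  then show "m = dv (rl f) x" unfolding sp(2) dv_def by (intro sum.cong) auto
qed

lemma PL_affine_near:
  assumes "PL k" "(e, a, s) \<in> dirs"
  shows "eventually (\<lambda>t. t \<in> I e \<and> (\<exists>c. \<exists>m::int. eventually (\<lambda>u. k (em e u) = c + of_int m * u) (nhds t))) (dfil a s)"
proof -
  note d = assms(2)
  obtain c where "eventually (\<lambda>t. k (em e t) = c + sgb s * of_int (sl k (e, a, s)) * t) (dfil a s)"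
    using PL_slp[OF assms] by (auto simp: slp_def)
  then obtain b where b: "beyond a s (ereal b)" "\<forall>t\<in>seg a s b. k (em e t) = c + sgb s * of_int (sl k (e, a, s)) * t"
    unfolding eventually_dfil[OF dirs_beyond[OF d]] by blast
  let ?m = "if s then sl k (e, a, s) else - sl k (e, a, s)"
  have *: "\<exists>c. \<exists>m::int. eventually (\<lambda>u. k (em e u) = c + of_int m * u) (nhds t)" if t: "t \<in> seg a s b" for t
  proof -
    have "eventually (\<lambda>u. u \<in> seg a s b) (nhds t)" using seg_open t by (rule eventually_nhds_in_open)
    then have "eventually (\<lambda>u. k (em e u) = c + of_int ?m * u) (nhds t)"
      by eventually_elim (use b(2) in \<open>cases s; auto\<close>)
    then show ?thesis by blast
  qed
  show ?thesis using eventually_dfil_seg[OF b(1)] dirs_ev_I[OF d] by eventually_elim (use * in blast)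
qed

text \<open>The values at the points at infinity are forced by continuity.\<close>

lemma PL_extend:
  assumes PL: "PL k"
  obtains f where "rational_function \<Gamma> f" "\<And>x. x \<notin> inf\<^sub>\<Gamma> \<Longrightarrow> f x = ereal (k x)"
proof -
  \<comment> \<open>Along an infinite end the function is affine, so it has a limit in the extended
    reals. As there is only one direction at such a point, this limit is the value to
    assign.\<close>
  have "\<exists>l. x \<in> inf\<^sub>\<Gamma> \<longrightarrow> (\<forall>e a s. (e, a, s) \<in> dirs_at x \<longrightarrow> ((\<lambda>t. ereal (k (em e t))) \<longlongrightarrow> l) (dfil a s))" for x
  proof (cases "x \<in> inf\<^sub>\<Gamma>")
    case True
    then obtain e a s where D: "dirs_at x = {(e, a, s)}" using dirs_at_inf by blast
    have d: "(e, a, s) \<in> dirs" using D dirs_at_dirs by blast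
    define m where "m = sl k (e, a, s)"
    obtain c where c: "eventually (\<lambda>t. k (em e t) = c + sgb s * of_int m * t) (dfil a s)"
      using PL_slp[OF PL d] by (auto simp: slp_def m_def)
    have "(ereal \<longlongrightarrow> a) (dfil a s)" by (rule filterlim_ereal_dfil[OF dirs_beyond[OF d]])
    then have "((\<lambda>t. ereal (sgb s * of_int m) * ereal t) \<longlongrightarrow> ereal (sgb s * of_int m) * a) (dfil a s)"
      by (intro tendsto_cmult_ereal) auto
    then have "((\<lambda>t. ereal c + ereal (sgb s * of_int m) * ereal t) \<longlongrightarrow> ereal c + ereal (sgb s * of_int m) * a) (dfil a s)"
      by (rule tendsto_ereal_add_const)
    moreover have "eventually (\<lambda>t. ereal c + ereal (sgb s * of_int m) * ereal t = ereal (k (em e t))) (dfil a s)"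
      using c by eventually_elim simp
    ultimately have "((\<lambda>t. ereal (k (em e t))) \<longlongrightarrow> ereal c + ereal (sgb s * of_int m) * a) (dfil a s)"
      by (rule Lim_transform_eventually)
    then show ?thesis using D by (intro exI[of _ "ereal c + ereal (sgb s * of_int m) * a"]) auto
  qed auto
  then obtain l where l: "\<And>x e a s. x \<in> inf\<^sub>\<Gamma> \<Longrightarrow> (e, a, s) \<in> dirs_at x \<Longrightarrow> ((\<lambda>t. ereal (k (em e t))) \<longlongrightarrow> l x) (dfil a s)"
    by metis
  define f where "f x = (if x \<in> inf\<^sub>\<Gamma> then l x else ereal (k x))" for x
  have fk: "f x = ereal (k x)" if "x \<notin> inf\<^sub>\<Gamma>" for x using that by (simp add: f_def)
  have fin: "fin_off_inf f" by (simp add: fk)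
  have rlf: "rl f (em e t) = k (em e t)" if "e \<in> E" "t \<in> I e" for e t
    using em_not_inf[OF that] by (simp add: rl_def fk)
  have lim: "((\<lambda>t. f (em e t)) \<longlongrightarrow> f x) (dfil a s)" if dx: "(e, a, s) \<in> dirs_at x" for x e a s
  proof -
    have d: "(e, a, s) \<in> dirs" by (rule dirs_at_dirs[OF dx])
    have "((\<lambda>t. ereal (k (em e t))) \<longlongrightarrow> f x) (dfil a s)"
    proof (cases "x \<in> inf\<^sub>\<Gamma>")
      case True then show ?thesis using l[OF True dx] by (simp add: f_def)
    next
      case False
      then have "dlim k (e, a, s)" using PL_dlim[OF PL d] target_eq[OF dx] by simp
      then show ?thesis using False target_eq[OF dx] by (auto simp: dlim_def f_def)
    qed
    moreover have "eventually (\<lambda>t. ereal (k (em e t)) = f (em e t)) (dfil a s)"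
      using dirs_ev_I[OF d] by eventually_elim (use em_not_inf[OF dirs_edge[OF d]] in \<open>simp add: fk\<close>)
    ultimately show ?thesis by (rule Lim_transform_eventually)
  qed
  have cont: "(f \<longlongrightarrow> f x) (nhds x)" for x
  proof (rule topological_tendstoI)
    fix S assume S: "open S" "f x \<in> S"
    show "eventually (\<lambda>y. f y \<in> S) (nhds x)"
    proof (rule eventually_nhdsI)
      fix d assume dx: "d \<in> dirs_at x"
      obtain e a s where ds: "d = (e, a, s)" by (cases d) auto
      show "dir_ev (\<lambda>y. f y \<in> S) d" using topological_tendstoD[OF lim S, of e a s] dx by (simp add: ds dir_ev_def)
    qed (rule S(2))
  qed
  \<comment> \<open>Each point has a punctured neighbourhood on which \<open>f\<close> is linear, so
    only the centres of a finite cover can be exceptional.\<close>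
  define P where "P x y \<longleftrightarrow> y = x \<or> linear_near \<Gamma> f y" for x y
  have "eventually (P x) (nhds x)" for x
  proof (rule eventually_nhdsI)
    fix d assume dx: "d \<in> dirs_at x"
    obtain e a s where ds: "d = (e, a, s)" by (cases d) auto
    have d: "(e, a, s) \<in> dirs" using dirs_at_dirs[OF dx] ds by simp
    have "eventually (\<lambda>t. P x (em e t)) (dfil a s)"
      using PL_affine_near[OF PL d]
    proof eventually_elim
      case (elim t)
      then obtain c m where cm: "eventually (\<lambda>u. k (em e u) = c + of_int m * u) (nhds t)" and t: "t \<in> I e" by blast
      have "eventually (\<lambda>u. u \<in> I e) (nhds t)" using I_open t by (rule eventually_nhds_in_open)
      with cm have "eventually (\<lambda>u. rl f (em e u) = c + of_int m * u) (nhds t)"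
        by eventually_elim (simp add: rlf[OF dirs_edge[OF d]])
      then show ?case using linear_nearI[OF fin dirs_edge[OF d] t] by (auto simp: P_def)
    qed
    then show "dir_ev (P x) d" by (simp add: dir_ev_def ds)
  qed (simp add: P_def)
  then have "\<exists>X. finite X \<and> (\<forall>y. \<exists>x\<in>X. P x y)" by (rule compact_principle)
  then obtain X where X: "finite X" "\<And>y. \<exists>x\<in>X. P x y" by blast
  have "{x. \<not> linear_near \<Gamma> f x} \<subseteq> X"
  proof
    fix y assume "y \<in> {x. \<not> linear_near \<Gamma> f x}"
    then show "y \<in> X" using X(2)[of y] by (auto simp: P_def)
  qed
  then have "finite {x. \<not> linear_near \<Gamma> f x}" using X(1) by (rule finite_subset)
  moreover have "continuous_on UNIV f"
    using cont by (simp add: continuous_on_eq_continuous_at isCont_def tendsto_at_iff_tendsto_nhds)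
  ultimately have "rational_function \<Gamma> f" using fin by (simp add: rational_function_def)
  then show ?thesis using fk by (rule that)
qed

lemma PL_cong:
  assumes "PL k" "\<And>x. x \<notin> inf\<^sub>\<Gamma> \<Longrightarrow> k' x = k x"
  shows "PL k'" and "d \<in> dirs \<Longrightarrow> sl k' d = sl k d" and "dv k' x = dv k x"
proof -
  have ev: "eventually (\<lambda>t. k' (em e t) = k (em e t)) (dfil a s)" if d: "(e, a, s) \<in> dirs" for e a s
    using dirs_ev_I[OF d] by eventually_elim (use em_not_inf[OF dirs_edge[OF d]] assms(2) in blast)
  have slp: "slp k' d m" if "d \<in> dirs" and "slp k d m" for d m
  proof -
    obtain e a s where ds: "d = (e, a, s)" by (cases d) auto
    obtain c where "eventually (\<lambda>t. k (em e t) = c + sgb s * of_int m * t) (dfil a s)"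
      using \<open>slp k d m\<close> by (auto simp: slp_def ds)
    then have "eventually (\<lambda>t. k' (em e t) = c + sgb s * of_int m * t) (dfil a s)"
      using ev[of e a s] \<open>d \<in> dirs\<close>[unfolded ds] by (auto elim: eventually_elim2)
    then show ?thesis by (auto simp: slp_def ds)
  qed
  have dlim: "dlim k' d" if "d \<in> dirs" "target d \<notin> inf\<^sub>\<Gamma>" for d
  proof -
    obtain e a s where ds: "d = (e, a, s)" by (cases d) auto
    have "((\<lambda>t. k (em e t)) \<longlongrightarrow> k (target d)) (dfil a s)" using PL_dlim[OF assms(1) that] by (simp add: dlim_def ds)
    then have "((\<lambda>t. k' (em e t)) \<longlongrightarrow> k (target d)) (dfil a s)"
      by (rule Lim_transform_eventually) (use ev[of e a s] that(1) ds in \<open>auto elim: eventually_mono\<close>)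
    then show ?thesis using assms(2)[OF that(2)] by (simp add: dlim_def ds)
  qed
  show "PL k'" using assms(1) slp dlim unfolding PL_def by blast
  show sl: "sl k' d = sl k d" if "d \<in> dirs" for d by (rule sl_eq[OF that slp[OF that PL_slp[OF assms(1) that]]])
  show "dv k' x = dv k x" unfolding dv_def by (intro sum.cong refl sl) (rule dirs_at_dirs)
qed

lemma RR_D:
  assumes "f \<in> RR \<Gamma> D"
  shows "rational_function \<Gamma> f" "PL (rl f)" "fin_off_inf f" "principal \<Gamma> f = dv (rl f)" "0 \<le> D x + dv (rl f) x"
proof -
  show f: "rational_function \<Gamma> f" using assms by (simp add: RR_def)
  show "PL (rl f)" by (rule rational_PL[OF f])
  show "fin_off_inf f" by (rule rational_fin[OF f])
  then show p: "principal \<Gamma> f = dv (rl f)" using principal_eq \<open>PL (rl f)\<close> by blast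
  show "0 \<le> D x + dv (rl f) x" using assms p by (simp add: RR_def)
qed

text \<open>The way back: the moves below are constructed as real functions and must yield members
  of \<open>RR\<close>.\<close>

lemma RR_extend:
  assumes "PL k" "\<And>x. 0 \<le> D x + dv k x"
  obtains f where "f \<in> RR \<Gamma> D" "principal \<Gamma> f = dv k" "\<And>x. x \<notin> inf\<^sub>\<Gamma> \<Longrightarrow> f x = ereal (k x)"
proof -
  obtain f where f: "rational_function \<Gamma> f" "\<And>x. x \<notin> inf\<^sub>\<Gamma> \<Longrightarrow> f x = ereal (k x)"
    by (rule PL_extend[OF assms(1)]) (rule that)
  have "rl f x = k x" if "x \<notin> inf\<^sub>\<Gamma>" for x using f(2)[OF that] by (simp add: rl_def)
  then have "dv (rl f) x = dv k x" for x using PL_cong(3)[OF assms(1)] by blast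
  then have p: "principal \<Gamma> f = dv k"
    using principal_eq[OF rational_fin[OF f(1)] rational_PL[OF f(1)]] by auto
  then have "f \<in> RR \<Gamma> D" using f(1) assms(2) by (simp add: RR_def)
  then show ?thesis using p f(2) by (rule that)
qed

end

section \<open>Degree and slopes\<close>

lemma eventually_dfil_side:
  assumes "beyond a s c"
  shows "eventually (\<lambda>t. t < t0) (dfil a s) \<or> eventually (\<lambda>t. t > t0) (dfil a s)"
proof -
  consider "a < ereal t0" | "ereal t0 < a" | "a = ereal t0" by fastforce
  then show ?thesis
  proof cases
    case 1 then show ?thesis using eventually_dfil_less[OF assms 1] by simp
  next
    case 2 then show ?thesis using eventually_dfil_greater[OF assms 2] by simp
  next
    case 3 then show ?thesis using eventually_dfil_beyond[OF assms] by (cases s) (simp_all add: beyond_def)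
  qed
qed

lemma eventually_affine_sign:
  assumes "beyond a s c"
  shows "eventually (\<lambda>t. p + q * t \<ge> (0::real)) (dfil a s) \<or> eventually (\<lambda>t. p + q * t \<le> 0) (dfil a s)"
proof (cases "q = 0")
  case True then show ?thesis by (cases "p \<ge> 0") auto
next
  case False
  define t0 where "t0 = - p / q"
  have eq: "p + q * t = q * (t - t0)" for t using False by (simp add: t0_def field_simps)
  consider "eventually (\<lambda>t. t < t0) (dfil a s)" | "eventually (\<lambda>t. t > t0) (dfil a s)"
    using eventually_dfil_side[OF assms] by blast
  then show ?thesis
  proof cases
    case 1
    show ?thesis
    proof (cases "q > 0")
      case True
      have "eventually (\<lambda>t. p + q * t \<le> 0) (dfil a s)" using 1
        by eventually_elim (use True in \<open>simp add: eq mult_le_0_iff\<close>)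
      then show ?thesis ..
    next
      case False
      have "eventually (\<lambda>t. p + q * t \<ge> 0) (dfil a s)" using 1
        by eventually_elim (use False in \<open>simp add: eq zero_le_mult_iff\<close>)
      then show ?thesis ..
    qed
  next
    case 2
    show ?thesis
    proof (cases "q > 0")
      case True
      have "eventually (\<lambda>t. p + q * t \<ge> 0) (dfil a s)" using 2
        by eventually_elim (use True in \<open>simp add: eq zero_le_mult_iff\<close>)
      then show ?thesis ..
    next
      case False
      have "eventually (\<lambda>t. p + q * t \<le> 0) (dfil a s)" using 2
        by eventually_elim (use False in \<open>simp add: eq mult_le_0_iff\<close>)
      then show ?thesis ..
    qed
  qed
qed

context curve_model
begin

lemma dirs_I: "e \<in> E \<Longrightarrow> t \<in> I e \<Longrightarrow> (e, ereal t, s) \<in> dirs"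
  using dirs_at_I[of e t] dirs_at_dirs[of "(e, ereal t, s)" "em e t"] by (cases s) auto

lemma dv_I: "e \<in> E \<Longrightarrow> t \<in> I e \<Longrightarrow> dv k (em e t) = sl k (e, ereal t, True) + sl k (e, ereal t, False)"
  by (simp add: dv_def dirs_at_I)

lemma sl_affine:
  assumes e: "e \<in> E" "t \<in> I e" and lin: "eventually (\<lambda>u. k (em e u) = c + of_int m * u) (nhds t)"
  shows "sl k (e, ereal t, s) = (if s then m else - m)"
proof (rule sl_eq[OF dirs_I[OF e]])
  have "eventually (\<lambda>u. k (em e u) = c + of_int m * u) (dfil (ereal t) s)"
    using lin unfolding nhds_real_dfil by (cases s) auto
  then have "eventually (\<lambda>u. k (em e u) = c + sgb s * of_int (if s then m else - m) * u) (dfil (ereal t) s)"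
    by eventually_elim (cases s; simp)
  then show "slp k (e, ereal t, s) (if s then m else - m)" by (auto simp: slp_def)
qed

lemma dv_affine:
  assumes e: "e \<in> E" "t \<in> I e" and lin: "eventually (\<lambda>u. k (em e u) = c + of_int m * u) (nhds t)"
  shows "dv k (em e t) = 0"
  unfolding dv_I[OF e] sl_affine[OF e lin] by simp

lemma sl_near:
  assumes PL: "PL k" and d: "(e, a, s) \<in> dirs"
  shows "eventually (\<lambda>u. u \<in> I e \<and> sl k (e, ereal u, True) = (if s then sl k (e, a, s) else - sl k (e, a, s))) (dfil a s)"
proof -
  let ?m = "if s then sl k (e, a, s) else - sl k (e, a, s)"
  obtain c where "eventually (\<lambda>t. k (em e t) = c + sgb s * of_int (sl k (e, a, s)) * t) (dfil a s)"
    using PL_slp[OF assms] by (auto simp: slp_def)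
  then obtain b where b: "beyond a s (ereal b)" "\<forall>t\<in>seg a s b. k (em e t) = c + sgb s * of_int (sl k (e, a, s)) * t"
    unfolding eventually_dfil[OF dirs_beyond[OF d]] by blast
  have *: "sl k (e, ereal t, True) = ?m" if t: "t \<in> seg a s b" "t \<in> I e" for t
  proof -
    have "eventually (\<lambda>u. u \<in> seg a s b) (nhds t)" using seg_open t(1) by (rule eventually_nhds_in_open)
    then have "eventually (\<lambda>u. k (em e u) = c + of_int ?m * u) (nhds t)"
      by eventually_elim (use b(2) in \<open>cases s; auto\<close>)
    from sl_affine[OF dirs_edge[OF d] t(2) this] show ?thesis by simp
  qed
  show ?thesis using eventually_dfil_seg[OF b(1)] dirs_ev_I[OF d] by eventually_elim (use * in blast)
qed

text \<open>\<open>PL\<close> restricts germs only. Each germ is affine on a punctured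
  neighbourhood, and compactness makes the set of kinks finite.\<close>

lemma finite_dv_support:
  assumes PL: "PL k"
  shows "finite {x. dv k x \<noteq> 0}"
proof -
  define P where "P x y \<longleftrightarrow> y = x \<or> dv k y = 0" for x y
  have "eventually (P x) (nhds x)" for x
  proof (rule eventually_nhdsI)
    fix d assume dx: "d \<in> dirs_at x"
    obtain e a s where ds: "d = (e, a, s)" by (cases d) auto
    have d: "(e, a, s) \<in> dirs" using dirs_at_dirs[OF dx] ds by simp
    have "eventually (\<lambda>t. P x (em e t)) (dfil a s)"
      using PL_affine_near[OF PL d] by eventually_elim (use dv_affine[OF dirs_edge[OF d]] in \<open>auto simp: P_def\<close>)
    then show "dir_ev (P x) d" by (simp add: dir_ev_def ds)
  qed (simp add: P_def)
  then have "\<exists>X. finite X \<and> (\<forall>y. \<exists>x\<in>X. P x y)" by (rule compact_principle)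
  then obtain X where X: "finite X" "\<And>y. \<exists>x\<in>X. P x y" by blast
  have "{x. dv k x \<noteq> 0} \<subseteq> X"
  proof
    fix y assume "y \<in> {x. dv k x \<noteq> 0}"
    then show "y \<in> X" using X(2)[of y] by (auto simp: P_def)
  qed
  then show ?thesis using X(1) by (rule finite_subset)
qed

text \<open>The right slope at \<open>t\<close>, minus the jumps up to \<open>t\<close>, is locally constant.\<close>

lemma edge_slopes:
  assumes PL: "PL k" and e: "e \<in> E" and Z: "finite Z" "Z \<subseteq> I e" "\<And>t. t \<in> I e \<Longrightarrow> t \<notin> Z \<Longrightarrow> dv k (em e t) = 0"
  shows "(\<Sum>t\<in>Z. dv k (em e t)) + sl k (e, lo M e, True) + sl k (e, hi M e, False) = 0"
    and "t \<in> I e \<Longrightarrow> sl k (e, ereal t, True) = sl k (e, lo M e, True) + (\<Sum>z\<in>{z\<in>Z. z \<le> t}. dv k (em e z))"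
proof -
  define S where "S t = (\<Sum>u\<in>{u\<in>Z. u \<le> t}. dv k (em e u))" for t
  define \<phi> where "\<phi> t = sl k (e, ereal t, True) - S t" for t
  have loc: "eventually (\<lambda>u. \<phi> t = \<phi> u) (at t within I e)" if t: "t \<in> I e" for t
  proof -
    have right: "eventually (\<lambda>u. \<phi> t = \<phi> u) (dfil (ereal t) True)"
    proof -
      have "eventually (\<lambda>u. u < z) (dfil (ereal t) True)" if "t < z" for z
        using eventually_dfil_less[OF beyond_real[of t True], of "ereal z"] that by simp
      then have "eventually (\<lambda>u. \<forall>z\<in>{z\<in>Z. t < z}. u < z) (dfil (ereal t) True)"
        using Z(1) by (intro eventually_ball_finite) auto
      moreover have "eventually (\<lambda>u. t < u) (dfil (ereal t) True)"
        using eventually_dfil_beyond[OF beyond_real[of t True]] by (simp add: beyond_def)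
      ultimately show ?thesis using sl_near[OF PL dirs_I[OF e t, of True]]
      proof eventually_elim
        case (elim u)
        then have "{z\<in>Z. z \<le> u} = {z\<in>Z. z \<le> t}" by force
        then show ?case using elim by (simp add: \<phi>_def S_def)
      qed
    qed
    have left: "eventually (\<lambda>u. \<phi> t = \<phi> u) (dfil (ereal t) False)"
    proof -
      have "eventually (\<lambda>u. z < u) (dfil (ereal t) False)" if "z < t" for z
        using eventually_dfil_greater[OF beyond_real[of t False], of "ereal z"] that by simp
      then have "eventually (\<lambda>u. \<forall>z\<in>{z\<in>Z. z < t}. z < u) (dfil (ereal t) False)"
        using Z(1) by (intro eventually_ball_finite) auto
      moreover have "eventually (\<lambda>u. u < t) (dfil (ereal t) False)"
        using eventually_dfil_beyond[OF beyond_real[of t False]] by (simp add: beyond_def)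
      ultimately show ?thesis using sl_near[OF PL dirs_I[OF e t, of False]]
      proof eventually_elim
        case (elim u)
        have "{z\<in>Z. z \<le> u} = {z\<in>Z. z \<le> t} - {t}" using elim by force
        \<comment> \<open>Just to the left of \<open>t\<close> the jump at \<open>t\<close> is not
          yet counted. It equals the right slope minus the slope with which \<open>t\<close> is
          reached, so \<open>\<phi>\<close> does not change there.\<close>
        moreover have "S t = (\<Sum>u\<in>{z\<in>Z. z \<le> t} - {t}. dv k (em e u)) + dv k (em e t)"
        proof (cases "t \<in> Z")
          case True
          then show ?thesis unfolding S_def using Z(1) by (subst sum.remove[of _ t]) auto
        next
          case False
          then have "{z\<in>Z. z \<le> t} - {t} = {z\<in>Z. z \<le> t}" by auto
          then show ?thesis using Z(3)[OF t False] by (simp add: S_def)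
        qed
        ultimately show ?case using elim by (simp add: \<phi>_def S_def dv_I[OF e t])
      qed
    qed
    have "eventually (\<lambda>u. \<phi> t = \<phi> u) (nhds t)" unfolding nhds_real_dfil using left right by simp
    then show ?thesis unfolding eventually_at_filter by eventually_elim simp
  qed
  have const: "\<phi> t = \<phi> u" if "t \<in> I e" "u \<in> I e" for t u
    using connected_local_const[OF I_connected that] loc by blast
  have dl: "(e, lo M e, True) \<in> dirs" and dh: "(e, hi M e, False) \<in> dirs"
    using ends_dirs e by (auto simp: ends_def)
  have "eventually (\<lambda>u. u < z) (dfil (lo M e) True)" if "z \<in> Z" for z
  proof -
    have "lo M e < ereal z" using that Z(2) by (auto simp: edge_interval_def)
    from eventually_dfil_less[OF dirs_beyond[OF dl] this] show ?thesis by simp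
  qed
  then have "eventually (\<lambda>u. \<forall>z\<in>Z. u < z) (dfil (lo M e) True)"
    using Z(1) by (intro eventually_ball_finite) auto
  then have evl: "eventually (\<lambda>u. u \<in> I e \<and> \<phi> u = sl k (e, lo M e, True)) (dfil (lo M e) True)"
    using sl_near[OF PL dl]
  proof eventually_elim
    case (elim u)
    then have "{z\<in>Z. z \<le> u} = {}" by force
    then show ?case using elim by (simp add: \<phi>_def S_def del: Collect_empty_eq)
  qed
  have "eventually (\<lambda>u. z < u) (dfil (hi M e) False)" if "z \<in> Z" for z
  proof -
    have "ereal z < hi M e" using that Z(2) by (auto simp: edge_interval_def)
    from eventually_dfil_greater[OF dirs_beyond[OF dh] this] show ?thesis by simp
  qed
  then have "eventually (\<lambda>u. \<forall>z\<in>Z. z < u) (dfil (hi M e) False)"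
    using Z(1) by (intro eventually_ball_finite) auto
  then have evh: "eventually (\<lambda>u. u \<in> I e \<and> \<phi> u = - sl k (e, hi M e, False) - (\<Sum>t\<in>Z. dv k (em e t))) (dfil (hi M e) False)"
    using sl_near[OF PL dh]
  proof eventually_elim
    case (elim u)
    then have "{z\<in>Z. z \<le> u} = Z" by force
    then show ?case using elim by (simp add: \<phi>_def S_def)
  qed
  obtain t0 where t0: "t0 \<in> I e" "\<phi> t0 = sl k (e, lo M e, True)"
    using eventually_happens'[OF dirs_neq_bot[OF dl] evl] by blast
  obtain u where u: "u \<in> I e" "\<phi> u = - sl k (e, hi M e, False) - (\<Sum>t\<in>Z. dv k (em e t))"
    using eventually_happens'[OF dirs_neq_bot[OF dh] evh] by blast
  show "(\<Sum>t\<in>Z. dv k (em e t)) + sl k (e, lo M e, True) + sl k (e, hi M e, False) = 0"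
    using const[OF t0(1) u(1)] t0(2) u(2) by simp
  show "sl k (e, ereal t, True) = sl k (e, lo M e, True) + (\<Sum>z\<in>{z\<in>Z. z \<le> t}. dv k (em e z))" if "t \<in> I e"
    using const[OF t0(1) that] t0(2) by (simp add: \<phi>_def S_def)
qed

lemmas edge_divergence = edge_slopes(1)
lemmas edge_slope_formula = edge_slopes(2)

text \<open>On each edge the orders add up to minus the outgoing slopes at its two ends. Each end is
  a direction at exactly one vertex, so the orders at the vertices cancel these
  contributions.\<close>

lemma degree_zero:
  assumes PL: "PL k" and X: "finite X" "\<And>x. x \<notin> X \<Longrightarrow> dv k x = 0"
  shows "(\<Sum>x\<in>X. dv k x) = 0"
proof -
  let ?Y = "X \<union> V"
  have finY: "finite ?Y" using X(1) finite_V by simp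
  have edge: "(\<Sum>x\<in>?Y \<inter> e. dv k x) = - (sl k (e, lo M e, True) + sl k (e, hi M e, False))" if e: "e \<in> E" for e
  proof -
    let ?Z = "coord e ` (?Y \<inter> e)"
    have inj: "inj_on (coord e) (?Y \<inter> e)" using em_coord[OF e] by (intro inj_onI) (metis IntD2)
    have "(\<Sum>t\<in>?Z. dv k (em e t)) = (\<Sum>x\<in>?Y \<inter> e. dv k x)"
      unfolding sum.reindex[OF inj] using em_coord[OF e] by (intro sum.cong) auto
    moreover have "(\<Sum>t\<in>?Z. dv k (em e t)) + sl k (e, lo M e, True) + sl k (e, hi M e, False) = 0"
    proof (rule edge_divergence[OF PL e])
      show "?Z \<subseteq> I e" using coord_in[OF e] by auto
      fix t assume t: "t \<in> I e" "t \<notin> ?Z"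
      have "em e t \<notin> ?Y"
      proof
        assume "em e t \<in> ?Y"
        then have "coord e (em e t) \<in> ?Z" using em_in[OF e t(1)] by blast
        then show False using t coord_em[OF e t(1)] by simp
      qed
      then show "dv k (em e t) = 0" using X(2) by simp
    qed (use finY in simp)
    ultimately show ?thesis by simp
  qed
  have "(\<Sum>x\<in>X. dv k x) = (\<Sum>x\<in>?Y. dv k x)"
    using X finY by (intro sum.mono_neutral_left) auto
  also have "\<dots> = (\<Sum>x\<in>V. dv k x) + (\<Sum>x\<in>?Y - V. dv k x)"
    using finY by (subst sum.subset_diff[of V ?Y]) auto
  also have "?Y - V = (\<Union>e\<in>E. ?Y \<inter> e)" using edge_exists edge_subset by blast
  also have "(\<Sum>x\<in>(\<Union>e\<in>E. ?Y \<inter> e). dv k x) = (\<Sum>e\<in>E. \<Sum>x\<in>?Y \<inter> e. dv k x)"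
    using finite_edges finY edge_disjoint by (intro sum.UNION_disjoint) auto
  also have "\<dots> = - (\<Sum>e\<in>E. sl k (e, lo M e, True) + sl k (e, hi M e, False))"
    unfolding sum_negf[symmetric] by (intro sum.cong refl edge)
  also have "(\<Sum>x\<in>V. dv k x) = (\<Sum>v\<in>V. \<Sum>d\<in>{d\<in>ends. target d = v}. sl k d)"
    unfolding dv_def using dirs_at_V by simp
  also have "\<dots> = (\<Sum>d\<in>ends. sl k d)"
    by (rule sum.group) (use finite_edges finite_V ends_target in \<open>auto simp: ends_def\<close>)
  also have "\<dots> = (\<Sum>d\<in>(\<lambda>e. (e, lo M e, True)) ` E. sl k d) + (\<Sum>d\<in>(\<lambda>e. (e, hi M e, False)) ` E. sl k d)"
    unfolding ends_def by (rule sum.union_disjoint) (use finite_edges in auto)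
  also have "(\<Sum>d\<in>(\<lambda>e. (e, lo M e, True)) ` E. sl k d) = (\<Sum>e\<in>E. sl k (e, lo M e, True))"
    by (subst sum.reindex) (auto simp: inj_on_def)
  also have "(\<Sum>d\<in>(\<lambda>e. (e, hi M e, False)) ` E. sl k d) = (\<Sum>e\<in>E. sl k (e, hi M e, False))"
    by (subst sum.reindex) (auto simp: inj_on_def)
  finally show ?thesis by (simp add: sum.distrib)
qed

lemma dlim_ev:
  assumes "dlim k (e, a, s)" "open S" "k (target (e, a, s)) \<in> S"
  shows "eventually (\<lambda>t. k (em e t) \<in> S) (dfil a s)"
  using assms by (auto simp: dlim_def intro: topological_tendstoD)

text \<open>An affine function has a constant sign near an end, infinite or not, so truncation keeps
  the slope or makes it 0.\<close>

lemma slp_max_cases: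
  assumes d: "d \<in> dirs" and sk: "slp k d m"
  shows "slp (\<lambda>x. max (k x) c) d m \<or> slp (\<lambda>x. max (k x) c) d 0"
proof -
  obtain e a s where ds: "d = (e, a, s)" by (cases d) auto
  obtain p where p: "eventually (\<lambda>t. k (em e t) = p + sgb s * of_int m * t) (dfil a s)"
    using sk by (auto simp: slp_def ds)
  consider "eventually (\<lambda>t. (p - c) + (sgb s * of_int m) * t \<ge> 0) (dfil a s)"
    | "eventually (\<lambda>t. (p - c) + (sgb s * of_int m) * t \<le> 0) (dfil a s)"
    using eventually_affine_sign[OF dirs_beyond[OF d[unfolded ds]]] by blast
  then show ?thesis
  proof cases
    case 1
    with p have "eventually (\<lambda>t. max (k (em e t)) c = p + sgb s * of_int m * t) (dfil a s)"
      by eventually_elim auto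
    then show ?thesis by (auto simp: slp_def ds)
  next
    case 2
    with p have "eventually (\<lambda>t. max (k (em e t)) c = c + sgb s * of_int 0 * t) (dfil a s)"
      by eventually_elim auto
    then have "slp (\<lambda>x. max (k x) c) d 0" unfolding slp_def ds by blast
    then show ?thesis ..
  qed
qed

lemma PL_max:
  assumes "PL k" shows "PL (\<lambda>x. max (k x) c)"
  unfolding PL_def
proof (intro ballI conjI impI)
  fix d assume d: "d \<in> dirs"
  show "\<exists>m. slp (\<lambda>x. max (k x) c) d m" using slp_max_cases[OF d PL_slp[OF assms d]] by blast
  show "target d \<notin> inf\<^sub>\<Gamma> \<Longrightarrow> dlim (\<lambda>x. max (k x) c) d" using dlim_max PL_dlim[OF assms d] by blast
qed

lemma sl_max_above:
  assumes PL: "PL k" and d: "d \<in> dirs" "target d \<notin> inf\<^sub>\<Gamma>" "k (target d) > c"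
  shows "sl (\<lambda>x. max (k x) c) d = sl k d"
proof (rule sl_eq[OF d(1)])
  obtain e a s where ds: "d = (e, a, s)" by (cases d) auto
  obtain p where p: "eventually (\<lambda>t. k (em e t) = p + sgb s * of_int (sl k d) * t) (dfil a s)"
    using PL_slp[OF PL d(1)] by (auto simp: slp_def ds)
  have "eventually (\<lambda>t. k (em e t) \<in> {c<..}) (dfil a s)"
    using dlim_ev[of k e a s "{c<..}"] PL_dlim[OF PL d(1,2)] d(3) by (simp add: ds)
  with p have "eventually (\<lambda>t. max (k (em e t)) c = p + sgb s * of_int (sl k d) * t) (dfil a s)"
    by eventually_elim auto
  then show "slp (\<lambda>x. max (k x) c) d (sl k d)" unfolding slp_def ds by auto
qed

lemma sl_max_below:
  assumes PL: "PL k" and d: "d \<in> dirs" "target d \<notin> inf\<^sub>\<Gamma>" "k (target d) < c"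
  shows "sl (\<lambda>x. max (k x) c) d = 0"
proof (rule sl_eq[OF d(1)])
  obtain e a s where ds: "d = (e, a, s)" by (cases d) auto
  have "eventually (\<lambda>t. k (em e t) \<in> {..<c}) (dfil a s)"
    using dlim_ev[of k e a s "{..<c}"] PL_dlim[OF PL d(1,2)] d(3) by (simp add: ds)
  then have "eventually (\<lambda>t. max (k (em e t)) c = c + sgb s * of_int 0 * t) (dfil a s)"
    by eventually_elim auto
  then show "slp (\<lambda>x. max (k x) c) d 0" unfolding slp_def ds by blast
qed

text \<open>At a point of height exactly \<open>c\<close>, rising directions survive the truncation
  and falling ones become flat.\<close>

lemma sl_max_at:
  assumes PL: "PL k" and d: "d \<in> dirs" "target d \<notin> inf\<^sub>\<Gamma>" "k (target d) = c"
  shows "sl (\<lambda>x. max (k x) c) d = max (sl k d) 0"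
proof -
  obtain e a s where ds: "d = (e, a, s)" by (cases d) auto
  obtain \<alpha> where a: "a = ereal \<alpha>" using dirs_real d(1,2) ds by blast
  note dd = d(1)[unfolded ds a]
  obtain \<delta> where \<delta>: "\<delta> > 0" "\<And>\<tau>. 0 < \<tau> \<and> \<tau> < \<delta> \<Longrightarrow> k (em e (\<alpha> + sgb s * \<tau>)) = k (target (e, ereal \<alpha>, s)) + of_int (sl k d) * \<tau>"
    using slp_dlim_real[OF dd, of k "sl k d"] PL_slp[OF PL d(1)] PL_dlim[OF PL d(1,2)] ds a by blast
  have "max (k (em e (\<alpha> + sgb s * \<tau>))) c = max (k (target (e, ereal \<alpha>, s))) c + of_int (max (sl k d) 0) * \<tau>"
    if "0 < \<tau> \<and> \<tau> < \<delta>" for \<tau>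
    using \<delta>(2)[OF that] d(3) that unfolding ds a by (cases "sl k (e, ereal \<alpha>, s) \<ge> 0") (auto simp: max_def mult_le_0_iff)
  then have "slp (\<lambda>x. max (k x) c) (e, ereal \<alpha>, s) (max (sl k d) 0)"
    using slp_dlim_real[OF dd, of "\<lambda>x. max (k x) c" "max (sl k d) 0"] \<delta>(1) by blast
  then show ?thesis using sl_eq[OF d(1)] unfolding ds a by blast
qed

text \<open>Truncating below at the value \<open>c = k x\<close> turns the degree formula into a bound for the
  slopes at \<open>x\<close>.\<close>

lemma slope_bound:
  assumes PL: "PL k" and D: "divisor D" and eff: "\<And>x. 0 \<le> D x + dv k x"
    and d: "d \<in> dirs" "target d \<notin> inf\<^sub>\<Gamma>"
  shows "sl k d \<le> (\<Sum>x\<in>supp D. max 0 (D x))"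
proof -
  define x where "x = target d"
  define c where "c = k x"
  define g where "g = (\<lambda>x. max (k x) c)"
  have PLg: "PL g" unfolding g_def by (rule PL_max[OF PL])
  have noninf: "dv g y = dv k y \<and> k y > c \<or> dv g y = (\<Sum>d\<in>dirs_at y. max (sl k d) 0) \<and> k y = c \<or> dv g y = 0" if y: "y \<notin> inf\<^sub>\<Gamma>" for y
  proof -
    have t: "d \<in> dirs" "target d = y" if "d \<in> dirs_at y" for d using that dirs_at_iff by auto
    consider "k y > c" | "k y = c" | "k y < c" by linarith
    then show ?thesis
    proof cases
      case 1
      then have "dv g y = dv k y" unfolding dv_def g_def
        using sl_max_above[OF PL] t y by (intro sum.cong) auto
      then show ?thesis using 1 by simp
    next
      case 2
      then have "dv g y = (\<Sum>d\<in>dirs_at y. max (sl k d) 0)" unfolding dv_def g_def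
        using sl_max_at[OF PL] t y by (intro sum.cong) auto
      then show ?thesis using 2 by simp
    next
      case 3
      then have "dv g y = 0" unfolding dv_def g_def
        using sl_max_below[OF PL] t y by (intro sum.neutral) auto
      then show ?thesis by simp
    qed
  qed
  \<comment> \<open>Above height \<open>c\<close> the divisor of \<open>g\<close> is that of
    \<open>k\<close>, which is at least \<open>- D\<close>; at height \<open>c\<close> it is a sum
    of rising slopes, and below it vanishes. At infinity the one slope is kept or becomes 0.\<close>
  have lower: "dv g y \<ge> - max 0 (D y)" for y
  proof (cases "y \<in> inf\<^sub>\<Gamma>")
    case True
    then obtain e a s where Dy: "dirs_at y = {(e, a, s)}" by (rule dirs_at_inf)
    let ?d = "(e, a, s)"
    have dd: "?d \<in> dirs" using Dy dirs_at_dirs by blast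
    have "sl g ?d = sl k ?d \<or> sl g ?d = 0" unfolding g_def
      using slp_max_cases[OF dd PL_slp[OF PL dd]] sl_eq[OF dd] by blast
    then have "dv g y = dv k y \<or> dv g y = 0" unfolding dv_def Dy by simp
    then show ?thesis using eff[of y] by auto
  next
    case False
    have "(\<Sum>d\<in>dirs_at y. max (sl k d) 0) \<ge> 0" by (intro sum_nonneg) auto
    then show ?thesis using noninf[OF False] eff[of y] by linarith
  qed
  have dx: "d \<in> dirs_at x" using dirs_at_target[OF d(1)] by (simp add: x_def)
  have "dv g x = (\<Sum>d\<in>dirs_at x. sl g d)" by (simp add: dv_def)
  also have "\<dots> = (\<Sum>d\<in>dirs_at x. max (sl k d) 0)" unfolding g_def
    using sl_max_at[OF PL] d(2) dirs_at_iff by (intro sum.cong) (auto simp: c_def x_def)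
  finally have "dv g x = (\<Sum>d\<in>dirs_at x. max (sl k d) 0)" .
  moreover have "max (sl k d) 0 \<le> (\<Sum>d\<in>dirs_at x. max (sl k d) 0)"
    using finite_dirs_at dx by (intro member_le_sum) auto
  ultimately have gx: "sl k d \<le> dv g x" by linarith
  let ?X = "{x} \<union> {y. dv g y \<noteq> 0} \<union> supp D"
  have finX: "finite ?X" using finite_dv_support[OF PLg] D by (simp add: divisor_def)
  have "0 = (\<Sum>y\<in>?X. dv g y)" using degree_zero[OF PLg finX] by auto
  \<comment> \<open>The total degree of \<open>g\<close> is 0, so the zeros at \<open>x\<close>,
    which include the slope to be bounded, are paid for by poles, and these are bounded by
    \<open>D\<close>.\<close>
  also have "\<dots> = dv g x + (\<Sum>y\<in>?X - {x}. dv g y)" using finX by (subst sum.remove[of _ x]) auto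
  finally have 1: "0 = dv g x + (\<Sum>y\<in>?X - {x}. dv g y)" .
  have 2: "(\<Sum>y\<in>?X - {x}. - max 0 (D y)) \<le> (\<Sum>y\<in>?X - {x}. dv g y)"
    using lower by (intro sum_mono) auto
  have "(\<Sum>y\<in>?X - {x}. max 0 (D y)) \<le> (\<Sum>y\<in>?X. max 0 (D y))" using finX by (intro sum_mono2) auto
  also have "\<dots> = (\<Sum>y\<in>supp D. max 0 (D y))" using finX by (intro sum.mono_neutral_right) (auto simp: supp_def)
  finally have 3: "- (\<Sum>y\<in>supp D. max 0 (D y)) \<le> (\<Sum>y\<in>?X - {x}. - max 0 (D y))" by (simp add: sum_negf)
  show ?thesis using gx 1 2 3 by linarith
qed

section \<open>Locally constant functions and uniqueness up to constants\<close>

lemma not_eventually_inf: "\<not> eventually (\<lambda>z. z \<in> inf\<^sub>\<Gamma>) (nhds y)"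
proof
  assume ev: "eventually (\<lambda>z. z \<in> inf\<^sub>\<Gamma>) (nhds y)"
  then have "y \<in> inf\<^sub>\<Gamma>" by (rule eventually_nhds_x_imp_x)
  then obtain e a s where Dy: "dirs_at y = {(e, a, s)}" by (rule dirs_at_inf)
  have d: "(e, a, s) \<in> dirs_at y" using Dy by simp
  note dd = dirs_at_dirs[OF d]
  have "eventually (\<lambda>t. em e t \<in> inf\<^sub>\<Gamma>) (dfil a s)" using dirs_at_ev[OF d ev] by (simp add: dir_ev_def)
  then have "eventually (\<lambda>t. False) (dfil a s)" using dirs_ev_I[OF dd]
    by eventually_elim (use em_not_inf[OF dirs_edge[OF dd]] in blast)
  then show False using dirs_neq_bot[OF dd] by (simp add: trivial_limit_def)
qed

text \<open>The constant near \<open>x\<close> is determined by finite points, which accumulate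
  everywhere by \<open>not_eventually_inf\<close>. As a function of \<open>x\<close> it is locally
  constant, hence constant on \<open>S\<close>.\<close>

lemma locally_constant_imp_constant:
  assumes S: "connected S" "open S" and loc: "\<And>x. x \<in> S \<Longrightarrow> \<exists>c. eventually (\<lambda>y. y \<notin> inf\<^sub>\<Gamma> \<longrightarrow> h y = c) (nhds x)"
  shows "\<exists>c. \<forall>x\<in>S - inf\<^sub>\<Gamma>. h x = c"
proof (cases "S = {}")
  case False
  then obtain x0 where x0: "x0 \<in> S" by blast
  define C where "C x = (SOME c. eventually (\<lambda>y. y \<notin> inf\<^sub>\<Gamma> \<longrightarrow> h y = c) (nhds x))" for x
  have C: "eventually (\<lambda>y. y \<notin> inf\<^sub>\<Gamma> \<longrightarrow> h y = C x) (nhds x)" if "x \<in> S" for x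
    unfolding C_def by (rule someI_ex[OF loc[OF that]])
  have uniq: "c = c'" if "eventually (\<lambda>y. y \<notin> inf\<^sub>\<Gamma> \<longrightarrow> h y = c) (nhds x)" "eventually (\<lambda>y. y \<notin> inf\<^sub>\<Gamma> \<longrightarrow> h y = c') (nhds x)" for x c c'
  proof (rule ccontr)
    assume "c \<noteq> c'"
    have "eventually (\<lambda>y. y \<in> inf\<^sub>\<Gamma>) (nhds x)" using that by eventually_elim (use \<open>c \<noteq> c'\<close> in auto)
    then show False using not_eventually_inf by blast
  qed
  have "\<forall>a\<in>S. eventually (\<lambda>b. C a = C b) (at a within S)"
  proof
    fix a assume a: "a \<in> S"
    have "eventually (\<lambda>b. eventually (\<lambda>y. y \<notin> inf\<^sub>\<Gamma> \<longrightarrow> h y = C a) (nhds b)) (nhds a)"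
      using C[OF a] by (subst eventually_eventually)
    then have "eventually (\<lambda>b. b \<in> S \<longrightarrow> C a = C b) (nhds a)"
      by eventually_elim (use C uniq in blast)
    then show "eventually (\<lambda>b. C a = C b) (at a within S)"
      unfolding eventually_at_filter by eventually_elim auto
  qed
  then have const: "C x = C x0" if "x \<in> S" for x using connected_local_const[OF S(1) that x0] by blast
  have "h x = C x0" if "x \<in> S - inf\<^sub>\<Gamma>" for x
    using eventually_nhds_x_imp_x[OF C, of x] that const[of x] by auto
  then show ?thesis by blast
qed auto

lemma slope_zero_locally_constant:
  assumes PL: "PL h" and z: "\<And>d. d \<in> dirs_at x \<Longrightarrow> sl h d = 0"
  shows "\<exists>c. eventually (\<lambda>y. y \<notin> inf\<^sub>\<Gamma> \<longrightarrow> h y = c) (nhds x)"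
proof -
  have slp0: "\<exists>c. eventually (\<lambda>t. h (em e t) = c) (dfil a s)" if "(e, a, s) \<in> dirs_at x" for e a s
    using PL_slp[OF PL dirs_at_dirs[OF that]] z[OF that] by (simp add: slp_def)
  show ?thesis
  proof (cases "x \<in> inf\<^sub>\<Gamma>")
    case True
    then obtain e a s where Dy: "dirs_at x = {(e, a, s)}" by (rule dirs_at_inf)
    obtain c where c: "eventually (\<lambda>t. h (em e t) = c) (dfil a s)" using slp0 Dy by blast
    have "eventually (\<lambda>y. y \<notin> inf\<^sub>\<Gamma> \<longrightarrow> h y = c) (nhds x)"
      by (rule eventually_nhdsI) (use True Dy c in \<open>auto simp: dir_ev_def elim: eventually_mono\<close>)
    then show ?thesis by blast
  next
    case False
    have "eventually (\<lambda>y. h y = h x) (nhds x)"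
    proof (rule eventually_nhdsI)
      fix d assume dx: "d \<in> dirs_at x"
      obtain e a s where ds: "d = (e, a, s)" by (cases d) auto
      note dd = dirs_at_dirs[OF dx, unfolded ds]
      obtain c where c: "eventually (\<lambda>t. h (em e t) = c) (dfil a s)" using slp0 dx ds by blast
      have "((\<lambda>t. h (em e t)) \<longlongrightarrow> h x) (dfil a s)"
        using PL_dlim[OF PL dd] target_eq[OF dx] False by (simp add: ds dlim_def)
      moreover have "((\<lambda>t. h (em e t)) \<longlongrightarrow> c) (dfil a s)"
        by (rule tendsto_eventually[OF c])
      ultimately have "h x = c" using tendsto_unique[OF dirs_neq_bot[OF dd]] by blast
      then show "dir_ev (\<lambda>y. h y = h x) d" using c by (simp add: dir_ev_def ds)
    qed simp
    then show ?thesis by (intro exI[of _ "h x"]) (auto elim: eventually_mono)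
  qed
qed

text \<open>A maximum principle: \<open>slope_bound\<close> with the zero divisor makes all outgoing
  slopes at finite points nonpositive, and as they sum to 0 they vanish. At infinity the single
  slope is the order itself.\<close>

lemma harmonic_constant:
  assumes PL: "PL h" and z: "\<And>x. dv h x = 0"
  shows "\<exists>c. \<forall>x. x \<notin> inf\<^sub>\<Gamma> \<longrightarrow> h x = c"
proof -
  have le: "sl h d \<le> 0" if "d \<in> dirs" "target d \<notin> inf\<^sub>\<Gamma>" for d
  proof -
    have "sl h d \<le> (\<Sum>x\<in>supp (\<lambda>_::'a. 0). max 0 0)" 
      by (rule slope_bound[OF PL _ _ that]) (auto simp: divisor_def supp_def z)
    then show ?thesis by simp
  qed
  have "sl h d = 0" if dx: "d \<in> dirs_at x" for d x
  proof (cases "x \<in> inf\<^sub>\<Gamma>")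
    case True
    then obtain e a s where "dirs_at x = {(e, a, s)}" by (rule dirs_at_inf)
    then show ?thesis using z[of x] dx by (simp add: dv_def)
  next
    case False
    have "(\<Sum>d\<in>dirs_at x. - sl h d) = 0" using z[of x] by (simp add: dv_def sum_negf)
    moreover have "0 \<le> - sl h d'" if "d' \<in> dirs_at x" for d' using le that False dirs_at_iff by auto
    ultimately have "\<forall>d'\<in>dirs_at x. - sl h d' = 0"
      using sum_nonneg_eq_0_iff[OF finite_dirs_at, of x "\<lambda>d. - sl h d"] by simp
    then show ?thesis using dx by simp
  qed
  then have "\<exists>c. \<forall>x\<in>UNIV - inf\<^sub>\<Gamma>. h x = c"
    by (intro locally_constant_imp_constant[OF connected_UNIV] slope_zero_locally_constant[OF PL]) auto
  then show ?thesis by auto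
qed

lemma rational_determined:
  assumes "rational_function \<Gamma> f" "rational_function \<Gamma> g" "\<And>x. x \<notin> inf\<^sub>\<Gamma> \<Longrightarrow> g x = ereal c + f x"
  shows "g = trop_scale c f"
proof
  fix x show "g x = trop_scale c f x"
  proof (cases "x \<in> inf\<^sub>\<Gamma>")
    case True
    then obtain e a s where Dy: "dirs_at x = {(e, a, s)}" by (rule dirs_at_inf)
    have dx: "(e, a, s) \<in> dirs_at x" using Dy by simp
    note dd = dirs_at_dirs[OF dx]
    have "((\<lambda>t. ereal c + f (em e t)) \<longlongrightarrow> ereal c + f x) (dfil a s)"
      using rational_lim[OF assms(1) dd] target_eq[OF dx] by (intro tendsto_ereal_add_const) simp
    moreover have "eventually (\<lambda>t. ereal c + f (em e t) = g (em e t)) (dfil a s)"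
      using dirs_ev_I[OF dd] by eventually_elim (use em_not_inf[OF dirs_edge[OF dd]] assms(3) in auto)
    ultimately have "((\<lambda>t. g (em e t)) \<longlongrightarrow> ereal c + f x) (dfil a s)" by (rule Lim_transform_eventually)
    moreover have "((\<lambda>t. g (em e t)) \<longlongrightarrow> g x) (dfil a s)"
      using rational_lim[OF assms(2) dd] target_eq[OF dx] by simp
    ultimately show ?thesis using tendsto_unique[OF dirs_neq_bot[OF dd]] by (simp add: trop_scale_def)
  qed (use assms(3) in \<open>simp add: trop_scale_def\<close>)
qed

lemma same_divisor_scale:
  assumes f: "f \<in> RR \<Gamma> D" and g: "g \<in> RR \<Gamma> D" and eq: "principal \<Gamma> f = principal \<Gamma> g"
  obtains c where "g = trop_scale c f"
proof -
  note F = RR_D[OF f] and G = RR_D[OF g]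
  have "dv (\<lambda>x. rl g x - rl f x) x = 0" for x
    using dv_diff[OF G(2) F(2)] F(4) G(4) eq by simp
  then obtain c where c: "\<And>x. x \<notin> inf\<^sub>\<Gamma> \<Longrightarrow> rl g x - rl f x = c"
    using harmonic_constant[OF PL_diff[OF G(2) F(2)]] by blast
  have "g x = ereal c + f x" if "x \<notin> inf\<^sub>\<Gamma>" for x
    using c[OF that] ereal_rl[OF F(3) that] ereal_rl[OF G(3) that] by (metis add.commute diff_add_cancel plus_ereal.simps(1))
  then show ?thesis using rational_determined[OF F(1) G(1)] that by blast
qed

lemma degree_RR:
  assumes D: "divisor D" and f: "f \<in> RR \<Gamma> D" and X: "finite X" "supp (D + principal \<Gamma> f) \<subseteq> X"
  shows "(\<Sum>x\<in>X. (D + principal \<Gamma> f) x) = (\<Sum>x\<in>supp D. D x)" and "finite (supp (D + principal \<Gamma> f))"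
proof -
  note F = RR_D[OF f]
  let ?E = "D + principal \<Gamma> f"
  let ?Y = "X \<union> supp D \<union> {x. dv (rl f) x \<noteq> 0}"
  have finY: "finite ?Y" using X(1) D finite_dv_support[OF F(2)] by (simp add: divisor_def)
  have "(\<Sum>x\<in>X. ?E x) = (\<Sum>x\<in>?Y. ?E x)" using finY X(2) by (intro sum.mono_neutral_left) (auto simp: supp_def)
  also have "\<dots> = (\<Sum>x\<in>?Y. D x) + (\<Sum>x\<in>?Y. dv (rl f) x)" by (simp add: F(4) sum.distrib)
  also have "(\<Sum>x\<in>?Y. dv (rl f) x) = 0" using finY by (intro degree_zero[OF F(2)]) auto
  also have "(\<Sum>x\<in>?Y. D x) = (\<Sum>x\<in>supp D. D x)" using finY by (intro sum.mono_neutral_right) (auto simp: supp_def)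
  finally show "(\<Sum>x\<in>X. ?E x) = (\<Sum>x\<in>supp D. D x)" by simp
  show "finite (supp ?E)" using X finite_subset by blast
qed

lemma finite_supp_RR:
  assumes "divisor D" "f \<in> RR \<Gamma> D"
  shows "finite (supp (D + principal \<Gamma> f))"
proof -
  have "supp (D + principal \<Gamma> f) \<subseteq> supp D \<union> {x. dv (rl f) x \<noteq> 0}"
    using RR_D(4)[OF assms(2)] by (auto simp: supp_def)
  then show ?thesis using assms(1) finite_dv_support[OF RR_D(2)[OF assms(2)]] by (auto simp: divisor_def intro: finite_subset)
qed

end

section \<open>Cells\<close>

lemma vector_space_fun: "vector_space (\<lambda>(a::real) (x::'p \<Rightarrow> real) p. a * x p)"
  by unfold_locales (auto simp: fun_eq_iff algebra_simps)

lemma dim_fun_zero: "vector_space.dim (\<lambda>(a::real) (x::'p \<Rightarrow> real) p. a * x p) {0} = 0"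
proof -
  interpret vs: vector_space "\<lambda>(a::real) (x::'p \<Rightarrow> real) p. a * x p" by (rule vector_space_fun)
  have "card ({} :: ('p \<Rightarrow> real) set) = vs.dim {0}"
    by (rule vs.basis_card_eq_dim) (auto simp: vs.span_empty vs.independent_empty)
  then show ?thesis by simp
qed

text \<open>The finite set \<open>J\<close> of relevant coordinates guarantees a finite basis; an
  infinite one would also have \<open>card\<close> equal to 0.\<close>

lemma dim_fun_zero_imp:
  fixes S :: "('p \<Rightarrow> real) set"
  assumes "finite J" "\<And>x p. x \<in> S \<Longrightarrow> p \<notin> J \<Longrightarrow> x p = 0"
    and dim: "vector_space.dim (\<lambda>(a::real) (x::'p \<Rightarrow> real) p. a * x p) S = 0" and x: "x \<in> S"
  shows "x = 0"
proof -
  interpret vs: vector_space "\<lambda>(a::real) (x::'p \<Rightarrow> real) p. a * x p" by (rule vector_space_fun)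
  define unit where "unit j = (\<lambda>p::'p. if p = j then 1 else 0 :: real)" for j
  have "y \<in> vs.span (unit ` J)" if y: "y \<in> S" for y
  proof -
    have "y = (\<Sum>j\<in>J. (\<lambda>p. y j * unit j p))"
    proof
      fix p
      have "(\<Sum>j\<in>J. (\<lambda>p. y j * unit j p)) p = (\<Sum>j\<in>J. y j * unit j p)"
        using assms(1) by (induction J rule: finite_induct) auto
      also have "\<dots> = (\<Sum>j\<in>J. if p = j then y j else 0)" by (intro sum.cong) (auto simp: unit_def)
      also have "\<dots> = y p" using assms(1) assms(2)[OF y, of p] by (simp add: sum.delta')
      finally show "y p = (\<Sum>j\<in>J. (\<lambda>p. y j * unit j p)) p" by simp
    qed
    moreover have "(\<Sum>j\<in>J. (\<lambda>p. y j * unit j p)) \<in> vs.span (unit ` J)"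
      by (intro vs.span_sum vs.span_scale vs.span_base) auto
    ultimately show ?thesis by simp
  qed
  then have sub: "S \<subseteq> vs.span (unit ` J)" by blast
  obtain B where B: "B \<subseteq> S" "vs.independent B" "S \<subseteq> vs.span B"
    using vs.maximal_independent_subset by blast
  have "finite B" using vs.independent_span_bound[of "unit ` J" B] B sub assms(1) by auto
  moreover have "card B = 0" using vs.basis_card_eq_dim[OF B(1,3,2)] dim by simp
  ultimately have "B = {}" by simp
  then show ?thesis using B(3) x by (auto simp: vs.span_empty)
qed

context curve_model
begin

lemma ends_lo: "e \<in> E \<Longrightarrow> (e, lo M e, True) \<in> ends" and ends_hi: "e \<in> E \<Longrightarrow> (e, hi M e, False) \<in> ends"
  by (auto simp: ends_def)

lemma dirs_lo: "e \<in> E \<Longrightarrow> (e, lo M e, True) \<in> dirs" and dirs_hi: "e \<in> E \<Longrightarrow> (e, hi M e, False) \<in> dirs"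
  using ends_lo ends_hi ends_dirs by auto

text \<open>Translates the condition "below some parameter of the edge" in
  \<open>start_slope\<close> into the filter at the lower end.\<close>

lemma eventually_lo:
  assumes e: "e \<in> E"
  shows "eventually P (dfil (lo M e) True) \<longleftrightarrow> (\<exists>b\<in>I e. \<forall>t\<in>I e. t < b \<longrightarrow> P t)"
proof
  note d = dirs_lo[OF e]
  assume "eventually P (dfil (lo M e) True)"
  then obtain b where b: "beyond (lo M e) True (ereal b)" "\<forall>t\<in>seg (lo M e) True b. P t"
    unfolding eventually_dfil[OF dirs_beyond[OF d]] by blast
  have "eventually (\<lambda>t. t \<in> I e \<and> t \<in> seg (lo M e) True b) (dfil (lo M e) True)"
    using dirs_ev_I[OF d] eventually_dfil_seg[OF b(1)] by eventually_elim simp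
  then obtain t0 where t0: "t0 \<in> I e" "t0 \<in> seg (lo M e) True b"
    using eventually_happens'[OF dirs_neq_bot[OF d]] by blast
  have "P t" if "t \<in> I e" "t < t0" for t
    using b(2) that t0 by (auto simp: seg_def edge_interval_def)
  then show "\<exists>b\<in>I e. \<forall>t\<in>I e. t < b \<longrightarrow> P t" using t0(1) by blast
next
  note d = dirs_lo[OF e]
  assume "\<exists>b\<in>I e. \<forall>t\<in>I e. t < b \<longrightarrow> P t"
  then obtain b where b: "b \<in> I e" "\<And>t. t \<in> I e \<Longrightarrow> t < b \<Longrightarrow> P t" by blast
  have "lo M e < ereal b" using b(1) by (simp add: edge_interval_def)
  from eventually_dfil_less[OF dirs_beyond[OF d] this] dirs_ev_I[OF d]
  show "eventually P (dfil (lo M e) True)" by eventually_elim (use b(2) in auto)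
qed

lemma start_slope_iff:
  assumes f: "fin_off_inf f" "PL (rl f)" and e: "e \<in> E"
  shows "start_slope M f e m \<longleftrightarrow> sl (rl f) (e, lo M e, True) = m"
proof -
  have "start_slope M f e m \<longleftrightarrow> (\<exists>c. eventually (\<lambda>t. f (em e t) = ereal (c + of_int m * t)) (dfil (lo M e) True))"
    unfolding eventually_lo[OF e] start_slope_def by blast
  also have "\<dots> \<longleftrightarrow> slp (rl f) (e, lo M e, True) m"
  proof -
    have "eventually (\<lambda>t. f (em e t) = ereal (rl f (em e t))) (dfil (lo M e) True)"
      using dirs_ev_I[OF dirs_lo[OF e]] by eventually_elim (use ereal_rl[OF f(1)] em_not_inf[OF e] in blast)
    then have "eventually (\<lambda>t. f (em e t) = ereal (c + of_int m * t)) (dfil (lo M e) True) \<longleftrightarrow>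
       eventually (\<lambda>t. rl f (em e t) = c + sgb True * of_int m * t) (dfil (lo M e) True)" for c
      by (intro eventually_subst) (auto elim!: eventually_mono)
    then show ?thesis by (simp add: slp_def)
  qed
  also have "\<dots> \<longleftrightarrow> sl (rl f) (e, lo M e, True) = m"
    using sl_eq[OF dirs_lo[OF e]] PL_slp[OF f(2) dirs_lo[OF e]] by blast
  finally show ?thesis .
qed

lemma interior_slopes:
  assumes PL: "PL k" and e: "e \<in> E" and Z: "finite Z" "Z \<subseteq> I e" "\<And>t. t \<in> I e \<Longrightarrow> t \<notin> Z \<Longrightarrow> dv k (em e t) = 0"
    and t: "t \<in> I e"
  shows "sl k (e, ereal t, True) = sl k (e, lo M e, True) + (\<Sum>z\<in>{z\<in>Z. z \<le> t}. dv k (em e z))"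
    and "sl k (e, ereal t, False) = - sl k (e, lo M e, True) - (\<Sum>z\<in>{z\<in>Z. z < t}. dv k (em e z))"
proof -
  show 1: "sl k (e, ereal t, True) = sl k (e, lo M e, True) + (\<Sum>z\<in>{z\<in>Z. z \<le> t}. dv k (em e z))"
    using edge_slope_formula[OF PL e Z t] .
  have "(\<Sum>z\<in>{z\<in>Z. z \<le> t}. dv k (em e z)) = (\<Sum>z\<in>{z\<in>Z. z < t}. dv k (em e z)) + dv k (em e t)"
  proof (cases "t \<in> Z")
    case True
    have "{z\<in>Z. z \<le> t} - {t} = {z\<in>Z. z < t}" by auto
    then show ?thesis using Z(1) True by (subst sum.remove[of _ t]) auto
  next
    case False
    then have "{z\<in>Z. z \<le> t} = {z\<in>Z. z < t}" by (auto simp: order_le_less)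
    then show ?thesis using Z(3)[OF t False] by simp
  qed
  then show "sl k (e, ereal t, False) = - sl k (e, lo M e, True) - (\<Sum>z\<in>{z\<in>Z. z < t}. dv k (em e z))"
    using 1 dv_I[OF e t, of k] by simp
qed

text \<open>On an edge, a function is its initial affine part plus one ramp for each jump: after
  subtracting these, slopes to both sides vanish everywhere and a locally constant function is
  left.\<close>

lemma edge_formula:
  assumes PL: "PL k" and e: "e \<in> E" and Z: "finite Z" "Z \<subseteq> I e" "\<And>t. t \<in> I e \<Longrightarrow> t \<notin> Z \<Longrightarrow> dv k (em e t) = 0"
  shows "\<exists>c. \<forall>t\<in>I e. k (em e t) = c + of_int (sl k (e, lo M e, True)) * t + (\<Sum>z\<in>Z. of_int (dv k (em e z)) * max 0 (t - z))"
proof -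
  define A where "A = sl k (e, lo M e, True)"
  define W where "W t = (\<Sum>z\<in>Z. of_int (dv k (em e z)) * max 0 (t - z))" for t :: real
  define u where "u t = k (em e t) - of_int A * t - W t" for t
  have real: "\<exists>\<delta>>0. \<forall>\<tau>. 0 < \<tau> \<and> \<tau> < \<delta> \<longrightarrow> k (em e (t + sgb s * \<tau>)) = k (em e t) + of_int (sl k (e, ereal t, s)) * \<tau>" if t: "t \<in> I e" for t s
  proof -
    have d: "(e, ereal t, s) \<in> dirs" by (rule dirs_I[OF e t])
    have "target (e, ereal t, s) = em e t" by (rule target_I[OF e t])
    moreover have "em e t \<notin> inf\<^sub>\<Gamma>" by (rule em_not_inf[OF e t])
    ultimately show ?thesis using slp_dlim_real[OF d, of k] PL_slp[OF PL d] PL_dlim[OF PL d] by auto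
  qed
  have Wr: "\<exists>\<delta>>0. \<forall>\<tau>. 0 < \<tau> \<and> \<tau> < \<delta> \<longrightarrow> W (t + \<tau>) = W t + of_int (\<Sum>z\<in>{z\<in>Z. z \<le> t}. dv k (em e z)) * \<tau>" for t
  proof -
    \<comment> \<open>Up to the next jump the set of active ramps does not change.\<close>
    define \<delta> where "\<delta> = Min (insert 1 ((\<lambda>z. z - t) ` {z\<in>Z. t < z}))"
    have \<delta>: "\<delta> > 0" "\<And>z. z \<in> Z \<Longrightarrow> t < z \<Longrightarrow> \<delta> \<le> z - t" using Z(1) by (auto simp: \<delta>_def)
    have "W (t + \<tau>) = W t + of_int (\<Sum>z\<in>{z\<in>Z. z \<le> t}. dv k (em e z)) * \<tau>" if \<tau>: "0 < \<tau>" "\<tau> < \<delta>" for \<tau>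
    proof -
      have "W (t + \<tau>) - W t = (\<Sum>z\<in>Z. of_int (dv k (em e z)) * (max 0 (t + \<tau> - z) - max 0 (t - z)))"
        unfolding W_def sum_subtractf[symmetric] by (simp add: algebra_simps)
      also have "\<dots> = (\<Sum>z\<in>Z. if z \<le> t then of_int (dv k (em e z)) * \<tau> else 0)"
        using \<delta>(2) \<tau> by (intro sum.cong refl) force
      also have "\<dots> = of_int (\<Sum>z\<in>{z\<in>Z. z \<le> t}. dv k (em e z)) * \<tau>"
        using Z(1) by (simp add: sum.If_cases Int_def sum_distrib_right)
      finally show ?thesis by simp
    qed
    then show ?thesis using \<delta>(1) by blast
  qed
  have Wl: "\<exists>\<delta>>0. \<forall>\<tau>. 0 < \<tau> \<and> \<tau> < \<delta> \<longrightarrow> W (t - \<tau>) = W t - of_int (\<Sum>z\<in>{z\<in>Z. z < t}. dv k (em e z)) * \<tau>" for t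
  proof -
    define \<delta> where "\<delta> = Min (insert 1 ((\<lambda>z. t - z) ` {z\<in>Z. z < t}))"
    have \<delta>: "\<delta> > 0" "\<And>z. z \<in> Z \<Longrightarrow> z < t \<Longrightarrow> \<delta> \<le> t - z" using Z(1) by (auto simp: \<delta>_def)
    have "W (t - \<tau>) = W t - of_int (\<Sum>z\<in>{z\<in>Z. z < t}. dv k (em e z)) * \<tau>" if \<tau>: "0 < \<tau>" "\<tau> < \<delta>" for \<tau>
    proof -
      have "W t - W (t - \<tau>) = (\<Sum>z\<in>Z. of_int (dv k (em e z)) * (max 0 (t - z) - max 0 (t - \<tau> - z)))"
        unfolding W_def sum_subtractf[symmetric] by (simp add: algebra_simps)
      also have "\<dots> = (\<Sum>z\<in>Z. if z < t then of_int (dv k (em e z)) * \<tau> else 0)"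
        using \<delta>(2) \<tau> by (intro sum.cong refl) force
      also have "\<dots> = of_int (\<Sum>z\<in>{z\<in>Z. z < t}. dv k (em e z)) * \<tau>"
        using Z(1) by (simp add: sum.If_cases Int_def sum_distrib_right)
      finally show ?thesis by simp
    qed
    then show ?thesis using \<delta>(1) by blast
  qed
  have "eventually (\<lambda>s. u t = u s) (at t within I e)" if t: "t \<in> I e" for t
  proof -
    have "eventually (\<lambda>s. u t = u s) (dfil (ereal t) True)"
    proof -
      obtain \<delta>1 where 1: "\<delta>1 > 0" "\<And>\<tau>. 0 < \<tau> \<and> \<tau> < \<delta>1 \<Longrightarrow> k (em e (t + sgb True * \<tau>)) = k (em e t) + of_int (sl k (e, ereal t, True)) * \<tau>"
        using real[OF t, of True] by blast
      obtain \<delta>2 where 2: "\<delta>2 > 0" "\<And>\<tau>. 0 < \<tau> \<and> \<tau> < \<delta>2 \<Longrightarrow> W (t + \<tau>) = W t + of_int (\<Sum>z\<in>{z\<in>Z. z \<le> t}. dv k (em e z)) * \<tau>"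
        using Wr[of t] by blast
      have "u t = u (t + sgb True * \<tau>)" if "0 < \<tau> \<and> \<tau> < min \<delta>1 \<delta>2" for \<tau>
        using 1(2)[of \<tau>] 2(2)[of \<tau>] that interior_slopes(1)[OF PL e Z t]
        by (simp add: u_def A_def algebra_simps)
      then show ?thesis unfolding eventually_dfil_real using 1(1) 2(1) by (intro exI[of _ "min \<delta>1 \<delta>2"]) auto
    qed
    moreover have "eventually (\<lambda>s. u t = u s) (dfil (ereal t) False)"
    proof -
      obtain \<delta>1 where 1: "\<delta>1 > 0" "\<And>\<tau>. 0 < \<tau> \<and> \<tau> < \<delta>1 \<Longrightarrow> k (em e (t + sgb False * \<tau>)) = k (em e t) + of_int (sl k (e, ereal t, False)) * \<tau>"
        using real[OF t, of False] by blast
      obtain \<delta>2 where 2: "\<delta>2 > 0" "\<And>\<tau>. 0 < \<tau> \<and> \<tau> < \<delta>2 \<Longrightarrow> W (t - \<tau>) = W t - of_int (\<Sum>z\<in>{z\<in>Z. z < t}. dv k (em e z)) * \<tau>"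
        using Wl[of t] by blast
      have "u t = u (t + sgb False * \<tau>)" if "0 < \<tau> \<and> \<tau> < min \<delta>1 \<delta>2" for \<tau>
        using 1(2)[of \<tau>] 2(2)[of \<tau>] that interior_slopes(2)[OF PL e Z t]
        by (simp add: u_def A_def algebra_simps)
      then show ?thesis unfolding eventually_dfil_real using 1(1) 2(1) by (intro exI[of _ "min \<delta>1 \<delta>2"]) auto
    qed
    ultimately have "eventually (\<lambda>s. u t = u s) (nhds t)" unfolding nhds_real_dfil by simp
    then show ?thesis unfolding eventually_at_filter by eventually_elim simp
  qed
  then have const: "u t = u s" if "t \<in> I e" "s \<in> I e" for t s
    using connected_local_const[OF I_connected that] by blast
  obtain t0 where "t0 \<in> I e" using I_nonempty[OF e] by blast
  then have "k (em e t) = u t0 + of_int A * t + W t" if "t \<in> I e" for t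
    using const[OF that, of t0] by (simp add: u_def)
  then show ?thesis unfolding A_def W_def by blast
qed

definition chips :: "('a \<Rightarrow> int) \<Rightarrow> ('a \<Rightarrow> ereal) \<Rightarrow> 'a set" where
  "chips D f = supp (D + principal \<Gamma> f) - V"

text \<open>These functions lie between the two sets of the theorem and already generate the semi-module.\<close>

definition connected_functions :: "('a \<Rightarrow> int) \<Rightarrow> ('a \<Rightarrow> ereal) set" where
  "connected_functions D = {f \<in> RR \<Gamma> D. connected (- chips D f)}"

lemma no_smooth_cut_subset: "no_smooth_cut_functions \<Gamma> D \<subseteq> connected_functions D"
proof
  fix f assume f: "f \<in> no_smooth_cut_functions \<Gamma> D"
  have "has_valence \<Gamma> x 2" if "x \<in> chips D f" for x
    using is_model that unfolding model_def chips_def by blast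
  then have "smooth_set \<Gamma> (chips D f)" by (simp add: smooth_set_def)
  moreover have "chips D f \<subseteq> supp (D + principal \<Gamma> f)" by (auto simp: chips_def)
  ultimately show "f \<in> connected_functions D"
    using f by (auto simp: no_smooth_cut_functions_def connected_functions_def cut_set_def)
qed

lemma in_cell_edge:
  assumes C: "in_cell \<Gamma> M D c E' x" and e: "e \<in> E"
  shows "\<And>i. i < length (edge_comp c e) \<Longrightarrow> x (e, i) \<in> I e"
    "\<And>i j. i < j \<Longrightarrow> j < length (edge_comp c e) \<Longrightarrow> x (e, i) < x (e, j)"
    "\<And>t. t \<in> I e \<Longrightarrow> E' (em e t) = (\<Sum>i | i < length (edge_comp c e) \<and> x (e, i) = t. int (edge_comp c e ! i))"
proof -
  have *: "\<forall>e\<in>E. let r = length (edge_comp c e) in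
        (\<forall>i<r. x (e, i) \<in> I e) \<and> (\<forall>j<r. \<forall>i<j. x (e, i) < x (e, j)) \<and>
        (\<forall>t\<in>I e. E' (em e t) = (\<Sum>i | i < r \<and> x (e, i) = t. int (edge_comp c e ! i)))"
    using C unfolding in_cell_def by (elim conjE)
  note ** = bspec[OF * e, unfolded Let_def]
  show "\<And>i. i < length (edge_comp c e) \<Longrightarrow> x (e, i) \<in> I e"
    "\<And>i j. i < j \<Longrightarrow> j < length (edge_comp c e) \<Longrightarrow> x (e, i) < x (e, j)"
    "\<And>t. t \<in> I e \<Longrightarrow> E' (em e t) = (\<Sum>i | i < length (edge_comp c e) \<and> x (e, i) = t. int (edge_comp c e ! i))"
    using ** by blast+
qed

text \<open>Regroups a weighted sum over points by parts of the composition. The weight 1 gives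
  degrees, a ramp as weight gives the function of \<open>edge_formula\<close>.\<close>

lemma in_cell_sum:
  fixes g :: "real \<Rightarrow> real"
  assumes C: "in_cell \<Gamma> M D c E' x" and e: "e \<in> E" and Z: "finite Z" "Z \<subseteq> I e"
    "\<And>i. i < length (edge_comp c e) \<Longrightarrow> x (e, i) \<in> Z"
  shows "(\<Sum>z\<in>Z. of_int (E' (em e z)) * g z) = (\<Sum>i<length (edge_comp c e). real (edge_comp c e ! i) * g (x (e, i)))"
proof -
  let ?r = "length (edge_comp c e)"
  have "(\<Sum>i<?r. real (edge_comp c e ! i) * g (x (e, i)))
      = (\<Sum>z\<in>Z. \<Sum>i\<in>{i\<in>{..<?r}. x (e, i) = z}. real (edge_comp c e ! i) * g (x (e, i)))"
    by (rule sum.group[symmetric]) (use Z in auto)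
  also have "\<dots> = (\<Sum>z\<in>Z. of_int (E' (em e z)) * g z)"
  proof (intro sum.cong refl)
    fix z assume z: "z \<in> Z"
    have "(\<Sum>i\<in>{i\<in>{..<?r}. x (e, i) = z}. real (edge_comp c e ! i) * g (x (e, i)))
       = (\<Sum>i\<in>{i\<in>{..<?r}. x (e, i) = z}. real (edge_comp c e ! i)) * g z"
      unfolding sum_distrib_right by (intro sum.cong) auto
    also have "(\<Sum>i\<in>{i\<in>{..<?r}. x (e, i) = z}. real (edge_comp c e ! i)) = of_int (E' (em e z))"
      using in_cell_edge(3)[OF C e, of z] z Z(2) by (auto simp: lessThan_def)
    finally show "(\<Sum>i\<in>{i\<in>{..<?r}. x (e, i) = z}. real (edge_comp c e ! i) * g (x (e, i))) = of_int (E' (em e z)) * g z" .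
  qed
  finally show ?thesis by simp
qed

lemma in_cell_support:
  assumes C: "in_cell \<Gamma> M D c E' x" and e: "e \<in> E" and t: "t \<in> I e" "E' (em e t) \<noteq> 0"
  shows "\<exists>i<length (edge_comp c e). x (e, i) = t"
proof (rule ccontr)
  assume "\<not> ?thesis"
  then have "{i. i < length (edge_comp c e) \<and> x (e, i) = t} = {}" by auto
  then show False using in_cell_edge(3)[OF C e t(1)] t(2) by (simp del: Collect_empty_eq)
qed

lemma in_cell_function:
  assumes "in_cell \<Gamma> M D c E' x"
  obtains f where "f \<in> RR \<Gamma> D" "E' = D + principal \<Gamma> f" "\<And>e. e \<in> E \<Longrightarrow> sl (rl f) (e, lo M e, True) = edge_slope c e"
proof -
  have "\<exists>f\<in>RR \<Gamma> D. E' = D + principal \<Gamma> f \<and> (\<forall>e\<in>E. start_slope M f e (edge_slope c e))"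
    using assms unfolding in_cell_def by (rule conjunct1)
  then obtain f where f: "f \<in> RR \<Gamma> D" "E' = D + principal \<Gamma> f" "\<And>e. e \<in> E \<Longrightarrow> start_slope M f e (edge_slope c e)"
    by blast
  show ?thesis
    using that[OF f(1,2)] start_slope_iff[OF RR_D(3,2)[OF f(1)]] f(3) by simp
qed

text \<open>In one cell the initial slopes and the degree on each edge are fixed. So the difference
  \<open>h\<close> is flat at both ends of every edge, and in between it only records the
  displacement of the points.\<close>

lemma in_cell_compare:
  assumes C1: "in_cell \<Gamma> M D c E1 x1" and C2: "in_cell \<Gamma> M D c E2 x2"
  obtains h where "PL h" "\<And>d. d \<in> ends \<Longrightarrow> sl h d = 0"
    "\<And>e. e \<in> E \<Longrightarrow> \<exists>c0. \<forall>t\<in>I e. h (em e t) = c0 + (\<Sum>i<length (edge_comp c e). real (edge_comp c e ! i) * (max 0 (t - x2 (e, i)) - max 0 (t - x1 (e, i))))"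
proof -
  obtain f1 where f1: "f1 \<in> RR \<Gamma> D" "E1 = D + principal \<Gamma> f1" "\<And>e. e \<in> E \<Longrightarrow> sl (rl f1) (e, lo M e, True) = edge_slope c e"
    using in_cell_function[OF C1] by blast
  obtain f2 where f2: "f2 \<in> RR \<Gamma> D" "E2 = D + principal \<Gamma> f2" "\<And>e. e \<in> E \<Longrightarrow> sl (rl f2) (e, lo M e, True) = edge_slope c e"
    using in_cell_function[OF C2] by blast
  note F1 = RR_D[OF f1(1)] and F2 = RR_D[OF f2(1)]
  define h where "h = (\<lambda>x. rl f2 x - rl f1 x)"
  have PL: "PL h" unfolding h_def by (rule PL_diff[OF F2(2) F1(2)])
  have dvh: "dv h x = E2 x - E1 x" for x
    using dv_diff[OF F2(2) F1(2), of x] f1(2) f2(2) F1(4) F2(4) by (simp add: h_def)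
  have slo: "sl h (e, lo M e, True) = 0" if "e \<in> E" for e
    using sl_diff[OF F2(2) F1(2) dirs_lo[OF that]] f1(3)[OF that] f2(3)[OF that] by (simp add: h_def)
  let ?r = "\<lambda>e. length (edge_comp c e)"
  define Z where "Z e = (\<lambda>i. x1 (e, i)) ` {..<?r e} \<union> (\<lambda>i. x2 (e, i)) ` {..<?r e}" for e
  have Z: "finite (Z e)" "Z e \<subseteq> I e" "\<And>t. t \<in> I e \<Longrightarrow> t \<notin> Z e \<Longrightarrow> dv h (em e t) = 0" 
    "\<And>i. i < ?r e \<Longrightarrow> x1 (e, i) \<in> Z e" "\<And>i. i < ?r e \<Longrightarrow> x2 (e, i) \<in> Z e" if e: "e \<in> E" for e
  proof -
    show "finite (Z e)" by (simp add: Z_def)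
    show "Z e \<subseteq> I e" using in_cell_edge(1)[OF C1 e] in_cell_edge(1)[OF C2 e] by (auto simp: Z_def)
    fix t assume t: "t \<in> I e" "t \<notin> Z e"
    have "E1 (em e t) = 0" using in_cell_support[OF C1 e t(1)] t(2) by (auto simp: Z_def)
    moreover have "E2 (em e t) = 0" using in_cell_support[OF C2 e t(1)] t(2) by (auto simp: Z_def)
    ultimately show "dv h (em e t) = 0" by (simp add: dvh)
  qed (auto simp: Z_def)
  have sum: "(\<Sum>z\<in>Z e. of_int (dv h (em e z)) * g z) = (\<Sum>i<?r e. real (edge_comp c e ! i) * (g (x2 (e, i)) - g (x1 (e, i))))"
    if e: "e \<in> E" for e and g :: "real \<Rightarrow> real"
  proof -
    have "(\<Sum>z\<in>Z e. of_int (dv h (em e z)) * g z) = (\<Sum>z\<in>Z e. of_int (E2 (em e z)) * g z) - (\<Sum>z\<in>Z e. of_int (E1 (em e z)) * g z)"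
      unfolding sum_subtractf[symmetric] by (simp add: dvh algebra_simps)
    also have "\<dots> = (\<Sum>i<?r e. real (edge_comp c e ! i) * g (x2 (e, i))) - (\<Sum>i<?r e. real (edge_comp c e ! i) * g (x1 (e, i)))"
      using in_cell_sum[OF C1 e Z(1,2)[OF e] Z(4)[OF e]] in_cell_sum[OF C2 e Z(1,2)[OF e] Z(5)[OF e]] by simp
    finally show ?thesis unfolding sum_subtractf[symmetric] by (simp add: algebra_simps)
  qed
  \<comment> \<open>The orders of \<open>h\<close> on \<open>e\<close> sum to 0, because both
    divisors have the same parts there.\<close>
  have shi: "sl h (e, hi M e, False) = 0" if e: "e \<in> E" for e
  proof -
    have "real_of_int (\<Sum>z\<in>Z e. dv h (em e z)) = 0" using sum[OF e, of "\<lambda>_. 1"] by simp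
    then have "(\<Sum>z\<in>Z e. dv h (em e z)) = 0" by linarith
    then show ?thesis using edge_divergence[OF PL e Z(1-3)[OF e]] slo[OF e] by simp
  qed
  show ?thesis
  proof (rule that[OF PL])
    show "sl h d = 0" if "d \<in> ends" for d using that slo shi by (auto simp: ends_def)
    fix e assume e: "e \<in> E"
    obtain c0 where "\<forall>t\<in>I e. h (em e t) = c0 + of_int (sl h (e, lo M e, True)) * t + (\<Sum>z\<in>Z e. of_int (dv h (em e z)) * max 0 (t - z))"
      using edge_formula[OF PL e Z(1-3)[OF e]] by blast
    then show "\<exists>c0. \<forall>t\<in>I e. h (em e t) = c0 + (\<Sum>i<?r e. real (edge_comp c e ! i) * (max 0 (t - x2 (e, i)) - max 0 (t - x1 (e, i))))"
      using slo[OF e] sum[OF e] by auto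
  qed
qed

end

lemma trop_scaling_class:
  fixes f g :: "'b \<Rightarrow> ereal"
  assumes "g = trop_scale c f"
  shows "trop_scaling_rel `` {g} = trop_scaling_rel `` {f}"
proof -
  have 1: "trop_scale a g = trop_scale (a + c) f" for a
    unfolding assms trop_scale_def by (simp add: fun_eq_iff add.assoc[symmetric])
  have "trop_scale (a - c) g = trop_scale a f" for a using 1[of "a - c"] by simp
  then have 2: "\<exists>b. trop_scale a f = trop_scale b g" for a by metis
  have cls: "trop_scaling_rel `` {u} = range (\<lambda>a. trop_scale a u)" for u :: "'b \<Rightarrow> ereal"
    unfolding trop_scaling_rel_def Image_singleton by auto
  show ?thesis unfolding cls
  proof (intro subset_antisym subsetI)
    fix h assume "h \<in> range (\<lambda>a. trop_scale a g)"
    then show "h \<in> range (\<lambda>a. trop_scale a f)" using 1 by blast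
  next
    fix h assume "h \<in> range (\<lambda>a. trop_scale a f)"
    then show "h \<in> range (\<lambda>a. trop_scale a g)" using 2 by blast
  qed
qed

context curve_model
begin

section \<open>Cells of functions with connected chip complement, part (a)\<close>

definition the_edge :: "'a \<Rightarrow> 'a set" where
  "the_edge y = (SOME e. e \<in> E \<and> y \<in> e)"

lemma the_edge_em [simp]:
  assumes "e \<in> E" "t \<in> I e"
  shows "the_edge (em e t) = e"
proof -
  have e: "em e t \<in> e" by (rule em_in[OF assms])
  then have "\<exists>e'. e' \<in> E \<and> em e t \<in> e'" using assms(1) by blast
  then have *: "the_edge (em e t) \<in> E \<and> em e t \<in> the_edge (em e t)"
    unfolding the_edge_def by (rule someI_ex)
  show ?thesis by (rule edge_disjoint[OF conjunct1[OF *] assms(1) conjunct2[OF *] e])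
qed

lemma not_V_cases:
  assumes "y \<notin> V"
  obtains e t where "e \<in> E" "t \<in> I e" "y = em e t"
proof -
  obtain e where e: "e \<in> E" "y \<in> e" using edge_exists[OF assms] by blast
  show ?thesis by (rule that[of e "coord e y"]) (use e coord_in[OF e] em_coord[OF e] in simp_all)
qed

lemma finite_chips: "divisor D \<Longrightarrow> f \<in> RR \<Gamma> D \<Longrightarrow> finite (chips D f)"
  unfolding chips_def using finite_supp_RR by blast

lemma in_cell_off:
  assumes "in_cell \<Gamma> M D c E1 x" "\<not> (e \<in> E \<and> i < length (edge_comp c e))"
  shows "x (e, i) = 0"
  using assms unfolding in_cell_def by blast

text \<open>The difference \<open>h\<close> itself is not constant off the chips of
  \<open>f\<close>, since the points of the second divisor bend it too. The argument therefore uses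
  the labels \<open>w\<close>, which carry the constants at the vertices to all points of an edge
  not separated from an end by chips of \<open>f\<close>.\<close>

lemma connected_cell_unique:
  assumes D: "divisor D" and f: "f \<in> connected_functions D"
    and pos: "\<And>e m. e \<in> E \<Longrightarrow> m \<in> set (edge_comp c e) \<Longrightarrow> 0 < m"
    and C1: "in_cell \<Gamma> M D c (D + principal \<Gamma> f) x1" and C2: "in_cell \<Gamma> M D c E2 x2"
  shows "x1 = x2"
proof -
  define E1 where "E1 = D + principal \<Gamma> f"
  note C1 = C1[folded E1_def]
  have fRR: "f \<in> RR \<Gamma> D" and conn: "connected (- chips D f)" using f by (auto simp: connected_functions_def)
  let ?P = "chips D f"
  have opP: "open (- ?P)" using finite_chips[OF D fRR] by (simp add: open_Compl finite_imp_closed)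
  have PV: "v \<notin> ?P" if "v \<in> V" for v using that by (simp add: chips_def)
  let ?r = "\<lambda>e. length (edge_comp c e)"
  have Pem: "em e t \<in> ?P \<longleftrightarrow> (\<exists>i<?r e. x1 (e, i) = t)" if e: "e \<in> E" and t: "t \<in> I e" for e t
  proof
    assume "em e t \<in> ?P"
    then have "E1 (em e t) \<noteq> 0" by (auto simp: chips_def E1_def supp_def)
    then show "\<exists>i<?r e. x1 (e, i) = t" by (rule in_cell_support[OF C1 e t])
  next
    assume "\<exists>i<?r e. x1 (e, i) = t"
    then obtain i where i: "i < ?r e" "x1 (e, i) = t" by blast
    have "0 < edge_comp c e ! i" using pos[OF e, of "edge_comp c e ! i"] i(1) by simp
    moreover have "int (edge_comp c e ! i) \<le> (\<Sum>i | i < ?r e \<and> x1 (e, i) = t. int (edge_comp c e ! i))"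
      using i by (intro member_le_sum) auto
    ultimately have "E1 (em e t) \<noteq> 0" using in_cell_edge(3)[OF C1 e t] by simp
    then show "em e t \<in> ?P" using em_not_V[OF e t] by (auto simp: chips_def E1_def supp_def)
  qed
  show ?thesis
  proof (rule in_cell_compare[OF C1 C2])
    fix h
    assume PL: "PL h" and ends0: "\<And>d. d \<in> ends \<Longrightarrow> sl h d = 0"
      and hf: "\<And>e. e \<in> E \<Longrightarrow> \<exists>c0. \<forall>t\<in>I e. h (em e t) = c0 + (\<Sum>i<?r e. real (edge_comp c e ! i) * (max 0 (t - x2 (e, i)) - max 0 (t - x1 (e, i))))"
    \<comment> \<open>The constant near \<open>v\<close> rather than the value at \<open>v\<close>,
      since the latter carries no information at infinity.\<close>
    define cv where "cv v = (SOME c. eventually (\<lambda>y. y \<notin> inf\<^sub>\<Gamma> \<longrightarrow> h y = c) (nhds v))" for v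
    have cv: "eventually (\<lambda>y. y \<notin> inf\<^sub>\<Gamma> \<longrightarrow> h y = cv v) (nhds v)" if v: "v \<in> V" for v
    proof -
      have "\<exists>c. eventually (\<lambda>y. y \<notin> inf\<^sub>\<Gamma> \<longrightarrow> h y = c) (nhds v)"
        using ends0 dirs_at_V[OF v] by (intro slope_zero_locally_constant[OF PL]) auto
      then show ?thesis unfolding cv_def by (rule someI_ex)
    qed
    have cvd: "eventually (\<lambda>t. h (em e t) = cv (target (e, a, s))) (dfil a s)" if d: "(e, a, s) \<in> ends" for e a s
    proof -
      have dd: "(e, a, s) \<in> dirs" using d ends_dirs by blast
      have "eventually (\<lambda>t. em e t \<notin> inf\<^sub>\<Gamma> \<longrightarrow> h (em e t) = cv (target (e, a, s))) (dfil a s)"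
        using dirs_at_ev[OF dirs_at_target[OF dd] cv[OF ends_target[OF d]]] by (simp add: dir_ev_def)
      then show ?thesis using dirs_ev_I[OF dd] by eventually_elim (use em_not_inf[OF dirs_edge[OF dd]] in blast)
    qed
    have below: "eventually (\<lambda>t. t \<in> I e \<and> (\<forall>i<?r e. t < x (e, i))) (dfil (lo M e) True)"
      if e: "e \<in> E" and C: "in_cell \<Gamma> M D c E' x" for e E' x
    proof -
      have "eventually (\<lambda>t. t < x (e, i)) (dfil (lo M e) True)" if i: "i < ?r e" for i
      proof -
        have "lo M e < ereal (x (e, i))" using in_cell_edge(1)[OF C e i] by (simp add: edge_interval_def)
        from eventually_dfil_less[OF dirs_beyond[OF dirs_lo[OF e]] this] show ?thesis by simp
      qed
      then have "eventually (\<lambda>t. \<forall>i\<in>{..<?r e}. t < x (e, i)) (dfil (lo M e) True)"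
        by (intro eventually_ball_finite) auto
      then show ?thesis using dirs_ev_I[OF dirs_lo[OF e]] by eventually_elim auto
    qed
    have above: "eventually (\<lambda>t. t \<in> I e \<and> (\<forall>i<?r e. x (e, i) < t)) (dfil (hi M e) False)"
      if e: "e \<in> E" and C: "in_cell \<Gamma> M D c E' x" for e E' x
    proof -
      have "eventually (\<lambda>t. x (e, i) < t) (dfil (hi M e) False)" if i: "i < ?r e" for i
      proof -
        have "ereal (x (e, i)) < hi M e" using in_cell_edge(1)[OF C e i] by (simp add: edge_interval_def)
        from eventually_dfil_greater[OF dirs_beyond[OF dirs_hi[OF e]] this] show ?thesis by simp
      qed
      then have "eventually (\<lambda>t. \<forall>i\<in>{..<?r e}. x (e, i) < t) (dfil (hi M e) False)"
        by (intro eventually_ball_finite) auto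
      then show ?thesis using dirs_ev_I[OF dirs_hi[OF e]] by eventually_elim auto
    qed
    \<comment> \<open>Beyond all points of both divisors, a difference of ramps equals the
      displacement \<open>x1 - x2\<close>; hence the weighted sum of displacements is the change of
      \<open>h\<close> along the edge.\<close>
    have cvdiff: "cv (target (e, hi M e, False)) = cv (target (e, lo M e, True)) + (\<Sum>i<?r e. real (edge_comp c e ! i) * (x1 (e, i) - x2 (e, i)))"
      if e: "e \<in> E" for e
    proof -
      obtain c0 where c0: "\<And>t. t \<in> I e \<Longrightarrow> h (em e t) = c0 + (\<Sum>i<?r e. real (edge_comp c e ! i) * (max 0 (t - x2 (e, i)) - max 0 (t - x1 (e, i))))"
        using hf[OF e] by blast
      have "eventually (\<lambda>t. cv (target (e, lo M e, True)) = c0) (dfil (lo M e) True)"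
        using below[OF e C1] below[OF e C2] cvd[OF ends_lo[OF e]]
      proof eventually_elim
        case (elim t)
        then have "h (em e t) = c0 + (\<Sum>i<?r e. 0)" using c0[of t] by (auto intro!: sum.cong)
        then show ?case using elim by simp
      qed
      then have lo: "cv (target (e, lo M e, True)) = c0" using dirs_neq_bot[OF dirs_lo[OF e]] by simp
      have "eventually (\<lambda>t. cv (target (e, hi M e, False)) = c0 + (\<Sum>i<?r e. real (edge_comp c e ! i) * (x1 (e, i) - x2 (e, i)))) (dfil (hi M e) False)"
        using above[OF e C1] above[OF e C2] cvd[OF ends_hi[OF e]]
      proof eventually_elim
        case (elim t)
        then have "h (em e t) = c0 + (\<Sum>i<?r e. real (edge_comp c e ! i) * (x1 (e, i) - x2 (e, i)))"
          using c0[of t] by (auto intro!: sum.cong)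
        then show ?case using elim by simp
      qed
      then have "cv (target (e, hi M e, False)) = c0 + (\<Sum>i<?r e. real (edge_comp c e ! i) * (x1 (e, i) - x2 (e, i)))"
        using dirs_neq_bot[OF dirs_hi[OF e]] by simp
      then show ?thesis using lo by simp
    qed
    \<comment> \<open>The label \<open>None\<close> marks points between two chips of one edge.
      Since the label at a vertex is never \<open>None\<close>, its constancy will exclude such
      points.\<close>
    define w where "w y = (if y \<in> V then Some (cv y) else
        if \<forall>i<?r (the_edge y). coord (the_edge y) y < x1 (the_edge y, i) then Some (cv (target (the_edge y, lo M (the_edge y), True)))
        else if \<forall>i<?r (the_edge y). x1 (the_edge y, i) < coord (the_edge y) y then Some (cv (target (the_edge y, hi M (the_edge y), False)))
        else None)" for y
    have wem: "w (em e t) = (if \<forall>i<?r e. t < x1 (e, i) then Some (cv (target (e, lo M e, True)))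
        else if \<forall>i<?r e. x1 (e, i) < t then Some (cv (target (e, hi M e, False))) else None)"
      if e: "e \<in> E" "t \<in> I e" for e t
      using em_not_V[OF e] e by (auto simp: w_def)
    have loc: "eventually (\<lambda>z. z \<in> - ?P \<longrightarrow> w y = w z) (nhds y)" if y: "y \<in> - ?P" for y
    proof (rule eventually_nhdsI)
      fix d assume dy: "d \<in> dirs_at y"
      show "dir_ev (\<lambda>z. z \<in> - ?P \<longrightarrow> w y = w z) d"
      proof (cases "y \<in> V")
        case True
        then have d: "d \<in> ends" "target d = y" using dy dirs_at_V by auto
        then consider e where "e \<in> E" "d = (e, lo M e, True)" | e where "e \<in> E" "d = (e, hi M e, False)"
          by (auto simp: ends_def)
        then show ?thesis
        proof cases
          case (1 e)
          have "eventually (\<lambda>t. em e t \<in> - ?P \<longrightarrow> w y = w (em e t)) (dfil (lo M e) True)"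
            using below[OF 1(1) C1]
          proof eventually_elim
            case (elim t)
            have "w y = Some (cv y)" using True by (simp add: w_def)
            then show ?case using wem[OF 1(1), of t] elim d 1 by simp
          qed
          then show ?thesis by (simp add: dir_ev_def 1)
        next
          case (2 e)
          have "eventually (\<lambda>t. em e t \<in> - ?P \<longrightarrow> w y = w (em e t)) (dfil (hi M e) False)"
            using above[OF 2(1) C1]
          proof eventually_elim
            case (elim t)
            have wy: "w y = Some (cv (target (e, hi M e, False)))" using True d 2 by (simp add: w_def)
            show ?case
            \<comment> \<open>On an edge without chips both tests in \<open>w\<close> succeed and
              the first one decides, so the constants at the two ends must be shown equal.\<close>
            proof (cases "?r e = 0")
              case True
              then have "cv (target (e, hi M e, False)) = cv (target (e, lo M e, True))" using cvdiff[OF 2(1)] by simp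
              then show ?thesis using wy True elim 2(1) by (simp add: wem)
            next
              case False
              then have "\<not> (\<forall>i<?r e. t < x1 (e, i))" using elim by (metis gr0I less_asym)
              then have "w (em e t) = Some (cv (target (e, hi M e, False)))"
                using wem[OF 2(1), of t] elim by (metis (mono_tags, lifting))
              then show ?thesis using wy by simp
            qed
          qed
          then show ?thesis by (simp add: dir_ev_def 2)
        qed
      next
        case False
        then obtain e t where et: "e \<in> E" "t \<in> I e" "y = em e t" by (rule not_V_cases)
        then obtain s where d: "d = (e, ereal t, s)" using dy dirs_at_I by auto
        have ne: "x1 (e, i) \<noteq> t" if "i < ?r e" for i using Pem[OF et(1,2)] y et(3) that by auto
        have "eventually (\<lambda>u. (u < x1 (e, i) \<longleftrightarrow> t < x1 (e, i)) \<and> (x1 (e, i) < u \<longleftrightarrow> x1 (e, i) < t)) (nhds t)" if i: "i < ?r e" for i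
        proof (cases "t < x1 (e, i)")
          case True
          then have "eventually (\<lambda>u. u \<in> {..<x1 (e, i)}) (nhds t)" by (intro eventually_nhds_in_open) auto
          then show ?thesis by eventually_elim (use True in auto)
        next
          case False
          then have "t > x1 (e, i)" using ne[OF i] by simp
          then have "eventually (\<lambda>u. u \<in> {x1 (e, i)<..}) (nhds t)" by (intro eventually_nhds_in_open) auto
          then show ?thesis by eventually_elim (use \<open>t > x1 (e, i)\<close> in auto)
        qed
        then have "eventually (\<lambda>u. \<forall>i\<in>{..<?r e}. (u < x1 (e, i) \<longleftrightarrow> t < x1 (e, i)) \<and> (x1 (e, i) < u \<longleftrightarrow> x1 (e, i) < t)) (nhds t)"
          by (intro eventually_ball_finite) auto
        then have "eventually (\<lambda>u. \<forall>i\<in>{..<?r e}. (u < x1 (e, i) \<longleftrightarrow> t < x1 (e, i)) \<and> (x1 (e, i) < u \<longleftrightarrow> x1 (e, i) < t)) (dfil (ereal t) s)"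
          unfolding nhds_real_dfil by (cases s) auto
        then have "eventually (\<lambda>u. em e u \<in> - ?P \<longrightarrow> w y = w (em e u)) (dfil (ereal t) s)"
          using dirs_ev_I[OF dirs_I[OF et(1,2)]]
        proof eventually_elim
          case (elim u)
          have eq: "(\<forall>i<?r e. u < x1 (e, i)) \<longleftrightarrow> (\<forall>i<?r e. t < x1 (e, i))" "(\<forall>i<?r e. x1 (e, i) < u) \<longleftrightarrow> (\<forall>i<?r e. x1 (e, i) < t)"
            using elim(1) by auto
          have "w (em e t) = w (em e u)" unfolding wem[OF et(1,2)] wem[OF et(1) elim(2)] eq ..
          then show ?case using et(3) by simp
        qed
        then show ?thesis by (simp add: dir_ev_def d)
      qed
    qed simp
    have "\<forall>y\<in>- ?P. eventually (\<lambda>z. w y = w z) (at y within - ?P)"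
    proof
      fix y assume "y \<in> - ?P"
      from loc[OF this] show "eventually (\<lambda>z. w y = w z) (at y within - ?P)"
        unfolding eventually_at_filter by (rule eventually_mono) blast
    qed
    then have const: "w y = w z" if "y \<in> - ?P" "z \<in> - ?P" for y z
      using connected_local_const[OF conn that] by blast
    obtain v0 where v0: "v0 \<in> V" using V_nonempty by blast
    have wall: "w y = Some (cv v0)" if "y \<notin> ?P" for y
      using const[of y v0] that PV[OF v0] v0 by (simp add: w_def)
    have cvall: "cv v = cv v0" if "v \<in> V" for v using wall[OF PV[OF that]] that by (simp add: w_def)
    have r1: "?r e \<le> 1" if e: "e \<in> E" for e
    proof (rule ccontr)
      assume "\<not> ?r e \<le> 1"
      then have r2: "0 < ?r e" "1 < ?r e" by auto
      define a b where "a = x1 (e, 0)" and "b = x1 (e, 1)"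
      have ab: "a \<in> I e" "b \<in> I e" "a < b" using in_cell_edge(1,2)[OF C1 e] r2 by (auto simp: a_def b_def)
      \<comment> \<open>Any point strictly between the first two chips would do: it is off the chips
        but has the label \<open>None\<close>.\<close>
      define t where "t = (a + b) / 2"
      have t: "a < t" "t < b" using ab by (auto simp: t_def)
      have tI: "t \<in> I e"
        using ab t by (auto simp: edge_interval_def intro: less_trans[of _ "ereal a"] less_trans[of _ "ereal b"])
      have pos: "i = 0 \<or> b \<le> x1 (e, i)" if "i < ?r e" for i
        using in_cell_edge(2)[OF C1 e, of 1 i] that by (cases "i = 1"; cases "i = 0") (auto simp: b_def)
      have "em e t \<notin> ?P" unfolding Pem[OF e tI] using pos t by (fastforce simp: a_def)
      then have "w (em e t) = Some (cv v0)" by (rule wall)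
      moreover have "\<not> (\<forall>i<?r e. t < x1 (e, i))" using r2(1) t(1) by (auto simp: a_def intro!: exI[of _ 0])
      moreover have "\<not> (\<forall>i<?r e. x1 (e, i) < t)" using r2(2) t(2) by (auto simp: b_def intro!: exI[of _ 1])
      ultimately show False using wem[OF e tI] by (simp only: if_False option.distinct)
    qed
    have "x1 (e, i) = x2 (e, i)" for e i
    proof (cases "e \<in> E \<and> i < ?r e")
      case True
      then have r: "?r e = 1" "i = 0" using r1[of e] by auto
      have e: "e \<in> E" using True by simp
      have "cv (target (e, hi M e, False)) = cv (target (e, lo M e, True))"
        using cvall ends_target ends_lo[OF e] ends_hi[OF e] by simp
      then have "real (edge_comp c e ! 0) * (x1 (e, 0) - x2 (e, 0)) = 0" using cvdiff[OF e] r(1) by simp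
      moreover have "0 < edge_comp c e ! 0" using pos[OF e, of "edge_comp c e ! 0"] r(1) by simp
      ultimately show ?thesis using r(2) by simp
    next
      case False
      then show ?thesis using in_cell_off[OF C1 False] in_cell_off[OF C2 False] by simp
    qed
    then show "x1 = x2" by (intro ext) auto
  qed
qed

text \<open>Listing the support points of each edge in increasing order yields index and
  coordinates; the parts are positive because the divisor is effective.\<close>

lemma in_cell_exists:
  assumes D: "divisor D" and f: "f \<in> RR \<Gamma> D"
  obtains c x where "\<And>e m. e \<in> E \<Longrightarrow> m \<in> set (edge_comp c e) \<Longrightarrow> 0 < m" "in_cell \<Gamma> M D c (D + principal \<Gamma> f) x"
proof -
  note F = RR_D[OF f]
  define E1 where "E1 = D + principal \<Gamma> f"
  have nonneg: "E1 y \<ge> 0" for y using F(4,5) by (simp add: E1_def)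
  define S where "S e = {t\<in>I e. E1 (em e t) \<noteq> 0}" for e
  have finS: "finite (S e)" if e: "e \<in> E" for e
  proof -
    have "S e \<subseteq> coord e ` supp E1"
    proof
      fix t assume t: "t \<in> S e"
      then have "em e t \<in> supp E1" "coord e (em e t) = t" using e by (auto simp: S_def supp_def)
      then show "t \<in> coord e ` supp E1" by (metis imageI)
    qed
    then show ?thesis using finite_supp_RR[OF D f] unfolding E1_def by (metis finite_imageI finite_subset)
  qed
  define xs where "xs e = sorted_list_of_set (S e)" for e
  have xs: "set (xs e) = S e" "distinct (xs e)" "sorted (xs e)" if e: "e \<in> E" for e
    using finS[OF e] by (auto simp: xs_def)
  define c where "c = \<lparr>vert_mult = E1, edge_comp = (\<lambda>e. map (\<lambda>t. nat (E1 (em e t))) (xs e)),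
     edge_slope = (\<lambda>e. sl (rl f) (e, lo M e, True))\<rparr>"
  define x where "x = (\<lambda>(e, i). if e \<in> E \<and> i < length (xs e) then xs e ! i else 0)"
  have pos: "0 < m" if "e \<in> E" "m \<in> set (edge_comp c e)" for e m
  proof -
    have "m \<in> (\<lambda>t. nat (E1 (em e t))) ` S e" using that(2) xs(1)[OF that(1)] by (simp add: c_def)
    then obtain t where "t \<in> S e" "m = nat (E1 (em e t))" by blast
    then show ?thesis using nonneg[of "em e t"] by (simp add: S_def)
  qed
  have "in_cell \<Gamma> M D c E1 x"
    unfolding in_cell_def Let_def
  proof (intro conjI ballI allI impI)
    show "\<exists>f\<in>RR \<Gamma> D. E1 = D + principal \<Gamma> f \<and> (\<forall>e\<in>E. start_slope M f e (edge_slope c e))"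
      using f start_slope_iff[OF F(3,2)] by (intro bexI[of _ f]) (auto simp: E1_def c_def)
    show "E1 v = vert_mult c v" for v by (simp add: c_def)
    fix e assume e: "e \<in> E"
    have len: "length (edge_comp c e) = length (xs e)" by (simp add: c_def)
    show "x (e, i) \<in> I e" if "i < length (edge_comp c e)" for i
    proof -
      have "xs e ! i \<in> S e" using that len xs(1)[OF e] nth_mem by metis
      then show ?thesis using that len e by (simp add: x_def S_def)
    qed
    show "x (e, i) < x (e, j)" if "j < length (edge_comp c e)" "i < j" for i j
    proof -
      have "xs e ! i \<le> xs e ! j" using xs(3)[OF e] that len by (simp add: sorted_nth_mono)
      moreover have "xs e ! i \<noteq> xs e ! j" using xs(2)[OF e] that len by (simp add: nth_eq_iff_index_eq)
      ultimately show ?thesis using that len e by (simp add: x_def)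
    qed
    fix t assume t: "t \<in> I e"
    show "E1 (em e t) = (\<Sum>i | i < length (edge_comp c e) \<and> x (e, i) = t. int (edge_comp c e ! i))"
    proof (cases "t \<in> S e")
      case True
      then obtain i where i: "i < length (xs e)" "xs e ! i = t" using xs(1)[OF e] by (metis in_set_conv_nth)
      have uniq: "j = i" if "j < length (xs e)" "xs e ! j = t" for j
        using that i xs(2)[OF e] nth_eq_iff_index_eq[of "xs e" j i] by simp
      have "{j. j < length (edge_comp c e) \<and> x (e, j) = t} = {i}"
      proof (intro subset_antisym subsetI)
        fix j assume "j \<in> {j. j < length (edge_comp c e) \<and> x (e, j) = t}"
        then have "j < length (xs e)" "xs e ! j = t" using len e by (auto simp: x_def)
        then show "j \<in> {i}" using uniq by blast
      next
        fix j assume "j \<in> {i}"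
        then show "j \<in> {j. j < length (edge_comp c e) \<and> x (e, j) = t}" using i len e by (simp add: x_def)
      qed
      then show ?thesis using i nonneg by (simp add: c_def)
    next
      case False
      have "{j. j < length (edge_comp c e) \<and> x (e, j) = t} = {}"
      proof (rule ccontr)
        assume "\<not> ?thesis"
        then obtain j where "j < length (xs e)" "xs e ! j = t" using len e by (auto simp: x_def split: if_splits)
        then show False using False xs(1)[OF e] nth_mem by metis
      qed
      then show ?thesis using False t by (simp only: sum.empty) (simp add: S_def)
    qed
  next
    fix e i assume "\<not> (e \<in> E \<and> i < length (edge_comp c e))"
    then show "x (e, i) = 0" by (auto simp: x_def c_def)
  qed
  then show ?thesis using that[of c x] pos by (simp add: E1_def)
qed

lemma connected_subset_vertex:
  assumes D: "divisor D"
  shows "connected_functions D \<subseteq> vertex_functions \<Gamma> M D"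
proof
  fix f assume f: "f \<in> connected_functions D"
  then have fRR: "f \<in> RR \<Gamma> D" by (simp add: connected_functions_def)
  show "f \<in> vertex_functions \<Gamma> M D"
  proof (rule in_cell_exists[OF D fRR])
    fix c x
    assume pos: "\<And>e m. e \<in> E \<Longrightarrow> m \<in> set (edge_comp c e) \<Longrightarrow> 0 < m" and C: "in_cell \<Gamma> M D c (D + principal \<Gamma> f) x"
    have "x = y" if "in_cell \<Gamma> M D c E2 y" for E2 y
      by (rule connected_cell_unique[OF D f _ C that]) (rule pos)
    then have "cell_coords \<Gamma> M D c = {x}" using C unfolding cell_coords_def by blast
    then have "{y - z | y z. y \<in> cell_coords \<Gamma> M D c \<and> z \<in> cell_coords \<Gamma> M D c} = {0}" by auto
    then have "cell_dim \<Gamma> M D c = 0" unfolding cell_dim_def by (simp only: dim_fun_zero)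
    moreover have "D + principal \<Gamma> f \<in> cell \<Gamma> M D c" using C by (auto simp: cell_def)
    ultimately show ?thesis using fRR pos unfolding vertex_functions_def cell_vertices_def by blast
  qed
qed

section \<open>Finiteness of the vertex set, part (b)\<close>

lemma dim_zero_unique:
  assumes dim: "cell_dim \<Gamma> M D c = 0" and C1: "in_cell \<Gamma> M D c E1 x1" and C2: "in_cell \<Gamma> M D c E2 x2"
  shows "x1 = x2"
proof -
  let ?S = "{y - z | y z. y \<in> cell_coords \<Gamma> M D c \<and> z \<in> cell_coords \<Gamma> M D c}"
  let ?J = "Sigma E (\<lambda>e. {..<length (edge_comp c e)})"
  have "x1 - x2 = 0"
  proof (rule dim_fun_zero_imp)
    show "finite ?J" using finite_edges by auto
    show "vector_space.dim (\<lambda>(a::real) x p. a * x p) ?S = 0" using dim by (simp add: cell_dim_def)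
    show "x1 - x2 \<in> ?S" using C1 C2 by (auto simp: cell_coords_def)
    show "x p = 0" if "x \<in> ?S" "p \<notin> ?J" for x p
    proof -
      obtain e i where p: "p = (e, i)" by (cases p)
      obtain y z E3 E4 where yz: "x = y - z" "in_cell \<Gamma> M D c E3 y" "in_cell \<Gamma> M D c E4 z"
        using \<open>x \<in> ?S\<close> by (auto simp: cell_coords_def)
      have "\<not> (e \<in> E \<and> i < length (edge_comp c e))" using \<open>p \<notin> ?J\<close> by (simp add: p)
      then have "y p = 0" "z p = 0" using in_cell_off[OF yz(2)] in_cell_off[OF yz(3)] by (simp_all add: p)
      then show ?thesis by (simp add: yz(1))
    qed
  qed
  then show ?thesis by simp
qed

lemma in_cell_determines:
  assumes C1: "in_cell \<Gamma> M D c E1 x" and C2: "in_cell \<Gamma> M D c E2 x"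
  shows "E1 = E2"
proof
  fix y show "E1 y = E2 y"
  proof (cases "y \<in> V")
    case True
    have "E1 y = vert_mult c y" "E2 y = vert_mult c y" using C1 C2 True unfolding in_cell_def by blast+
    then show ?thesis by simp
  next
    case False
    then obtain e t where "e \<in> E" "t \<in> I e" "y = em e t" by (rule not_V_cases)
    then show ?thesis using in_cell_edge(3)[OF C1] in_cell_edge(3)[OF C2] by simp
  qed
qed

lemma in_cell_cong:
  assumes "\<And>v. v \<in> V \<Longrightarrow> vert_mult c v = vert_mult c' v" "\<And>e. e \<in> E \<Longrightarrow> edge_comp c e = edge_comp c' e"
    "\<And>e. e \<in> E \<Longrightarrow> edge_slope c e = edge_slope c' e" and C: "in_cell \<Gamma> M D c E1 x"
  shows "in_cell \<Gamma> M D c' E1 x"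
proof -
  have "(\<exists>f\<in>RR \<Gamma> D. E1 = D + principal \<Gamma> f \<and> (\<forall>e\<in>E. start_slope M f e (edge_slope c' e)))"
  proof -
    have "\<exists>f\<in>RR \<Gamma> D. E1 = D + principal \<Gamma> f \<and> (\<forall>e\<in>E. start_slope M f e (edge_slope c e))"
      using C unfolding in_cell_def by (rule conjunct1)
    then show ?thesis using assms(3) by auto
  qed
  moreover have "\<forall>v\<in>V. E1 v = vert_mult c' v" using C assms(1) unfolding in_cell_def by auto
  moreover have "\<forall>e\<in>E. let r = length (edge_comp c' e) in
        (\<forall>i<r. x (e, i) \<in> I e) \<and> (\<forall>j<r. \<forall>i<j. x (e, i) < x (e, j)) \<and>
        (\<forall>t\<in>I e. E1 (em e t) = (\<Sum>i | i < r \<and> x (e, i) = t. int (edge_comp c' e ! i)))"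
    (is "\<forall>e\<in>E. ?Q (edge_comp c' e) e")
  proof
    fix e assume e: "e \<in> E"
    have "?Q (edge_comp c e) e" using C e unfolding in_cell_def by (elim conjE) (rule bspec)
    then show "?Q (edge_comp c' e) e" using assms(2)[OF e] by simp
  qed
  moreover have "\<forall>e i. \<not> (e \<in> E \<and> i < length (edge_comp c' e)) \<longrightarrow> x (e, i) = 0"
    using in_cell_off[OF C] assms(2) by auto
  ultimately show ?thesis unfolding in_cell_def by (intro conjI)
qed

text \<open>Multiplicities are nonnegative with total at most \<open>N\<close>. Because parts are
  positive, this bounds their number as well as their size.\<close>

lemma in_cell_bounds:
  assumes D: "divisor D" and C: "in_cell \<Gamma> M D c E1 x"
    and pos: "\<And>e m. e \<in> E \<Longrightarrow> m \<in> set (edge_comp c e) \<Longrightarrow> 0 < m"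
  defines "N \<equiv> (\<Sum>y\<in>supp D. max 0 (D y))"
  shows "\<And>v. v \<in> V \<Longrightarrow> vert_mult c v \<in> {0..N}"
    and "\<And>e. e \<in> E \<Longrightarrow> edge_comp c e \<in> {l. set l \<subseteq> {..nat N} \<and> length l \<le> nat N}"
    and "\<And>e. e \<in> E \<Longrightarrow> edge_slope c e \<in> {-N..N}"
proof -
  obtain f where f: "f \<in> RR \<Gamma> D" "E1 = D + principal \<Gamma> f" "\<And>e. e \<in> E \<Longrightarrow> sl (rl f) (e, lo M e, True) = edge_slope c e"
    by (rule in_cell_function[OF C]) (rule that)
  note F = RR_D[OF f(1)]
  have nonneg: "E1 y \<ge> 0" for y using F(4,5) by (simp add: f(2))
  have finE1: "finite (supp E1)" using finite_supp_RR[OF D f(1)] f(2) by simp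
  have le: "(\<Sum>y\<in>Y. E1 y) \<le> N" if "finite Y" for Y
  proof -
    have "(\<Sum>y\<in>Y. E1 y) \<le> (\<Sum>y\<in>Y \<union> supp E1. E1 y)" using that finE1 nonneg by (intro sum_mono2) auto
    also have "\<dots> = (\<Sum>y\<in>supp D. D y)" using degree_RR(1)[OF D f(1), of "Y \<union> supp E1"] that finE1 f(2) by auto
    also have "\<dots> \<le> N" unfolding N_def by (intro sum_mono) auto
    finally show ?thesis .
  qed
  show "vert_mult c v \<in> {0..N}" if "v \<in> V" for v
  proof -
    have "vert_mult c v = E1 v" using C that unfolding in_cell_def by metis
    then show ?thesis using nonneg le[of "{v}"] by simp
  qed
  show "edge_comp c e \<in> {l. set l \<subseteq> {..nat N} \<and> length l \<le> nat N}" if e: "e \<in> E" for e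
  proof -
    let ?r = "length (edge_comp c e)"
    let ?Z = "(\<lambda>i. x (e, i)) ` {..<?r}"
    have Z: "?Z \<subseteq> I e" using in_cell_edge(1)[OF C e] by auto
    have inj: "inj_on (em e) ?Z" using Z em_inj[OF e] by (auto simp: inj_on_def subset_iff)
    have "real_of_int (\<Sum>z\<in>?Z. E1 (em e z)) = (\<Sum>i<?r. real (edge_comp c e ! i))"
      using in_cell_sum[OF C e, of ?Z "\<lambda>_. 1"] Z by simp
    also have "\<dots> = real_of_int (int (sum_list (edge_comp c e)))" by (simp add: sum_list_sum_nth atLeast0LessThan)
    finally have "int (sum_list (edge_comp c e)) = (\<Sum>z\<in>?Z. E1 (em e z))" by linarith
    also have "\<dots> = (\<Sum>y\<in>em e ` ?Z. E1 y)" by (rule sum.reindex[OF inj, symmetric, unfolded o_def])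
    also have "\<dots> \<le> N" by (rule le) simp
    finally have sN: "sum_list (edge_comp c e) \<le> nat N" by linarith
    have "length l \<le> sum_list l" if "\<forall>m\<in>set l. 0 < m" for l :: "nat list"
      using that by (induction l) auto
    then have "length (edge_comp c e) \<le> nat N" using pos[OF e] sN by (meson order_trans)
    moreover have "m \<le> nat N" if "m \<in> set (edge_comp c e)" for m
      using member_le_sum_list[OF that] sN by simp
    ultimately show ?thesis by auto
  qed
  show "edge_slope c e \<in> {-N..N}" if e: "e \<in> E" for e
  proof -
    \<comment> \<open>The lower end may be at infinity, where \<open>slope_bound\<close> does not
      apply. Instead a nearby interior point \<open>u\<close> of order 0 is used: its two outgoing
      slopes are \<open>?A\<close> and \<open>- ?A\<close>, which bounds both signs.\<close>
    let ?A = "sl (rl f) (e, lo M e, True)"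
    note d = dirs_lo[OF e]
    have "finite (coord e ` {y. dv (rl f) y \<noteq> 0})" using finite_dv_support[OF F(2)] by simp
    then have "eventually (\<lambda>u. u \<notin> coord e ` {y. dv (rl f) y \<noteq> 0}) (dfil (lo M e) True)"
      by (rule eventually_dfil_not_in_finite[OF dirs_beyond[OF d]])
    then have "eventually (\<lambda>u. u \<in> I e \<and> sl (rl f) (e, ereal u, True) = ?A \<and> dv (rl f) (em e u) = 0) (dfil (lo M e) True)"
      using sl_near[OF F(2) d]
    proof eventually_elim
      case (elim u)
      have "u \<in> coord e ` {y. dv (rl f) y \<noteq> 0}" if "dv (rl f) (em e u) \<noteq> 0"
        using that coord_em[OF e, of u] elim by (intro image_eqI[of _ _ "em e u"]) simp_all
      then have "dv (rl f) (em e u) = 0" using elim by blast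
      then show ?case using elim by simp
    qed
    then obtain u where u: "u \<in> I e" "sl (rl f) (e, ereal u, True) = ?A" "dv (rl f) (em e u) = 0"
      using eventually_happens'[OF dirs_neq_bot[OF d]] by blast
    have b: "sl (rl f) (e, ereal u, s) \<le> N" for s
      unfolding N_def using em_not_inf[OF e u(1)] target_I[OF e u(1)]
      by (intro slope_bound[OF F(2) D F(5) dirs_I[OF e u(1)]]) simp
    have "sl (rl f) (e, ereal u, False) = - ?A" using u(2,3) dv_I[OF e u(1), of "rl f"] by simp
    then show ?thesis using b[of True] b[of False] u(2) f(3)[OF e] by simp
  qed
qed

text \<open>In a cell of dimension 0 the index determines the coordinates, and these determine the
  divisor; so vertices can be counted by their indices.\<close>

lemma finite_cell_vertices:
  assumes D: "divisor D"
  shows "finite (cell_vertices \<Gamma> M D)"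
proof -
  define N where "N = (\<Sum>y\<in>supp D. max 0 (D y))"
  have "\<forall>E1\<in>cell_vertices \<Gamma> M D. \<exists>c. (\<forall>e\<in>E. \<forall>k\<in>set (edge_comp c e). 0 < k) \<and> E1 \<in> cell \<Gamma> M D c \<and> cell_dim \<Gamma> M D c = 0"
    unfolding cell_vertices_def by blast
  then obtain C where C: "\<And>E1. E1 \<in> cell_vertices \<Gamma> M D \<Longrightarrow> (\<forall>e\<in>E. \<forall>k\<in>set (edge_comp (C E1) e). 0 < k) \<and> E1 \<in> cell \<Gamma> M D (C E1) \<and> cell_dim \<Gamma> M D (C E1) = 0"
    by metis
  \<comment> \<open>Index components are arbitrary outside the vertices and edges of the model; only
    their restrictions range over a finite set.\<close>
  define key where "key E1 = (restrict (vert_mult (C E1)) V, restrict (edge_comp (C E1)) E, restrict (edge_slope (C E1)) E)" for E1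
  let ?K = "(V \<rightarrow>\<^sub>E {0..N}) \<times> (E \<rightarrow>\<^sub>E {l. set l \<subseteq> {..nat N} \<and> length l \<le> nat N}) \<times> (E \<rightarrow>\<^sub>E {-N..N})"
  have "finite ?K"
    using finite_V finite_edges finite_lists_length_le[of "{..nat N}" "nat N"] by (intro finite_cartesian_product finite_PiE) auto
  moreover have "key ` cell_vertices \<Gamma> M D \<subseteq> ?K"
  proof
    fix p assume "p \<in> key ` cell_vertices \<Gamma> M D"
    then obtain E1 where E1: "E1 \<in> cell_vertices \<Gamma> M D" "p = key E1" by blast
    obtain x where x: "in_cell \<Gamma> M D (C E1) E1 x" using C[OF E1(1)] unfolding cell_def by blast
    have pos: "\<And>e m. e \<in> E \<Longrightarrow> m \<in> set (edge_comp (C E1) e) \<Longrightarrow> 0 < m" using C[OF E1(1)] by blast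
    show "p \<in> ?K" unfolding E1(2) key_def N_def
      by (intro SigmaI restrict_PiE_iff[THEN iffD2] ballI in_cell_bounds[OF D x pos])
  qed
  ultimately have "finite (key ` cell_vertices \<Gamma> M D)" by (rule finite_subset[rotated])
  moreover have "inj_on key (cell_vertices \<Gamma> M D)"
  proof (rule inj_onI)
    fix E1 E2 assume E1: "E1 \<in> cell_vertices \<Gamma> M D" and E2: "E2 \<in> cell_vertices \<Gamma> M D" and eq: "key E1 = key E2"
    obtain x1 where x1: "in_cell \<Gamma> M D (C E1) E1 x1" using C[OF E1(1)] unfolding cell_def by blast
    obtain x2 where x2: "in_cell \<Gamma> M D (C E2) E2 x2" using C[OF E2(1)] unfolding cell_def by blast
    have k: "restrict (vert_mult (C E2)) V = restrict (vert_mult (C E1)) V" "restrict (edge_comp (C E2)) E = restrict (edge_comp (C E1)) E"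
      "restrict (edge_slope (C E2)) E = restrict (edge_slope (C E1)) E" using eq by (auto simp: key_def)
    have "in_cell \<Gamma> M D (C E1) E2 x2"
      by (rule in_cell_cong[OF _ _ _ x2]) (use k in \<open>metis restrict_apply'\<close>)+
    moreover from this have "x1 = x2" using dim_zero_unique[OF _ x1] C[OF E1] by blast
    ultimately show "E1 = E2" using in_cell_determines x1 by blast
  qed
  ultimately show ?thesis by (rule finite_imageD)
qed

lemma finite_vertex_classes:
  assumes D: "divisor D"
  shows "finite (vertex_functions \<Gamma> M D // trop_scaling_rel)"
proof -
  let ?F = "\<lambda>E1. SOME f. f \<in> vertex_functions \<Gamma> M D \<and> D + principal \<Gamma> f = E1"
  have "vertex_functions \<Gamma> M D // trop_scaling_rel \<subseteq> (\<lambda>E1. trop_scaling_rel `` {?F E1}) ` cell_vertices \<Gamma> M D"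
  proof
    fix K assume "K \<in> vertex_functions \<Gamma> M D // trop_scaling_rel"
    then obtain f where f: "f \<in> vertex_functions \<Gamma> M D" "K = trop_scaling_rel `` {f}" by (auto simp: quotient_def)
    define g where "g = ?F (D + principal \<Gamma> f)"
    have g: "g \<in> vertex_functions \<Gamma> M D \<and> D + principal \<Gamma> g = D + principal \<Gamma> f"
      unfolding g_def by (rule someI[of _ f]) (use f in simp)
    have RR: "f \<in> RR \<Gamma> D" "g \<in> RR \<Gamma> D" using f g by (auto simp: vertex_functions_def)
    have "principal \<Gamma> f = principal \<Gamma> g" using g by (metis add_left_cancel)
    then obtain c where gc: "g = trop_scale c f" by (rule same_divisor_scale[OF RR])
    have "K = trop_scaling_rel `` {g}" unfolding f(2) trop_scaling_class[OF gc] ..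
    moreover have "D + principal \<Gamma> f \<in> cell_vertices \<Gamma> M D" using f(1) by (simp add: vertex_functions_def)
    ultimately show "K \<in> (\<lambda>E1. trop_scaling_rel `` {?F E1}) ` cell_vertices \<Gamma> M D"
      unfolding g_def by blast
  qed
  then show ?thesis using finite_cell_vertices[OF D] by (meson finite_imageI finite_subset)
qed

end

section \<open>Moving chips\<close>

text \<open>Outgoing slope of the ramp \<open>max 0 (t - p)\<close> at \<open>a\<close> in the
  direction \<open>s\<close>. At its corner the ramp has slope 1 to the right and 0 to the left,
  hence one weak and one strict comparison.\<close>

definition rsl :: "real \<Rightarrow> ereal \<Rightarrow> bool \<Rightarrow> int" where
  "rsl p a s = (if s then (if ereal p \<le> a then 1 else 0) else (if ereal p < a then - 1 else 0))"

text \<open>A line of integer slope plus weighted ramps. The list displays the divisor: each pair is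
  an order and its position.\<close>

definition pw :: "real \<Rightarrow> int \<Rightarrow> (int \<times> real) list \<Rightarrow> real \<Rightarrow> real" where
  "pw C A L t = C + of_int A * t + (\<Sum>(n, p)\<leftarrow>L. of_int n * max 0 (t - p))"

definition pwsl :: "int \<Rightarrow> (int \<times> real) list \<Rightarrow> ereal \<Rightarrow> bool \<Rightarrow> int" where
  "pwsl A L a s = (if s then A else - A) + (\<Sum>(n, p)\<leftarrow>L. n * rsl p a s)"

lemma ramp_eventually:
  assumes "beyond a s c"
  shows "\<exists>c'. eventually (\<lambda>t. max 0 (t - p) = c' + sgb s * of_int (rsl p a s) * t) (dfil a s)"
proof (cases s)
  case True
  show ?thesis
  proof (cases "ereal p \<le> a")
    case le: True
    have "eventually (\<lambda>t. max 0 (t - p) = - p + sgb s * of_int (rsl p a s) * t) (dfil a s)"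
      using eventually_dfil_beyond[OF assms]
    proof eventually_elim
      case (elim t)
      then have "ereal p < ereal t" using le_less_trans[OF le, of "ereal t"] True by (simp add: beyond_def)
      then show ?case using le True by (simp add: rsl_def)
    qed
    then show ?thesis by blast
  next
    case False
    then have "a < ereal p" by simp
    then have "eventually (\<lambda>t. max 0 (t - p) = 0 + sgb s * of_int (rsl p a s) * t) (dfil a s)"
      using eventually_dfil_less[OF assms, of "ereal p"] by (auto simp: rsl_def True elim!: eventually_mono)
    then show ?thesis by blast
  qed
next
  case False
  show ?thesis
  proof (cases "ereal p < a")
    case less: True
    then have "eventually (\<lambda>t. max 0 (t - p) = - p + sgb s * of_int (rsl p a s) * t) (dfil a s)"
      using eventually_dfil_greater[OF assms, of "ereal p"] by (auto simp: rsl_def False elim!: eventually_mono)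
    then show ?thesis by blast
  next
    case nl: False
    have "eventually (\<lambda>t. max 0 (t - p) = 0 + sgb s * of_int (rsl p a s) * t) (dfil a s)"
      using eventually_dfil_beyond[OF assms]
    proof eventually_elim
      case (elim t)
      then have "ereal t < ereal p" using less_le_trans[of "ereal t" a "ereal p"] nl False by (simp add: beyond_def)
      then show ?case using nl False by (simp add: rsl_def)
    qed
    then show ?thesis by blast
  qed
qed

lemma pw_eventually:
  assumes "beyond a s c"
  shows "\<exists>c'. eventually (\<lambda>t. pw C A L t = c' + sgb s * of_int (pwsl A L a s) * t) (dfil a s)"
proof (induction L)
  case Nil
  have "eventually (\<lambda>t. pw C A [] t = C + sgb s * of_int (pwsl A [] a s) * t) (dfil a s)"
    by (cases s) (simp_all add: pw_def pwsl_def)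
  then show ?case by blast
next
  case (Cons x L)
  obtain n p where x: "x = (n, p)" by (cases x)
  obtain c1 where 1: "eventually (\<lambda>t. pw C A L t = c1 + sgb s * of_int (pwsl A L a s) * t) (dfil a s)" using Cons by blast
  obtain c2 where 2: "eventually (\<lambda>t. max 0 (t - p) = c2 + sgb s * of_int (rsl p a s) * t) (dfil a s)"
    using ramp_eventually[OF assms] by blast
  from 1 2 have "eventually (\<lambda>t. pw C A (x # L) t = (c1 + of_int n * c2) + sgb s * of_int (pwsl A (x # L) a s) * t) (dfil a s)"
  proof eventually_elim
    case (elim t)
    have "pw C A (x # L) t = pw C A L t + of_int n * max 0 (t - p)" by (simp add: pw_def x)
    moreover have "pwsl A (x # L) a s = pwsl A L a s + n * rsl p a s" by (simp add: pwsl_def x)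
    ultimately show ?case using elim by (simp add: algebra_simps)
  qed
  then show ?case by blast
qed

lemma pw_continuous: "continuous_on UNIV (pw C A L)"
proof (induction L)
  case Nil show ?case unfolding pw_def by (auto intro!: continuous_intros)
next
  case (Cons x L)
  have "pw C A (x # L) = (\<lambda>t. pw C A L t + of_int (fst x) * max 0 (t - snd x))"
    by (cases x) (auto simp: pw_def fun_eq_iff)
  then show ?case using Cons by (auto intro!: continuous_intros)
qed

lemma pwsl_jump: "pwsl A L (ereal t) True + pwsl A L (ereal t) False = (\<Sum>(n, p)\<leftarrow>L. if p = t then n else 0)"
proof (induction L)
  case (Cons x L)
  obtain n p where x: "x = (n, p)" by (cases x)
  have "pwsl A (x # L) a s = pwsl A L a s + n * rsl p a s" for a s by (simp add: pwsl_def x)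
  moreover have "rsl p (ereal t) True + rsl p (ereal t) False = (if p = t then 1 else 0)" by (simp add: rsl_def)
  then have "n * rsl p (ereal t) True + n * rsl p (ereal t) False = (if p = t then n else 0)"
    by (simp only: distrib_left[symmetric]) simp
  ultimately show ?case using Cons by (simp add: x)
qed (simp add: pwsl_def)

context curve_model
begin

section \<open>Gluing functions from their pieces on the edges\<close>

abbreviation "tgl e \<equiv> target (e, lo M e, True)"
abbreviation "tgh e \<equiv> target (e, hi M e, False)"

definition glue :: "('a \<Rightarrow> real) \<Rightarrow> ('a set \<Rightarrow> real) \<Rightarrow> ('a set \<Rightarrow> int) \<Rightarrow> ('a set \<Rightarrow> (int \<times> real) list) \<Rightarrow> 'a \<Rightarrow> real" where
  "glue \<phi> C A L y = (if y \<in> V then \<phi> y else pw (C (the_edge y)) (A (the_edge y)) (L (the_edge y)) (coord (the_edge y) y))"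

lemma glue_V: "y \<in> V \<Longrightarrow> glue \<phi> C A L y = \<phi> y"
  by (simp add: glue_def)

lemma glue_em: "e \<in> E \<Longrightarrow> t \<in> I e \<Longrightarrow> glue \<phi> C A L (em e t) = pw (C e) (A e) (L e) t"
  using em_not_V[of e t] by (simp add: glue_def)

lemma tgl_V: "e \<in> E \<Longrightarrow> tgl e \<in> V" and tgh_V: "e \<in> E \<Longrightarrow> tgh e \<in> V"
  using ends_target ends_lo ends_hi by auto

text \<open>Continuity at the ends with real coordinates. Infinite ends impose no condition, in
  keeping with \<open>PL\<close>.\<close>

definition glue_ok :: "('a \<Rightarrow> real) \<Rightarrow> ('a set \<Rightarrow> real) \<Rightarrow> ('a set \<Rightarrow> int) \<Rightarrow> ('a set \<Rightarrow> (int \<times> real) list) \<Rightarrow> bool" where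
  "glue_ok \<phi> C A L \<longleftrightarrow> (\<forall>e\<in>E. \<forall>t. (lo M e = ereal t \<longrightarrow> pw (C e) (A e) (L e) t = \<phi> (tgl e)) \<and>
     (hi M e = ereal t \<longrightarrow> pw (C e) (A e) (L e) t = \<phi> (tgh e)))"

lemma glue_PL:
  assumes ok: "glue_ok \<phi> C A L"
  shows "PL (glue \<phi> C A L)" and "(e, a, s) \<in> dirs \<Longrightarrow> sl (glue \<phi> C A L) (e, a, s) = pwsl (A e) (L e) a s"
    and "e \<in> E \<Longrightarrow> t \<in> I e \<Longrightarrow> dv (glue \<phi> C A L) (em e t) = (\<Sum>(n, p)\<leftarrow>L e. if p = t then n else 0)"
proof -
  let ?g = "glue \<phi> C A L"
  have ev: "eventually (\<lambda>t. ?g (em e t) = pw (C e) (A e) (L e) t) (dfil a s)" if d: "(e, a, s) \<in> dirs" for e a s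
    using dirs_ev_I[OF d] by eventually_elim (simp add: glue_em dirs_edge[OF d])
  have slp: "slp ?g (e, a, s) (pwsl (A e) (L e) a s)" if d: "(e, a, s) \<in> dirs" for e a s
  proof -
    obtain c where "eventually (\<lambda>t. pw (C e) (A e) (L e) t = c + sgb s * of_int (pwsl (A e) (L e) a s) * t) (dfil a s)"
      using pw_eventually[OF dirs_beyond[OF d]] by blast
    with ev[OF d] have "eventually (\<lambda>t. ?g (em e t) = c + sgb s * of_int (pwsl (A e) (L e) a s) * t) (dfil a s)"
      by eventually_elim simp
    then show ?thesis by (auto simp: slp_def)
  qed
  have lim: "dlim ?g (e, a, s)" if d: "(e, a, s) \<in> dirs" and inf: "target (e, a, s) \<notin> inf\<^sub>\<Gamma>" for e a s
  proof -
    obtain \<alpha> where a: "a = ereal \<alpha>" using dirs_real[OF d inf] by blast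
    have e: "e \<in> E" by (rule dirs_edge[OF d])
    have "isCont (pw (C e) (A e) (L e)) \<alpha>" using pw_continuous by (simp add: continuous_on_eq_continuous_at)
    moreover have "((\<lambda>t. t) \<longlongrightarrow> \<alpha>) (dfil a s)" using filterlim_dfil by (simp add: id_def a)
    ultimately have l: "((\<lambda>t. pw (C e) (A e) (L e) t) \<longlongrightarrow> pw (C e) (A e) (L e) \<alpha>) (dfil a s)"
      by (rule isCont_tendsto_compose)
    have "pw (C e) (A e) (L e) \<alpha> = ?g (target (e, a, s))"
      using d
    proof (cases rule: dirs_cases)
      case 1
      then consider "a = lo M e" "s" | "a = hi M e" "\<not> s" by (auto simp: ends_def)
      then show ?thesis
      proof cases
        case 1 then show ?thesis using ok e a tgl_V[OF e] by (simp add: glue_V glue_ok_def)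
      next
        case 2 then show ?thesis using ok e a tgh_V[OF e] by (simp add: glue_V glue_ok_def)
      qed
    next
      case (2 t)
      then show ?thesis using a by (simp add: target_I[OF e] glue_em[OF e])
    qed
    then have "((\<lambda>t. pw (C e) (A e) (L e) t) \<longlongrightarrow> ?g (target (e, a, s))) (dfil a s)" using l by simp
    then have "((\<lambda>t. ?g (em e t)) \<longlongrightarrow> ?g (target (e, a, s))) (dfil a s)"
      by (rule Lim_transform_eventually) (use ev[OF d] in \<open>auto elim: eventually_mono\<close>)
    then show ?thesis by (simp add: dlim_def)
  qed
  show "PL ?g" unfolding PL_def
  proof (intro ballI)
    fix d assume d: "d \<in> dirs"
    obtain e a s where ds: "d = (e, a, s)" by (cases d) auto
    show "(\<exists>m. slp ?g d m) \<and> (target d \<notin> inf\<^sub>\<Gamma> \<longrightarrow> dlim ?g d)"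
      using slp[OF d[unfolded ds]] lim[OF d[unfolded ds]] unfolding ds by blast
  qed
  show sl: "sl ?g (e, a, s) = pwsl (A e) (L e) a s" if "(e, a, s) \<in> dirs" for e a s
    using sl_eq[OF that slp[OF that]] .
  show "dv ?g (em e t) = (\<Sum>(n, p)\<leftarrow>L e. if p = t then n else 0)" if e: "e \<in> E" "t \<in> I e" for e t
    unfolding dv_I[OF e] sl[OF dirs_I[OF e]] by (rule pwsl_jump)
qed

text \<open>Subtracting a function that leaves every end with nonpositive slope can only increase
  the divisor at the vertices, so effectiveness is safe there.\<close>

lemma dv_V_nonpos:
  assumes "v \<in> V" "\<And>e. e \<in> E \<Longrightarrow> sl k (e, lo M e, True) \<le> 0 \<and> sl k (e, hi M e, False) \<le> 0"
  shows "dv k v \<le> 0"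
  unfolding dv_def dirs_at_V[OF assms(1)] using assms(2) by (intro sum_nonpos) (auto simp: ends_def)

definition improves :: "('a \<Rightarrow> int) \<Rightarrow> 'a \<Rightarrow> ('a \<Rightarrow> ereal) \<Rightarrow> ('a \<Rightarrow> ereal) \<Rightarrow> bool" where
  "improves D x0 f g \<longleftrightarrow> g \<in> RR \<Gamma> D \<and> (\<forall>x. x \<notin> inf\<^sub>\<Gamma> \<longrightarrow> g x \<le> f x) \<and> g x0 = f x0 \<and> card (chips D g) < card (chips D f)"

text \<open>Here \<open>\<phi>\<close> is the amount of lowering, so the divisor changes by
  \<open>- dv \<phi>\<close>. Every new chip is the image under \<open>F\<close> of an old chip
  other than \<open>b\<close>; it is this loss of \<open>b\<close> that makes the count
  drop.\<close>

lemma apply_move: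
  assumes D: "divisor D" and f: "f \<in> RR \<Gamma> D" and x0: "x0 \<notin> inf\<^sub>\<Gamma>" and PL: "PL \<phi>"
    and nonneg: "\<And>x. x \<notin> inf\<^sub>\<Gamma> \<Longrightarrow> 0 \<le> \<phi> x" and zero: "\<phi> x0 = 0"
    and eff: "\<And>x. dv \<phi> x \<le> (D + principal \<Gamma> f) x"
    and chips: "\<And>x. x \<notin> V \<Longrightarrow> (D + principal \<Gamma> f) x \<noteq> dv \<phi> x \<Longrightarrow> x \<in> F ` (chips D f - {b})" and b: "b \<in> chips D f"
  shows "\<exists>g. improves D x0 f g"
proof -
  note R = RR_D[OF f]
  let ?k = "\<lambda>x. rl f x - \<phi> x"
  have PLk: "PL ?k" by (rule PL_diff[OF R(2) PL])
  have dvk: "dv ?k x = dv (rl f) x - dv \<phi> x" for x by (rule dv_diff[OF R(2) PL])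
  have "0 \<le> D x + dv ?k x" for x using eff[of x] R(4) by (simp add: dvk)
  then obtain g where g: "g \<in> RR \<Gamma> D" "principal \<Gamma> g = dv ?k" "\<And>x. x \<notin> inf\<^sub>\<Gamma> \<Longrightarrow> g x = ereal (?k x)"
    using RR_extend[OF PLk] by blast
  have "chips D g \<subseteq> F ` (chips D f - {b})"
  proof
    fix x assume x: "x \<in> chips D g"
    then have "x \<notin> V" "(D + principal \<Gamma> f) x \<noteq> dv \<phi> x" using R(4) g(2) by (auto simp: chips_def supp_def dvk)
    then show "x \<in> F ` (chips D f - {b})" by (rule chips)
  qed
  then have "card (chips D g) \<le> card (F ` (chips D f - {b}))" using finite_chips[OF D f] by (intro card_mono) auto
  also have "\<dots> \<le> card (chips D f - {b})" using finite_chips[OF D f] by (intro card_image_le) auto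
  also have "\<dots> < card (chips D f)" using finite_chips[OF D f] b by (intro psubset_card_mono) auto
  finally have "card (chips D g) < card (chips D f)" .
  moreover have "g x \<le> f x" if "x \<notin> inf\<^sub>\<Gamma>" for x
    using g(3)[OF that] ereal_rl[OF R(3) that] nonneg[OF that] by simp
  moreover have "g x0 = f x0" using g(3)[OF x0] ereal_rl[OF R(3) x0] zero by simp
  ultimately show ?thesis using g(1) unfolding improves_def by blast
qed

lemma chip_pos:
  assumes "f \<in> RR \<Gamma> D" "x \<in> chips D f"
  shows "0 < (D + principal \<Gamma> f) x"
  using RR_D(4,5)[OF assms(1)] assms(2) by (auto simp: chips_def supp_def order_less_le)

lemma nonneg_E: "f \<in> RR \<Gamma> D \<Longrightarrow> 0 \<le> (D + principal \<Gamma> f) x"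
  using RR_D(4,5) by simp

text \<open>A lowering of one edge that vanishes at its finite ends, extended by 0. The position
  \<open>q\<close> is the one given up, and \<open>F\<close> moves the other positions.\<close>

lemma single_edge_move:
  assumes D: "divisor D" and f: "f \<in> RR \<Gamma> D" and x0: "x0 \<notin> inf\<^sub>\<Gamma>" and e: "e \<in> E"
    and zero: "\<And>t. lo M e = ereal t \<or> hi M e = ereal t \<Longrightarrow> pw c n l t = 0"
    and nonneg: "\<And>t. 0 \<le> pw c n l t"
    and x0e: "\<And>t. t \<in> I e \<Longrightarrow> x0 = em e t \<Longrightarrow> pw c n l t = 0"
    and ends: "pwsl n l (lo M e) True \<le> 0" "pwsl n l (hi M e) False \<le> 0"
    and eff: "\<And>t. t \<in> I e \<Longrightarrow> (\<Sum>(n, p)\<leftarrow>l. if p = t then n else 0) \<le> (D + principal \<Gamma> f) (em e t)"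
    and q: "q \<in> I e" "em e q \<in> chips D f"
    and chips: "\<And>t. t \<in> I e \<Longrightarrow> (D + principal \<Gamma> f) (em e t) \<noteq> (\<Sum>(n, p)\<leftarrow>l. if p = t then n else 0) \<Longrightarrow>
       \<exists>u\<in>I e. em e u \<in> chips D f \<and> u \<noteq> q \<and> t = F u"
  shows "\<exists>g. improves D x0 f g"
proof -
  define C where "C e' = (if e' = e then c else 0)" for e'
  define A where "A e' = (if e' = e then n else 0)" for e'
  define L where "L e' = (if e' = e then l else [])" for e'
  let ?\<phi> = "glue (\<lambda>_. 0) C A L"
  have pwe: "pw (C e') (A e') (L e') t = (if e' = e then pw c n l t else 0)" for e' t
    by (simp add: C_def A_def L_def pw_def)
  have "glue_ok (\<lambda>_. 0) C A L" using zero by (simp add: glue_ok_def pwe)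
  note G = glue_PL[OF this]
  have jump: "dv ?\<phi> (em e' t) = (if e' = e then (\<Sum>(n, p)\<leftarrow>l. if p = t then n else 0) else 0)" if "e' \<in> E" "t \<in> I e'" for e' t
    unfolding G(3)[OF that] by (simp add: L_def)
  have ends': "sl ?\<phi> (e', lo M e', True) \<le> 0 \<and> sl ?\<phi> (e', hi M e', False) \<le> 0" if "e' \<in> E" for e'
    unfolding G(2)[OF dirs_lo[OF that]] G(2)[OF dirs_hi[OF that]] using ends by (simp add: A_def L_def pwsl_def)
  let ?F = "\<lambda>y. if y \<in> e then em e (F (coord e y)) else y"
  show ?thesis
  proof (rule apply_move[OF D f x0 G(1), where F="?F" and b="em e q"])
    show "0 \<le> ?\<phi> x" for x
    proof (cases "x \<in> V")
      case False
      then obtain e' t where "e' \<in> E" "t \<in> I e'" "x = em e' t" by (rule not_V_cases)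
      then show ?thesis using nonneg by (simp add: glue_em pwe)
    qed (simp add: glue_V)
    show "?\<phi> x0 = 0"
    proof (cases "x0 \<in> V")
      case False
      then obtain e' t where "e' \<in> E" "t \<in> I e'" "x0 = em e' t" by (rule not_V_cases)
      then show ?thesis using x0e[of t] by (cases "e' = e") (simp_all add: glue_em pwe)
    qed (simp add: glue_V)
    show "dv ?\<phi> x \<le> (D + principal \<Gamma> f) x" for x
    proof (cases "x \<in> V")
      case True
      have "dv ?\<phi> x \<le> 0" by (rule dv_V_nonpos[OF True ends'])
      then show ?thesis using nonneg_E[OF f, of x] by linarith
    next
      case False
      then obtain e' t where et: "e' \<in> E" "t \<in> I e'" "x = em e' t" by (rule not_V_cases)
      show ?thesis unfolding et(3) jump[OF et(1,2)] using nonneg_E[OF f, of "em e' t"] eff[of t] et(2)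
        by (cases "e' = e") simp_all
    qed
    show "x \<in> ?F ` (chips D f - {em e q})" if xV: "x \<notin> V" and ne: "(D + principal \<Gamma> f) x \<noteq> dv ?\<phi> x" for x
    proof -
      from xV obtain e' t where et: "e' \<in> E" "t \<in> I e'" "x = em e' t" by (rule not_V_cases)
      show ?thesis
      proof (cases "e' = e")
        case True
        then obtain u where u: "u \<in> I e" "em e u \<in> chips D f" "u \<noteq> q" "t = F u"
          using chips[of t] ne et jump[OF et(1,2)] by auto
        have "em e u \<in> chips D f - {em e q}" using u(2,3) em_inj[OF e u(1) q(1)] by simp
        moreover have "x = ?F (em e u)" using em_in[OF e u(1)] coord_em[OF e u(1)] u(4) et(3) True by simp
        ultimately show ?thesis by blast
      next
        case False
        have xe: "x \<notin> e" using edge_disjoint[OF et(1) e, of x] em_in[OF et(1,2)] et(3) False by blast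
        have "dv ?\<phi> x = 0" unfolding et(3) jump[OF et(1,2)] using False by simp
        then have "x \<in> chips D f" using ne xV by (simp add: chips_def supp_def)
        moreover have "x \<noteq> em e q" using xe em_in[OF e q(1)] by blast
        ultimately show ?thesis using xe by (intro image_eqI[of _ _ x]) simp_all
      qed
    qed
    show "em e q \<in> chips D f" by (rule q(2))
  qed
qed

text \<open>All chips at \<open>p\<close> move to the infinite end of their edge.\<close>

lemma half_line_move_hi:
  assumes D: "divisor D" and f: "f \<in> RR \<Gamma> D" and x0: "x0 \<notin> inf\<^sub>\<Gamma>"
    and e: "e \<in> E" and p: "p \<in> I e" "em e p \<in> chips D f" and hi: "hi M e = \<infinity>"
    and x0e: "\<And>t. t \<in> I e \<Longrightarrow> x0 = em e t \<Longrightarrow> t \<le> p"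
  shows "\<exists>g. improves D x0 f g"
proof -
  define k where "k = (D + principal \<Gamma> f) (em e p)"
  have k: "k > 0" using chip_pos[OF f p(2)] by (simp add: k_def)
  have pI: "lo M e < ereal p" using p(1) by (simp add: edge_interval_def)
  have pwe: "pw 0 0 [(k, p)] t = of_int k * max 0 (t - p)" for t by (simp add: pw_def)
  show ?thesis
  \<comment> \<open>The kink \<open>k\<close> removes everything at \<open>p\<close>. Beyond
    \<open>p\<close> the lowering grows without bound, and the multiplicity reappears at the end of
    the edge, a vertex, where it is not counted as a chip.\<close>
  proof (rule single_edge_move[OF D f x0 e, where c=0 and n=0 and l="[(k, p)]" and q=p and F=id])
    show "pwsl 0 [(k, p)] (lo M e) True \<le> 0" "pwsl 0 [(k, p)] (hi M e) False \<le> 0"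
      using k pI by (simp_all add: pwsl_def rsl_def hi)
    show "\<exists>u\<in>I e. em e u \<in> chips D f \<and> u \<noteq> p \<and> t = id u"
      if "t \<in> I e" "(D + principal \<Gamma> f) (em e t) \<noteq> (\<Sum>(n, p)\<leftarrow>[(k, p)]. if p = t then n else 0)" for t
      using that em_not_V[OF e that(1)] by (intro bexI[of _ t]) (auto simp: k_def chips_def supp_def split: if_splits)
    show "(\<Sum>(n, p)\<leftarrow>[(k, p)]. if p = t then n else 0) \<le> (D + principal \<Gamma> f) (em e t)" for t
      using nonneg_E[OF f, of "em e t"] by (simp add: k_def)
  qed (use k p x0e pI hi in \<open>auto simp: pwe\<close>)
qed

lemma half_line_move_lo:
  assumes D: "divisor D" and f: "f \<in> RR \<Gamma> D" and x0: "x0 \<notin> inf\<^sub>\<Gamma>"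
    and e: "e \<in> E" and p: "p \<in> I e" "em e p \<in> chips D f" and lo: "lo M e = - \<infinity>"
    and x0e: "\<And>t. t \<in> I e \<Longrightarrow> x0 = em e t \<Longrightarrow> p \<le> t"
  shows "\<exists>g. improves D x0 f g"
proof -
  define k where "k = (D + principal \<Gamma> f) (em e p)"
  have k: "k > 0" using chip_pos[OF f p(2)] by (simp add: k_def)
  have pI: "ereal p < hi M e" using p(1) by (simp add: edge_interval_def)
  \<comment> \<open>A falling ramp is a line of slope \<open>- k\<close> corrected by a kink
    \<open>k\<close> at \<open>p\<close>; the constant makes it vanish from \<open>p\<close>
    on.\<close>
  have pwe: "pw (of_int k * p) (- k) [(k, p)] t = of_int k * max 0 (p - t)" for t
    by (simp add: pw_def max_def algebra_simps)
  show ?thesis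
  proof (rule single_edge_move[OF D f x0 e, where c="of_int k * p" and n="- k" and l="[(k, p)]" and q=p and F=id])
    show "pwsl (- k) [(k, p)] (lo M e) True \<le> 0" "pwsl (- k) [(k, p)] (hi M e) False \<le> 0"
      using k pI by (simp_all add: pwsl_def rsl_def lo)
    show "\<exists>u\<in>I e. em e u \<in> chips D f \<and> u \<noteq> p \<and> t = id u"
      if "t \<in> I e" "(D + principal \<Gamma> f) (em e t) \<noteq> (\<Sum>(n, p)\<leftarrow>[(k, p)]. if p = t then n else 0)" for t
      using that em_not_V[OF e that(1)] by (intro bexI[of _ t]) (auto simp: k_def chips_def supp_def split: if_splits)
    show "(\<Sum>(n, p)\<leftarrow>[(k, p)]. if p = t then n else 0) \<le> (D + principal \<Gamma> f) (em e t)" for t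
      using nonneg_E[OF f, of "em e t"] by (simp add: k_def)
  qed (use k p x0e pI lo in \<open>auto simp: pwe\<close>)
qed

text \<open>The chips at \<open>p\<close> and \<open>q\<close> move towards each other until they meet in \<open>m\<close>.\<close>

lemma hill_move:
  assumes D: "divisor D" and f: "f \<in> RR \<Gamma> D" and x0: "x0 \<notin> inf\<^sub>\<Gamma>"
    and e: "e \<in> E" and p: "p \<in> I e" "em e p \<in> chips D f" and q: "q \<in> I e" "em e q \<in> chips D f" and pq: "p < q"
    and x0e: "\<And>t. t \<in> I e \<Longrightarrow> x0 = em e t \<Longrightarrow> t \<le> p \<or> q \<le> t"
  shows "\<exists>g. improves D x0 f g"
proof -
  define k where "k = (D + principal \<Gamma> f) (em e p)"
  define l where "l = (D + principal \<Gamma> f) (em e q)"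
  have kl: "k > 0" "l > 0" using chip_pos[OF f] p q by (auto simp: k_def l_def)
  \<comment> \<open>The weighted mean makes the rise of slope \<open>k\<close> from \<open>p\<close>
    to \<open>m\<close> equal to the descent of slope \<open>l\<close> from \<open>m\<close> to
    \<open>q\<close>, although slopes are prescribed by the multiplicities.\<close>
  define m where "m = (of_int k * p + of_int l * q) / of_int (k + l)"
  have klr: "real_of_int k > 0" "real_of_int l > 0" "real_of_int k + real_of_int l > 0" using kl by auto
  have mk: "of_int k * (m - p) = of_int l * (q - m)"
    using klr by (simp add: m_def field_simps)
  have pm: "p < m" "m < q" using klr pq by (simp_all add: m_def field_simps)
  let ?L = "[(k, p), (- (k + l), m), (l, q)]"
  have pwe: "pw 0 0 ?L t = of_int k * max 0 (t - p) - (of_int k + of_int l) * max 0 (t - m) + of_int l * max 0 (t - q)" for t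
    by (simp add: pw_def algebra_simps)
  have below: "pw 0 0 ?L t = 0" if "t \<le> p" for t using that pm unfolding pwe by simp
  have above: "pw 0 0 ?L t = 0" if "q \<le> t" for t
  proof -
    have "pw 0 0 ?L t = of_int k * (t - p) - (of_int k + of_int l) * (t - m) + of_int l * (t - q)"
      using that pm unfolding pwe by simp
    also have "\<dots> = of_int k * (m - p) - of_int l * (q - m)" by (simp add: algebra_simps)
    finally show ?thesis using mk by simp
  qed
  have nonneg: "0 \<le> pw 0 0 ?L t" for t
  proof -
    consider "t \<le> p \<or> q \<le> t" | "p \<le> t" "t \<le> m" | "m \<le> t" "t \<le> q" by linarith
    then show ?thesis
    proof cases
      case 1 then show ?thesis using below[of t] above[of t] by linarith
    next
      case 2
      then have "pw 0 0 ?L t = of_int k * (t - p)" using pm unfolding pwe by simp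
      then show ?thesis using klr 2 by simp
    next
      case 3
      then have "pw 0 0 ?L t = of_int k * (t - p) - (of_int k + of_int l) * (t - m)" using pm unfolding pwe by simp
      also have "\<dots> = of_int k * (m - p) - of_int l * (t - m)" by (simp add: algebra_simps)
      also have "\<dots> = of_int l * (q - t)" unfolding mk by (simp add: algebra_simps)
      finally show ?thesis using klr 3 by simp
    qed
  qed
  have I: "lo M e < ereal p" "ereal q < hi M e" using p(1) q(1) by (auto simp: edge_interval_def)
  have I': "lo M e < ereal m" "lo M e < ereal q" "ereal p < hi M e" "ereal m < hi M e"
    using I pm less_trans[OF I(1)] less_trans[OF _ I(2)] by auto
  have jump: "(\<Sum>(n, p)\<leftarrow>?L. if p = t then n else 0) = (if t = p then k else if t = m then - (k + l) else if t = q then l else 0)" for t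
    using pm by auto
  show ?thesis
  \<comment> \<open>Both positions end at \<open>m\<close>: it is taken as the image of
    \<open>p\<close>, and \<open>q\<close> is the position given up.\<close>
  proof (rule single_edge_move[OF D f x0 e, where c=0 and n=0 and l="?L" and q=q and F="\<lambda>u. if u = p then m else u"])
    show "pw 0 0 ?L t = 0" if "lo M e = ereal t \<or> hi M e = ereal t" for t
      using that I below[of t] above[of t] by auto
    show "pw 0 0 ?L t = 0" if "t \<in> I e" "x0 = em e t" for t using x0e[OF that] below above by blast
    show "pwsl 0 ?L (lo M e) True \<le> 0" "pwsl 0 ?L (hi M e) False \<le> 0"
      using kl I I' by (simp_all add: pwsl_def rsl_def not_le)
    show "(\<Sum>(n, p)\<leftarrow>?L. if p = t then n else 0) \<le> (D + principal \<Gamma> f) (em e t)" for t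
      unfolding jump using nonneg_E[OF f, of "em e t"] kl by (auto simp: k_def l_def)
    show "\<exists>u\<in>I e. em e u \<in> chips D f \<and> u \<noteq> q \<and> t = (if u = p then m else u)"
      if t: "t \<in> I e" and ne: "(D + principal \<Gamma> f) (em e t) \<noteq> (\<Sum>(n, p)\<leftarrow>?L. if p = t then n else 0)" for t
    proof (cases "t = m")
      case True
      then show ?thesis using p pq by (intro bexI[of _ p]) auto
    next
      case False
      then have tpq: "t \<noteq> p" "t \<noteq> q" using ne pm unfolding jump by (auto simp: k_def l_def)
      then have "(D + principal \<Gamma> f) (em e t) \<noteq> 0" using ne False unfolding jump by simp
      with tpq show ?thesis using t em_not_V[OF e t] by (intro bexI[of _ t]) (auto simp: chips_def supp_def)
    qed
  qed (use nonneg q in auto)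
qed

end

text \<open>Profile for points moving from \<open>p\<close> down to \<open>p'\<close>: height
  \<open>\<epsilon>\<close> up to \<open>p'\<close>, then a descent of slope \<open>k\<close> that
  reaches 0 at \<open>p\<close>.\<close>

lemma down_step:
  fixes k p p' \<epsilon> t :: real
  assumes "k > 0" "k * (p - p') = \<epsilon>" "p' < p"
  shows "t \<le> p' \<Longrightarrow> \<epsilon> - k * max 0 (t - p') + k * max 0 (t - p) = \<epsilon>"
    and "p \<le> t \<Longrightarrow> \<epsilon> - k * max 0 (t - p') + k * max 0 (t - p) = 0"
    and "0 \<le> \<epsilon> - k * max 0 (t - p') + k * max 0 (t - p)"
proof -
  show "t \<le> p' \<Longrightarrow> \<epsilon> - k * max 0 (t - p') + k * max 0 (t - p) = \<epsilon>" using assms(3) by simp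
  show 2: "p \<le> t \<Longrightarrow> \<epsilon> - k * max 0 (t - p') + k * max 0 (t - p) = 0"
    using assms(3) by (simp add: assms(2)[symmetric] algebra_simps)
  show "0 \<le> \<epsilon> - k * max 0 (t - p') + k * max 0 (t - p)"
  proof (cases "p \<le> t")
    case False
    have "k * max 0 (t - p') \<le> k * (p - p')" using assms False by (intro mult_left_mono) auto
    then show ?thesis using False assms(2) by simp
  next
    case True
    show ?thesis unfolding 2[OF True] ..
  qed
qed

text \<open>The mirror image: height 0 up to \<open>q\<close>, then a rise of slope \<open>k\<close>
  to \<open>\<epsilon>\<close> at \<open>q'\<close>.\<close>

lemma up_step:
  fixes k q q' \<epsilon> t :: real
  assumes "k > 0" "k * (q' - q) = \<epsilon>" "q < q'"
  shows "t \<le> q \<Longrightarrow> k * max 0 (t - q) - k * max 0 (t - q') = 0"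
    and "q' \<le> t \<Longrightarrow> k * max 0 (t - q) - k * max 0 (t - q') = \<epsilon>"
    and "0 \<le> k * max 0 (t - q) - k * max 0 (t - q')"
proof -
  show "t \<le> q \<Longrightarrow> k * max 0 (t - q) - k * max 0 (t - q') = 0" using assms(3) by simp
  show "q' \<le> t \<Longrightarrow> k * max 0 (t - q) - k * max 0 (t - q') = \<epsilon>"
    using assms(3) by (simp add: assms(2)[symmetric] algebra_simps)
  have "k * max 0 (t - q') \<le> k * max 0 (t - q)" using assms by (intro mult_left_mono) auto
  then show "0 \<le> k * max 0 (t - q) - k * max 0 (t - q')" by simp
qed

context curve_model
begin

text \<open>The function is lowered by \<open>\<epsilon>\<close> on the part of the curve spanned by the vertices \<open>W\<close>: on
  the edges outside \<open>K\<close> the chips at \<open>p\<close> and \<open>q\<close> move towards the ends of the edge in \<open>W\<close>, and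
  \<open>\<epsilon>\<close> is such that the first of them reaches a vertex.\<close>

lemma step_move:
  assumes D: "divisor D" and f: "f \<in> RR \<Gamma> D" and x0: "x0 \<notin> inf\<^sub>\<Gamma>" and \<epsilon>: "\<epsilon> > 0"
    and K: "\<And>e. e \<in> E \<Longrightarrow> e \<in> K \<Longrightarrow> tgl e \<in> W \<and> tgh e \<in> W"
    and lo: "\<And>e. e \<in> E \<Longrightarrow> e \<notin> K \<Longrightarrow> tgl e \<in> W \<Longrightarrow> p e \<in> I e \<and> em e (p e) \<in> chips D f \<and>
       lo M e \<le> ereal (p e - \<epsilon> / of_int ((D + principal \<Gamma> f) (em e (p e))))"
    and hi: "\<And>e. e \<in> E \<Longrightarrow> e \<notin> K \<Longrightarrow> tgh e \<in> W \<Longrightarrow> q e \<in> I e \<and> em e (q e) \<in> chips D f \<and>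
       ereal (q e + \<epsilon> / of_int ((D + principal \<Gamma> f) (em e (q e)))) \<le> hi M e"
    and both: "\<And>e. e \<in> E \<Longrightarrow> e \<notin> K \<Longrightarrow> tgl e \<in> W \<Longrightarrow> tgh e \<in> W \<Longrightarrow> p e < q e"
    and e0: "e0 \<in> E" "e0 \<notin> K"
    and hit: "tgl e0 \<in> W \<and> lo M e0 = ereal (p e0 - \<epsilon> / of_int ((D + principal \<Gamma> f) (em e0 (p e0)))) \<or>
       tgh e0 \<in> W \<and> hi M e0 = ereal (q e0 + \<epsilon> / of_int ((D + principal \<Gamma> f) (em e0 (q e0))))"
    and x0V: "x0 \<notin> W"
    and x0e: "\<And>e t. e \<in> E \<Longrightarrow> t \<in> I e \<Longrightarrow> x0 = em e t \<Longrightarrow> e \<notin> K \<and> (tgl e \<in> W \<longrightarrow> p e \<le> t) \<and> (tgh e \<in> W \<longrightarrow> t \<le> q e)"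
  shows "\<exists>g. improves D x0 f g"
proof -
  define k where "k e = (D + principal \<Gamma> f) (em e (p e))" for e
  define l where "l e = (D + principal \<Gamma> f) (em e (q e))" for e
  define p' where "p' e = p e - \<epsilon> / of_int (k e)" for e
  define q' where "q' e = q e + \<epsilon> / of_int (l e)" for e
  define C where "C e = (if e \<in> K \<or> tgl e \<in> W then \<epsilon> else 0)" for e
  \<comment> \<open>One kink removes the multiplicity at the old position, the opposite kink
    restores it at the new one. The displacement is \<open>\<epsilon>\<close> divided by the
    multiplicity, so that the slope between them produces the height \<open>\<epsilon>\<close>. On
    \<open>K\<close> the lowering is constant.\<close>
  define L where "L e = (if e \<in> K then [] else (if tgl e \<in> W then [(- k e, p' e), (k e, p e)] else []) @
     (if tgh e \<in> W then [(l e, q e), (- l e, q' e)] else []))" for e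
  define dn where "dn e t = (if tgl e \<in> W then \<epsilon> - of_int (k e) * max 0 (t - p' e) + of_int (k e) * max 0 (t - p e) else 0)" for e t
  define up where "up e t = (if tgh e \<in> W then of_int (l e) * max 0 (t - q e) - of_int (l e) * max 0 (t - q' e) else 0)" for e t
  define \<phi>v where "\<phi>v v = (if v \<in> W then \<epsilon> else 0)" for v
  let ?\<phi> = "glue \<phi>v C (\<lambda>_. 0) L"
  have pwK: "pw (C e) 0 (L e) t = \<epsilon>" if "e \<in> K" for e t using that by (simp add: pw_def C_def L_def)
  have pwN: "pw (C e) 0 (L e) t = dn e t + up e t" if "e \<notin> K" for e t
    using that by (simp add: pw_def C_def L_def dn_def up_def)
  have P: "p e \<in> I e" "em e (p e) \<in> chips D f" "k e > 0" "of_int (k e) * (p e - p' e) = \<epsilon>" "p' e < p e" "lo M e \<le> ereal (p' e)"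
    "lo M e < ereal (p e)" "ereal (p e) < hi M e"
    if "e \<in> E" "e \<notin> K" "tgl e \<in> W" for e
  proof -
    show 1: "p e \<in> I e" "em e (p e) \<in> chips D f" "lo M e \<le> ereal (p' e)" using lo[OF that] by (auto simp: p'_def k_def)
    show 2: "k e > 0" using chip_pos[OF f 1(2)] by (simp add: k_def)
    then show "of_int (k e) * (p e - p' e) = \<epsilon>" "p' e < p e" using \<epsilon> by (simp_all add: p'_def)
    show "lo M e < ereal (p e)" "ereal (p e) < hi M e" using 1(1) by (auto simp: edge_interval_def)
  qed
  have Q: "q e \<in> I e" "em e (q e) \<in> chips D f" "l e > 0" "of_int (l e) * (q' e - q e) = \<epsilon>" "q e < q' e" "ereal (q' e) \<le> hi M e"
    "lo M e < ereal (q e)" "ereal (q e) < hi M e"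
    if "e \<in> E" "e \<notin> K" "tgh e \<in> W" for e
  proof -
    show 1: "q e \<in> I e" "em e (q e) \<in> chips D f" "ereal (q' e) \<le> hi M e" using hi[OF that] by (auto simp: q'_def l_def)
    show 2: "l e > 0" using chip_pos[OF f 1(2)] by (simp add: l_def)
    then show "of_int (l e) * (q' e - q e) = \<epsilon>" "q e < q' e" using \<epsilon> by (simp_all add: q'_def)
    show "lo M e < ereal (q e)" "ereal (q e) < hi M e" using 1(1) by (auto simp: edge_interval_def)
  qed
  have dn1: "t \<le> p' e \<Longrightarrow> dn e t = \<epsilon>" "p e \<le> t \<Longrightarrow> dn e t = 0" "0 \<le> dn e t"
    if "e \<in> E" "e \<notin> K" "tgl e \<in> W" for e t
    using down_step[of "of_int (k e)" "p e" "p' e" \<epsilon> t] P[OF that] that by (simp_all add: dn_def)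
  have dn0: "dn e t = 0" if "tgl e \<notin> W" for e t using that by (simp add: dn_def)
  have up1: "t \<le> q e \<Longrightarrow> up e t = 0" "q' e \<le> t \<Longrightarrow> up e t = \<epsilon>" "0 \<le> up e t"
    if "e \<in> E" "e \<notin> K" "tgh e \<in> W" for e t
    using up_step[of "of_int (l e)" "q' e" "q e" \<epsilon> t] Q[OF that] that by (simp_all add: up_def)
  have up0: "up e t = 0" if "tgh e \<notin> W" for e t using that by (simp add: up_def)
  have "glue_ok \<phi>v C (\<lambda>_. 0) L"
    unfolding glue_ok_def
  proof (intro ballI allI conjI impI)
    fix e t assume e: "e \<in> E" and t: "lo M e = ereal t"
    show "pw (C e) 0 (L e) t = \<phi>v (tgl e)"
    proof (cases "e \<in> K")
      case True then show ?thesis using K[OF e] by (simp add: pwK \<phi>v_def)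
    next
      case False
      have "up e t = 0" using up0 up1(1)[OF e False] Q(7)[OF e False] t by (cases "tgh e \<in> W") auto
      moreover have "dn e t = \<phi>v (tgl e)" using dn0 dn1(1)[OF e False] P(6)[OF e False] t by (cases "tgl e \<in> W") (auto simp: \<phi>v_def)
      ultimately show ?thesis by (simp add: pwN[OF False])
    qed
  next
    fix e t assume e: "e \<in> E" and t: "hi M e = ereal t"
    show "pw (C e) 0 (L e) t = \<phi>v (tgh e)"
    proof (cases "e \<in> K")
      case True then show ?thesis using K[OF e] by (simp add: pwK \<phi>v_def)
    next
      case False
      have "dn e t = 0" using dn0 dn1(2)[OF e False] P(8)[OF e False] t by (cases "tgl e \<in> W") auto
      moreover have "up e t = \<phi>v (tgh e)" using up0 up1(2)[OF e False] Q(6)[OF e False] t by (cases "tgh e \<in> W") (auto simp: \<phi>v_def)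
      ultimately show ?thesis by (simp add: pwN[OF False])
    qed
  qed
  note G = glue_PL[OF this]
  have jumpK: "dv ?\<phi> (em e t) = 0" if "e \<in> E" "t \<in> I e" "e \<in> K" for e t
    unfolding G(3)[OF that(1,2)] using that(3) by (simp add: L_def)
  have jumpN: "dv ?\<phi> (em e t) = (if tgl e \<in> W then (if p' e = t then - k e else 0) + (if p e = t then k e else 0) else 0)
      + (if tgh e \<in> W then (if q e = t then l e else 0) + (if q' e = t then - l e else 0) else 0)"
    if "e \<in> E" "t \<in> I e" "e \<notin> K" for e t
    unfolding G(3)[OF that(1,2)] using that(3) by (simp add: L_def)
  \<comment> \<open>An end is left with slope 0, unless a moving point has just arrived there; then
    the slope is minus its multiplicity, which the vertex receives.\<close>
  have ends: "sl ?\<phi> (e, lo M e, True) \<le> 0 \<and> sl ?\<phi> (e, hi M e, False) \<le> 0" if e: "e \<in> E" for e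
  proof (cases "e \<in> K")
    case True then show ?thesis using G(2)[OF dirs_lo[OF e]] G(2)[OF dirs_hi[OF e]] by (simp add: pwsl_def L_def)
  next
    case False
    have dnl: "tgl e \<in> W \<Longrightarrow> - k e * rsl (p' e) (lo M e) True + k e * rsl (p e) (lo M e) True \<le> 0"
      using P[OF e False] by (auto simp: rsl_def)
    have upl: "tgh e \<in> W \<Longrightarrow> l e * rsl (q e) (lo M e) True + - l e * rsl (q' e) (lo M e) True \<le> 0"
      using Q[OF e False] by (auto simp: rsl_def)
    have dnh: "tgl e \<in> W \<Longrightarrow> - k e * rsl (p' e) (hi M e) False + k e * rsl (p e) (hi M e) False \<le> 0"
    proof -
      assume W: "tgl e \<in> W"
      have "ereal (p' e) < ereal (p e)" using P(5)[OF e False W] by simp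
      then have "ereal (p' e) < hi M e" using P(8)[OF e False W] by (rule less_trans)
      then show ?thesis using P(8)[OF e False W] by (simp add: rsl_def)
    qed
    have uph: "tgh e \<in> W \<Longrightarrow> l e * rsl (q e) (hi M e) False + - l e * rsl (q' e) (hi M e) False \<le> 0"
      using Q[OF e False] by (auto simp: rsl_def)
    have sum: "pwsl 0 (L e) a s = (if tgl e \<in> W then - k e * rsl (p' e) a s + k e * rsl (p e) a s else 0)
        + (if tgh e \<in> W then l e * rsl (q e) a s + - l e * rsl (q' e) a s else 0)" for a s
      using False by (simp add: pwsl_def L_def)
    have if_le: "(P \<Longrightarrow> i \<le> 0) \<Longrightarrow> (if P then i else 0) \<le> 0" for P and i :: int by simp
    show ?thesis unfolding G(2)[OF dirs_lo[OF e]] G(2)[OF dirs_hi[OF e]] sum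
      by (intro conjI add_nonpos_nonpos[OF if_le if_le]; (rule dnl upl dnh uph; assumption))
  qed
  \<comment> \<open>The point of \<open>e0\<close> that reaches a vertex has no new position inside
    the edge; it is the chip lost in the count.\<close>
  have b: "\<exists>b. b \<in> chips D f \<and> (b = em e0 (p e0) \<and> tgl e0 \<in> W \<and> p' e0 \<notin> I e0 \<or> b = em e0 (q e0) \<and> tgh e0 \<in> W \<and> q' e0 \<notin> I e0)"
    using hit
  proof
    assume h: "tgl e0 \<in> W \<and> lo M e0 = ereal (p e0 - \<epsilon> / of_int ((D + principal \<Gamma> f) (em e0 (p e0))))"
    then have "p' e0 \<notin> I e0" by (simp add: edge_interval_def p'_def k_def)
    then show ?thesis using h P(2)[OF e0] by blast
  next
    assume h: "tgh e0 \<in> W \<and> hi M e0 = ereal (q e0 + \<epsilon> / of_int ((D + principal \<Gamma> f) (em e0 (q e0))))"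
    then have "q' e0 \<notin> I e0" by (simp add: edge_interval_def q'_def l_def)
    then show ?thesis using h Q(2)[OF e0] by blast
  qed
  then obtain b where b: "b \<in> chips D f"
    "b = em e0 (p e0) \<and> tgl e0 \<in> W \<and> p' e0 \<notin> I e0 \<or> b = em e0 (q e0) \<and> tgh e0 \<in> W \<and> q' e0 \<notin> I e0" by blast
  have b_em: "e = e0 \<and> (tgl e0 \<in> W \<and> t = p e0 \<and> p' e0 \<notin> I e0 \<or> tgh e0 \<in> W \<and> t = q e0 \<and> q' e0 \<notin> I e0)"
    if "e \<in> E" "t \<in> I e" "em e t = b" for e t
    using b(2)
  proof
    assume h: "b = em e0 (p e0) \<and> tgl e0 \<in> W \<and> p' e0 \<notin> I e0"
    then have "e = e0 \<and> t = p e0" using em_inj2[OF that(1,2) e0(1) P(1)[OF e0]] that(3) by blast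
    then show ?thesis using h by blast
  next
    assume h: "b = em e0 (q e0) \<and> tgh e0 \<in> W \<and> q' e0 \<notin> I e0"
    then have "e = e0 \<and> t = q e0" using em_inj2[OF that(1,2) e0(1) Q(1)[OF e0]] that(3) by blast
    then show ?thesis using h by blast
  qed
  \<comment> \<open>Old positions go to the new ones, all other chips stay. Where a moving point
    lands on another chip, \<open>F\<close> merges them, which only lowers the count.\<close>
  define F where "F y = (let e = the_edge y; t = coord e y in
     if e \<notin> K \<and> tgl e \<in> W \<and> t = p e then em e (p' e) else if e \<notin> K \<and> tgh e \<in> W \<and> t = q e then em e (q' e) else y)" for y
  have F: "F (em e t) = (if e \<notin> K \<and> tgl e \<in> W \<and> t = p e then em e (p' e) else if e \<notin> K \<and> tgh e \<in> W \<and> t = q e then em e (q' e) else em e t)"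
    if "e \<in> E" "t \<in> I e" for e t unfolding F_def Let_def the_edge_em[OF that] coord_em[OF that] ..
  show ?thesis
  proof (rule apply_move[OF D f x0 G(1), where F=F and b=b])
    show "0 \<le> ?\<phi> x" for x
    proof (cases "x \<in> V")
      case True then show ?thesis using \<epsilon> by (simp add: glue_V \<phi>v_def)
    next
      case False
      then obtain e t where et: "e \<in> E" "t \<in> I e" "x = em e t" by (rule not_V_cases)
      show ?thesis
      proof (cases "e \<in> K")
        case True then show ?thesis using et \<epsilon> by (simp add: glue_em pwK)
      next
        case False
        have "0 \<le> dn e t" using dn0 dn1(3)[OF et(1) False] by (cases "tgl e \<in> W") auto
        moreover have "0 \<le> up e t" using up0 up1(3)[OF et(1) False] by (cases "tgh e \<in> W") auto
        ultimately show ?thesis using et False by (simp add: glue_em pwN)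
      qed
    qed
    show "?\<phi> x0 = 0"
    proof (cases "x0 \<in> V")
      case True then show ?thesis using x0V by (simp add: glue_V \<phi>v_def)
    next
      case False
      then obtain e t where et: "e \<in> E" "t \<in> I e" "x0 = em e t" by (rule not_V_cases)
      note c = x0e[OF et]
      have "dn e t = 0" using dn0 dn1(2)[OF et(1)] c by (cases "tgl e \<in> W") auto
      moreover have "up e t = 0" using up0 up1(1)[OF et(1)] c by (cases "tgh e \<in> W") auto
      ultimately show ?thesis using et c by (simp add: glue_em pwN)
    qed
    show "dv ?\<phi> x \<le> (D + principal \<Gamma> f) x" for x
    proof (cases "x \<in> V")
      case True
      have "dv ?\<phi> x \<le> 0" by (rule dv_V_nonpos[OF True ends])
      then show ?thesis using nonneg_E[OF f, of x] by linarith
    next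
      case False
      then obtain e t where et: "e \<in> E" "t \<in> I e" "x = em e t" by (rule not_V_cases)
      note nn = nonneg_E[OF f, of x]
      show ?thesis
      proof (cases "e \<in> K")
        case True then show ?thesis using jumpK[OF et(1,2)] et(3) nn by simp
      next
        case N: False
        \<comment> \<open>A negative kink of \<open>\<phi>\<close> adds to the divisor and may be
          dropped; a positive one takes exactly the multiplicity present at the old
          position.\<close>
        have A: "(if tgl e \<in> W then (if p' e = t then - k e else 0) + (if p e = t then k e else 0) else 0)
           \<le> (if tgl e \<in> W \<and> p e = t then (D + principal \<Gamma> f) x else 0)"
          using P(3)[OF et(1) N] et(3) by (auto simp: k_def)
        have B: "(if tgh e \<in> W then (if q e = t then l e else 0) + (if q' e = t then - l e else 0) else 0)
           \<le> (if tgh e \<in> W \<and> q e = t then (D + principal \<Gamma> f) x else 0)"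
          using Q(3)[OF et(1) N] et(3) by (auto simp: l_def)
        \<comment> \<open>The hypothesis \<open>both\<close> keeps the two old positions of an edge
          apart, so no multiplicity is taken away twice.\<close>
        have "(if tgl e \<in> W \<and> p e = t then (D + principal \<Gamma> f) x else 0) + (if tgh e \<in> W \<and> q e = t then (D + principal \<Gamma> f) x else 0)
           \<le> (D + principal \<Gamma> f) x"
          using both[OF et(1) N] nn by (cases "tgl e \<in> W \<and> p e = t"; cases "tgh e \<in> W \<and> q e = t") auto
        moreover have "dv ?\<phi> x \<le> (if tgl e \<in> W \<and> p e = t then (D + principal \<Gamma> f) x else 0) + (if tgh e \<in> W \<and> q e = t then (D + principal \<Gamma> f) x else 0)"
          using add_mono[OF A B] unfolding jumpN[OF et(1,2) N, folded et(3)] .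
        ultimately show ?thesis by linarith
      qed
    qed
    show "x \<in> F ` (chips D f - {b})" if xV: "x \<notin> V" and ne: "(D + principal \<Gamma> f) x \<noteq> dv ?\<phi> x" for x
    proof -
      from xV obtain e t where et: "e \<in> E" "t \<in> I e" "x = em e t" by (rule not_V_cases)
      have stay: ?thesis if "dv ?\<phi> x = 0" "x \<noteq> b" "F x = x"
      proof -
        have "x \<in> chips D f" using ne that(1) xV by (simp add: chips_def supp_def)
        then show ?thesis using that(2,3) by (metis DiffI image_eqI singletonD)
      qed
      show ?thesis
      proof (cases "e \<in> K")
        case True
        have "x \<noteq> b" using b_em[OF et(1,2)] et(3) True e0(2) by blast
        moreover have "F x = x" using F[OF et(1,2)] True et(3) by simp
        ultimately show ?thesis using stay jumpK[OF et(1,2) True] et(3) by blast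
      next
        case N: False
        consider (c1) "tgl e \<in> W" "t = p' e" | (c2) "tgh e \<in> W" "t = q' e"
          | (c3) "\<not> (tgl e \<in> W \<and> t = p' e)" "\<not> (tgh e \<in> W \<and> t = q' e)" by blast
        then show ?thesis
        proof cases
          case c1
          note Pe = P[OF et(1) N c1(1)]
          have "em e (p e) \<noteq> b"
          proof
            assume "em e (p e) = b"
            from b_em[OF et(1) Pe(1) this] show False
              using both[OF e0] c1 et(2) by auto
          qed
          moreover have "x = F (em e (p e))" using F[OF et(1) Pe(1)] N c1 et(3) by simp
          ultimately show ?thesis using Pe(2) by blast
        next
          case c2
          note Qe = Q[OF et(1) N c2(1)]
          have "em e (q e) \<noteq> b"
          proof
            assume "em e (q e) = b"
            from b_em[OF et(1) Qe(1) this] show False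
              using both[OF e0] c2 et(2) by auto
          qed
          moreover have "x = F (em e (q e))"
          proof -
            have "\<not> (tgl e \<in> W \<and> q e = p e)" using both[OF et(1) N] c2(1) by auto
            then show ?thesis using F[OF et(1) Qe(1)] N c2 et(3) by auto
          qed
          ultimately show ?thesis using Qe(2) by blast
        next
          case c3
          have np: "\<not> (tgl e \<in> W \<and> p e = t)"
          proof
            assume h: "tgl e \<in> W \<and> p e = t"
            then have "\<not> (tgh e \<in> W \<and> q e = t)" using both[OF et(1) N] by auto
            then have "dv ?\<phi> x = k e" using jumpN[OF et(1,2) N] h c3 et(3) by auto
            then show False using ne h et(3) by (simp add: k_def)
          qed
          have nq: "\<not> (tgh e \<in> W \<and> q e = t)"
          proof
            assume h: "tgh e \<in> W \<and> q e = t"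
            then have "dv ?\<phi> x = l e" using jumpN[OF et(1,2) N] np c3 et(3) by auto
            then show False using ne h et(3) by (simp add: l_def)
          qed
          have "dv ?\<phi> x = 0" using jumpN[OF et(1,2) N] np nq c3 et(3) by auto
          moreover have "x \<noteq> b" using b_em[OF et(1,2)] et(3) np nq by blast
          moreover have "F x = x" using F[OF et(1,2)] np nq et(3) by auto
          ultimately show ?thesis by (rule stay)
        qed
      qed
    qed
    show "b \<in> chips D f" by (rule b(1))
  qed
qed

text \<open>The chip-free stretch from \<open>t\<close> down to the lower end is connected, so it
  lies on one side of the cut, and so does the vertex it converges to.\<close>

lemma side_lo:
  assumes X: "open X" "open Y" "X \<inter> Y = {}" "X \<union> Y = - P" "V \<subseteq> - P"
    and e: "e \<in> E" "t \<in> I e" "em e t \<in> X" and free: "\<And>u. u \<in> I e \<Longrightarrow> u \<le> t \<Longrightarrow> em e u \<notin> P"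
  shows "tgl e \<in> X"
proof (rule ccontr)
  assume "tgl e \<notin> X"
  then have tY: "tgl e \<in> Y" using X(4,5) tgl_V[OF e(1)] by blast
  let ?J = "I e \<inter> {..t}"
  have "is_interval (I e)" using I_connected is_interval_connected_1 by blast
  then have "connected ?J" using is_interval_Int[OF _ is_interval_ic] is_interval_connected_1 by blast
  then have "connected (em e ` ?J)" using em_continuous[OF e(1)] by (intro connected_continuous_image) (auto elim: continuous_on_subset)
  moreover have "em e ` ?J \<subseteq> X \<union> Y" using free X(4) by auto
  ultimately have "X \<inter> em e ` ?J = {} \<or> Y \<inter> em e ` ?J = {}" using connectedD[of "em e ` ?J" X Y] X(1-3) by blast
  moreover have "em e t \<in> X \<inter> em e ` ?J" using e by auto
  ultimately have Y: "Y \<inter> em e ` ?J = {}" by blast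
  note d = dirs_lo[OF e(1)]
  have "eventually (\<lambda>u. em e u \<in> Y) (dfil (lo M e) True)"
    using dirs_at_ev[OF dirs_at_target[OF d] eventually_nhds_in_open[OF X(2) tY]] by (simp add: dir_ev_def)
  moreover have "eventually (\<lambda>u. u < t) (dfil (lo M e) True)"
    using eventually_dfil_less[OF dirs_beyond[OF d], of "ereal t"] e(2) by (simp add: edge_interval_def)
  ultimately have "eventually (\<lambda>u. False) (dfil (lo M e) True)" using dirs_ev_I[OF d]
    by eventually_elim (use Y in force)
  then show False using dirs_neq_bot[OF d] by (simp add: trivial_limit_def)
qed

lemma side_hi:
  assumes X: "open X" "open Y" "X \<inter> Y = {}" "X \<union> Y = - P" "V \<subseteq> - P"
    and e: "e \<in> E" "t \<in> I e" "em e t \<in> X" and free: "\<And>u. u \<in> I e \<Longrightarrow> t \<le> u \<Longrightarrow> em e u \<notin> P"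
  shows "tgh e \<in> X"
proof (rule ccontr)
  assume "tgh e \<notin> X"
  then have tY: "tgh e \<in> Y" using X(4,5) tgh_V[OF e(1)] by blast
  let ?J = "I e \<inter> {t..}"
  have "is_interval (I e)" using I_connected is_interval_connected_1 by blast
  then have "connected ?J" using is_interval_Int[OF _ is_interval_ci] is_interval_connected_1 by blast
  then have "connected (em e ` ?J)" using em_continuous[OF e(1)] by (intro connected_continuous_image) (auto elim: continuous_on_subset)
  moreover have "em e ` ?J \<subseteq> X \<union> Y" using free X(4) by auto
  ultimately have "X \<inter> em e ` ?J = {} \<or> Y \<inter> em e ` ?J = {}" using connectedD[of "em e ` ?J" X Y] X(1-3) by blast
  moreover have "em e t \<in> X \<inter> em e ` ?J" using e by auto
  ultimately have Y: "Y \<inter> em e ` ?J = {}" by blast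
  note d = dirs_hi[OF e(1)]
  have "eventually (\<lambda>u. em e u \<in> Y) (dfil (hi M e) False)"
    using dirs_at_ev[OF dirs_at_target[OF d] eventually_nhds_in_open[OF X(2) tY]] by (simp add: dir_ev_def)
  moreover have "eventually (\<lambda>u. t < u) (dfil (hi M e) False)"
    using eventually_dfil_greater[OF dirs_beyond[OF d], of "ereal t"] e(2) by (simp add: edge_interval_def)
  ultimately have "eventually (\<lambda>u. False) (dfil (hi M e) False)" using dirs_ev_I[OF d]
    by eventually_elim (use Y in force)
  then show False using dirs_neq_bot[OF d] by (simp add: trivial_limit_def)
qed

text \<open>If no edge joined \<open>W\<close> to the other vertices, the indicator of
  \<open>W\<close>, extended constantly along the edges, would be a nonconstant harmonic
  function.\<close>

lemma boundary_edge_exists: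
  assumes v: "v1 \<in> V" "v1 \<in> W" and v': "v2 \<in> V" "v2 \<notin> W"
  shows "\<exists>e\<in>E. (tgl e \<in> W) \<noteq> (tgh e \<in> W)"
proof (rule ccontr)
  assume "\<not> ?thesis"
  then have same: "tgl e \<in> W \<longleftrightarrow> tgh e \<in> W" if "e \<in> E" for e using that by blast
  let ?C = "\<lambda>e. if tgl e \<in> W then 1 else (0::real)" and ?v = "\<lambda>v. if v \<in> W then 1 else (0::real)"
  let ?\<phi> = "glue ?v ?C (\<lambda>_. 0) (\<lambda>_. [])"
  have "glue_ok ?v ?C (\<lambda>_. 0) (\<lambda>_. [])" using same by (simp add: glue_ok_def pw_def)
  note G = glue_PL[OF this]
  have "sl ?\<phi> d = 0" if "d \<in> dirs" for d using that G(2) by (cases d) (simp add: pwsl_def)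
  then have "dv ?\<phi> x = 0" for x unfolding dv_def using dirs_at_dirs by (intro sum.neutral) blast
  then obtain c where c: "\<And>x. x \<notin> inf\<^sub>\<Gamma> \<Longrightarrow> ?\<phi> x = c" using harmonic_constant[OF G(1)] by blast
  have "?v v = c" if vV: "v \<in> V" for v
  \<comment> \<open>\<open>harmonic_constant\<close> says nothing about the value at infinity; it is
    compared with the value on the one edge ending there.\<close>
  proof (cases "v \<in> inf\<^sub>\<Gamma>")
    case False then show ?thesis using c[OF False] vV by (simp add: glue_V)
  next
    case True
    then obtain e a s where Dv: "dirs_at v = {(e, a, s)}" by (rule dirs_at_inf)
    let ?d = "(e, a, s)"
    have "?d \<in> ends" "target ?d = v" "?d \<in> dirs" using dirs_at_V[OF vV] Dv ends_dirs by blast+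
    then have e: "e \<in> E" and tv: "tgl e = v \<or> tgh e = v" using dirs_edge by (auto simp: ends_def)
    obtain t where t: "t \<in> I e" using I_nonempty[OF e] by blast
    have "?\<phi> (em e t) = c" by (rule c[OF em_not_inf[OF e t]])
    then have "?C e = c" by (simp add: glue_em[OF e t] pw_def)
    then show ?thesis using tv same[OF e] by auto
  qed
  from this[OF v(1)] this[OF v'(1)] show False using v v' by simp
qed

text \<open>The side of the cut that does not contain \<open>x0\<close> is lowered. If \<open>x0\<close> carries a chip, the side
  not containing the lower end of its edge is taken. Uniqueness of the chip on each edge
  guarantees that every segment of an edge reaches a vertex.\<close>

lemma cut_move:
  assumes D: "divisor D" and f: "f \<in> RR \<Gamma> D" and x0: "x0 \<notin> inf\<^sub>\<Gamma>" and disc: "\<not> connected (- chips D f)"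
    and uniq: "\<And>e p q. e \<in> E \<Longrightarrow> p \<in> I e \<Longrightarrow> q \<in> I e \<Longrightarrow> em e p \<in> chips D f \<Longrightarrow> em e q \<in> chips D f \<Longrightarrow> p = q"
    and nhi: "\<And>e p. e \<in> E \<Longrightarrow> p \<in> I e \<Longrightarrow> em e p \<in> chips D f \<Longrightarrow> hi M e = \<infinity> \<Longrightarrow> \<exists>t\<in>I e. x0 = em e t \<and> p < t"
    and nlo: "\<And>e p. e \<in> E \<Longrightarrow> p \<in> I e \<Longrightarrow> em e p \<in> chips D f \<Longrightarrow> lo M e = -\<infinity> \<Longrightarrow> \<exists>t\<in>I e. x0 = em e t \<and> t < p"
  shows "\<exists>g. improves D x0 f g"
proof -
  let ?P = "chips D f"
  have opP: "open (- ?P)" using finite_chips[OF D f] by (simp add: open_Compl finite_imp_closed)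
  have VP: "V \<subseteq> - ?P" by (auto simp: chips_def)
  define z0 where "z0 = (if x0 \<in> ?P then tgl (the_edge x0) else x0)"
  have z0: "z0 \<in> - ?P"
  proof (cases "x0 \<in> ?P")
    case True
    then have "x0 \<notin> V" using VP by blast
    then obtain e t where "e \<in> E" "t \<in> I e" "x0 = em e t" by (rule not_V_cases)
    then show ?thesis using True tgl_V VP by (auto simp: z0_def)
  qed (simp add: z0_def)
  obtain A B where AB: "open A" "open B" "- ?P \<subseteq> A \<union> B" "A \<inter> B \<inter> - ?P = {}" "A \<inter> - ?P \<noteq> {}" "B \<inter> - ?P \<noteq> {}"
    using disc unfolding connected_def by blast
  have "\<exists>U U'. open U \<and> open U' \<and> U \<inter> U' = {} \<and> U \<union> U' = - ?P \<and> U \<noteq> {} \<and> z0 \<in> U'"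
  proof (cases "z0 \<in> A")
    case True
    show ?thesis
      by (rule exI[of _ "B \<inter> - ?P"], rule exI[of _ "A \<inter> - ?P"]) (use AB opP True z0 in \<open>auto intro: open_Int\<close>)
  next
    case False
    then have "z0 \<in> B" using z0 AB(3) by blast
    then show ?thesis
      by (intro exI[of _ "A \<inter> - ?P"] exI[of _ "B \<inter> - ?P"]) (use AB opP z0 in \<open>auto intro: open_Int\<close>)
  qed
  then obtain U U' where U: "open U" "open U'" "U \<inter> U' = {}" "U \<union> U' = - ?P" "U \<noteq> {}" "z0 \<in> U'" by blast
  note sl = side_lo[OF U(1-4) VP] and sh = side_hi[OF U(1-4) VP]
  have U': "U' \<inter> U = {}" "U' \<union> U = - ?P" using U(3,4) by blast+
  note sl' = side_lo[OF U(2,1) U' VP] and sh' = side_hi[OF U(2,1) U' VP]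
  \<comment> \<open>A chip below \<open>t\<close> and one above \<open>t\<close> would be the same
    by uniqueness, hence at \<open>t\<close> itself. So at least one way from \<open>t\<close> to an
    end is free.\<close>
  have free: "(\<forall>u\<in>I e. u \<le> t \<longrightarrow> em e u \<notin> ?P) \<or> (\<forall>u\<in>I e. t \<le> u \<longrightarrow> em e u \<notin> ?P)"
    if "e \<in> E" "t \<in> I e" "em e t \<notin> ?P" for e t
  proof (rule ccontr)
    assume "\<not> ?thesis"
    then obtain u u' where u: "u \<in> I e" "u \<le> t" "em e u \<in> ?P" "u' \<in> I e" "t \<le> u'" "em e u' \<in> ?P" by blast
    then have "u = u'" using uniq[OF that(1)] by blast
    then have "u = t" using u by simp
    then show False using u that(3) by simp
  qed
  have vU: "\<exists>v\<in>V. v \<in> U"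
  proof -
    obtain y where y: "y \<in> U" using U(5) by blast
    show ?thesis
    proof (cases "y \<in> V")
      case False
      then obtain e t where et: "e \<in> E" "t \<in> I e" "y = em e t" by (rule not_V_cases)
      have "em e t \<notin> ?P" "em e t \<in> U" using y U(4) et(3) by auto
      then have "tgl e \<in> U \<or> tgh e \<in> U" using free[OF et(1,2)] sl[OF et(1,2)] sh[OF et(1,2)] by blast
      then show ?thesis using tgl_V[OF et(1)] tgh_V[OF et(1)] by blast
    qed (use y in blast)
  qed
  have vU': "\<exists>v\<in>V. v \<in> U'"
  proof (cases "z0 \<in> V")
    case False
    then obtain e t where et: "e \<in> E" "t \<in> I e" "z0 = em e t" by (rule not_V_cases)
    have "em e t \<notin> ?P" "em e t \<in> U'" using z0 U(6) et(3) by auto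
    then have "tgl e \<in> U' \<or> tgh e \<in> U'" using free[OF et(1,2)] sl'[OF et(1,2)] sh'[OF et(1,2)] by blast
    then show ?thesis using tgl_V[OF et(1)] tgh_V[OF et(1)] by blast
  qed (use U(6) in blast)
  define W where "W = V \<inter> U"
  define K where "K = {e. tgl e \<in> W \<and> tgh e \<in> W}"
  define p where "p e = (SOME t. t \<in> I e \<and> em e t \<in> ?P)" for e
  have tglW: "tgl e \<in> W \<longleftrightarrow> tgl e \<in> U" and tghW: "tgh e \<in> W \<longleftrightarrow> tgh e \<in> U" if "e \<in> E" for e
    using tgl_V[OF that] tgh_V[OF that] by (auto simp: W_def)
  \<comment> \<open>An edge with ends on different sides of the cut must carry a chip; otherwise the
    side would propagate from one end to the other.\<close>
  have chip: "p e \<in> I e \<and> em e (p e) \<in> ?P" if e: "e \<in> E" and ne: "(tgl e \<in> W) \<noteq> (tgh e \<in> W)" for e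
  proof -
    have "\<exists>t. t \<in> I e \<and> em e t \<in> ?P"
    proof (rule ccontr)
      assume "\<not> ?thesis"
      then have no: "em e t \<notin> ?P" if "t \<in> I e" for t using that by blast
      show False
      proof (cases "tgl e \<in> W")
        case True
        note d = dirs_lo[OF e]
        have "tgl e \<in> U" using True tglW[OF e] by simp
        then have "eventually (\<lambda>u. em e u \<in> U) (dfil (lo M e) True)"
          using dirs_at_ev[OF dirs_at_target[OF d] eventually_nhds_in_open[OF U(1)]] by (simp add: dir_ev_def)
        then have "eventually (\<lambda>u. u \<in> I e \<and> em e u \<in> U) (dfil (lo M e) True)" using dirs_ev_I[OF d] by eventually_elim simp
        then obtain t where "t \<in> I e" "em e t \<in> U" using eventually_happens'[OF dirs_neq_bot[OF d]] by blast
        then have "tgh e \<in> U" using sh[OF e] no by blast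
        then show False using True ne tghW[OF e] by simp
      next
        case False
        then have "tgh e \<in> W" using ne by simp
        note d = dirs_hi[OF e]
        have "tgh e \<in> U" using \<open>tgh e \<in> W\<close> tghW[OF e] by simp
        then have "eventually (\<lambda>u. em e u \<in> U) (dfil (hi M e) False)"
          using dirs_at_ev[OF dirs_at_target[OF d] eventually_nhds_in_open[OF U(1)]] by (simp add: dir_ev_def)
        then have "eventually (\<lambda>u. u \<in> I e \<and> em e u \<in> U) (dfil (hi M e) False)" using dirs_ev_I[OF d] by eventually_elim simp
        then obtain t where "t \<in> I e" "em e t \<in> U" using eventually_happens'[OF dirs_neq_bot[OF d]] by blast
        then have "tgl e \<in> U" using sl[OF e] no by blast
        then show False using False tglW[OF e] by simp
      qed
    qed
    then show ?thesis unfolding p_def by (rule someI_ex)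
  qed
  \<comment> \<open>If \<open>x0\<close> is not a chip, a free way leads from it to an end of its
    edge, which therefore lies on the side that is kept. So the edge is not in \<open>K\<close>, and
    \<open>x0\<close> is behind the chip as seen from an end in \<open>W\<close>.\<close>
  have x0e: "e \<notin> K \<and> (tgl e \<in> W \<longrightarrow> p e \<le> t) \<and> (tgh e \<in> W \<longrightarrow> t \<le> p e)"
    if e: "e \<in> E" and t: "t \<in> I e" and xt: "x0 = em e t" for e t
  proof (cases "x0 \<in> ?P")
    case True
    then have "tgl e \<in> U'" using U(6) e t xt by (simp add: z0_def)
    then have n: "tgl e \<notin> W" using U(3) by (auto simp: W_def)
    have "t \<le> p e" if "tgh e \<in> W"
    proof -
      have c: "p e \<in> I e \<and> em e (p e) \<in> ?P" using chip[OF e] n that by blast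
      have "t = p e" by (rule uniq[OF e t]) (use c True xt in auto)
      then show ?thesis by simp
    qed
    then show ?thesis using n by (simp add: K_def)
  next
    case False
    then have tU': "em e t \<in> U'" and tP: "em e t \<notin> ?P" using U(6) xt by (auto simp: z0_def)
    have "tgl e \<in> U' \<or> tgh e \<in> U'" using free[OF e t tP] sl'[OF e t tU'] sh'[OF e t tU'] by blast
    then have nK: "\<not> (tgl e \<in> W \<and> tgh e \<in> W)" using U(3) by (auto simp: W_def)
    moreover have "p e \<le> t" if W: "tgl e \<in> W"
    proof (rule ccontr)
      assume lt: "\<not> p e \<le> t"
      have c: "p e \<in> I e \<and> em e (p e) \<in> ?P" using chip[OF e] nK W by blast
      have "em e u \<notin> ?P" if "u \<in> I e" "u \<le> t" for u
        using uniq[OF e that(1), of "p e"] c lt that(2) by auto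
      then have "tgl e \<in> U'" using sl'[OF e t tU'] by blast
      then show False using W U(3) by (auto simp: W_def)
    qed
    moreover have "t \<le> p e" if W: "tgh e \<in> W"
    proof (rule ccontr)
      assume lt: "\<not> t \<le> p e"
      have c: "p e \<in> I e \<and> em e (p e) \<in> ?P" using chip[OF e] nK W by blast
      have "em e u \<notin> ?P" if "u \<in> I e" "t \<le> u" for u
        using uniq[OF e that(1), of "p e"] c lt that(2) by auto
      then have "tgh e \<in> U'" using sh'[OF e t tU'] by blast
      then show False using W U(3) by (auto simp: W_def)
    qed
    ultimately show ?thesis by (simp add: K_def)
  qed
  define B where "B = {e\<in>E. (tgl e \<in> W) \<noteq> (tgh e \<in> W)}"
  have finB: "finite B" using finite_edges by (simp add: B_def)
  have Bne: "B \<noteq> {}"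
  proof -
    obtain v where v: "v \<in> V" "v \<in> U" using vU by blast
    obtain v' where v': "v' \<in> V" "v' \<in> U'" using vU' by blast
    have "v \<in> W" "v' \<notin> W" using v v' U(3) by (auto simp: W_def)
    from boundary_edge_exists[OF v(1) this(1) v'(1) this(2)] show ?thesis by (auto simp: B_def)
  qed
  define k where "k e = (D + principal \<Gamma> f) (em e (p e))" for e
  \<comment> \<open>The amount of lowering after which the chip of \<open>e\<close> reaches its end
    in \<open>W\<close>: multiplicity times distance.\<close>
  define len where "len e = of_int (k e) * (if tgl e \<in> W then p e - real_of_ereal (lo M e) else real_of_ereal (hi M e) - p e)" for e
  have kpos: "k e > 0" if "e \<in> B" for e
    unfolding k_def by (rule chip_pos[OF f]) (use chip that in \<open>auto simp: B_def\<close>)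
  \<comment> \<open>A chip cannot have to run to an infinite end: by \<open>nlo\<close> the point
    \<open>x0\<close> would lie between the chip and that end, that is, on the lowered part, against
    \<open>x0e\<close>.\<close>
  have lo_real: "lo M e = ereal (real_of_ereal (lo M e))" if e: "e \<in> E" and W: "tgl e \<in> W" "tgh e \<notin> W" for e
  proof -
    have c: "p e \<in> I e" "em e (p e) \<in> ?P" using chip[OF e] W by auto
    have "lo M e \<noteq> -\<infinity>"
    proof
      assume "lo M e = -\<infinity>"
      then obtain t where "t \<in> I e" "x0 = em e t" "t < p e" using nlo[OF e c] by blast
      then show False using x0e[OF e] W by force
    qed
    moreover have "lo M e < \<infinity>" using I_less[OF e] by auto
    ultimately show ?thesis by (cases "lo M e") auto
  qed
  have hi_real: "hi M e = ereal (real_of_ereal (hi M e))" if e: "e \<in> E" and W: "tgl e \<notin> W" "tgh e \<in> W" for e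
  proof -
    have c: "p e \<in> I e" "em e (p e) \<in> ?P" using chip[OF e] W by auto
    have "hi M e \<noteq> \<infinity>"
    proof
      assume "hi M e = \<infinity>"
      then obtain t where "t \<in> I e" "x0 = em e t" "p e < t" using nhi[OF e c] by blast
      then show False using x0e[OF e] W by force
    qed
    moreover have "hi M e > -\<infinity>" using I_less[OF e] by auto
    ultimately show ?thesis by (cases "hi M e") auto
  qed
  have len_pos: "len e > 0" if eB: "e \<in> B" for e
  proof -
    have e: "e \<in> E" and ne: "(tgl e \<in> W) \<noteq> (tgh e \<in> W)" using eB by (auto simp: B_def)
    have c: "lo M e < ereal (p e)" "ereal (p e) < hi M e" using chip[OF e ne] by (auto simp: edge_interval_def)
    have "(if tgl e \<in> W then p e - real_of_ereal (lo M e) else real_of_ereal (hi M e) - p e) > 0"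
    proof (cases "tgl e \<in> W")
      case True
      have "ereal (real_of_ereal (lo M e)) < ereal (p e)" using c(1) lo_real[OF e True] True ne by simp
      then show ?thesis using True by simp
    next
      case False
      have "ereal (p e) < ereal (real_of_ereal (hi M e))" using c(2) hi_real[OF e False] False ne by simp
      then show ?thesis using False by simp
    qed
    then show ?thesis using kpos[OF eB] by (simp add: len_def)
  qed
  \<comment> \<open>The first arrival at a vertex fixes the amount; no other chip has overrun its
    end by then.\<close>
  define \<epsilon> where "\<epsilon> = Min (len ` B)"
  have \<epsilon>_le: "\<epsilon> \<le> len e" if "e \<in> B" for e using that finB by (simp add: \<epsilon>_def)
  have "\<epsilon> \<in> len ` B" unfolding \<epsilon>_def using finB Bne by (intro Min_in) auto
  then obtain e0 where e0: "e0 \<in> B" "\<epsilon> = len e0" by blast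
  have \<epsilon>: "\<epsilon> > 0" using len_pos e0 by simp
  show ?thesis
  proof (rule step_move[OF D f x0 \<epsilon>, where K=K and W=W and p=p and q=p and ?e0.0=e0])
    show "tgl e \<in> W \<and> tgh e \<in> W" if "e \<in> K" for e using that by (simp add: K_def)
    show "p e \<in> I e \<and> em e (p e) \<in> chips D f \<and> lo M e \<le> ereal (p e - \<epsilon> / of_int ((D + principal \<Gamma> f) (em e (p e))))"
      if e: "e \<in> E" and W: "e \<notin> K" "tgl e \<in> W" for e
    proof -
      have W': "tgh e \<notin> W" using W by (simp add: K_def)
      have eB: "e \<in> B" using e W W' by (simp add: B_def)
      have "\<epsilon> \<le> of_int (k e) * (p e - real_of_ereal (lo M e))" using \<epsilon>_le[OF eB] W by (simp add: len_def)
      then have "\<epsilon> / of_int (k e) \<le> p e - real_of_ereal (lo M e)" using kpos[OF eB] by (simp add: divide_le_eq mult.commute)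
      then have "ereal (real_of_ereal (lo M e)) \<le> ereal (p e - \<epsilon> / of_int (k e))" by simp
      then show ?thesis using chip[OF e] W W' lo_real[OF e W(2) W'] by (simp add: k_def)
    qed
    show "p e \<in> I e \<and> em e (p e) \<in> chips D f \<and> ereal (p e + \<epsilon> / of_int ((D + principal \<Gamma> f) (em e (p e)))) \<le> hi M e"
      if e: "e \<in> E" and W: "e \<notin> K" "tgh e \<in> W" for e
    proof -
      have W': "tgl e \<notin> W" using W by (simp add: K_def)
      have eB: "e \<in> B" using e W W' by (simp add: B_def)
      have "\<epsilon> \<le> of_int (k e) * (real_of_ereal (hi M e) - p e)" using \<epsilon>_le[OF eB] W' by (simp add: len_def)
      then have "\<epsilon> / of_int (k e) \<le> real_of_ereal (hi M e) - p e" using kpos[OF eB] by (simp add: divide_le_eq mult.commute)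
      then have "ereal (p e + \<epsilon> / of_int (k e)) \<le> ereal (real_of_ereal (hi M e))" by simp
      then show ?thesis using chip[OF e] W W' hi_real[OF e W' W(2)] by (simp add: k_def)
    qed
    show "p e < p e" if "e \<notin> K" "tgl e \<in> W" "tgh e \<in> W" for e using that by (simp add: K_def)
    show "e0 \<in> E" "e0 \<notin> K" using e0(1) by (auto simp: B_def K_def)
    show "tgl e0 \<in> W \<and> lo M e0 = ereal (p e0 - \<epsilon> / of_int ((D + principal \<Gamma> f) (em e0 (p e0)))) \<or>
       tgh e0 \<in> W \<and> hi M e0 = ereal (p e0 + \<epsilon> / of_int ((D + principal \<Gamma> f) (em e0 (p e0))))"
    proof (cases "tgl e0 \<in> W")
      case True
      then have W': "tgh e0 \<notin> W" "e0 \<in> E" using e0(1) by (auto simp: B_def)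
      have "p e0 - \<epsilon> / of_int (k e0) = real_of_ereal (lo M e0)" using True kpos[OF e0(1)] by (simp add: e0(2) len_def)
      then show ?thesis using lo_real[OF W'(2) True W'(1)] True by (simp add: k_def)
    next
      case False
      then have W': "tgh e0 \<in> W" "e0 \<in> E" using e0(1) by (auto simp: B_def)
      have "p e0 + \<epsilon> / of_int (k e0) = real_of_ereal (hi M e0)" using False kpos[OF e0(1)] by (simp add: e0(2) len_def)
      then show ?thesis using hi_real[OF W'(2) False W'(1)] W' by (simp add: k_def)
    qed
    show "x0 \<notin> W"
    proof
      assume "x0 \<in> W"
      then have "x0 \<in> V" "x0 \<in> U" by (auto simp: W_def)
      then have "x0 \<notin> ?P" using VP by blast
      then have "x0 \<in> U'" using U(6) by (simp add: z0_def)
      then show False using \<open>x0 \<in> U\<close> U(3) by blast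
    qed
    show "e \<notin> K \<and> (tgl e \<in> W \<longrightarrow> p e \<le> t) \<and> (tgh e \<in> W \<longrightarrow> t \<le> p e)"
      if "e \<in> E" "t \<in> I e" "x0 = em e t" for e t by (rule x0e[OF that])
  qed
qed

text \<open>Assuming that no move works, \<open>x0\<close> must shield every infinite end from the
  chips of its edge and separate any two chips of an edge. Two such chips have finite ends behind
  them and can be moved outwards; if there is no such pair, the hypotheses of
  \<open>cut_move\<close> hold.\<close>

lemma descent:
  assumes D: "divisor D" and f: "f \<in> RR \<Gamma> D" and x0: "x0 \<notin> inf\<^sub>\<Gamma>" and disc: "\<not> connected (- chips D f)"
  shows "\<exists>g. improves D x0 f g"
proof (rule ccontr)
  assume no: "\<not> ?thesis"
  have nhi: "\<exists>t\<in>I e. x0 = em e t \<and> p < t" if "e \<in> E" "p \<in> I e" "em e p \<in> chips D f" "hi M e = \<infinity>" for e p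
    using half_line_move_hi[OF D f x0 that] no by (meson not_le)
  have nlo: "\<exists>t\<in>I e. x0 = em e t \<and> t < p" if "e \<in> E" "p \<in> I e" "em e p \<in> chips D f" "lo M e = -\<infinity>" for e p
    using half_line_move_lo[OF D f x0 that] no by (meson not_le)
  have nhill: "\<exists>t\<in>I e. x0 = em e t \<and> p < t \<and> t < q"
    if "e \<in> E" "p \<in> I e" "em e p \<in> chips D f" "q \<in> I e" "em e q \<in> chips D f" "p < q" for e p q
    using hill_move[OF D f x0 that] no by (meson not_le)
  have uniq: "\<not> p < q" if e: "e \<in> E" and p: "p \<in> I e" "em e p \<in> chips D f" and q: "q \<in> I e" "em e q \<in> chips D f" for e p q
  proof
    assume pq: "p < q"
    obtain t where t: "t \<in> I e" "x0 = em e t" "p < t" "t < q" using nhill[OF e p q pq] by blast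
    have "hi M e \<noteq> \<infinity>"
    proof
      assume "hi M e = \<infinity>"
      then obtain u where "u \<in> I e" "x0 = em e u" "q < u" using nhi[OF e q] by blast
      then show False using t em_inj[OF e, of t u] by simp
    qed
    moreover have "ereal q < hi M e" "ereal p < hi M e" "lo M e < ereal p" "lo M e < ereal q" using p q by (auto simp: edge_interval_def)
    ultimately obtain h where h: "hi M e = ereal h" "q < h" by (cases "hi M e") auto
    have "lo M e \<noteq> -\<infinity>"
    proof
      assume "lo M e = -\<infinity>"
      then obtain u where "u \<in> I e" "x0 = em e u" "u < p" using nlo[OF e p] by blast
      then show False using t em_inj[OF e, of t u] by simp
    qed
    then obtain l where l: "lo M e = ereal l" "l < p" using \<open>lo M e < ereal p\<close> by (cases "lo M e") auto
    define k where "k = real_of_int ((D + principal \<Gamma> f) (em e p))"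
    define m where "m = real_of_int ((D + principal \<Gamma> f) (em e q))"
    have km: "k > 0" "m > 0" using chip_pos[OF f p(2)] chip_pos[OF f q(2)] by (simp_all add: k_def m_def)
    \<comment> \<open>The smaller of the two amounts after which the outer chips would reach the
      ends \<open>l\<close> and \<open>h\<close>.\<close>
    define \<epsilon> where "\<epsilon> = min (k * (p - l)) (m * (h - q))"
    have \<epsilon>: "\<epsilon> > 0" using km l(2) h(2) by (simp add: \<epsilon>_def)
    have "\<epsilon> / k \<le> p - l" "\<epsilon> / m \<le> h - q" using km by (auto simp: \<epsilon>_def divide_le_eq mult.commute min_le_iff_disj)
    then have le: "lo M e \<le> ereal (p - \<epsilon> / k)" "ereal (q + \<epsilon> / m) \<le> hi M e" by (auto simp: l h)
    have hit: "lo M e = ereal (p - \<epsilon> / k) \<or> hi M e = ereal (q + \<epsilon> / m)"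
      using km by (auto simp: l h \<epsilon>_def min_def)
    have "\<exists>g. improves D x0 f g"
    \<comment> \<open>All vertices and all edges other than \<open>e\<close> are lowered by the full
      amount; only the segment from \<open>p\<close> to \<open>q\<close>, which contains
      \<open>x0\<close>, is kept.\<close>
    proof (rule step_move[OF D f x0 \<epsilon>, where K="- {e}" and W=V and p="\<lambda>_. p" and q="\<lambda>_. q" and ?e0.0=e])
      show "x0 \<notin> V" using em_not_V[OF e t(1)] t(2) by simp
      show "e' \<notin> - {e} \<and> (tgl e' \<in> V \<longrightarrow> p \<le> t') \<and> (tgh e' \<in> V \<longrightarrow> t' \<le> q)"
        if "e' \<in> E" "t' \<in> I e'" "x0 = em e' t'" for e' t'
      proof -
        have "e' = e \<and> t' = t" using em_inj2[OF that(1,2) e t(1)] that(3) t(2) by blast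
        then show ?thesis using t by simp
      qed
      show "tgl e \<in> V \<and> lo M e = ereal (p - \<epsilon> / of_int ((D + principal \<Gamma> f) (em e p))) \<or>
         tgh e \<in> V \<and> hi M e = ereal (q + \<epsilon> / of_int ((D + principal \<Gamma> f) (em e q)))"
        using hit tgl_V[OF e] tgh_V[OF e] unfolding k_def m_def by blast
    qed (use e p q pq le tgl_V tgh_V in \<open>simp_all add: k_def m_def\<close>)
    then show False using no by blast
  qed
  have "\<exists>g. improves D x0 f g"
  proof (rule cut_move[OF D f x0 disc])
    show "p = q" if "e \<in> E" "p \<in> I e" "q \<in> I e" "em e p \<in> chips D f" "em e q \<in> chips D f" for e p q
      using uniq[of e p q] uniq[of e q p] that by linarith
  qed (use nhi nlo in blast)+
  then show False using no by blast
qed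

section \<open>Generation\<close>

lemma connected_minorant:
  assumes D: "divisor D" and x0: "x0 \<notin> inf\<^sub>\<Gamma>" and f: "f \<in> RR \<Gamma> D"
  shows "\<exists>g\<in>connected_functions D. (\<forall>x. x \<notin> inf\<^sub>\<Gamma> \<longrightarrow> g x \<le> f x) \<and> g x0 = f x0"
  using f
proof (induction "card (chips D f)" arbitrary: f rule: less_induct)
  case less
  show ?case
  proof (cases "connected (- chips D f)")
    case True
    then have "f \<in> connected_functions D" using less.prems by (simp add: connected_functions_def)
    then show ?thesis by (intro bexI[of _ f]) auto
  next
    case False
    obtain g where g: "g \<in> RR \<Gamma> D" "\<And>x. x \<notin> inf\<^sub>\<Gamma> \<Longrightarrow> g x \<le> f x" "g x0 = f x0" "card (chips D g) < card (chips D f)"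
      using descent[OF D less.prems x0 False] unfolding improves_def by blast
    obtain h where h: "h \<in> connected_functions D" "\<And>x. x \<notin> inf\<^sub>\<Gamma> \<Longrightarrow> h x \<le> g x" "h x0 = g x0"
      using less.hyps[OF g(4,1)] by blast
    show ?thesis using h g(2,3) by (intro bexI[OF _ h(1)]) (auto intro: order_trans)
  qed
qed

lemma not_inf_exists: "\<exists>x. x \<notin> inf\<^sub>\<Gamma>"
proof (rule ccontr)
  assume "\<not> ?thesis"
  then have "eventually (\<lambda>z. z \<in> inf\<^sub>\<Gamma>) (nhds undefined)" by (simp add: eventually_nhds)
  then show False using not_eventually_inf by blast
qed

lemma RR_subset_span:
  assumes D: "divisor D"
  shows "RR \<Gamma> D \<subseteq> trop_span (vertex_functions \<Gamma> M D)"
proof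
  fix f assume f: "f \<in> RR \<Gamma> D"
  let ?S = "vertex_functions \<Gamma> M D"
  have "\<forall>x0\<in>- inf\<^sub>\<Gamma>. \<exists>g. g \<in> connected_functions D \<and> (\<forall>x. x \<notin> inf\<^sub>\<Gamma> \<longrightarrow> g x \<le> f x) \<and> g x0 = f x0"
    using connected_minorant[OF D _ f] by blast
  from bchoice[OF this] obtain g where g: "g x0 \<in> connected_functions D \<and> (\<forall>x. x \<notin> inf\<^sub>\<Gamma> \<longrightarrow> g x0 x \<le> f x) \<and> g x0 x0 = f x0"
    if "x0 \<notin> inf\<^sub>\<Gamma>" for x0 by blast
  define H where "H = g ` (- inf\<^sub>\<Gamma>)"
  have HS: "H \<subseteq> ?S" using g connected_subset_vertex[OF D] by (auto simp: H_def)
  have HR: "h \<in> RR \<Gamma> D" if "h \<in> H" for h using HS that by (auto simp: vertex_functions_def)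
  have le: "h x \<le> f x" if "h \<in> H" "x \<notin> inf\<^sub>\<Gamma>" for h x using that g by (auto simp: H_def)
  \<comment> \<open>Each member of \<open>H\<close> lies below \<open>f\<close> and touches it at a
    finite point. If two differ by a constant, the point of contact of either one shows that the
    constant has a definite sign, and the two signs force it to be 0.\<close>
  have "inj_on (\<lambda>h. trop_scaling_rel `` {h}) H"
  proof (rule inj_onI)
    fix h h' assume h: "h \<in> H" "h' \<in> H" and eq: "trop_scaling_rel `` {h} = trop_scaling_rel `` {h'}"
    have "h' \<in> trop_scaling_rel `` {h'}" by (auto simp: trop_scaling_rel_def trop_scale_def intro!: exI[of _ 0])
    then have "h' \<in> trop_scaling_rel `` {h}" using eq by simp
    then obtain a where a: "h' = trop_scale a h" by (auto simp: trop_scaling_rel_def)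
    obtain x where x: "x \<notin> inf\<^sub>\<Gamma>" "h x = f x" using h(1) g by (auto simp: H_def)
    obtain y where y: "y \<notin> inf\<^sub>\<Gamma>" "h' y = f y" using h(2) g by (auto simp: H_def)
    note fin = ereal_rl[OF RR_D(3)[OF f]] and finh = ereal_rl[OF RR_D(3)[OF HR[OF h(1)]]]
    have "ereal a + h x \<le> f x" using le[OF h(2) x(1)] a by (simp add: trop_scale_def)
    then have "a \<le> 0" using x fin[OF x(1)] finh[OF x(1)] by simp
    moreover have "h y \<le> ereal a + h y" using le[OF h(1) y(1)] y(2) a by (simp add: trop_scale_def)
    then have "0 \<le> a" using finh[OF y(1)] by simp
    ultimately have "a = 0" by simp
    then show "h = h'" using a by (simp add: trop_scale_def zero_ereal_def[symmetric])
  qed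
  moreover have "(\<lambda>h. trop_scaling_rel `` {h}) ` H \<subseteq> ?S // trop_scaling_rel" using HS by (auto simp: quotient_def)
  ultimately have finH: "finite H" using finite_vertex_classes[OF D] by (meson finite_imageD finite_subset)
  have Hne: "H \<noteq> {}" using not_inf_exists by (auto simp: H_def)
  have "f x = Max ((\<lambda>h. trop_scale 0 h x) ` H)" for x
  proof -
    have bound: "h x \<le> f x" if h: "h \<in> H" for h
    proof (cases "x \<in> inf\<^sub>\<Gamma>")
      case True
      then obtain e a s where Dx: "dirs_at x = {(e, a, s)}" by (rule dirs_at_inf)
      have dx: "(e, a, s) \<in> dirs_at x" using Dx by simp
      note dd = dirs_at_dirs[OF dx]
      have "((\<lambda>t. h (em e t)) \<longlongrightarrow> h x) (dfil a s)" "((\<lambda>t. f (em e t)) \<longlongrightarrow> f x) (dfil a s)"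
        using rational_lim[OF RR_D(1)[OF HR[OF h]] dd] rational_lim[OF RR_D(1)[OF f] dd] target_eq[OF dx] by simp_all
      moreover have "eventually (\<lambda>t. h (em e t) \<le> f (em e t)) (dfil a s)"
        using dirs_ev_I[OF dd] by eventually_elim (use le[OF h] em_not_inf[OF dirs_edge[OF dd]] in blast)
      ultimately show ?thesis using dirs_neq_bot[OF dd] by (intro tendsto_le[of "dfil a s"])
    qed (rule le[OF h])
    \<comment> \<open>Minorants were chosen for finite points only. At infinity, if every member of
      the finite set \<open>H\<close> were strictly below \<open>f\<close>, the same would hold at
      finite points nearby, against the choice of the minorants there.\<close>
    have "\<exists>h\<in>H. h x = f x"
    proof (cases "x \<in> inf\<^sub>\<Gamma>")
      case True
      then obtain e a s where Dx: "dirs_at x = {(e, a, s)}" by (rule dirs_at_inf)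
      have dx: "(e, a, s) \<in> dirs_at x" using Dx by simp
      note dd = dirs_at_dirs[OF dx]
      show ?thesis
      proof (rule ccontr)
        assume no: "\<not> ?thesis"
        have "eventually (\<lambda>t. h (em e t) < f (em e t)) (dfil a s)" if h: "h \<in> H" for h
        proof -
          have "h x < f x" using bound[OF h] no h by (metis order_less_le)
          moreover have "((\<lambda>t. h (em e t)) \<longlongrightarrow> h x) (dfil a s)" "((\<lambda>t. f (em e t)) \<longlongrightarrow> f x) (dfil a s)"
            using rational_lim[OF RR_D(1)[OF HR[OF h]] dd] rational_lim[OF RR_D(1)[OF f] dd] target_eq[OF dx] by simp_all
          ultimately obtain c where c: "h x < c" "c < f x" using dense by blast
          have "eventually (\<lambda>t. h (em e t) < c) (dfil a s)"
            by (rule order_tendstoD(2)[OF _ c(1)]) fact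
          moreover have "eventually (\<lambda>t. c < f (em e t)) (dfil a s)"
            by (rule order_tendstoD(1)[OF _ c(2)]) fact
          ultimately show ?thesis by eventually_elim (rule less_trans)
        qed
        then have "eventually (\<lambda>t. \<forall>h\<in>H. h (em e t) < f (em e t)) (dfil a s)" using finH by (intro eventually_ball_finite) auto
        then have "eventually (\<lambda>t. False) (dfil a s)" using dirs_ev_I[OF dd]
        proof eventually_elim
          case (elim t)
          have y: "em e t \<notin> inf\<^sub>\<Gamma>" by (rule em_not_inf[OF dirs_edge[OF dd] elim(2)])
          then have "g (em e t) \<in> H" "g (em e t) (em e t) = f (em e t)" using g by (auto simp: H_def)
          then show ?case using elim(1) by force
        qed
        then show False using dirs_neq_bot[OF dd] by (simp add: trivial_limit_def)
      qed
    next
      case False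
      then show ?thesis using g[OF False] by (auto simp: H_def)
    qed
    then obtain h where "h \<in> H" "h x = f x" by blast
    then have "Max ((\<lambda>h. h x) ` H) = f x" using finH bound by (intro Max_eqI) (auto intro: rev_image_eqI)
    then show ?thesis by (simp add: trop_scale_def zero_ereal_def[symmetric])
  qed
  then have "f = (\<lambda>x. Max ((\<lambda>h. trop_scale 0 h x) ` H))" by (intro ext)
  then show "f \<in> trop_span ?S" unfolding trop_span_def
    by (intro CollectI exI[of _ H] exI[of _ "\<lambda>_. 0"] conjI finH Hne HS)
qed

end

theorem theorem13:
  fixes \<Gamma> :: "'a::t2_space curve" and M :: "'a model" and D :: "'a \<Rightarrow> int"
  assumes "tropical_curve \<Gamma>" and "model \<Gamma> M" and "divisor D"
  shows "no_smooth_cut_functions \<Gamma> D \<subseteq> vertex_functions \<Gamma> M D \<and>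
         finite (vertex_functions \<Gamma> M D // trop_scaling_rel) \<and>
         RR \<Gamma> D \<subseteq> trop_span (vertex_functions \<Gamma> M D)"
proof -
  interpret curve_model \<Gamma> M using assms(1,2) by unfold_locales
  show ?thesis
    using no_smooth_cut_subset connected_subset_vertex[OF assms(3)] finite_vertex_classes[OF assms(3)]
      RR_subset_span[OF assms(3)] by blast
qed

end
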